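(* Let $1<\alpha<2$, let $\Omega\subset\mathbb R^d$ ($d=1,2,3$) be a convex $d$-polytope, let $u_0,u_1\in L^2(\Omega)$ and $f\in L^1(0,\infty;L^2(\Omega))\cap{}_0H^{(1-\alpha)/2}(0,\infty;H^{-1}(\Omega))$. Let $\tau>0$, $t_j=j\tau$, and let $(U_k)_{k\ge0}$ and $(\mathcal U_k)_{k\ge0}$ in $S_h$ be the solutions of the fully discrete L1 scheme and of the fully discrete modified L1 scheme described in the context. Then there is a constant $C_\alpha>0$ depending only on $\alpha$ such that for each integer $k\ge1$, $$\|U_k\|_{L^2(\Omega)}\le C_\alpha\Big(\|u_0\|_{L^2(\Omega)}+t_k^{1-\alpha/2}\|u_1\|_{H^{-1}(\Omega)}+\|f\|_{{}_0H^{(1-\alpha)/2}(0,t_k;H^{-1}(\Omega))}\Big),$$ $$\|\mathcal U_k\|_{L^2(\Omega)}\le C_\alpha\Big(\|u_0\|_{L^2(\Omega)}+t_k^{1-\alpha/2}\|u_1\|_{H^{-1}(\Omega)}+\|f\|_{{}_0H^{(1-\alpha)/2}(0,t_k;H^{-1}(\Omega))}\Big).$$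
   Context: Spatial discretization: $\mathcal K_h$ is a quasi-uniform and shape-regular triangulation of $\Omega$ into $d$-simplexes, $h$ is the maximum diameter of its elements, $S_h=\{v_h\in H_0^1(\Omega): v_h|_K \text{ is a polynomial of degree}\le1\ \forall K\in\mathcal K_h\}$, $P_h$ is the $L^2(\Omega)$-orthogonal projection onto $S_h$, and $\Delta_h:S_h\to S_h$ is defined by $\langle-\Delta_hv_h,w_h\rangle_\Omega=\langle\nabla v_h,\nabla w_h\rangle_\Omega$ for all $v_h,w_h\in S_h$, where $\langle p,q\rangle_\Omega=\int_\Omega p\,q$ (or $\int_\Omega p\cdot q$). Coefficients: $b_j=j^{2-\alpha}/\Gamma(3-\alpha)$ for $j=0,1,2,\dots$; $\beta_1=b_1+2\sin(\alpha\pi/2)\sum_{k=1}^\infty(2k\pi)^{\alpha-3}$ and $\beta_k=b_k$ for all nonnegative integers $k\ne1$. L1 scheme: $U_0=P_hu_0$ and, for each $k=0,1,2,\dots$, $U_{k+1}\in S_h$ is determined by $$(b_{k+1}-b_k)(U_1-U_0)+\sum_{j=1}^k(b_{k-j+1}-b_{k-j})(U_{j+1}-2U_j+U_{j-1})-\frac{\tau^\alpha}{2}\Delta_h(U_k+U_{k+1})=\tau^{\alpha-1}P_h\int_{t_k}^{t_{k+1}}f(t)\,dt+\tau(b_{k+1}-b_k)P_hu_1.$$ Modified L1 scheme: $\mathcal U_0=P_hu_0$ and $\mathcal U_{k+1}\in S_h$, $k=0,1,2,\dots$, is determined by the same relation with every $b_j$ replaced by $\beta_j$ and every $U_j$ by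 $\mathcal U_j$. Function spaces: $H_0^1(\Omega)$ carries the norm $\|\nabla v\|_{L^2(\Omega)}$ and $H^{-1}(\Omega)$ is its dual. For an interval $(a,b)$ and a separable Hilbert space $X$ (identified with its dual through its inner product), ${}^0H^1(a,b;X)=\{v\in L^2(a,b;X): v'\in L^2(a,b;X),\ \lim_{t\to b-}v(t)=0\}$ with norm $\|v'\|_{L^2(a,b;X)}$; for $0<\gamma<1$, ${}^0H^\gamma(a,b;X)=[L^2(a,b;X),{}^0H^1(a,b;X)]_{\gamma,2}$ is the real ($K$-method) interpolation space, and ${}_0H^{-\gamma}(a,b;X)$ is the dual of ${}^0H^\gamma(a,b;X)$. Here $\gamma=(\alpha-1)/2$. An $L^1$ function $f$ belongs to ${}_0H^{-\gamma}(a,b;X)$ if $w\mapsto\int_a^b(f(t),w(t))_X\,dt$, defined for bounded $w\in{}^0H^\gamma(a,b;X)$, extends to a bounded functional on ${}^0H^\gamma(a,b;X)$; its norm on $(0,t_k)$ is that of its restriction to $(0,t_k)$. *)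

theory Defs
  imports "HOL-Analysis.Analysis" "HOL-Library.Function_Algebras"
begin

section \<open>Pointwise vector space structure on functions\<close>

instantiation "fun" :: (type, real_vector) real_vector
begin

definition scaleR_fun :: "real \<Rightarrow> ('a \<Rightarrow> 'b) \<Rightarrow> 'a \<Rightarrow> 'b" where
  "scaleR_fun c f = (\<lambda>x. c *\<^sub>R f x)"

instance
  by standard (auto simp: scaleR_fun_def plus_fun_def scaleR_add_right scaleR_add_left)

end


section \<open>Normed spaces given by a carrier and a norm\<close>

text \<open>The spaces below depend on a domain or an interval, so they are not types. A space is a subspace
  \<open>V\<close> of some real vector space together with a function \<open>N\<close> that is a norm on \<open>V\<close>
  (for spaces of functions: a seminorm that vanishes exactly on the null functions).\<close>

definition dual_space :: "'x::real_vector set \<Rightarrow> ('x \<Rightarrow> real) \<Rightarrow> ('x \<Rightarrow> real) set" where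
  "dual_space V N =
     {F. (\<forall>u\<in>V. \<forall>v\<in>V. \<forall>a b. F (a *\<^sub>R u + b *\<^sub>R v) = a * F u + b * F v) \<and>
         (\<exists>C. \<forall>v\<in>V. \<bar>F v\<bar> \<le> C * N v) \<and>
         (\<forall>v. v \<notin> V \<longrightarrow> F v = 0)}"

definition dual_norm :: "'x set \<Rightarrow> ('x \<Rightarrow> real) \<Rightarrow> ('x \<Rightarrow> real) \<Rightarrow> real" where
  "dual_norm V N F = Sup {\<bar>F v\<bar> | v. v \<in> V \<and> N v \<le> 1}"

text \<open>The inner product of a Hilbert space, recovered from its norm by polarization.\<close>

definition polar_inner :: "('x::real_vector \<Rightarrow> real) \<Rightarrow> 'x \<Rightarrow> 'x \<Rightarrow> real" where
  "polar_inner N x y = ((N (x + y))\<^sup>2 - (N (x - y))\<^sup>2) / 4"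

text \<open>Real interpolation (K-method, second exponent 2).\<close>

definition K_functional ::
  "'z::real_vector set \<Rightarrow> ('z \<Rightarrow> real) \<Rightarrow> 'z set \<Rightarrow> ('z \<Rightarrow> real) \<Rightarrow> real \<Rightarrow> 'z \<Rightarrow> real" where
  "K_functional X0 N0 X1 N1 s w =
     Inf {N0 w0 + s * N1 w1 | w0 w1. w0 \<in> X0 \<and> w1 \<in> X1 \<and> w = w0 + w1}"

definition interp_space ::
  "'z::real_vector set \<Rightarrow> ('z \<Rightarrow> real) \<Rightarrow> 'z set \<Rightarrow> ('z \<Rightarrow> real) \<Rightarrow> real \<Rightarrow> 'z set" where
  "interp_space X0 N0 X1 N1 \<theta> =
     {w. (\<exists>w0\<in>X0. \<exists>w1\<in>X1. w = w0 + w1) \<and>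
         integrable (lebesgue_on {0<..})
           (\<lambda>s. (s powr (- \<theta>) * K_functional X0 N0 X1 N1 s w)\<^sup>2 / s)}"

definition interp_norm ::
  "'z::real_vector set \<Rightarrow> ('z \<Rightarrow> real) \<Rightarrow> 'z set \<Rightarrow> ('z \<Rightarrow> real) \<Rightarrow> real \<Rightarrow> 'z \<Rightarrow> real" where
  "interp_norm X0 N0 X1 N1 \<theta> w =
     sqrt (integral\<^sup>L (lebesgue_on {0<..})
       (\<lambda>s. (s powr (- \<theta>) * K_functional X0 N0 X1 N1 s w)\<^sup>2 / s))"


section \<open>Bochner spaces of functions of time\<close>

text \<open>\<open>HOL-Analysis\<close> integrates functions into a Banach space type; the following repeats its
  construction for values in a space \<open>V\<close> with norm \<open>N\<close>.\<close>

definition simple_into :: "'x::real_vector set \<Rightarrow> real set \<Rightarrow> (real \<Rightarrow> 'x) \<Rightarrow> bool" where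
  "simple_into V S s \<longleftrightarrow>
     finite (s ` S) \<and> s ` S \<subseteq> V \<and> (\<forall>x. {t\<in>S. s t = x} \<in> sets lebesgue) \<and>
     emeasure lebesgue {t\<in>S. s t \<noteq> 0} < \<infinity>"

definition strongly_measurable ::
  "'x::real_vector set \<Rightarrow> ('x \<Rightarrow> real) \<Rightarrow> real set \<Rightarrow> (real \<Rightarrow> 'x) \<Rightarrow> bool" where
  "strongly_measurable V N S w \<longleftrightarrow>
     (\<forall>t\<in>S. w t \<in> V) \<and>
     (\<exists>s. (\<forall>n. simple_into V S (s n)) \<and>
          (AE t in lebesgue_on S. (\<lambda>n::nat. N (s n t - w t)) \<longlonglongrightarrow> 0))"

definition has_integral_into ::
  "'x::real_vector set \<Rightarrow> ('x \<Rightarrow> real) \<Rightarrow> real set \<Rightarrow> (real \<Rightarrow> 'x) \<Rightarrow> 'x \<Rightarrow> bool" where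
  "has_integral_into V N S w y \<longleftrightarrow>
     y \<in> V \<and> strongly_measurable V N S w \<and>
     (\<exists>s. (\<forall>n. simple_into V S (s n)) \<and>
          (\<lambda>n::nat. \<integral>\<^sup>+ t. ennreal (N (s n t - w t)) \<partial>lebesgue_on S) \<longlonglongrightarrow> 0 \<and>
          (\<lambda>n. N ((\<Sum>x\<in>s n ` S. measure lebesgue {t\<in>S. s n t = x} *\<^sub>R x) - y)) \<longlonglongrightarrow> 0)"

definition integral_into ::
  "'x::real_vector set \<Rightarrow> ('x \<Rightarrow> real) \<Rightarrow> real set \<Rightarrow> (real \<Rightarrow> 'x) \<Rightarrow> 'x" where
  "integral_into V N S w = (SOME y. has_integral_into V N S w y)"

definition bochner_L1 ::
  "'x::real_vector set \<Rightarrow> ('x \<Rightarrow> real) \<Rightarrow> real set \<Rightarrow> (real \<Rightarrow> 'x) set" where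
  "bochner_L1 V N S =
     {w. strongly_measurable V N S w \<and> integrable (lebesgue_on S) (\<lambda>t. N (w t))}"

definition bochner_L2 ::
  "'x::real_vector set \<Rightarrow> ('x \<Rightarrow> real) \<Rightarrow> real set \<Rightarrow> (real \<Rightarrow> 'x) set" where
  "bochner_L2 V N S =
     {w. strongly_measurable V N S w \<and> integrable (lebesgue_on S) (\<lambda>t. (N (w t))\<^sup>2)}"

definition bochner_L2_norm :: "('x \<Rightarrow> real) \<Rightarrow> real set \<Rightarrow> (real \<Rightarrow> 'x) \<Rightarrow> real" where
  "bochner_L2_norm N S w = sqrt (integral\<^sup>L (lebesgue_on S) (\<lambda>t. (N (w t))\<^sup>2))"


section \<open>Test functions\<close>

primrec Ck :: "nat \<Rightarrow> ('a::euclidean_space \<Rightarrow> real) \<Rightarrow> bool" where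
  "Ck 0 f \<longleftrightarrow> continuous_on UNIV f"
| "Ck (Suc k) f \<longleftrightarrow>
     (\<forall>x. f differentiable (at x)) \<and> (\<forall>e\<in>Basis. Ck k (\<lambda>x. frechet_derivative f (at x) e))"

definition test_functions :: "'a::euclidean_space set \<Rightarrow> ('a \<Rightarrow> real) set" where
  "test_functions \<Omega> =
     {\<phi>. (\<forall>k. Ck k \<phi>) \<and> compact (closure {x. \<phi> x \<noteq> 0}) \<and> closure {x. \<phi> x \<noteq> 0} \<subseteq> \<Omega>}"


section \<open>Sobolev spaces in time\<close>

definition is_weak_time_derivative ::
  "'x::real_vector set \<Rightarrow> ('x \<Rightarrow> real) \<Rightarrow> real set \<Rightarrow> (real \<Rightarrow> 'x) \<Rightarrow> (real \<Rightarrow> 'x) \<Rightarrow> bool" where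
  "is_weak_time_derivative V N S v g \<longleftrightarrow>
     (\<forall>\<phi>\<in>test_functions S. \<exists>y.
        has_integral_into V N S (\<lambda>t. deriv \<phi> t *\<^sub>R v t) y \<and>
        has_integral_into V N S (\<lambda>t. \<phi> t *\<^sub>R g t) (- y))"

definition weak_time_derivative ::
  "'x::real_vector set \<Rightarrow> ('x \<Rightarrow> real) \<Rightarrow> real set \<Rightarrow> (real \<Rightarrow> 'x) \<Rightarrow> real \<Rightarrow> 'x" where
  "weak_time_derivative V N S v =
     (SOME g. g \<in> bochner_L2 V N S \<and> is_weak_time_derivative V N S v g)"

text \<open>\<open>H1_right V N a b\<close> is the space of functions on \<open>(a, b)\<close>, \<open>b \<le> \<infinity>\<close>, with square integrable
  weak derivative that vanish at the right endpoint; the limit is that of the continuous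
  representative \<open>c\<close>.\<close>

definition H1_right ::
  "'x::real_vector set \<Rightarrow> ('x \<Rightarrow> real) \<Rightarrow> ereal \<Rightarrow> ereal \<Rightarrow> (real \<Rightarrow> 'x) set" where
  "H1_right V N a b =
     {v \<in> bochner_L2 V N (einterval a b).
        (\<exists>g\<in>bochner_L2 V N (einterval a b). is_weak_time_derivative V N (einterval a b) v g) \<and>
        (\<exists>c. (\<forall>t\<in>einterval a b. c t \<in> V) \<and>
             (\<forall>t\<in>einterval a b. ((\<lambda>s. N (c s - c t)) \<longlongrightarrow> 0) (at t within einterval a b)) \<and>
             (AE t in lebesgue_on (einterval a b). N (v t - c t) = 0) \<and>
             ((\<lambda>t. N (c (real_of_ereal t))) \<longlongrightarrow> 0) (at_left b))}"

definition H1_right_norm ::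
  "'x::real_vector set \<Rightarrow> ('x \<Rightarrow> real) \<Rightarrow> ereal \<Rightarrow> ereal \<Rightarrow> (real \<Rightarrow> 'x) \<Rightarrow> real" where
  "H1_right_norm V N a b v =
     bochner_L2_norm N (einterval a b) (weak_time_derivative V N (einterval a b) v)"

definition Hfrac_right ::
  "real \<Rightarrow> 'x::real_vector set \<Rightarrow> ('x \<Rightarrow> real) \<Rightarrow> ereal \<Rightarrow> ereal \<Rightarrow> (real \<Rightarrow> 'x) set" where
  "Hfrac_right \<gamma> V N a b =
     interp_space (bochner_L2 V N (einterval a b)) (bochner_L2_norm N (einterval a b))
       (H1_right V N a b) (H1_right_norm V N a b) \<gamma>"

definition Hfrac_right_norm ::
  "real \<Rightarrow> 'x::real_vector set \<Rightarrow> ('x \<Rightarrow> real) \<Rightarrow> ereal \<Rightarrow> ereal \<Rightarrow> (real \<Rightarrow> 'x) \<Rightarrow> real" where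
  "Hfrac_right_norm \<gamma> V N a b =
     interp_norm (bochner_L2 V N (einterval a b)) (bochner_L2_norm N (einterval a b))
       (H1_right V N a b) (H1_right_norm V N a b) \<gamma>"

text \<open>An integrable \<open>f\<close> on \<open>(a, b)\<close> belongs to the dual of \<open>Hfrac_right\<close> if its pairing with the
  bounded elements extends to a bounded functional \<open>F\<close>. Only the values of \<open>f\<close> on \<open>(a, b)\<close> matter,
  so restricting \<open>f\<close> to a subinterval just changes \<open>a\<close> and \<open>b\<close>.\<close>

definition neg_extension ::
  "real \<Rightarrow> 'x::real_vector set \<Rightarrow> ('x \<Rightarrow> real) \<Rightarrow> ereal \<Rightarrow> ereal \<Rightarrow> (real \<Rightarrow> 'x)
     \<Rightarrow> ((real \<Rightarrow> 'x) \<Rightarrow> real) \<Rightarrow> bool" where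
  "neg_extension \<gamma> V N a b f F \<longleftrightarrow>
     F \<in> dual_space (Hfrac_right \<gamma> V N a b) (Hfrac_right_norm \<gamma> V N a b) \<and>
     (\<forall>w\<in>Hfrac_right \<gamma> V N a b.
        (\<exists>M. AE t in lebesgue_on (einterval a b). N (w t) \<le> M) \<longrightarrow>
        F w = integral\<^sup>L (lebesgue_on (einterval a b)) (\<lambda>t. polar_inner N (f t) (w t)))"

definition Hneg_time ::
  "real \<Rightarrow> 'x::real_vector set \<Rightarrow> ('x \<Rightarrow> real) \<Rightarrow> ereal \<Rightarrow> ereal \<Rightarrow> (real \<Rightarrow> 'x) set" where
  "Hneg_time \<gamma> V N a b =
     {f \<in> bochner_L1 V N (einterval a b). \<exists>F. neg_extension \<gamma> V N a b f F}"

definition Hneg_time_norm ::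
  "real \<Rightarrow> 'x::real_vector set \<Rightarrow> ('x \<Rightarrow> real) \<Rightarrow> ereal \<Rightarrow> ereal \<Rightarrow> (real \<Rightarrow> 'x) \<Rightarrow> real" where
  "Hneg_time_norm \<gamma> V N a b f =
     dual_norm (Hfrac_right \<gamma> V N a b) (Hfrac_right_norm \<gamma> V N a b)
       (SOME F. neg_extension \<gamma> V N a b f F)"


section \<open>Function spaces on the spatial domain\<close>

text \<open>Functions on \<open>\<Omega>\<close> are total functions whose values outside \<open>\<Omega>\<close> are ignored.\<close>

definition convex_polytope_domain :: "'a::euclidean_space set \<Rightarrow> bool" where
  "convex_polytope_domain \<Omega> \<longleftrightarrow> open \<Omega> \<and> \<Omega> \<noteq> {} \<and> convex \<Omega> \<and> polytope (closure \<Omega>)"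

definition L2_space :: "'a::euclidean_space set \<Rightarrow> ('a \<Rightarrow> 'b::euclidean_space) set" where
  "L2_space \<Omega> = {u \<in> borel_measurable (lebesgue_on \<Omega>).
                   integrable (lebesgue_on \<Omega>) (\<lambda>x. (norm (u x))\<^sup>2)}"

definition L2_inner ::
  "'a::euclidean_space set \<Rightarrow> ('a \<Rightarrow> 'b::euclidean_space) \<Rightarrow> ('a \<Rightarrow> 'b) \<Rightarrow> real" where
  "L2_inner \<Omega> p q = integral\<^sup>L (lebesgue_on \<Omega>) (\<lambda>x. p x \<bullet> q x)"

definition L2_norm :: "'a::euclidean_space set \<Rightarrow> ('a \<Rightarrow> 'b::euclidean_space) \<Rightarrow> real" where
  "L2_norm \<Omega> u = sqrt (L2_inner \<Omega> u u)"

definition is_weak_gradient ::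
  "'a::euclidean_space set \<Rightarrow> ('a \<Rightarrow> real) \<Rightarrow> ('a \<Rightarrow> 'a) \<Rightarrow> bool" where
  "is_weak_gradient \<Omega> v g \<longleftrightarrow>
     (\<forall>\<phi>\<in>test_functions \<Omega>. \<forall>e\<in>Basis.
        L2_inner \<Omega> v (\<lambda>x. frechet_derivative \<phi> (at x) e) = - L2_inner \<Omega> (\<lambda>x. g x \<bullet> e) \<phi>)"

definition H1_space :: "'a::euclidean_space set \<Rightarrow> ('a \<Rightarrow> real) set" where
  "H1_space \<Omega> = {v \<in> L2_space \<Omega>. \<exists>g\<in>L2_space \<Omega>. is_weak_gradient \<Omega> v g}"

definition grad :: "'a::euclidean_space set \<Rightarrow> ('a \<Rightarrow> real) \<Rightarrow> 'a \<Rightarrow> 'a" where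
  "grad \<Omega> v = (SOME g. g \<in> L2_space \<Omega> \<and> is_weak_gradient \<Omega> v g)"

definition H10_space :: "'a::euclidean_space set \<Rightarrow> ('a \<Rightarrow> real) set" where
  "H10_space \<Omega> =
     {v \<in> H1_space \<Omega>. \<exists>\<phi>. (\<forall>n::nat. \<phi> n \<in> test_functions \<Omega>) \<and>
        (\<lambda>n. L2_norm \<Omega> (\<phi> n - v)) \<longlonglongrightarrow> 0 \<and>
        (\<lambda>n. L2_norm \<Omega> (grad \<Omega> (\<phi> n) - grad \<Omega> v)) \<longlonglongrightarrow> 0}"

definition H10_norm :: "'a::euclidean_space set \<Rightarrow> ('a \<Rightarrow> real) \<Rightarrow> real" where
  "H10_norm \<Omega> v = L2_norm \<Omega> (grad \<Omega> v)"

definition Hm1_space :: "'a::euclidean_space set \<Rightarrow> (('a \<Rightarrow> real) \<Rightarrow> real) set" where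
  "Hm1_space \<Omega> = dual_space (H10_space \<Omega>) (H10_norm \<Omega>)"

definition Hm1_norm :: "'a::euclidean_space set \<Rightarrow> (('a \<Rightarrow> real) \<Rightarrow> real) \<Rightarrow> real" where
  "Hm1_norm \<Omega> = dual_norm (H10_space \<Omega>) (H10_norm \<Omega>)"

text \<open>The embedding of \<open>L2_space \<Omega>\<close> into \<open>Hm1_space \<Omega>\<close>.\<close>

definition to_Hm1 :: "'a::euclidean_space set \<Rightarrow> ('a \<Rightarrow> real) \<Rightarrow> ('a \<Rightarrow> real) \<Rightarrow> real" where
  "to_Hm1 \<Omega> u = (\<lambda>v. if v \<in> H10_space \<Omega> then L2_inner \<Omega> u v else 0)"


section \<open>Finite elements\<close>

definition simplicial_mesh :: "'a::euclidean_space set \<Rightarrow> 'a set set \<Rightarrow> bool" where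
  "simplicial_mesh \<Omega> \<K> \<longleftrightarrow>
     triangulation \<K> \<and> (\<forall>K\<in>\<K>. int DIM('a) simplex K) \<and> \<Union>\<K> = closure \<Omega>"

definition mesh_size :: "'a::euclidean_space set set \<Rightarrow> real" where
  "mesh_size \<K> = Max (diameter ` \<K>)"

definition shape_regular :: "real \<Rightarrow> 'a::euclidean_space set set \<Rightarrow> bool" where
  "shape_regular \<kappa> \<K> \<longleftrightarrow> (\<forall>K\<in>\<K>. \<exists>x r. 0 < r \<and> cball x r \<subseteq> K \<and> diameter K \<le> \<kappa> * r)"

definition quasi_uniform :: "real \<Rightarrow> 'a::euclidean_space set set \<Rightarrow> bool" where
  "quasi_uniform \<rho> \<K> \<longleftrightarrow> (\<forall>K\<in>\<K>. mesh_size \<K> \<le> \<rho> * diameter K)"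

text \<open>Elements of the finite element space are represented by the continuous function on the closure
  of \<open>\<Omega>\<close>, extended by zero. This makes \<open>fe_space\<close> a space of functions with ordinary equality.\<close>

definition fe_space :: "'a::euclidean_space set \<Rightarrow> 'a set set \<Rightarrow> ('a \<Rightarrow> real) set" where
  "fe_space \<Omega> \<K> =
     {v \<in> H10_space \<Omega>. (\<forall>K\<in>\<K>. \<exists>a c. \<forall>x\<in>K. v x = a \<bullet> x + c) \<and>
                        (\<forall>x. x \<notin> \<Union>\<K> \<longrightarrow> v x = 0)}"

definition L2_projection ::
  "'a::euclidean_space set \<Rightarrow> 'a set set \<Rightarrow> ('a \<Rightarrow> real) \<Rightarrow> 'a \<Rightarrow> real" where
  "L2_projection \<Omega> \<K> u =
     (THE p. p \<in> fe_space \<Omega> \<K> \<and> (\<forall>w\<in>fe_space \<Omega> \<K>. L2_inner \<Omega> p w = L2_inner \<Omega> u w))"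

definition discrete_laplacian ::
  "'a::euclidean_space set \<Rightarrow> 'a set set \<Rightarrow> ('a \<Rightarrow> real) \<Rightarrow> 'a \<Rightarrow> real" where
  "discrete_laplacian \<Omega> \<K> v =
     (THE z. z \<in> fe_space \<Omega> \<K> \<and>
        (\<forall>w\<in>fe_space \<Omega> \<K>. L2_inner \<Omega> (- z) w = L2_inner \<Omega> (grad \<Omega> v) (grad \<Omega> w)))"


section \<open>The two schemes\<close>

definition coeff_b :: "real \<Rightarrow> nat \<Rightarrow> real" where
  "coeff_b \<alpha> j = real j powr (2 - \<alpha>) / Gamma (3 - \<alpha>)"

definition coeff_beta :: "real \<Rightarrow> nat \<Rightarrow> real" where
  "coeff_beta \<alpha> j =
     (if j = 1
      then coeff_b \<alpha> 1 + 2 * sin (\<alpha> * pi / 2) * (\<Sum>k. (2 * real (Suc k) * pi) powr (\<alpha> - 3))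
      else coeff_b \<alpha> j)"

text \<open>The scheme with coefficients \<open>c\<close>: \<open>c = coeff_b \<alpha>\<close> is the L1 scheme and \<open>c = coeff_beta \<alpha>\<close> the
  modified L1 scheme.\<close>

definition is_scheme_solution ::
  "(nat \<Rightarrow> real) \<Rightarrow> real \<Rightarrow> 'a::euclidean_space set \<Rightarrow> 'a set set \<Rightarrow> real \<Rightarrow>
   ('a \<Rightarrow> real) \<Rightarrow> ('a \<Rightarrow> real) \<Rightarrow> (real \<Rightarrow> 'a \<Rightarrow> real) \<Rightarrow> (nat \<Rightarrow> 'a \<Rightarrow> real) \<Rightarrow> bool" where
  "is_scheme_solution c \<alpha> \<Omega> \<K> \<tau> u0 u1 f U \<longleftrightarrow>
     U 0 = L2_projection \<Omega> \<K> u0 \<and>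
     (\<forall>k. U (k + 1) \<in> fe_space \<Omega> \<K> \<and>
        (c (k + 1) - c k) *\<^sub>R (U 1 - U 0)
        + (\<Sum>j=1..k. (c (k - j + 1) - c (k - j)) *\<^sub>R (U (j + 1) - 2 *\<^sub>R U j + U (j - 1)))
        - (\<tau> powr \<alpha> / 2) *\<^sub>R discrete_laplacian \<Omega> \<K> (U k + U (k + 1))
        = \<tau> powr (\<alpha> - 1) *\<^sub>R L2_projection \<Omega> \<K>
              (integral_into (L2_space \<Omega>) (L2_norm \<Omega>) {real k * \<tau><..<real (k + 1) * \<tau>} f)
          + (\<tau> * (c (k + 1) - c k)) *\<^sub>R L2_projection \<Omega> \<K> u1)"

end

(*
  With delta_j = U_{j+1} - U_j and z_k = (-Delta_h)^{-1} delta_k, the scheme is the convolution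
  sum_{j<=k} kern c (k-j) delta_j - tau^alpha/2 Delta_h (U_k + U_{k+1}) = right-hand side.
  Testing it with z_k and summing over k < n gives
    Q_c(z) + tau^alpha/2 (|U_n|^2 - |U_0|^2) = tau^{alpha-1} int_0^T <f, Z> + tau sum_k (c_{k+1}-c_k) <u_1, z_k>,
  where Q_c(z) = sum kern c (k-j) <grad z_j, grad z_k> and Z is the step function with values z_k.
  For c = b, summation by parts writes Q_b as a sum of squares |z_j - z_k|^2 with positive weights; up to a
  constant depending on alpha this is tau^{alpha-2} times the squared Gagliardo seminorm of Z, which bounds the
  K-method norm of Z in the dual of the space of f (split Z into a moving average and the remainder).  For
  c = beta, m^{2-alpha} is an average of 1 - exp(-m x), and for each frequency x the extra term in beta_1 is
  absorbed by a sum of squares, so Q_beta >= epsilon Q_b.  Young's inequality then absorbs the right-hand side.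
*)
theory Submission
  imports Defs "HOL-Real_Asymp.Real_Asymp"
begin

section \<open>Dual spaces and Riesz representation\<close>

text \<open>The test function is dictated by the data norms: u_1 and f may be paired only with
  something measured in the gradient norm, while the Laplacian term must still telescope in L2; the
  inverse discrete Laplacian of the increment does both. In a basis of S_h orthonormal for the
  gradient product the form Q_c and all norms split into scalar ones, so neither mesh nor domain
  enters the constant. The powers of \<tau> match: both data terms carry
  \<open>\<tau> powr (\<alpha> / 2)\<close>, whose square multiplies |U_n|^2. For beta the obstacle
  is that the form of the extra coefficient is indefinite, so it must be absorbed quantitatively.
  Its density over the frequency x is the sum over k >= 1 of 2x / (x^2 + (2 k pi)^2), which is below
  min (1/2) (x/12); squares can absorb the density \<open>aa x\<close>, and strict inequality for x
  < 1 leaves the margin epsilon. The right endpoint shapes the time part: functions in the primal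
  space vanish there, so the moving averages look forward, into the region where the step function
  is zero.\<close>

locale seminormed_space =
  fixes V :: "'x::real_vector set" and N :: "'x \<Rightarrow> real"
  assumes zero_mem: "0 \<in> V"
    and add_mem: "u \<in> V \<Longrightarrow> v \<in> V \<Longrightarrow> u + v \<in> V"
    and scale_mem: "u \<in> V \<Longrightarrow> c *\<^sub>R u \<in> V"
    and N_nonneg: "u \<in> V \<Longrightarrow> 0 \<le> N u"
    and N_triangle: "u \<in> V \<Longrightarrow> v \<in> V \<Longrightarrow> N (u + v) \<le> N u + N v"
    and N_scale: "u \<in> V \<Longrightarrow> N (c *\<^sub>R u) = \<bar>c\<bar> * N u"
begin

lemma N_zero: "N 0 = 0" using N_scale[OF zero_mem, of 0] by simp

lemma minus_mem: "u \<in> V \<Longrightarrow> - u \<in> V" using scale_mem[of u "-1"] by simp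

lemma diff_mem: "u \<in> V \<Longrightarrow> v \<in> V \<Longrightarrow> u - v \<in> V" using add_mem[of u "- v"] minus_mem[of v] by simp

lemma sum_mem: "(\<And>i. i \<in> I \<Longrightarrow> x i \<in> V) \<Longrightarrow> (\<Sum>i\<in>I. x i) \<in> V" by (induction I rule: infinite_finite_induct) (auto simp: zero_mem add_mem)

lemma N_minus: "u \<in> V \<Longrightarrow> N (- u) = N u" using N_scale[of u "-1"] by simp

lemma N_diff_comm: "u \<in> V \<Longrightarrow> v \<in> V \<Longrightarrow> N (u - v) = N (v - u)" using N_minus[of "u - v"] by (simp add: diff_mem)

lemma N_diff_triangle:
  "u \<in> V \<Longrightarrow> v \<in> V \<Longrightarrow> w \<in> V \<Longrightarrow> N (u - w) \<le> N (u - v) + N (v - w)" using N_triangle[of "u - v" "v - w"] by (simp add: diff_mem)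

lemma N_diff_le: "u \<in> V \<Longrightarrow> v \<in> V \<Longrightarrow> N (u - v) \<le> N u + N v" using N_triangle[of u "- v"] by (simp add: minus_mem N_minus)

lemma N_abs_diff: "u \<in> V \<Longrightarrow> v \<in> V \<Longrightarrow> \<bar>N u - N v\<bar> \<le> N (u - v)" using N_triangle[of "u - v" v] N_triangle[of "v - u" u] N_diff_comm[of u v]
  by (simp add: diff_mem)

lemma N_sum_le:
  assumes "\<And>i. i \<in> I \<Longrightarrow> x i \<in> V"
  shows "N (\<Sum>i\<in>I. x i) \<le> (\<Sum>i\<in>I. N (x i))" using assms
proof (induction I rule: infinite_finite_induct)
  case (insert i F)
  have "N (x i + sum x F) \<le> N (x i) + N (sum x F)" using insert by (intro N_triangle sum_mem) auto
  also have "N (sum x F) \<le> (\<Sum>i\<in>F. N (x i))" using insert by auto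
  finally show ?case using insert by simp
qed (auto simp: N_zero)

lemma dual_space_add:
  "F \<in> dual_space V N \<Longrightarrow> u \<in> V \<Longrightarrow> v \<in> V \<Longrightarrow> F (u + v) = F u + F v"
  unfolding dual_space_def by (force dest: bspec[of _ _ u] spec[of _ 1] elim!: allE[of _ 1])

lemma dual_space_scale:
  assumes "F \<in> dual_space V N" "u \<in> V"
  shows "F (c *\<^sub>R u) = c * F u"
proof -
  have "F (c *\<^sub>R u + 0 *\<^sub>R u) = c * F u + 0 * F u" using assms unfolding dual_space_def by blast
  then show ?thesis by simp
qed

lemma dual_bdd:
  assumes "F \<in> dual_space V N"
  shows "bdd_above {\<bar>F v\<bar> | v. v \<in> V \<and> N v \<le> 1}"
proof -
  obtain C where C: "\<forall>v\<in>V. \<bar>F v\<bar> \<le> C * N v" using assms unfolding dual_space_def by blast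
  show ?thesis
  proof (rule bdd_aboveI[of _ "\<bar>C\<bar>"], safe)
    fix v assume v: "v \<in> V" "N v \<le> 1"
    have "\<bar>F v\<bar> \<le> C * N v" using C v by auto
    also have "\<dots> \<le> \<bar>C\<bar> * 1" using v N_nonneg[of v] by (intro mult_mono) auto
    finally show "\<bar>F v\<bar> \<le> \<bar>C\<bar>" by simp
  qed
qed

lemma dual_norm_nonneg:
  assumes "F \<in> dual_space V N" shows "0 \<le> dual_norm V N F"
proof -
  have "\<bar>F 0\<bar> \<le> dual_norm V N F" unfolding dual_norm_def
    by (intro cSup_upper dual_bdd assms) (auto simp: zero_mem N_zero intro!: exI[of _ 0])
  then show ?thesis by linarith
qed

lemma dual_norm_bound:
  assumes F: "F \<in> dual_space V N" and v: "v \<in> V"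
  shows "\<bar>F v\<bar> \<le> dual_norm V N F * N v"
proof (cases "N v = 0")
  case True
  obtain C where "\<forall>v\<in>V. \<bar>F v\<bar> \<le> C * N v" using F unfolding dual_space_def by blast
  then show ?thesis using True v by fastforce
next
  case False
  then have p: "N v > 0" using N_nonneg[OF v] by simp
  have "\<bar>F ((1 / N v) *\<^sub>R v)\<bar> \<le> dual_norm V N F" unfolding dual_norm_def using p v
    by (intro cSup_upper dual_bdd F CollectI exI[of _ "(1 / N v) *\<^sub>R v"]) (auto simp: scale_mem N_scale)
  then show ?thesis using p by (simp add: dual_space_scale[OF F v] field_simps)
qed

lemma dual_norm_least:
  assumes "\<And>v. v \<in> V \<Longrightarrow> N v \<le> 1 \<Longrightarrow> \<bar>F v\<bar> \<le> B"
  shows "dual_norm V N F \<le> B" unfolding dual_norm_def using assms by (intro cSup_least) (auto simp: zero_mem N_zero intro!: exI[of _ 0])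

lemma dual_norm_least':
  assumes "\<And>v. v \<in> V \<Longrightarrow> \<bar>F v\<bar> \<le> B * N v" "0 \<le> B"
  shows "dual_norm V N F \<le> B"
proof (rule dual_norm_least)
  fix v assume v: "v \<in> V" "N v \<le> 1"
  have "\<bar>F v\<bar> \<le> B * N v" by (rule assms(1)[OF v(1)])
  also have "\<dots> \<le> B * 1" using v assms(2) by (intro mult_left_mono) auto
  finally show "\<bar>F v\<bar> \<le> B" by simp
qed

text \<open>Lets a dual space serve in turn as the value space of Bochner integrals and
  interpolation spaces. Homogeneity comes from one inequality used for both \<open>c\<close> and
  \<open>1 / c\<close>.\<close>

lemma dual_seminormed: "seminormed_space (dual_space V N) (dual_norm V N)"
proof
  show "0 \<in> dual_space V N" unfolding dual_space_def by (auto intro!: exI[of _ 0])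
next
  fix F G assume FG: "F \<in> dual_space V N" "G \<in> dual_space V N"
  show "F + G \<in> dual_space V N" unfolding dual_space_def
  proof (intro CollectI conjI ballI allI impI)
    show "\<exists>C. \<forall>v\<in>V. \<bar>(F + G) v\<bar> \<le> C * N v"
    proof (intro exI ballI)
      fix v assume v: "v \<in> V"
      show "\<bar>(F + G) v\<bar> \<le> (dual_norm V N F + dual_norm V N G) * N v"
        using dual_norm_bound[OF FG(1) v] dual_norm_bound[OF FG(2) v] by (simp add: algebra_simps)
    qed
  next
    fix u v a b assume "u \<in> V" "v \<in> V"
    then show "(F + G) (a *\<^sub>R u + b *\<^sub>R v) = a * (F + G) u + b * (F + G) v"
      using FG by (simp add: dual_space_add dual_space_scale scale_mem algebra_simps)
  next
    fix v assume "v \<notin> V" then show "(F + G) v = 0" using FG by (simp add: dual_space_def)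
  qed
  show "dual_norm V N (F + G) \<le> dual_norm V N F + dual_norm V N G"
  proof (rule dual_norm_least')
    fix v assume v: "v \<in> V"
    show "\<bar>(F + G) v\<bar> \<le> (dual_norm V N F + dual_norm V N G) * N v"
      using dual_norm_bound[OF FG(1) v] dual_norm_bound[OF FG(2) v] by (simp add: algebra_simps)
  qed (use FG in \<open>simp add: dual_norm_nonneg\<close>)
next
  fix F c assume F: "F \<in> dual_space V N"
  have mem: "c *\<^sub>R F \<in> dual_space V N" for c unfolding dual_space_def
  proof (intro CollectI conjI ballI allI impI)
    show "\<exists>C. \<forall>v\<in>V. \<bar>(c *\<^sub>R F) v\<bar> \<le> C * N v"
    proof (intro exI ballI)
      fix v assume v: "v \<in> V"
      show "\<bar>(c *\<^sub>R F) v\<bar> \<le> (\<bar>c\<bar> * dual_norm V N F) * N v" using mult_left_mono[OF dual_norm_bound[OF F v], of "\<bar>c\<bar>"]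
        by (simp add: scaleR_fun_def abs_mult algebra_simps)
    qed
  next
    fix u v a b assume "u \<in> V" "v \<in> V"
    then show "(c *\<^sub>R F) (a *\<^sub>R u + b *\<^sub>R v) = a * (c *\<^sub>R F) u + b * (c *\<^sub>R F) v"
      using F by (simp add: scaleR_fun_def dual_space_add dual_space_scale scale_mem algebra_simps)
  next
    fix v assume "v \<notin> V" then show "(c *\<^sub>R F) v = 0" using F by (simp add: dual_space_def scaleR_fun_def)
  qed
  show "c *\<^sub>R F \<in> dual_space V N" by (rule mem)
  have le: "dual_norm V N (c *\<^sub>R F) \<le> \<bar>c\<bar> * dual_norm V N F" if F: "F \<in> dual_space V N" for c F
  proof (rule dual_norm_least')
    fix v assume v: "v \<in> V"
    show "\<bar>(c *\<^sub>R F) v\<bar> \<le> (\<bar>c\<bar> * dual_norm V N F) * N v" using mult_left_mono[OF dual_norm_bound[OF F v], of "\<bar>c\<bar>"]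
      by (simp add: scaleR_fun_def abs_mult algebra_simps)
  qed (use F in \<open>simp add: dual_norm_nonneg\<close>)
  show "dual_norm V N (c *\<^sub>R F) = \<bar>c\<bar> * dual_norm V N F"
  proof (cases "c = 0")
    case True then show ?thesis using le[OF F, of 0] dual_norm_nonneg[OF mem[of 0]] by (simp)
  next
    case False
    have "dual_norm V N F \<le> \<bar>1/c\<bar> * dual_norm V N (c *\<^sub>R F)" using le[OF mem[of c], of "1/c"] False by simp
    then show ?thesis using le[OF F, of c] False by (simp add: field_simps)
  qed
qed (rule dual_norm_nonneg)

end

section \<open>Semi-inner products, approximate Riesz representation, orthonormal expansions\<close>

locale semi_inner_space =
  fixes V :: "'x::real_vector set" and ip :: "'x \<Rightarrow> 'x \<Rightarrow> real" and N :: "'x \<Rightarrow> real"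
  assumes zero_mem: "0 \<in> V"
    and add_mem: "u \<in> V \<Longrightarrow> v \<in> V \<Longrightarrow> u + v \<in> V"
    and scale_mem: "u \<in> V \<Longrightarrow> c *\<^sub>R u \<in> V"
    and ip_sym: "u \<in> V \<Longrightarrow> v \<in> V \<Longrightarrow> ip u v = ip v u"
    and ip_add: "u \<in> V \<Longrightarrow> v \<in> V \<Longrightarrow> w \<in> V \<Longrightarrow> ip (u + v) w = ip u w + ip v w"
    and ip_scale: "u \<in> V \<Longrightarrow> w \<in> V \<Longrightarrow> ip (c *\<^sub>R u) w = c * ip u w"
    and ip_nonneg: "u \<in> V \<Longrightarrow> 0 \<le> ip u u"
    and N_eq: "u \<in> V \<Longrightarrow> N u = sqrt (ip u u)"
begin

lemma ip_add_right: "u \<in> V \<Longrightarrow> v \<in> V \<Longrightarrow> w \<in> V \<Longrightarrow> ip w (u + v) = ip w u + ip w v" by (simp add: ip_sym[of w] ip_add add_mem)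

lemma ip_scale_right: "u \<in> V \<Longrightarrow> w \<in> V \<Longrightarrow> ip w (c *\<^sub>R u) = c * ip w u" by (simp add: ip_sym[of w] ip_scale scale_mem)

lemma ip_zero: "w \<in> V \<Longrightarrow> ip 0 w = 0" "w \<in> V \<Longrightarrow> ip w 0 = 0" using ip_scale[OF zero_mem, of w 0] ip_scale_right[OF zero_mem, of w 0] by auto

lemma N_sq: "u \<in> V \<Longrightarrow> (N u)^2 = ip u u" by (simp add: N_eq ip_nonneg)

lemma ip_square_add: "u \<in> V \<Longrightarrow> v \<in> V \<Longrightarrow>
    ip (u + t *\<^sub>R v) (u + t *\<^sub>R v) = ip u u + 2 * t * ip u v + t^2 * ip v v" using ip_sym[of v u]
  by (simp add: ip_add ip_add_right ip_scale ip_scale_right add_mem scale_mem power2_eq_square algebra_simps)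

lemma cauchy_schwarz: assumes u: "u \<in> V" and v: "v \<in> V" shows "\<bar>ip u v\<bar> \<le> N u * N v"
proof -
  have q: "0 \<le> ip u u + 2 * t * ip u v + t^2 * ip v v" for t
    using ip_nonneg[of "u + t *\<^sub>R v"] ip_square_add[OF u v, of t] by (simp add: add_mem scale_mem u v)
  have "(ip u v)^2 \<le> ip u u * ip v v"
  proof (cases "ip v v = 0")
    case True
    have "ip u v = 0"
    proof (rule ccontr)
      assume n: "ip u v \<noteq> 0"
      \<comment> \<open>For \<open>ip v v = 0\<close> the quadratic is affine in t; this t gives it
        the value -1.\<close>
      define t where "t = - (ip u u + 1) / (2 * ip u v)"
      have "2 * t * ip u v = - (ip u u + 1)" unfolding t_def using n by simp
      then show False using q[of t] True by simp
    qed
    then show ?thesis using True by simp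
  next
    case False
    then have p: "ip v v > 0" using ip_nonneg[OF v] by simp
    define t where "t = - ip u v / ip v v"
    have t: "t * ip v v = - ip u v" unfolding t_def using p by simp
    have "t^2 * ip v v = t * - ip u v" unfolding power2_eq_square mult.assoc t ..
    then have "0 \<le> ip u u + t * ip u v" using q[of t] by simp
    then have "0 \<le> (ip u u + t * ip u v) * ip v v" using p by simp
    also have "\<dots> = ip u u * ip v v + ip u v * (t * ip v v)" by (simp add: algebra_simps)
    finally show ?thesis unfolding t by (simp add: power2_eq_square)
  qed
  then have "\<bar>ip u v\<bar> \<le> sqrt (ip u u * ip v v)" by (metis real_sqrt_abs real_sqrt_le_mono)
  then show ?thesis by (simp add: N_eq u v real_sqrt_mult)
qed

lemma seminormed: "seminormed_space V N"
proof
  fix u v c assume u: "u \<in> V"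
  show "0 \<le> N u" using u by (simp add: N_eq ip_nonneg)
  have "ip (c *\<^sub>R u) (c *\<^sub>R u) = c^2 * ip u u" using u by (simp add: scale_mem ip_scale ip_scale_right power2_eq_square)
  then show "N (c *\<^sub>R u) = \<bar>c\<bar> * N u" using u by (simp add: N_eq scale_mem real_sqrt_mult)
  assume v: "v \<in> V"
  have "(N (u + v))^2 = (N u)^2 + 2 * ip u v + (N v)^2" using ip_square_add[OF u v, of 1] by (simp add: N_sq add_mem u v)
  also have "\<dots> \<le> (N u + N v)^2" using cauchy_schwarz[OF u v] by (simp add: power2_sum)
  finally have "(N (u + v))^2 \<le> (N u + N v)^2" .
  then show "N (u + v) \<le> N u + N v" by (rule power2_le_imp_le) (auto simp: u v N_eq ip_nonneg)
qed (auto simp: zero_mem add_mem scale_mem)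

sublocale seminormed_space V N by (rule seminormed)

lemma ip_sum: "(\<And>i. i \<in> I \<Longrightarrow> x i \<in> V) \<Longrightarrow> w \<in> V \<Longrightarrow> ip (\<Sum>i\<in>I. x i) w = (\<Sum>i\<in>I. ip (x i) w)"
  by (induction I rule: infinite_finite_induct) (auto simp: ip_zero ip_add sum_mem)

lemma ip_sum_right: "(\<And>i. i \<in> I \<Longrightarrow> x i \<in> V) \<Longrightarrow> w \<in> V \<Longrightarrow> ip w (\<Sum>i\<in>I. x i) = (\<Sum>i\<in>I. ip w (x i))" by (simp add: ip_sym[of w] sum_mem ip_sum)

lemma ip_minus: "u \<in> V \<Longrightarrow> w \<in> V \<Longrightarrow> ip (- u) w = - ip u w" using ip_scale[of u w "-1"] by simp

lemma ip_diff: "u \<in> V \<Longrightarrow> v \<in> V \<Longrightarrow> w \<in> V \<Longrightarrow> ip (u - v) w = ip u w - ip v w" using ip_add[of u "- v" w] ip_minus[of v w] minus_mem[of v] by simp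

lemma ip_diff_right: "u \<in> V \<Longrightarrow> v \<in> V \<Longrightarrow> w \<in> V \<Longrightarrow> ip w (u - v) = ip w u - ip w v" by (simp add: ip_sym[of w] ip_diff diff_mem)

text \<open>The Riesz map. The value 0 off \<open>V\<close> is what membership in
  \<open>dual_space V N\<close> demands.\<close>

definition riesz :: "'x \<Rightarrow> 'x \<Rightarrow> real" where
  "riesz v = (\<lambda>u. if u \<in> V then ip v u else 0)"

lemma riesz_mem: assumes v: "v \<in> V" shows "riesz v \<in> dual_space V N" unfolding dual_space_def
proof (intro CollectI conjI ballI allI impI)
  show "\<exists>C. \<forall>u\<in>V. \<bar>riesz v u\<bar> \<le> C * N u" using cauchy_schwarz[OF v] by (intro exI[of _ "N v"]) (simp add: riesz_def)
qed (auto simp: riesz_def add_mem scale_mem ip_add_right ip_scale_right v)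

lemma riesz_norm: assumes v: "v \<in> V" shows "dual_norm V N (riesz v) = N v"
proof (rule antisym)
  show "dual_norm V N (riesz v) \<le> N v" using cauchy_schwarz[OF v] by (intro dual_norm_least') (auto simp: riesz_def N_nonneg v)
  have "N v * N v \<le> dual_norm V N (riesz v) * N v" using dual_norm_bound[OF riesz_mem[OF v] v] v N_sq[OF v] ip_nonneg[OF v]
    by (simp add: riesz_def power2_eq_square)
  then show "N v \<le> dual_norm V N (riesz v)" using N_nonneg[OF v] dual_norm_nonneg[OF riesz_mem[OF v]]
    by (cases "N v = 0") (auto simp: mult_le_cancel_right)
qed

lemma riesz_add: "u \<in> V \<Longrightarrow> v \<in> V \<Longrightarrow> riesz (u + v) = riesz u + riesz v" by (auto simp: riesz_def fun_eq_iff ip_add)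

lemma riesz_scale: "u \<in> V \<Longrightarrow> riesz (c *\<^sub>R u) = c *\<^sub>R riesz u" by (auto simp: riesz_def fun_eq_iff ip_scale scaleR_fun_def)

lemma riesz_zero: "riesz 0 = 0" by (rule ext) (simp add: riesz_def ip_zero)

lemma riesz_sum: "(\<And>i. i \<in> I \<Longrightarrow> x i \<in> V) \<Longrightarrow> riesz (\<Sum>i\<in>I. x i) = (\<Sum>i\<in>I. riesz (x i))"
proof (induction I rule: infinite_finite_induct)
  case (insert x F)
  then show ?case by (simp add: riesz_add sum_mem)
qed (simp_all add: riesz_zero)

text \<open>Take u in the unit ball with \<open>G u\<close> within e of the norm M of
  \<open>G\<close>. Comparing \<open>G (u + t *\<^sub>R w)\<close> with M times the norm of its
  argument, which is at most 1 + t \<open>ip u w\<close> + t^2/2, shows that \<open>G\<close> and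
  the functional of M u differ on the unit ball by O(sqrt e). The values t = sqrt e and t = - sqrt e
  balance the two error terms.\<close>

lemma approx_riesz_aux:
  assumes G: "G \<in> dual_space V N" and e: "e > 0"
  shows "\<exists>g\<in>V. \<forall>w\<in>V. N w \<le> 1 \<longrightarrow> \<bar>(G - riesz g) w\<bar> \<le> sqrt e * (1 + dual_norm V N G / 2)"
proof -
  define M where "M = dual_norm V N G"
  have M0: "0 \<le> M" unfolding M_def by (rule dual_norm_nonneg[OF G])
  have "\<exists>y\<in>{\<bar>G v\<bar> | v. v \<in> V \<and> N v \<le> 1}. M - e < y" unfolding M_def dual_norm_def using e
    by (subst less_cSup_iff[symmetric]) (auto simp: dual_bdd[OF G] zero_mem N_zero intro!: exI[of _ 0])
  then obtain v where v: "v \<in> V" "N v \<le> 1" "M - e < \<bar>G v\<bar>" by auto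
  obtain u where u: "u \<in> V" "N u \<le> 1" "M - e < G u"
  proof (cases "G v \<ge> 0")
    case True then show ?thesis using v that[of v] by simp
  next
    case False then show ?thesis using v that[of "- v"] dual_space_scale[OF G v(1), of "-1"] by (simp add: minus_mem N_minus)
  qed
  have key: "t * (G w - M * ip u w) \<le> e + M * t^2 / 2" if w: "w \<in> V" "N w \<le> 1" for w t
  proof -
    have "(N (u + t *\<^sub>R w))^2 \<le> 1 + 2 * t * ip u w + t^2"
    proof -
      have "ip u u \<le> 1" using u N_nonneg[OF u(1)] by (metis N_sq power_le_one)
      moreover have "t^2 * ip w w \<le> t^2 * 1" using w N_nonneg[OF w(1)] by (intro mult_left_mono) (metis N_sq power_le_one, simp)
      ultimately show ?thesis using ip_square_add[OF u(1) w(1), of t] by (simp add: N_sq add_mem scale_mem u w)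
    qed
    moreover have "N (u + t *\<^sub>R w) \<le> (1 + (N (u + t *\<^sub>R w))^2) / 2" using sum_squares_bound[of 1 "N (u + t *\<^sub>R w)"] by simp
    ultimately have a: "N (u + t *\<^sub>R w) \<le> 1 + t * ip u w + t^2 / 2" by (simp add: field_simps)
    have "G u + t * G w \<le> M * N (u + t *\<^sub>R w)" using dual_norm_bound[OF G, of "u + t *\<^sub>R w"] u w
      by (simp add: M_def add_mem scale_mem dual_space_add[OF G] dual_space_scale[OF G])
    also have "\<dots> \<le> M * (1 + t * ip u w + t^2 / 2)" by (intro mult_left_mono a M0)
    finally show ?thesis using u(3) by (simp add: algebra_simps)
  qed
  show ?thesis
  proof (intro bexI[of _ "M *\<^sub>R u"] ballI impI)
    fix w assume w: "w \<in> V" "N w \<le> 1"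
    have se: "sqrt e > 0" "sqrt e * sqrt e = e" using e by auto
    have e1: "sqrt e * (sqrt e * (1 + M / 2)) = e * (1 + M / 2)" by (simp only: mult.assoc[symmetric] se)
    have 1: "sqrt e * (G w - M * ip u w) \<le> sqrt e * (sqrt e * (1 + M / 2))"
      using key[OF w, of "sqrt e"] e unfolding e1 by (simp add: algebra_simps)
    have 2: "sqrt e * - (G w - M * ip u w) \<le> sqrt e * (sqrt e * (1 + M / 2))"
      using key[OF w, of "- sqrt e"] e unfolding e1 by (simp add: algebra_simps)
    have "\<bar>G w - M * ip u w\<bar> \<le> sqrt e * (1 + M / 2)" using 1 2 se by (simp add: mult_le_cancel_left abs_le_iff)
    then show "\<bar>(G - riesz (M *\<^sub>R u)) w\<bar> \<le> sqrt e * (1 + dual_norm V N G / 2)" by (simp add: riesz_def ip_scale u w M_def)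
  qed (simp add: scale_mem u)
qed

text \<open>No completeness is needed: the representers are taken along a maximizing sequence.\<close>

lemma approx_riesz:
  assumes G: "G \<in> dual_space V N"
  shows "\<exists>g. (\<forall>n. g n \<in> V) \<and> (\<lambda>n::nat. dual_norm V N (G - riesz (g n))) \<longlonglongrightarrow> 0"
proof -
  define B where "B = 1 + dual_norm V N G / 2"
  have "\<forall>n. \<exists>g\<in>V. \<forall>w\<in>V. N w \<le> 1 \<longrightarrow> \<bar>(G - riesz g) w\<bar> \<le> sqrt (1 / real (Suc n)) * B" unfolding B_def by (intro allI approx_riesz_aux G) simp
  then obtain g where g: "\<And>n. g n \<in> V"
    "\<And>n w. w \<in> V \<Longrightarrow> N w \<le> 1 \<Longrightarrow> \<bar>(G - riesz (g n)) w\<bar> \<le> sqrt (1 / real (Suc n)) * B" by metis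
  interpret D: seminormed_space "dual_space V N" "dual_norm V N" by (rule dual_seminormed)
  have "(\<lambda>n. dual_norm V N (G - riesz (g n))) \<longlonglongrightarrow> 0"
  proof (rule tendsto_sandwich[of "\<lambda>n. 0"])
    have "(\<lambda>n. sqrt (1 / real (Suc n)) * B) \<longlonglongrightarrow> sqrt 0 * B" by (intro tendsto_intros) (rule LIMSEQ_Suc, rule lim_1_over_n)
    then show "(\<lambda>n. sqrt (1 / real (Suc n)) * B) \<longlonglongrightarrow> 0" by simp
    show "\<forall>\<^sub>F n in sequentially. dual_norm V N (G - riesz (g n)) \<le> sqrt (1 / real (Suc n)) * B"
      by (intro always_eventually allI dual_norm_least g)
    show "\<forall>\<^sub>F n in sequentially. 0 \<le> dual_norm V N (G - riesz (g n))" by (intro always_eventually allI D.N_nonneg D.diff_mem G riesz_mem g)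
  qed auto
  then show ?thesis using g by auto
qed

text \<open>\<open>polar_inner\<close> knows the dual inner product only through norms. On
  representers it equals \<open>ip (g n) v\<close> by polarization in \<open>V\<close>, and both
  sides pass to the limit along \<open>approx_riesz\<close>. This is how the pairing of f with a
  step function of Riesz images becomes an L2 product.\<close>

lemma polar_inner_riesz:
  assumes G: "G \<in> dual_space V N" and v: "v \<in> V"
  shows "polar_inner (dual_norm V N) G (riesz v) = G v"
proof -
  interpret D: seminormed_space "dual_space V N" "dual_norm V N" by (rule dual_seminormed)
  let ?D = "dual_norm V N"
  obtain g where g: "\<And>n. g n \<in> V" and lim: "(\<lambda>n. ?D (G - riesz (g n))) \<longlonglongrightarrow> 0" using approx_riesz[OF G] by auto
  note mem = G v g riesz_mem D.diff_mem D.add_mem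
  have "(\<lambda>n. \<bar>N (g n + v) - ?D (G + riesz v)\<bar>) \<longlonglongrightarrow> 0"
  proof (rule tendsto_sandwich[OF _ _ tendsto_const lim]; intro always_eventually allI)
    fix n
    have "\<bar>?D (G + riesz v) - ?D (riesz (g n + v))\<bar> \<le> ?D (G + riesz v - riesz (g n + v))" by (intro D.N_abs_diff mem add_mem)
    then show "\<bar>N (g n + v) - ?D (G + riesz v)\<bar> \<le> ?D (G - riesz (g n))"
      by (simp add: riesz_norm[OF add_mem[OF g v], symmetric] abs_minus_commute riesz_add g v)
  qed simp
  then have 1: "(\<lambda>n. N (g n + v)) \<longlonglongrightarrow> ?D (G + riesz v)" by (simp add: LIM_zero_iff tendsto_rabs_zero_iff)
  have rm: "riesz (g n - v) = riesz (g n) - riesz v" for n by (auto simp: riesz_def fun_eq_iff ip_diff g v)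
  have "(\<lambda>n. \<bar>N (g n - v) - ?D (G - riesz v)\<bar>) \<longlonglongrightarrow> 0"
  proof (rule tendsto_sandwich[OF _ _ tendsto_const lim]; intro always_eventually allI)
    fix n
    have "\<bar>?D (G - riesz v) - ?D (riesz (g n - v))\<bar> \<le> ?D (G - riesz v - riesz (g n - v))" by (intro D.N_abs_diff mem diff_mem)
    then show "\<bar>N (g n - v) - ?D (G - riesz v)\<bar> \<le> ?D (G - riesz (g n))"
      by (simp add: riesz_norm[OF diff_mem[OF g v], symmetric] abs_minus_commute rm)
  qed simp
  then have 2: "(\<lambda>n. N (g n - v)) \<longlonglongrightarrow> ?D (G - riesz v)" by (simp add: LIM_zero_iff tendsto_rabs_zero_iff)
  have "(\<lambda>n. ((N (g n + v))^2 - (N (g n - v))^2) / 4) \<longlonglongrightarrow> polar_inner ?D G (riesz v)"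
    unfolding polar_inner_def by (intro tendsto_intros 1 2) simp
  moreover have "((N (g n + v))^2 - (N (g n - v))^2) / 4 = ip (g n) v" for n
    using ip_square_add[OF g v, of n 1] ip_square_add[OF g v, of n "-1"] by (simp add: N_sq add_mem diff_mem g v)
  ultimately have 3: "(\<lambda>n. ip (g n) v) \<longlonglongrightarrow> polar_inner ?D G (riesz v)" by simp
  have "(\<lambda>n. \<bar>ip (g n) v - G v\<bar>) \<longlonglongrightarrow> 0"
  proof (rule tendsto_sandwich[OF _ _ tendsto_const])
    show "(\<lambda>n. ?D (G - riesz (g n)) * N v) \<longlonglongrightarrow> 0" using tendsto_mult_right[OF lim, of "N v"] by simp
    show "\<forall>\<^sub>F n in sequentially. \<bar>ip (g n) v - G v\<bar> \<le> ?D (G - riesz (g n)) * N v"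
    proof (intro always_eventually allI)
      fix n show "\<bar>ip (g n) v - G v\<bar> \<le> ?D (G - riesz (g n)) * N v" using dual_norm_bound[OF D.diff_mem[OF G riesz_mem[OF g]] v, of n] v
        by (simp add: riesz_def abs_minus_commute)
    qed
  qed simp
  then have "(\<lambda>n. ip (g n) v) \<longlonglongrightarrow> G v" by (simp add: LIM_zero_iff tendsto_rabs_zero_iff)
  then show ?thesis using 3 LIMSEQ_unique by blast
qed

text \<open>Gram-Schmidt along a spanning set that may be linearly dependent, so the residual
  \<open>c\<close> may vanish. The expansion is the form in which orthonormality is used later: it
  splits quadratic forms and norms into scalar coordinates.\<close>

lemma finite_orthonormal_expansion:
  assumes "finite B" "B \<subseteq> V" and pos: "\<And>u. u \<in> V \<Longrightarrow> ip u u = 0 \<Longrightarrow> u = 0"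
  shows "\<exists>E. finite E \<and> E \<subseteq> span B \<and> (\<forall>w\<in>span B. w = (\<Sum>e\<in>E. ip w e *\<^sub>R e))" using assms(1,2)
proof (induction B rule: finite_induct)
  case empty then show ?case by (auto intro!: exI[of _ "{}"])
next
  case (insert b B)
  then obtain E where E: "finite E" "E \<subseteq> span B" "\<And>w. w \<in> span B \<Longrightarrow> w = (\<Sum>e\<in>E. ip w e *\<^sub>R e)" by auto
  have sub: "subspace V" unfolding subspace_def by (auto simp: zero_mem add_mem scale_mem)
  have spV: "span B \<subseteq> V" using insert by (intro span_minimal sub) auto
  have EV: "E \<subseteq> V" using E spV by auto
  have bV: "b \<in> V" using insert by auto
  define r where "r = (\<Sum>e\<in>E. ip b e *\<^sub>R e)"
  have r: "r \<in> span B" unfolding r_def using E by (intro span_sum span_scale) auto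
  define c where "c = b - r"
  have cV: "c \<in> V" unfolding c_def using bV r spV by (intro diff_mem) auto
  have orth: "ip c w = 0" if w: "w \<in> span B" for w
  proof -
    have wV: "w \<in> V" using w spV by auto
    have "ip b w = ip b (\<Sum>e\<in>E. ip w e *\<^sub>R e)" using E(3)[OF w] by simp
    also have "\<dots> = (\<Sum>e\<in>E. ip w e * ip b e)" using EV by (subst ip_sum_right) (auto simp: bV scale_mem ip_scale_right intro!: sum.cong)
    finally have "ip b w = (\<Sum>e\<in>E. ip w e * ip b e)" .
    moreover have "ip r w = (\<Sum>e\<in>E. ip b e * ip e w)"
      unfolding r_def using EV by (subst ip_sum) (auto simp: wV scale_mem ip_scale intro!: sum.cong)
    moreover have "(\<Sum>e\<in>E. ip b e * ip e w) = (\<Sum>e\<in>E. ip w e * ip b e)" using EV wV by (intro sum.cong refl) (auto simp: ip_sym[of w])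
    ultimately show ?thesis unfolding c_def using bV wV r spV by (subst ip_diff) auto
  qed
  have span_ins: "\<exists>w'\<in>span B. \<exists>t. w = w' + t *\<^sub>R c" if w: "w \<in> span (insert b B)" for w
  proof -
    obtain k where k: "w - k *\<^sub>R b \<in> span B" using w unfolding span_insert by auto
    show ?thesis
    proof (intro bexI exI)
      show "w = (w - k *\<^sub>R b + k *\<^sub>R r) + k *\<^sub>R c" unfolding c_def by (simp add: algebra_simps)
      show "w - k *\<^sub>R b + k *\<^sub>R r \<in> span B" using k r by (intro span_add span_scale)
    qed
  qed
  have mono: "span B \<subseteq> span (insert b B)" by (intro span_mono) auto
  show ?case
  proof (cases "c = 0")
    case True
    have "w = (\<Sum>e\<in>E. ip w e *\<^sub>R e)" if w: "w \<in> span (insert b B)" for w using span_ins[OF w] True E(3)[of w] by auto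
    then show ?thesis using E(1,2) mono by (intro exI[of _ E]) auto
  next
    case False
    then have p: "ip c c > 0" using pos[OF cV] ip_nonneg[OF cV] by (auto simp: order.strict_iff_order)
    define s where "s = sqrt (ip c c)"
    have s: "s > 0" "s * s = ip c c" using p by (auto simp: s_def)
    define e' where "e' = (1 / s) *\<^sub>R c"
    have e'V: "e' \<in> V" unfolding e'_def by (intro scale_mem cV)
    have e'c: "ip c e' = s" unfolding e'_def using s cV by (simp add: ip_scale_right field_simps)
    have e'w: "ip w e' = 0" if "w \<in> span B" for w
      using orth[OF that] spV that cV unfolding e'_def by (auto simp: ip_scale_right ip_sym[of w])
    have e'E: "e' \<notin> E"
    proof
      assume "e' \<in> E"
      then have "ip c e' = 0" using E(2) orth by auto
      then show False using e'c s by simp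
    qed
    have e's: "e' \<in> span (insert b B)" unfolding e'_def c_def using r mono by (intro span_scale span_diff) (auto intro: span_base)
    have "w = (\<Sum>e\<in>insert e' E. ip w e *\<^sub>R e)" if w: "w \<in> span (insert b B)" for w
    proof -
      obtain w' t where w': "w' \<in> span B" "w = w' + t *\<^sub>R c" using span_ins[OF w] by auto
      have w'V: "w' \<in> V" using w' spV by auto
      have "ip w e' = t * s" unfolding w'(2) using w'V cV e'V e'c e'w[OF w'(1)] by (simp add: ip_add scale_mem ip_scale)
      moreover have "ip w e = ip w' e" if "e \<in> E" for e unfolding w'(2) using w'V cV subsetD[OF EV that] orth[OF subsetD[OF E(2) that]]
        by (simp add: ip_add scale_mem ip_scale)
      ultimately have "(\<Sum>e\<in>insert e' E. ip w e *\<^sub>R e) = (t * s) *\<^sub>R e' + (\<Sum>e\<in>E. ip w' e *\<^sub>R e)" using e'E E(1) by (simp cong: sum.cong)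
      also have "\<dots> = w" unfolding e'_def w'(2) using E(3)[OF w'(1)] s by simp
      finally show ?thesis by simp
    qed
    then show ?thesis using E(1,2) mono e's by (intro exI[of _ "insert e' E"]) auto
  qed
qed

end

section \<open>The quadratic form of the scheme\<close>

text \<open>The kernel of the scheme after summation by parts: the left-hand side is
  \<open>\<Sum>j\<le>k. kern c (k - j) *\<^sub>R (U (j + 1) - U j)\<close>.\<close>

definition kern :: "(nat \<Rightarrow> real) \<Rightarrow> nat \<Rightarrow> real" where
  "kern c i = (if i = 0 then c 1 - c 0 else c (i + 1) - 2 * c i + c (i - 1))"

definition kform :: "(nat \<Rightarrow> real) \<Rightarrow> nat \<Rightarrow> (nat \<Rightarrow> real) \<Rightarrow> real" where
  "kform c n x = (\<Sum>k<n. x k * (\<Sum>j\<le>k. kern c (k - j) * x j))"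

lemma sum_kern: "(\<Sum>i\<le>m. kern c i) = c (m + 1) - c m" by (induction m) (auto simp: kern_def)

lemma kern_diff: "0 < i \<Longrightarrow> kern c i = (c (i + 1) - c i) - (c i - c (i - 1))" by (simp add: kern_def)

text \<open>Abel summation: second differences of \<open>U\<close> are first differences of the
  increments, and \<open>kern\<close> is the backward difference of \<open>c (i + 1) - c i\<close>,
  with the first value kept at i = 0.\<close>

lemma scheme_lhs_kern:
  fixes U :: "nat \<Rightarrow> 'x::real_vector"
  shows "(c (k + 1) - c k) *\<^sub>R (U 1 - U 0)
    + (\<Sum>j=1..k. (c (k - j + 1) - c (k - j)) *\<^sub>R (U (j + 1) - 2 *\<^sub>R U j + U (j - 1)))
    = (\<Sum>j\<le>k. kern c (k - j) *\<^sub>R (U (j + 1) - U j))"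
proof -
  define w where "w i = c (i + 1) - c i" for i
  define \<delta> where "\<delta> j = U (j + 1) - U j" for j
  have "(\<Sum>j=1..k. w (k - j) *\<^sub>R (U (j + 1) - 2 *\<^sub>R U j + U (j - 1)))
      = (\<Sum>j<k. w (k - Suc j) *\<^sub>R (\<delta> (Suc j) - \<delta> j))" by (rule sum.reindex_bij_witness[of _ Suc "\<lambda>j. j - 1"])
      (auto simp: \<delta>_def algebra_simps scaleR_2)
  also have "\<dots> = (\<Sum>j<k. w (k - Suc j) *\<^sub>R \<delta> (Suc j)) - (\<Sum>j<k. w (k - Suc j) *\<^sub>R \<delta> j)" by (simp add: scaleR_diff_right sum_subtractf)
  finally have "w k *\<^sub>R \<delta> 0 + (\<Sum>j=1..k. w (k - j) *\<^sub>R (U (j + 1) - 2 *\<^sub>R U j + U (j - 1)))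
    = (w k *\<^sub>R \<delta> 0 + (\<Sum>j<k. w (k - Suc j) *\<^sub>R \<delta> (Suc j))) - (\<Sum>j<k. w (k - Suc j) *\<^sub>R \<delta> j)" by simp
  also have "w k *\<^sub>R \<delta> 0 + (\<Sum>j<k. w (k - Suc j) *\<^sub>R \<delta> (Suc j)) = (\<Sum>j<Suc k. w (k - j) *\<^sub>R \<delta> j)" by (subst sum.lessThan_Suc_shift) simp
  also have "\<dots> - (\<Sum>j<k. w (k - Suc j) *\<^sub>R \<delta> j) = (\<Sum>j<k. kern c (k - j) *\<^sub>R \<delta> j) + kern c 0 *\<^sub>R \<delta> k"
  proof -
    have "kern c (k - j) = w (k - j) - w (k - Suc j)" if "j < k" for j using that kern_diff[of "k - j" c] by (simp add: w_def Suc_diff_Suc)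
    then have "(\<Sum>j<k. kern c (k - j) *\<^sub>R \<delta> j) = (\<Sum>j<k. w (k - j) *\<^sub>R \<delta> j - w (k - Suc j) *\<^sub>R \<delta> j)"
      by (intro sum.cong) (auto simp: scaleR_diff_left)
    then show ?thesis by (simp add: sum_subtractf w_def kern_def)
  qed
  also have "\<dots> = (\<Sum>j\<le>k. kern c (k - j) *\<^sub>R \<delta> j)" by (simp flip: lessThan_Suc_atMost)
  finally show ?thesis by (simp add: w_def \<delta>_def)
qed

text \<open>Polarize \<open>x k * x j = ((x k)^2 + (x j)^2 - (x k - x j)^2) / 2\<close>. The row
  sums of the kernel are \<open>c (k + 1) - c k\<close> by \<open>sum_kern\<close>, the column sums
  truncated at \<open>n\<close> are \<open>c (n - k) - c (n - Suc k)\<close>; through the latter the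
  form sees the right endpoint. For increasing concave \<open>c\<close> every weight has the good
  sign.\<close>

lemma kform_eq_squares:
  "kform c n x = (\<Sum>k<n. ((c (k + 1) - c k) + (c (n - k) - c (n - Suc k))) * (x k)^2) / 2
     - (\<Sum>k<n. \<Sum>j<k. kern c (k - j) * (x k - x j)^2) / 2"
proof (induction n)
  case (Suc n)
  define w where "w i = c (i + 1) - c i" for i
  have wk: "w (n - k) - w (n - Suc k) = kern c (n - k)" if "k < n" for k
    using that kern_diff[of "n - k" c] by (simp add: w_def Suc_diff_Suc)
  have wn: "c (n - k) - c (n - Suc k) = w (n - Suc k)" if "k < n" for k using that by (simp add: w_def Suc_diff_Suc)
  have "(\<Sum>j<n. kern c (n - j)) = (\<Sum>j\<in>{1..n}. kern c j)" by (rule sum.reindex_bij_witness[of _ "\<lambda>j. n - j" "\<lambda>j. n - j"]) auto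
  also have "\<dots> = (\<Sum>i\<le>n. kern c i) - kern c 0" by (simp add: atMost_atLeast0 sum.atLeast_Suc_atMost)
  finally have sk: "(\<Sum>j<n. kern c (n - j)) = w n - w 0" unfolding sum_kern by (simp add: w_def kern_def)
  have "(\<Sum>k<Suc n. (w k + (c (Suc n - k) - c (Suc n - Suc k))) * (x k)^2)
      = (w n + w 0) * (x n)^2 + (\<Sum>k<n. (w k + w (n - k)) * (x k)^2)" by (auto simp: w_def Suc_diff_le intro!: sum.cong)
  also have "(\<Sum>k<n. (w k + w (n - k)) * (x k)^2)
      = (\<Sum>k<n. (w k + (c (n - k) - c (n - Suc k))) * (x k)^2 + kern c (n - k) * (x k)^2)"
    by (intro sum.cong refl) (simp add: wn wk[symmetric] algebra_simps)
  finally have 1: "(\<Sum>k<Suc n. (w k + (c (Suc n - k) - c (Suc n - Suc k))) * (x k)^2)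
     = (w n + w 0) * (x n)^2 + (\<Sum>k<n. (w k + (c (n - k) - c (n - Suc k))) * (x k)^2)
       + (\<Sum>k<n. kern c (n - k) * (x k)^2)" by (simp add: sum.distrib)
  define S1 where "S1 = (\<Sum>k<n. (w k + (c (n - k) - c (n - Suc k))) * (x k)^2)"
  define S2 where "S2 = (\<Sum>k<n. kern c (n - k) * (x k)^2)"
  define S3 where "S3 = (\<Sum>k<n. \<Sum>j<k. kern c (k - j) * (x k - x j)^2)"
  define S4 where "S4 = (\<Sum>j<n. kern c (n - j) * x j)"
  have "(\<Sum>j<n. kern c (n - j) * (x n - x j)^2) = (\<Sum>j<n. kern c (n - j)) * (x n)^2 - 2 * x n * S4 + S2" unfolding S4_def S2_def
    by (simp add: power2_diff algebra_simps sum.distrib sum_subtractf sum_distrib_left)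
  then have 2: "(\<Sum>k<Suc n. \<Sum>j<k. kern c (k - j) * (x k - x j)^2)
      = S3 + ((w n - w 0) * (x n)^2 - 2 * x n * S4 + S2)" unfolding sk by (simp add: S3_def)
  have 3: "kform c (Suc n) x = kform c n x + x n * (w 0 * x n + S4)"
    unfolding kform_def S4_def by (simp add: kern_def w_def flip: lessThan_Suc_atMost)
  have IH: "kform c n x = S1 / 2 - S3 / 2" using Suc.IH unfolding S1_def S3_def w_def by simp
  have "kform c (Suc n) x = ((w n + w 0) * (x n)^2 + S1 + S2) / 2
      - (S3 + ((w n - w 0) * (x n)^2 - 2 * x n * S4 + S2)) / 2" unfolding 3 IH by (simp add: field_simps power2_eq_square)
  moreover have "(\<Sum>k<Suc n. ((c (k + 1) - c k) + (c (Suc n - k) - c (Suc n - Suc k))) * (x k)^2)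
      = (w n + w 0) * (x n)^2 + S1 + S2" using 1 unfolding S1_def S2_def w_def .
  ultimately show ?case using 2 by (simp only:)
qed (simp add: kform_def)

section \<open>Linearity and padding of forms; the model coefficients 1 - r^m and the unit at
  1\<close>

lemma kern_lin: "kern (\<lambda>m. a * c m + b * e m) i = a * kern c i + b * kern e i" by (simp add: kern_def algebra_simps)

lemma kform_lin: "kform (\<lambda>m. a * c m + b * e m) n x = a * kform c n x + b * kform e n x"
  by (simp add: kform_def kern_lin algebra_simps sum.distrib sum_distrib_left)

lemma kform_cutoff:
  assumes "\<And>k. n \<le> k \<Longrightarrow> x k = 0" "n \<le> m"
  shows "kform c m x = kform c n x" unfolding kform_def using assms by (intro sum.mono_neutral_right) auto

lemma kform_cong: "(\<And>k. k < n \<Longrightarrow> x k = y k) \<Longrightarrow> kform c n x = kform c n y"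
  unfolding kform_def by (intro sum.cong refl arg_cong2[where f = "(*)"]) auto

lemma kform_shift: "kform c (Suc n) (\<lambda>k. if k = 0 then 0 else x (k - 1)) = kform c n x"
proof -
  have "(\<Sum>j\<le>Suc k. kern c (Suc k - j) * (if j = 0 then 0 else x (j - 1))) = (\<Sum>j\<le>k. kern c (k - j) * x j)"
    for k by (subst sum.atMost_Suc_shift) simp
  then show ?thesis unfolding kform_def by (subst sum.lessThan_Suc_shift) (simp del: sum.atMost_Suc)
qed

text \<open>For these coefficients the kernel is geometric off the diagonal, so the convolution
  reduces to the one-step recursion \<open>s\<close>, with inner sum
  \<open>(1 - r) * x k - (1 - r)^2 * s k\<close>. The increments of \<open>s\<close> carry the
  dissipation; the last term is the energy still stored at time \<open>n\<close>.\<close>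

lemma kform_geometric:
  assumes s0: "s 0 = 0" and s: "\<And>k. s (Suc k) = r * s k + x k"
  shows "kform (\<lambda>m. 1 - r ^ m) n x
    = (1 - r^2) / 2 * (\<Sum>k<n. (s (Suc k) - s k)^2) + (1 - r)^2 / 2 * (s n)^2"
proof -
  have kr: "kern (\<lambda>m. 1 - r ^ m) (Suc i) = - ((1 - r)^2 * r ^ i)" for i by (simp add: kern_def power2_eq_square algebra_simps)
  have sk: "s k = (\<Sum>j<k. r ^ (k - Suc j) * x j)" for k
  proof (induction k)
    case (Suc k)
    have "r * (\<Sum>j<k. r ^ (k - Suc j) * x j) = (\<Sum>j<k. r ^ (k - j) * x j)" unfolding sum_distrib_left
      by (intro sum.cong refl) (auto simp: mult.assoc[symmetric] power_Suc[symmetric] Suc_diff_Suc simp del: power_Suc)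
    then show ?case using Suc s[of k] by simp
  qed (simp add: s0)
  have inner: "(\<Sum>j\<le>k. kern (\<lambda>m. 1 - r ^ m) (k - j) * x j) = (1 - r) * x k - (1 - r)^2 * s k" for k
  proof -
    have "(\<Sum>j<k. kern (\<lambda>m. 1 - r ^ m) (k - j) * x j) = (\<Sum>j<k. - ((1 - r)^2) * (r ^ (k - Suc j) * x j))"
    proof (intro sum.cong refl)
      fix j assume "j \<in> {..<k}"
      then have "k - j = Suc (k - Suc j)" by auto
      then show "kern (\<lambda>m. 1 - r ^ m) (k - j) * x j = - ((1 - r)^2) * (r ^ (k - Suc j) * x j)" by (simp add: kr)
    qed
    then have "(\<Sum>j<k. kern (\<lambda>m. 1 - r ^ m) (k - j) * x j) = - ((1 - r)^2) * s k" unfolding sk by (simp only: sum_distrib_left)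
    then show ?thesis by (simp add: kern_def flip: lessThan_Suc_atMost)
  qed
  show ?thesis
  proof (induction n)
    case (Suc n)
    have x: "x n = s (Suc n) - r * s n" using s[of n] by simp
    have "kform (\<lambda>m. 1 - r ^ m) (Suc n) x
      = kform (\<lambda>m. 1 - r ^ m) n x + x n * ((1 - r) * x n - (1 - r)^2 * s n)" by (simp add: kform_def inner)
    then show ?case unfolding Suc.IH unfolding x sum.lessThan_Suc by (simp add: field_simps power2_eq_square)
  qed (simp add: kform_def s0)
qed

text \<open>Here \<open>kern\<close> takes the values 1, -2, 1 and then 0, a second difference in
  time. Summation by parts leaves products of consecutive increments, whose sign is indefinite. The
  two leading zeros of \<open>x\<close> stand for the missing past.\<close>

lemma kform_unit:
  assumes "x 0 = 0" "x 1 = 0"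
  shows "kform (\<lambda>m. if m = 1 then 1 else 0) (N + 2) x
    = - (\<Sum>k<N. (x (k + 2) - x (k + 1)) * (x (k + 1) - x k)) + (x (N + 1))^2 - x (N + 1) * x N"
proof -
  let ?c = "\<lambda>m::nat. if m = 1 then 1 else 0 :: real"
  have inner: "(\<Sum>j\<le>k+2. kern ?c (k + 2 - j) * x j) = x (k + 2) - 2 * x (k + 1) + x k" for k
  proof -
    have "(\<Sum>j\<le>k+2. kern ?c (k + 2 - j) * x j) = (\<Sum>j\<in>{k, k+1, k+2}. kern ?c (k + 2 - j) * x j)"
      by (rule sum.mono_neutral_right) (auto simp: kern_def)
    then show ?thesis by (simp add: kern_def)
  qed
  show ?thesis
  proof (induction N)
    case 0 then show ?case using assms by (simp add: kform_def numeral_2_eq_2)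
  next
    case (Suc N)
    have "kform ?c (Suc N + 2) x = kform ?c (N + 2) x + x (N + 2) * (x (N + 2) - 2 * x (N + 1) + x N)"
      unfolding inner[symmetric] by (simp add: kform_def)
    then show ?case unfolding Suc.IH by (simp add: algebra_simps power2_eq_square)
  qed
qed

text \<open>The sum of squares certificate on the frequency side is
  \<open>2 r a u^2 - a (1 + r^2) u + (1 - r^2) / 2 = p (u - v)^2 + q (1 - u) + t\<close> with \<open>u = cos \<theta>\<close>.\<close>

lemma sos_certificate:
  fixes y :: "nat \<Rightarrow> real"
  assumes p: "p = 2 * r * a" and q: "2 * p * v + q = a * (1 + r^2)"
    and t: "p * v^2 + q + t = (1 - r^2) / 2" and y0: "y 0 = 0" "y 1 = 0"
  shows "(1 - r^2) / 2 * (\<Sum>k<N+2. (y k)^2)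
      - a * (\<Sum>k<N. (y (k + 2) - r * y (k + 1)) * (y (k + 1) - r * y k))
    = (\<Sum>k<N. p * ((y (k + 2) + y k) / 2 - v * y (k + 1))^2 + q / 2 * (y (k + 2) - y (k + 1))^2
        + t * (y (k + 1))^2)
      + ((1 - r^2) / 2 - p / 4 - q / 2) * (y (N + 1))^2 + p / 4 * (y N)^2
      + (p * v + q - a) * (y (N + 1) * y N)"
proof (induction N)
  case 0 then show ?case using y0 by (simp add: numeral_2_eq_2)
next
  case (Suc N)
  \<comment> \<open>The induction step is an identity of quadratic forms in three consecutive
    values; its last line removes the boundary terms of the previous step.\<close>
  define A B C where "A = y N" "B = y (N + 1)" "C = y (N + 2)"
  have "(1 - r^2) / 2 * C^2 - a * ((C - r * B) * (B - r * A))
     = p * ((C + A) / 2 - v * B)^2 + q / 2 * (C - B)^2 + t * B^2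
       + ((1 - r^2) / 2 - p / 4 - q / 2) * C^2 + p / 4 * B^2 + (p * v + q - a) * (C * B)
       - ((1 - r^2) / 2 - p / 4 - q / 2) * B^2 - p / 4 * A^2 - (p * v + q - a) * (B * A)"
  proof -
    have t': "t = (1 - r^2) / 2 - p * v^2 - q" using t by linarith
    have q': "q = a * (1 + r^2) - 2 * p * v" using q by linarith
    show ?thesis unfolding t' q' p by (simp add: power2_eq_square field_simps)
  qed
  then show ?case using Suc.IH unfolding A_B_C_def by (simp add: algebra_simps)
qed

text \<open>The certificate at a single frequency. Let \<open>s\<close> be the recursive filter of
  the padded input and \<open>y\<close> its increments; the increments of the input are then
  \<open>y (k + 1) - r * y k\<close>, both forms become quadratic in \<open>y\<close>, and
  \<open>sos_certificate\<close> applies. Two zeros in front and summation beyond the support of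
  \<open>x\<close> remove the boundary contributions.\<close>

lemma kform_geometric_unit_nonneg:
  assumes r: "0 < r" "r < 1"
    and a: "a = (if r \<le> 1/4 then 1/2 else (1 - r) / 4)"
  shows "0 \<le> kform (\<lambda>m. 1 - r ^ m) n x + a * kform (\<lambda>m. if m = 1 then 1 else 0) n x"
proof -
  define x1 where "x1 k = (if k < n then x k else 0)" for k
  define x2 where "x2 k = (if k = 0 then 0 else x1 (k - 1))" for k
  define x3 where "x3 k = (if k = 0 then 0 else x2 (k - 1))" for k
  have eq: "kform c (Suc (Suc n)) x3 = kform c n x" for c
  proof -
    have "kform c (Suc (Suc n)) x3 = kform c (Suc n) x2" unfolding x3_def by (rule kform_shift)
    also have "\<dots> = kform c n x1" unfolding x2_def by (rule kform_shift)
    also have "\<dots> = kform c n x" by (rule kform_cong) (simp add: x1_def)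
    finally show ?thesis .
  qed
  have x3z: "x3 k = 0" if "k \<ge> n + 2" for k using that by (auto simp: x3_def x2_def x1_def)
  have x30: "x3 0 = 0" "x3 1 = 0" by (auto simp: x3_def x2_def)
  define s where "s = rec_nat 0 (\<lambda>k s. r * s + x3 k)"
  have s0: "s 0 = 0" and s: "\<And>k. s (Suc k) = r * s k + x3 k" by (auto simp: s_def)
  define y where "y k = s (Suc k) - s k" for k
  have y0: "y 0 = 0" "y 1 = 0" using x30 by (auto simp: y_def s s0)
  have yd: "x3 (k + 1) - x3 k = y (k + 1) - r * y k" for k using s[of k] s[of "Suc k"] by (simp add: y_def algebra_simps)
  have a0: "0 \<le> a" using a r by auto
  \<comment> \<open>Certificate for the quadratic in u = cos \<theta>, u <= 1. For r at most 1/4 its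
    vertex lies beyond 1, so the minimum is at u = 1: take v = 1 and put the slope into q. Otherwise
    v is the vertex \<open>(1 + r^2) / (4 * r)\<close> and q = 0.\<close>
  obtain p q t v where pqt: "p = 2 * r * a" "2 * p * v + q = a * (1 + r^2)"
    "p * v^2 + q + t = (1 - r^2) / 2" "0 \<le> p" "0 \<le> q" "0 \<le> t"
  proof (cases "r \<le> 1/4")
    case True
    then have aa: "a = 1/2" using a by simp
    have "0 \<le> (1 + r^2) / 2 - 2 * r"
    proof -
      have "4 * r \<le> 1 + r^2" using add_increasing2[of "r^2" "4 * r" 1] True by simp
      then show ?thesis by (simp add: field_simps)
    qed
    moreover have "0 \<le> (1 - r^2) / 2 - r - ((1 + r^2) / 2 - 2 * r)"
      using r mult_right_mono[of r 1 r] by (simp add: power2_eq_square field_simps)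
    ultimately show ?thesis using r aa by (intro that[of r 1 "(1 + r^2) / 2 - 2 * r" "(1 - r^2) / 2 - r - ((1 + r^2) / 2 - 2 * r)"]) auto
  next
    case False
    then have aa: "a = (1 - r) / 4" using a by simp
    define v where "v = (1 + r^2) / (4 * r)"
    define p where "p = 2 * r * a"
    have pv: "2 * p * v = a * (1 + r^2)" using r by (simp add: p_def v_def)
    have "p * v^2 = a * (1 + r^2) * v / 2" using pv by (simp add: power2_eq_square)
    also have "\<dots> = (1 - r) * ((1 + r^2)^2 / (32 * r))" using r by (simp add: aa v_def power2_eq_square field_simps)
    also have "\<dots> \<le> (1 - r) * ((1 + r) / 2)"
    proof (rule mult_left_mono)
      have "1 + r^2 \<le> 1 + r" using r by (simp add: power2_eq_square mult_le_cancel_left)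
      then have "(1 + r^2)^2 \<le> (1 + r)^2" by (rule power_mono) simp
      also have "\<dots> \<le> 16 * r * (1 + r)" unfolding power2_eq_square using False r by (intro mult_right_mono) auto
      finally show "(1 + r^2)^2 / (32 * r) \<le> (1 + r) / 2" using r by (simp add: field_simps)
    qed (use r in simp)
    also have "\<dots> = (1 - r^2) / 2" by (simp add: power2_eq_square field_simps)
    finally have "0 \<le> (1 - r^2) / 2 - p * v^2" by simp
    then show ?thesis using pv r a0 by (intro that[of p v 0 "(1 - r^2) / 2 - p * v^2"]) (auto simp: p_def)
  qed
  define E where "E N = ((1 - r^2) / 2 - p / 4 - q / 2) * (y (N + 1))^2 + p / 4 * (y N)^2
      + (p * v + q - a) * (y (N + 1) * y N)" for N
  have ge: "E N \<le> kform (\<lambda>m. 1 - r ^ m) n x + a * kform (\<lambda>m. if m = 1 then 1 else 0) n x"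
    if N: "N \<ge> n + 2" for N
  proof -
    have cut: "kform c n x = kform c (N + 2) x3" for c using kform_cutoff[of "n + 2" x3 "N + 2" c] x3z N eq[of c] by simp
    have "E N \<le> (1 - r^2) / 2 * (\<Sum>k<N+2. (y k)^2)
      - a * (\<Sum>k<N. (y (k + 2) - r * y (k + 1)) * (y (k + 1) - r * y k))" unfolding sos_certificate[OF pqt(1-3) y0] E_def using pqt(4-6)
      by (simp add: add.assoc sum_nonneg)
    also have "(\<Sum>k<N. (y (k + 2) - r * y (k + 1)) * (y (k + 1) - r * y k))
       = (\<Sum>k<N. (x3 (k + 2) - x3 (k + 1)) * (x3 (k + 1) - x3 k))"
      using yd yd[of "Suc _"] by (intro sum.cong refl) (simp add: numeral_2_eq_2)
    finally have "E N \<le> (1 - r^2) / 2 * (\<Sum>k<N+2. (y k)^2)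
      - a * (\<Sum>k<N. (x3 (k + 2) - x3 (k + 1)) * (x3 (k + 1) - x3 k))" .
    moreover have "kform (\<lambda>m. if m = 1 then 1 else 0) (N + 2) x3
      = - (\<Sum>k<N. (x3 (k + 2) - x3 (k + 1)) * (x3 (k + 1) - x3 k))" unfolding kform_unit[OF x30] using N by (simp add: x3z)
    \<comment> \<open>The stored-energy term of \<open>kform_geometric\<close> is a square and is
      dropped.\<close>
    moreover have "(1 - r^2) / 2 * (\<Sum>k<N+2. (y k)^2) \<le> kform (\<lambda>m. 1 - r ^ m) (N + 2) x3"
      unfolding kform_geometric[OF s0 s] y_def[symmetric] by simp
    ultimately show ?thesis unfolding cut by simp
  qed
  \<comment> \<open>Beyond the support the filter decays like \<open>r ^ k\<close>, so the boundary
    terms \<open>E N\<close> tend to 0, while the forms no longer depend on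
    \<open>N\<close>.\<close>
  have "y \<longlonglongrightarrow> 0"
  proof (rule LIMSEQ_offset[of _ "n + 2"])
    have sk: "s (k + (n + 2)) = r ^ k * s (n + 2)" for k by (induction k) (auto simp: s x3z)
    have "(\<lambda>k. (r - 1) * (r ^ k * s (n + 2))) \<longlonglongrightarrow> (r - 1) * (0 * s (n + 2))" using r by (intro tendsto_intros LIMSEQ_power_zero) auto
    moreover have "y (k + (n + 2)) = (r - 1) * (r ^ k * s (n + 2))" for k unfolding sk[symmetric] y_def by (simp add: s x3z algebra_simps)
    ultimately show "(\<lambda>k. y (k + (n + 2))) \<longlonglongrightarrow> 0" by simp
  qed
  then have "(\<lambda>N. y (N + 1)) \<longlonglongrightarrow> 0" "y \<longlonglongrightarrow> 0" by (auto dest: LIMSEQ_Suc)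
  then have "E \<longlonglongrightarrow> ((1 - r^2) / 2 - p / 4 - q / 2) * 0^2 + p / 4 * 0^2 + (p * v + q - a) * (0 * 0)" unfolding E_def by (intro tendsto_intros)
  then have "E \<longlonglongrightarrow> 0" by simp
  then show ?thesis using ge by (intro LIMSEQ_le_const2) auto
qed

section \<open>Smooth bump functions\<close>

lemma Ck_SucI:
  assumes "\<And>x. (f has_derivative f' x) (at x)" "\<And>e. e \<in> Basis \<Longrightarrow> Ck k (\<lambda>x. f' x e)"
  shows "Ck (Suc k) f"
proof -
  have "frechet_derivative f (at x) = f' x" for x using assms(1) by (metis frechet_derivative_at)
  then show ?thesis using assms by (auto simp: differentiable_def)
qed

lemma Ck_has_derivative: "Ck (Suc k) f \<Longrightarrow> (f has_derivative frechet_derivative f (at x)) (at x)" by (simp add: frechet_derivative_works)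

lemma Ck_lower: "Ck (Suc k) f \<Longrightarrow> Ck k f"
proof (induction k arbitrary: f)
  case 0 then show ?case by (auto intro!: continuous_at_imp_continuous_on differentiable_imp_continuous_within)
next
  case (Suc k)
  have "\<forall>x. f differentiable (at x)" "\<forall>e\<in>Basis. Ck (Suc k) (\<lambda>x. frechet_derivative f (at x) e)"
    using Suc.prems by (subst (asm) Ck.simps, blast)+
  then show ?case using Suc.IH by (subst Ck.simps) blast
qed

lemma Ck_continuous: "Ck k f \<Longrightarrow> continuous_on UNIV f" by (induction k) (auto dest: Ck_lower simp del: Ck.simps(2))

lemma Ck_const: "Ck k (\<lambda>x. c)"
proof (induction k arbitrary: c)
  case (Suc k) show ?case by (rule Ck_SucI[where f' = "\<lambda>x y. 0"]) (auto simp: Suc)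
qed auto

lemma Ck_add: "Ck k f \<Longrightarrow> Ck k g \<Longrightarrow> Ck k (\<lambda>x. f x + g x)"
proof (induction k arbitrary: f g)
  case (Suc k)
  note d = Ck_has_derivative[OF Suc.prems(1)] Ck_has_derivative[OF Suc.prems(2)]
  show ?case by (rule Ck_SucI, rule has_derivative_add[OF d]) (use Suc in auto)
qed (auto intro!: continuous_intros)

lemma Ck_mult: "Ck k f \<Longrightarrow> Ck k g \<Longrightarrow> Ck k (\<lambda>x. f x * g x)"
proof (induction k arbitrary: f g)
  case (Suc k)
  note d = Ck_has_derivative[OF Suc.prems(1)] Ck_has_derivative[OF Suc.prems(2)]
  have l: "Ck k f" "Ck k g" using Suc.prems by (auto intro: Ck_lower simp del: Ck.simps)
  show ?case by (rule Ck_SucI, rule has_derivative_mult[OF d]) (use Suc l in \<open>auto intro!: Ck_add\<close>)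
qed (auto intro!: continuous_intros)

lemma Ck_cmult: "Ck k f \<Longrightarrow> Ck k (\<lambda>x. c * f x)" by (rule Ck_mult[OF Ck_const])

lemma Ck_prod: "(\<And>i. i \<in> I \<Longrightarrow> Ck k (f i)) \<Longrightarrow> Ck k (\<lambda>x. \<Prod>i\<in>I. f i x)"
  by (induction I rule: infinite_finite_induct) (auto intro: Ck_const Ck_mult)

lemma Ck_compose_affine:
  fixes h :: "real \<Rightarrow> real" and a :: "'a::euclidean_space"
  assumes "Ck k h" shows "Ck k (\<lambda>x. h (x \<bullet> a + c))" using assms
proof (induction k arbitrary: h)
  case 0 then show ?case by (auto intro!: continuous_intros intro: continuous_on_compose2)
next
  case (Suc k)
  note d = Ck_has_derivative[OF Suc.prems(1)]
  let ?h' = "\<lambda>t. frechet_derivative h (at t) 1"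
  have lin: "frechet_derivative h (at t) y = y * ?h' t" for t y
    using linear_scale[OF linear_frechet_derivative[of h "at t"], of y 1] Suc.prems by simp
  have "((\<lambda>x. h (x \<bullet> a + c)) has_derivative (\<lambda>y. (y \<bullet> a) * ?h' (x \<bullet> a + c))) (at x)" for x
  proof -
    have "((\<lambda>x. h (x \<bullet> a + c)) has_derivative (\<lambda>y. frechet_derivative h (at (x \<bullet> a + c)) (y \<bullet> a))) (at x)"
      by (rule has_derivative_compose[of "\<lambda>x. x \<bullet> a + c", OF _ d])
        (auto intro!: derivative_eq_intros)
    then show ?thesis unfolding lin[of _ "_ \<bullet> a"] .
  qed
  then show ?case by (rule Ck_SucI) (use Suc in \<open>auto intro!: Ck_cmult\<close>)
qed

text \<open>The case n = 0 is the classical flat function. The family is closed under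
  differentiation up to linear combinations, which turns smoothness into one induction for all
  n.\<close>

definition bmp :: "nat \<Rightarrow> real \<Rightarrow> real" where
  "bmp n x = (if 0 < x then inverse x ^ n * exp (- inverse x) else 0)"

lemma bmp_tendsto_0: "(bmp n \<longlongrightarrow> 0) (at 0)"
proof -
  have "((\<lambda>y::real. y ^ n / exp y) \<longlongrightarrow> 0) at_top" by (rule tendsto_power_div_exp_0)
  then have "((\<lambda>x. inverse x ^ n / exp (inverse x)) \<longlongrightarrow> 0) (at_right (0::real))"
    by (rule filterlim_compose[OF _ filterlim_inverse_at_top_right])
  then have "(bmp n \<longlongrightarrow> 0) (at_right 0)" by (rule Lim_transform_eventually)
       (auto simp: eventually_at_filter bmp_def exp_minus field_simps)
  moreover have "(bmp n \<longlongrightarrow> 0) (at_left 0)" by (rule Lim_transform_eventually[OF tendsto_const]) (auto simp: eventually_at_filter bmp_def)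
  ultimately show ?thesis by (simp add: filterlim_split_at)
qed

lemma bmp_has_derivative:
  "(bmp n has_real_derivative (bmp (n + 2) x - real n * bmp (n + 1) x)) (at x)"
proof -
  consider "x > 0" | "x < 0" | "x = 0" by linarith
  then show ?thesis
  proof cases
    case 1
    have p: "((\<lambda>x. inverse x ^ n) has_real_derivative - (real n * inverse x ^ (n + 1))) (at x)"
      using DERIV_power[OF DERIV_inverse[of x UNIV], of n] 1 by (cases n) (simp_all add: algebra_simps numeral_2_eq_2)
    have "((\<lambda>x. inverse x ^ n * exp (- inverse x)) has_real_derivative
        (bmp (n + 2) x - real n * bmp (n + 1) x)) (at x)"
    proof -
      have e: "((\<lambda>x. exp (- inverse x)) has_real_derivative exp (- inverse x) * inverse x ^ 2) (at x)"
        using 1 by (auto intro!: derivative_eq_intros simp: power2_eq_square)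
      show ?thesis using DERIV_mult[OF p e] 1 by (simp add: bmp_def algebra_simps power2_eq_square)
    qed
    then show ?thesis by (rule has_field_derivative_transform_within_open[of _ _ _ "{0<..}"]) (use 1 in \<open>auto simp: bmp_def\<close>)
  next
    case 2
    have "((\<lambda>x. 0) has_real_derivative (bmp (n + 2) x - real n * bmp (n + 1) x)) (at x)" using 2 by (simp add: bmp_def)
    then show ?thesis by (rule has_field_derivative_transform_within_open[of _ _ _ "{..<0}"]) (use 2 in \<open>auto simp: bmp_def\<close>)
  next
    case 3
    have "((\<lambda>h. bmp n h / h) \<longlongrightarrow> 0) (at 0)"
    proof (rule Lim_transform_eventually[OF bmp_tendsto_0[of "Suc n"]])
      show "\<forall>\<^sub>F h in at 0. bmp (Suc n) h = bmp n h / h" by (auto simp: eventually_at_filter bmp_def divide_inverse ac_simps)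
    qed
    then show ?thesis using 3 by (simp add: DERIV_def bmp_def)
  qed
qed

lemma Ck_bmp: "Ck k (bmp n)"
proof (induction k arbitrary: n)
  case 0
  have "isCont (bmp n) x" for x using bmp_has_derivative DERIV_isCont by blast
  then show ?case by (simp add: continuous_on_eq_continuous_at)
next
  case (Suc k)
  show ?case
  proof (rule Ck_SucI)
    fix x show "(bmp n has_derivative (\<lambda>y. (bmp (n + 2) x - real n * bmp (n + 1) x) * y)) (at x)"
      using bmp_has_derivative[of n x] by (simp add: has_field_derivative_def)
    fix e :: real assume "e \<in> Basis"
    then show "Ck k (\<lambda>x. (bmp (n + 2) x - real n * bmp (n + 1) x) * e)"
      using Ck_add[OF Suc[of "n+2"] Ck_cmult[OF Suc[of "n+1"], of "- real n"]] by simp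
  qed
qed

lemma bmp_bounds: "0 \<le> bmp 0 x" "bmp 0 x \<le> 1" by (auto simp: bmp_def)

lemma bmp_limit: "(\<lambda>m. bmp 0 (real (Suc m) * x)) \<longlonglongrightarrow> (if 0 < x then 1 else 0)"
proof (cases "0 < x")
  case True
  have "(\<lambda>m. exp (- (inverse x * inverse (real (Suc m))))) \<longlonglongrightarrow> exp (- (inverse x * 0))" by (intro tendsto_intros LIMSEQ_inverse_real_of_nat)
  moreover have "exp (- (inverse x * inverse (real (Suc m)))) = bmp 0 (real (Suc m) * x)" for m
  proof -
    have "0 < real (Suc m) * x" using True by (intro mult_pos_pos) auto
    then show ?thesis by (simp add: bmp_def mult.commute)
  qed
  ultimately show ?thesis using True by simp
next
  case False
  then have "bmp 0 (real (Suc m) * x) = 0" for m by (auto simp: bmp_def zero_less_mult_iff)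
  then show ?thesis using False by simp
qed

text \<open>Smooth minorants of the indicator of an open box. Dilation by \<open>Suc m\<close>
  pushes each factor to 1 inside the box without moving the support, so dominated convergence can
  take the place of mollification.\<close>

definition box_bump :: "'a::euclidean_space \<Rightarrow> 'a \<Rightarrow> nat \<Rightarrow> 'a \<Rightarrow> real" where
  "box_bump a b m x = (\<Prod>e\<in>Basis. bmp 0 (real (Suc m) * (x \<bullet> e - a \<bullet> e)) * bmp 0 (real (Suc m) * (b \<bullet> e - x \<bullet> e)))"

lemma Ck_box_bump: "Ck k (box_bump a b m)"
proof -
  have 1: "Ck k (\<lambda>x. bmp 0 (real (Suc m) * (x \<bullet> e - a \<bullet> e)))" for e
    using Ck_compose_affine[OF Ck_bmp[of k 0], of "real (Suc m) *\<^sub>R e" "- (real (Suc m) * (a \<bullet> e))"] by (simp add: algebra_simps)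
  have 2: "Ck k (\<lambda>x. bmp 0 (real (Suc m) * (b \<bullet> e - x \<bullet> e)))" for e
    using Ck_compose_affine[OF Ck_bmp[of k 0], of "- real (Suc m) *\<^sub>R e" "(real (Suc m) * (b \<bullet> e))"] by (simp add: algebra_simps)
  show ?thesis unfolding box_bump_def by (intro Ck_prod Ck_mult 1 2)
qed

lemma box_bump_bounds: "0 \<le> box_bump a b m x" "box_bump a b m x \<le> 1" unfolding box_bump_def
  by (auto intro!: prod_nonneg prod_le_1 mult_le_one mult_nonneg_nonneg simp: bmp_bounds)

lemma box_bump_limit: "(\<lambda>m. box_bump a b m x) \<longlonglongrightarrow> indicator (box a b) x"
proof -
  have 1: "(\<lambda>m. box_bump a b m x) \<longlonglongrightarrow>
     (\<Prod>e\<in>Basis. (if 0 < x \<bullet> e - a \<bullet> e then 1 else 0) * (if 0 < b \<bullet> e - x \<bullet> e then 1 else 0))"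
    unfolding box_bump_def by (intro tendsto_intros bmp_limit)
  have "(\<Prod>e\<in>Basis. (if 0 < x \<bullet> e - a \<bullet> e then 1 else 0) * (if 0 < b \<bullet> e - x \<bullet> e then 1 else 0)) = (indicator (box a b) x :: real)"
  proof (cases "x \<in> box a b")
    case True then show ?thesis by (auto simp: box_def intro!: prod.neutral)
  next
    case False
    then show ?thesis by (force simp: box_def prod_zero_iff)
  qed
  then show ?thesis using 1 by simp
qed

lemma box_bump_support: "{x. box_bump a b m x \<noteq> 0} \<subseteq> box a b"
  by (auto simp: box_bump_def box_def bmp_def zero_less_mult_iff split: if_splits)

lemma box_bump_test: assumes "cbox a b \<subseteq> S" shows "box_bump a b m \<in> test_functions S"
proof -
  have "closure {x. box_bump a b m x \<noteq> 0} \<subseteq> cbox a b"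
    using box_bump_support[of a b m] by (intro closure_minimal) (auto simp: subset_eq mem_box less_imp_le)
  then show ?thesis using assms Ck_box_bump unfolding test_functions_def
    by (auto simp: compact_eq_bounded_closed intro: bounded_subset[OF bounded_cbox])
qed

lemma test_mult:
  assumes "\<phi> \<in> test_functions S" "\<And>k. Ck k \<psi>"
  shows "(\<lambda>x. \<phi> x * \<psi> x) \<in> test_functions S"
proof -
  have "closure {x. \<phi> x * \<psi> x \<noteq> 0} \<subseteq> closure {x. \<phi> x \<noteq> 0}" by (intro closure_mono) auto
  then show ?thesis using assms unfolding test_functions_def by (auto simp: Ck_mult compact_eq_bounded_closed intro: bounded_subset)
qed

lemma test_scale: "\<phi> \<in> test_functions S \<Longrightarrow> (\<lambda>x. c * \<phi> x) \<in> test_functions S"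
  using test_mult[of \<phi> S "\<lambda>_. c"] by (simp add: Ck_const mult.commute)

lemma test_zero: "(\<lambda>x. 0) \<in> test_functions S" by (simp add: test_functions_def Ck_const)

lemma test_add:
  assumes "\<phi> \<in> test_functions S" "\<psi> \<in> test_functions S"
  shows "(\<lambda>x. \<phi> x + \<psi> x) \<in> test_functions S"
proof -
  have "closure {x. \<phi> x + \<psi> x \<noteq> 0} \<subseteq> closure ({x. \<phi> x \<noteq> 0} \<union> {x. \<psi> x \<noteq> 0})" by (intro closure_mono) auto
  then show ?thesis using assms unfolding test_functions_def
    by (auto simp: Ck_add compact_eq_bounded_closed intro: bounded_subset[of "closure _ \<union> closure _"])
qed

lemma test_smooth: "\<phi> \<in> test_functions S \<Longrightarrow> Ck k \<phi>" by (auto simp: test_functions_def)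

lemma test_has_derivative: "\<phi> \<in> test_functions S \<Longrightarrow> (\<phi> has_derivative frechet_derivative \<phi> (at x)) (at x)"
  by (intro Ck_has_derivative[of 0] test_smooth)

lemma test_partial:
  assumes "\<phi> \<in> test_functions S" and e: "e \<in> Basis"
  shows "(\<lambda>x. frechet_derivative \<phi> (at x) e) \<in> test_functions S"
proof -
  let ?D = "\<lambda>x. frechet_derivative \<phi> (at x) e"
  let ?C = "closure {x. \<phi> x \<noteq> 0}"
  have C: "compact ?C" "?C \<subseteq> S" using assms by (auto simp: test_functions_def)
  have z: "?D x = 0" if x: "x \<notin> ?C" for x
  proof -
    have "((\<lambda>_. 0) has_derivative (\<lambda>_. 0)) (at x)" by simp
    then have "(\<phi> has_derivative (\<lambda>_. 0)) (at x)" by (rule has_derivative_transform_within_open[of _ _ _ _ "- ?C"])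
        (use x closure_subset[of "{x. \<phi> x \<noteq> 0}"] in \<open>auto simp: open_Compl\<close>)
    then show ?thesis by (metis frechet_derivative_at)
  qed
  have "closure {x. ?D x \<noteq> 0} \<subseteq> ?C" by (rule closure_minimal) (use z in auto)
  moreover have "Ck k ?D" for k using test_smooth[OF assms(1), of "Suc k"] e by simp
  ultimately show ?thesis using C unfolding test_functions_def by (auto simp: compact_eq_bounded_closed intro: bounded_subset)
qed

section \<open>The coefficients as averages of exponentials\<close>

lemma Gamma_reflection_real: "Gamma z * Gamma (1 - z) = pi / sin (pi * z)" for z :: real
proof -
  have "complex_of_real (Gamma z * Gamma (1 - z)) = of_real (pi / sin (pi * z))" using Gamma_reflection_complex[of "of_real z"]
    by (simp add: Gamma_complex_of_real[symmetric] sin_of_real[symmetric])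
  then show ?thesis using of_real_eq_iff by blast
qed

text \<open>Write \<open>1 - exp (- (m * x))\<close> as the integral of
  \<open>m * exp (- (m * y))\<close> over y between 0 and x, exchange by Tonelli, integrate the
  power over x >= y and recognize the Gamma integral at \<open>1 - p\<close>. With nonnegative
  integrals, finiteness is a result of the computation.\<close>

lemma nn_integral_exp_powr:
  assumes p: "0 < p" "p < 1" and m: "0 < m"
  shows "(\<integral>\<^sup>+x. ennreal (indicator {0<..} x * ((1 - exp (- (m * x))) * x powr (- 1 - p))) \<partial>lborel)
    = ennreal (m powr p * (Gamma (1 - p) / p))"
proof -
  let ?h = "\<lambda>x y. ennreal (if 0 \<le> y \<and> y \<le> x then m * exp (- (m * y)) * x powr (- 1 - p) else 0)"
  have "(\<integral>\<^sup>+x. ennreal (indicator {0<..} x * ((1 - exp (- (m * x))) * x powr (- 1 - p))) \<partial>lborel)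
    = (\<integral>\<^sup>+x. \<integral>\<^sup>+y. ?h x y \<partial>lborel \<partial>lborel)"
  proof (intro nn_integral_cong_AE, rule AE_mp[OF AE_lborel_singleton[of 0]], rule AE_I2, rule impI)
    fix x :: real assume x0: "x \<noteq> 0"
    show "ennreal (indicator {0<..} x * ((1 - exp (- (m * x))) * x powr (- 1 - p))) = (\<integral>\<^sup>+y. ?h x y \<partial>lborel)"
    proof (cases "x > 0")
      case True
      have "(\<integral>\<^sup>+y. ?h x y \<partial>lborel)
          = (\<integral>\<^sup>+y. ennreal (x powr (- 1 - p)) * (ennreal (m * exp (- (m * y))) * indicator {0..x} y) \<partial>lborel)"
        using m by (intro nn_integral_cong) (auto simp: indicator_def ennreal_mult[symmetric] mult.commute)
      also have "\<dots> = ennreal (x powr (- 1 - p)) * (\<integral>\<^sup>+y. ennreal (m * exp (- (m * y))) * indicator {0..x} y \<partial>lborel)"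
        by (intro nn_integral_cmult) auto
      also have "(\<integral>\<^sup>+y. ennreal (m * exp (- (m * y))) * indicator {0..x} y \<partial>lborel)
        = - exp (- (m * x)) - (- exp (- (m * 0)))" using True m by (intro nn_integral_FTC_Icc) (auto intro!: derivative_eq_intros)
      finally show ?thesis using True m by (simp add: ennreal_mult[symmetric] mult.commute)
    next
      case False
      have "(\<integral>\<^sup>+y. ?h x y \<partial>lborel) = (\<integral>\<^sup>+(y::real). 0 \<partial>lborel)" by (rule nn_integral_cong) (use False x0 in auto)
      then show ?thesis using False by simp
    qed
  qed
  also have "\<dots> = (\<integral>\<^sup>+y. \<integral>\<^sup>+x. ?h x y \<partial>lborel \<partial>lborel)" by (rule lborel_pair.Fubini') simp
  also have "\<dots> = (\<integral>\<^sup>+y. ennreal (m / p) * ennreal (indicator {0..} y * y powr (- p) / exp (m * y)) \<partial>lborel)"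
  proof (intro nn_integral_cong_AE, rule AE_mp[OF AE_lborel_singleton[of 0]], rule AE_I2, rule impI)
    fix y :: real assume y0: "y \<noteq> 0"
    show "(\<integral>\<^sup>+x. ?h x y \<partial>lborel) = ennreal (m / p) * ennreal (indicator {0..} y * y powr (- p) / exp (m * y))"
    proof (cases "y > 0")
      case True
      have lim: "((\<lambda>x. - (x powr (- p) / p)) \<longlongrightarrow> - (0 / p)) at_top" using p by (intro tendsto_intros tendsto_neg_powr filterlim_ident) auto
      have "(\<integral>\<^sup>+x. ?h x y \<partial>lborel)
          = (\<integral>\<^sup>+x. ennreal (m * exp (- (m * y))) * (ennreal (x powr (- 1 - p)) * indicator {y..} x) \<partial>lborel)"
        using m True by (intro nn_integral_cong) (auto simp: indicator_def ennreal_mult[symmetric])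
      also have "\<dots> = ennreal (m * exp (- (m * y))) * (\<integral>\<^sup>+x. ennreal (x powr (- 1 - p)) * indicator {y..} x \<partial>lborel)"
        by (intro nn_integral_cmult) auto
      also have "(\<integral>\<^sup>+x. ennreal (x powr (- 1 - p)) * indicator {y..} x \<partial>lborel)
         = ennreal (- (0 / p) - - (y powr (- p) / p))"
      proof (rule nn_integral_FTC_atLeast[OF _ _ _ lim])
        fix x assume "y \<le> x"
        then have "x > 0" using True by simp
        then show "((\<lambda>x. - (x powr (- p) / p)) has_real_derivative x powr (- 1 - p)) (at x)"
          using p by (auto intro!: derivative_eq_intros simp: minus_diff_commute)
      qed auto
      finally show ?thesis using True m p by (simp add: ennreal_mult[symmetric] exp_minus field_simps)
    qed (use y0 in simp)
  qed
  also have "\<dots> = ennreal (m / p) * (\<integral>\<^sup>+y. ennreal (indicator {0..} y * y powr (- p) / exp (m * y)) \<partial>lborel)"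
    by (intro nn_integral_cmult) auto
  also have "(\<integral>\<^sup>+y. ennreal (indicator {0..} y * y powr (- p) / exp (m * y)) \<partial>lborel)
     = ennreal (m powr (p - 1) * Gamma (1 - p))"
  proof -
    have "ennreal (Gamma (1 - p)) = (\<integral>\<^sup>+t. ennreal (indicator {0..} t * t powr (- p) / exp t) \<partial>lborel)"
      using Gamma_conv_nn_integral_real[of "1 - p"] p by simp
    also have "\<dots> = \<bar>m\<bar> * (\<integral>\<^sup>+y. ennreal (indicator {0..} (0 + m * y) * (0 + m * y) powr (- p) / exp (0 + m * y)) \<partial>lborel)"
      using m by (intro nn_integral_real_affine) auto
    also have "(\<integral>\<^sup>+y. ennreal (indicator {0..} (0 + m * y) * (0 + m * y) powr (- p) / exp (0 + m * y)) \<partial>lborel)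
      = (\<integral>\<^sup>+y. ennreal (m powr (- p)) * ennreal (indicator {0..} y * y powr (- p) / exp (m * y)) \<partial>lborel)"
      using m by (intro nn_integral_cong)
        (auto simp: indicator_def ennreal_mult[symmetric] powr_mult zero_le_mult_iff)
    also have "\<dots> = ennreal (m powr (- p)) * (\<integral>\<^sup>+y. ennreal (indicator {0..} y * y powr (- p) / exp (m * y)) \<partial>lborel)"
      by (intro nn_integral_cmult) auto
    finally have G: "ennreal (Gamma (1 - p)) = ennreal (m * m powr (- p)) * (\<integral>\<^sup>+y. ennreal (indicator {0..} y * y powr (- p) / exp (m * y)) \<partial>lborel)"
      using m by (simp add: ennreal_mult mult.assoc)
    have "ennreal (m powr (p - 1)) * ennreal (Gamma (1 - p))
       = ennreal (m powr (p - 1) * (m * m powr (- p))) * (\<integral>\<^sup>+y. ennreal (indicator {0..} y * y powr (- p) / exp (m * y)) \<partial>lborel)"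
      unfolding G using m by (simp add: ennreal_mult mult.assoc)
    also have "m powr (p - 1) * (m * m powr (- p)) = 1" using m powr_add[of m "p - 1" 1] powr_add[of m p "- p"] by (simp flip: mult.assoc)
    finally show ?thesis using p Gamma_real_pos[of "1 - p"] by (simp add: ennreal_mult)
  qed
  finally show ?thesis using p m Gamma_real_pos[of "1 - p"] powr_add[of m 1 "p - 1"] by (simp add: ennreal_mult[symmetric] flip: mult.assoc)
qed

text \<open>The substitution u = 1 / (1 + t^2) turns the case c = 1 into the Beta integral at
  \<open>(1 + p) / 2\<close> and \<open>(1 - p) / 2\<close>, which the reflection formula evaluates;
  general \<open>c\<close> follows by scaling.\<close>

lemma nn_integral_powr_over_square:
  assumes p: "0 < p" "p < 1" and c: "0 < c"
  shows "(\<integral>\<^sup>+x. ennreal (indicator {0<..} x * (x powr (- 1 - p) * (2 * x / (x^2 + c^2)))) \<partial>lborel)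
    = ennreal (c powr (- 1 - p) * (pi / cos (pi * p / 2)))"
proof -
  define f where "f u = u powr ((p - 1) / 2) * (1 - u) powr ((- 1 - p) / 2)" for u :: real
  define g where "g t = 1 / (1 + t^2)" for t :: real
  define g' where "g' t = - (2 * t) / (1 + t^2)^2" for t :: real
  have im: "g ` {0<..} = {0<..<1}"
  proof (intro equalityI subsetI)
    fix u assume "u \<in> g ` {0<..}"
    then show "u \<in> {0<..<1}" by (auto simp: g_def add_pos_pos add_pos_nonneg)
  next
    fix u :: real assume u: "u \<in> {0<..<1}"
    then have "u = g (sqrt ((1 - u) / u))" by (simp add: g_def field_simps)
    then show "u \<in> g ` {0<..}" using u by (intro image_eqI[of _ _ "sqrt ((1 - u) / u)"]) auto
  qed
  have inj: "inj_on g {0<..}" by (rule inj_onI) (auto simp: g_def power2_eq_iff_nonneg)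
  have der: "(g has_field_derivative g' x) (at x within {0<..})" for x unfolding g_def g'_def
    by (rule derivative_eq_intros refl | simp)+ (auto simp: power2_eq_square add_nonneg_eq_0_iff)
  have B: "Beta ((1 + p) / 2) ((1 - p) / 2) = pi / cos (pi * p / 2)"
  proof -
    have b: "(1 - p) / 2 = 1 - (1 + p) / 2" by (simp add: field_simps)
    have "Beta b (1 - b) = pi / sin (pi * b)" for b :: real by (simp add: Beta_def Gamma_reflection_real)
    then have "Beta ((1 + p) / 2) ((1 - p) / 2) = pi / sin (pi * ((1 + p) / 2))" unfolding b .
    also have "pi * ((1 + p) / 2) = pi / 2 - - (pi * p / 2)" by (simp add: field_simps)
    also have "sin \<dots> = cos (pi * p / 2)" by (subst sin_cos_eq) simp
    finally show ?thesis .
  qed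
  have fi: "(f has_integral pi / cos (pi * p / 2)) {0<..<1}"
  proof -
    have e: "(1 + p) / 2 - 1 = (p - 1) / 2" "(1 - p) / 2 - 1 = (- 1 - p) / 2" by (simp_all add: field_simps)
    show ?thesis using has_integral_Beta_real[of "(1 + p) / 2" "(1 - p) / 2"] p unfolding f_def e B by (simp add: has_integral_Icc_iff_Ioo)
  qed
  have fai: "f absolutely_integrable_on {0<..<1}"
    using fi by (intro nonnegative_absolutely_integrable_1) (auto simp: f_def integrable_on_def)
  have eq: "\<bar>g' t\<bar> * f (g t) = t powr (- 1 - p) * (2 * t / (t^2 + 1))" if t: "t > 0" for t
  proof -
    have s: "1 + t^2 > 0" by (simp add: add_pos_nonneg)
    have "1 - g t = t^2 * (1 / (1 + t^2))" using s by (simp add: g_def field_simps)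
    then have "(1 - g t) powr ((- 1 - p) / 2) = (t^2) powr ((- 1 - p) / 2) * (1 / (1 + t^2)) powr ((- 1 - p) / 2)"
      using s by (simp only:) (subst powr_mult, auto)
    then have "f (g t) = (1 / (1 + t^2)) powr ((p - 1) / 2 + (- 1 - p) / 2) * (t^2) powr ((- 1 - p) / 2)"
      unfolding f_def powr_add by (simp only: g_def mult_ac)
    also have "(p - 1) / 2 + (- 1 - p) / 2 = (- 1::real)" by (simp add: field_simps)
    also have "(1 / (1 + t^2)) powr - 1 = 1 + t^2" using s by (simp add: powr_minus)
    also have "(t^2) powr ((- 1 - p) / 2) = t powr (- 1 - p)"
    proof -
      have "2 * ((- 1 - p) / 2) = - 1 - p" by simp
      then show ?thesis using t powr_powr[of t 2 "(- 1 - p) / 2"] by (simp only: powr_numeral)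
    qed
    finally have b: "f (g t) = (1 + t^2) * t powr (- 1 - p)" .
    define S where "S = 1 + t^2"
    have a: "\<bar>g' t\<bar> = 2 * t / S^2" unfolding g'_def S_def using t by (simp add: abs_mult)
    show ?thesis using s unfolding a b add.commute[of "t^2" 1] S_def[symmetric] by (simp add: power2_eq_square)
  qed
  have "(\<lambda>x. \<bar>g' x\<bar> * f (g x)) absolutely_integrable_on {0<..} \<and>
      integral {0<..} (\<lambda>x. \<bar>g' x\<bar> * f (g x)) = pi / cos (pi * p / 2)" by (subst has_absolute_integral_change_of_variables_1'[OF _ der inj])
       (use fai fi im in \<open>auto simp: integral_unique\<close>)
  then have "((\<lambda>x. \<bar>g' x\<bar> * f (g x)) has_integral pi / cos (pi * p / 2)) {0<..}"
    using set_lebesgue_integral_eq_integral(1) by (metis has_integral_integral)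
  then have hi: "((\<lambda>t. t powr (- 1 - p) * (2 * t / (t^2 + 1))) has_integral pi / cos (pi * p / 2)) {0<..}"
    by (rule has_integral_eq[rotated]) (use eq in auto)
  have one: "(\<integral>\<^sup>+x. ennreal (indicator {0<..} x * (x powr (- 1 - p) * (2 * x / (x^2 + 1)))) \<partial>lborel)
      = ennreal (pi / cos (pi * p / 2))"
    by (rule nn_integral_has_integral_lebesgue[OF _ hi]) (auto intro!: mult_nonneg_nonneg divide_nonneg_nonneg)
  have "(\<integral>\<^sup>+x. ennreal (indicator {0<..} x * (x powr (- 1 - p) * (2 * x / (x^2 + c^2)))) \<partial>lborel)
     = \<bar>c\<bar> * (\<integral>\<^sup>+t. ennreal (indicator {0<..} (0 + c * t) * ((0 + c * t) powr (- 1 - p) * (2 * (0 + c * t) / ((0 + c * t)^2 + c^2)))) \<partial>lborel)"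
    using c by (intro nn_integral_real_affine) auto
  also have "(\<integral>\<^sup>+t. ennreal (indicator {0<..} (0 + c * t) * ((0 + c * t) powr (- 1 - p) * (2 * (0 + c * t) / ((0 + c * t)^2 + c^2)))) \<partial>lborel)
     = (\<integral>\<^sup>+t. ennreal (c powr (- 1 - p) / c) * ennreal (indicator {0<..} t * (t powr (- 1 - p) * (2 * t / (t^2 + 1)))) \<partial>lborel)"
  proof (intro nn_integral_cong)
    fix t :: real
    show "ennreal (indicator {0<..} (0 + c * t) * ((0 + c * t) powr (- 1 - p) * (2 * (0 + c * t) / ((0 + c * t)^2 + c^2))))
      = ennreal (c powr (- 1 - p) / c) * ennreal (indicator {0<..} t * (t powr (- 1 - p) * (2 * t / (t^2 + 1))))"
    proof (cases "t > 0")
      case True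
      have "2 * (c * t) / ((c * t)^2 + c^2) = (1 / c) * (2 * t / (t^2 + 1))"
      proof -
        have "(c * t)^2 + c^2 = c * (c * (t^2 + 1))" by (simp add: power2_eq_square algebra_simps)
        then show ?thesis using c by simp
      qed
      then show ?thesis using True c by (simp add: ennreal_mult[symmetric] powr_mult)
    qed (use c in \<open>auto simp: zero_less_mult_iff\<close>)
  qed
  also have "\<dots> = ennreal (c powr (- 1 - p) / c) * ennreal (pi / cos (pi * p / 2))" unfolding one[symmetric] by (rule nn_integral_cmult) simp
  also have "\<bar>c\<bar> * \<dots> = ennreal (c powr (- 1 - p) * (pi / cos (pi * p / 2)))"
    using c by (simp add: ennreal_mult'[symmetric] flip: mult.assoc)
  finally show ?thesis .
qed

text \<open>The summand is the derivative of \<open>arctan (2 * pi * y / t) / pi\<close> at y = k +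
  1 and decreases in y, so the sum stays below an integral. The full series is the partial fraction
  expansion of 1 / (exp t - 1) - 1 / t + 1 / 2; this is the bound for large t.\<close>

lemma sum_quotient_le_half:
  assumes t: "0 < t"
  shows "(\<Sum>k<n. 2 * t / (t^2 + (2 * real (Suc k) * pi)^2)) \<le> 1 / 2"
proof -
  have "(\<Sum>k<n. 2 * t / (t^2 + (2 * real (Suc k) * pi)^2)) \<le> arctan (2 * pi * real n / t) / pi"
  proof (induction n)
    case (Suc n)
    let ?F = "\<lambda>y. arctan (2 * pi * y / t) / pi"
    have "\<exists>z>real n. z < real (Suc n) \<and> ?F (real (Suc n)) - ?F (real n) = (real (Suc n) - real n) * (2 * t / (t^2 + (2 * z * pi)^2))"
    proof (rule MVT2)
      fix y :: real
      have "((\<lambda>y. arctan (2 * pi * y / t) / pi) has_real_derivative (inverse (1 + (2 * pi * y / t)^2) * (2 * pi / t)) / pi) (at y)"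
        using t by (auto intro!: derivative_eq_intros)
      moreover have "(inverse (1 + (2 * pi * y / t)^2) * (2 * pi / t)) / pi = 2 * t / (t^2 + (2 * y * pi)^2)"
      proof -
        define S where "S = t^2 + (2 * y * pi)^2"
        have n: "S > 0" unfolding S_def using t by (simp add: add_pos_nonneg)
        have "1 + (2 * pi * y / t)^2 = S / t^2" unfolding S_def using t by (simp add: power2_eq_square field_simps)
        then show ?thesis using t n unfolding S_def[symmetric] by (simp add: power2_eq_square divide_simps)
      qed
      ultimately show "((\<lambda>y. arctan (2 * pi * y / t) / pi) has_real_derivative 2 * t / (t^2 + (2 * y * pi)^2)) (at y)" by simp
    qed simp
    then obtain z where z: "real n < z" "z < real (Suc n)"
      "?F (real (Suc n)) - ?F (real n) = 2 * t / (t^2 + (2 * z * pi)^2)" by auto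
    have "2 * t / (t^2 + (2 * real (Suc n) * pi)^2) \<le> 2 * t / (t^2 + (2 * z * pi)^2)"
      using z t by (intro divide_left_mono add_left_mono power_mono mult_right_mono mult_left_mono)
        (auto intro!: mult_pos_pos add_pos_nonneg)
    then show ?case using Suc z(3) by simp
  qed simp
  also have "\<dots> \<le> (pi / 2) / pi" using arctan_ubound[of "2 * pi * real n / t"] by (intro divide_right_mono) auto
  finally show ?thesis by simp
qed

text \<open>The companion bound for small t: drop \<open>t^2\<close> from the denominators and use
  the Basel sum; 1/12 is pi^2 / 6 divided by 2 pi^2.\<close>

lemma sum_quotient_le_linear:
  assumes t: "0 < t"
  shows "(\<Sum>k<n. 2 * t / (t^2 + (2 * real (Suc k) * pi)^2)) \<le> t / 12"
proof -
  have "(\<Sum>k<n. 2 * t / (t^2 + (2 * real (Suc k) * pi)^2)) \<le> (\<Sum>k<n. (t / (2 * pi^2)) * (1 / (real k + 1)^2))"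
  proof (intro sum_mono)
    fix k
    have "2 * t / (t^2 + (2 * real (Suc k) * pi)^2) \<le> 2 * t / (2 * real (Suc k) * pi)^2"
      using t by (intro divide_left_mono) (auto intro!: mult_pos_pos add_nonneg_pos)
    moreover have q: "(2 * real (Suc k) * pi)^2 = 4 * (pi^2 * (real k + 1)^2)"
    proof -
      have "2 * real (Suc k) * pi = 2 * (pi * (real k + 1))" by (simp add: algebra_simps)
      then show ?thesis by (simp only: power_mult_distrib) simp
    qed
    moreover have "2 * t / (2 * real (Suc k) * pi)^2 = (t / (2 * pi^2)) * (1 / (real k + 1)^2)" unfolding q by simp
    ultimately show "2 * t / (t^2 + (2 * real (Suc k) * pi)^2) \<le> (t / (2 * pi^2)) * (1 / (real k + 1)^2)" by simp
  qed
  also have "\<dots> = (t / (2 * pi^2)) * (\<Sum>k<n. 1 / (real k + 1)^2)" by (simp only: sum_distrib_left)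
  also have "\<dots> \<le> (t / (2 * pi^2)) * (pi^2 / 6)"
  proof (rule mult_left_mono)
    have S: "(\<lambda>k. 1 / (real k + 1)^2) sums (pi^2 / 6)" using inverse_squares_sums by (simp add: add.commute)
    have "(\<Sum>k<n. 1 / (real k + 1)^2) \<le> (\<Sum>k. 1 / (real k + 1)^2)" by (rule sum_le_suminf[OF sums_summable[OF S]]) auto
    also have "\<dots> = pi^2 / 6" by (rule sums_unique[OF S, symmetric])
    finally show "(\<Sum>k<n. 1 / (real k + 1)^2) \<le> pi^2 / 6" .
  qed (use t in simp)
  also have "\<dots> = t / 12" by simp
  finally show ?thesis .
qed

lemma sin_half_beta: "sin (\<alpha> * pi / 2) = sin (pi * (2 - \<alpha>) / 2)"
proof -
  have "\<alpha> * pi / 2 = pi - pi * (2 - \<alpha>) / 2" by (simp add: field_simps)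
  then show ?thesis by (simp only: sin_pi_minus)
qed

section \<open>Comparison of the two coefficient sequences frequency by frequency\<close>

locale order_param =
  fixes \<alpha> :: real
  assumes \<alpha>: "1 < \<alpha>" "\<alpha> < 2"
begin

abbreviation "p \<equiv> 2 - \<alpha>"
text \<open>The normalization that makes \<open>KK * coeff_b \<alpha> m\<close> the integral of
  \<open>1 - exp (- x) ^ m\<close> against \<open>wgt\<close>.\<close>

definition "KK = Gamma (3 - \<alpha>) * (Gamma (1 - p) / p)"
definition "wgt x = indicator {0<..} x * x powr (- 1 - p)" for x :: real
text \<open>The amount of the unit coefficient that \<open>kform_geometric_unit_nonneg\<close>
  absorbs at r = exp (- x).\<close>

definition "aa x = (if exp (- x) \<le> 1/4 then 1/2 else (1 - exp (- x)) / 4)" for x :: real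
text \<open>The smaller of the two bounds on the frequency density of \<open>corr\<close>, so that
  this density need not be summed in closed form.\<close>

definition "mm x = min (1/2) (x / 12)" for x :: real
definition "corr = 2 * sin (\<alpha> * pi / 2) * (\<Sum>k. (2 * real (Suc k) * pi) powr (\<alpha> - 3))"

lemma pp: "0 < p" "p < 1" using \<alpha> by auto

lemma Gpos: "Gamma (3 - \<alpha>) > 0" "Gamma (1 - p) > 0" using \<alpha> by (auto intro!: Gamma_real_pos)

lemma KK_pos: "KK > 0" using Gpos pp by (simp add: KK_def)

lemma wgt_nonneg: "0 \<le> wgt x" by (simp add: wgt_def indicator_def)

lemma wgt_measurable [measurable]: "wgt \<in> borel_measurable borel" unfolding wgt_def by measurable
lemma aa_measurable [measurable]: "aa \<in> borel_measurable borel" unfolding aa_def by measurable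
lemma mm_measurable [measurable]: "mm \<in> borel_measurable borel" unfolding mm_def by measurable

lemma coeff_b_integral:
  "has_bochner_integral lborel (\<lambda>x. wgt x * (1 - exp (- x) ^ m)) (KK * coeff_b \<alpha> m)"
proof (cases "m = 0")
  case True then show ?thesis by (simp add: coeff_b_def has_bochner_integral_zero)
next
  case False
  show ?thesis
  proof (rule has_bochner_integral_nn_integral)
    have e: "exp (- x) ^ m = exp (- (real m * x))" for x :: real by (simp add: exp_of_nat_mult[symmetric])
    have "(\<integral>\<^sup>+x. ennreal (wgt x * (1 - exp (- x) ^ m)) \<partial>lborel)
       = (\<integral>\<^sup>+x. ennreal (indicator {0<..} x * ((1 - exp (- (real m * x))) * x powr (- 1 - p))) \<partial>lborel)"
      by (intro nn_integral_cong) (simp add: wgt_def e mult.commute mult.left_commute)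
    also have "\<dots> = ennreal (real m powr p * (Gamma (1 - p) / p))" by (rule nn_integral_exp_powr) (use pp False in auto)
    also have "real m powr p * (Gamma (1 - p) / p) = KK * coeff_b \<alpha> m" using Gpos by (simp add: KK_def coeff_b_def)
    finally show "(\<integral>\<^sup>+x. ennreal (wgt x * (1 - exp (- x) ^ m)) \<partial>lborel) = ennreal (KK * coeff_b \<alpha> m)" .
    show "AE x in lborel. 0 \<le> wgt x * (1 - exp (- x) ^ m)" by (rule AE_I2) (auto simp: wgt_def indicator_def power_le_one)
    show "0 \<le> KK * coeff_b \<alpha> m" using KK_pos Gpos by (simp add: coeff_b_def)
  qed simp
qed

lemma kern_has_integral:
  assumes "\<And>m. has_bochner_integral M (\<lambda>t. c t m) (e m)"
  shows "has_bochner_integral M (\<lambda>t. kern (c t) i) (kern e i)" unfolding kern_def using assms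
  by (cases "i = 0") (auto intro!: has_bochner_integral_add has_bochner_integral_diff has_bochner_integral_mult_right)

lemma kform_has_integral:
  assumes "\<And>m. has_bochner_integral M (\<lambda>t. c t m) (e m)"
  shows "has_bochner_integral M (\<lambda>t. kform (c t) n x) (kform e n x)" unfolding kform_def
  by (intro has_bochner_integral_sum has_bochner_integral_mult_right has_bochner_integral_mult_left
      kern_has_integral assms)

lemma kform_coeff_b_integral:
  "has_bochner_integral lborel (\<lambda>t. wgt t * kform (\<lambda>m. 1 - exp (- t) ^ m) n x) (KK * kform (coeff_b \<alpha>) n x)"
proof -
  have "has_bochner_integral lborel (\<lambda>t. kform (\<lambda>m. wgt t * (1 - exp (- t) ^ m)) n x) (kform (\<lambda>m. KK * coeff_b \<alpha> m) n x)"
    by (intro kform_has_integral coeff_b_integral)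
  moreover have "kform (\<lambda>m. a * c m) n x = a * kform c n x" for a c using kform_lin[of a c 0 c n x] by simp
  ultimately show ?thesis by simp
qed

lemma aa_le: "x > 0 \<Longrightarrow> aa x \<le> 1 - exp (- x)" by (auto simp: aa_def)
lemma aa_nonneg: "x > 0 \<Longrightarrow> 0 \<le> aa x" by (auto simp: aa_def)

text \<open>Where \<open>aa x\<close> is not 1/2 the claim reads
  \<open>3 \<le> (3 - x) * exp x\<close>; it follows from \<open>1 + x \<le> exp x\<close> and (3 -
  x) (1 + x) = 3 + x (2 - x) for x < 2. Strictness for x < 1 is the source of the positive margin in
  \<open>beta_ratio_pos\<close>.\<close>

lemma mm_le_aa: assumes x: "x > 0" shows "mm x \<le> aa x" "x < 1 \<Longrightarrow> mm x < aa x"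
proof -
  have e: "1 + x \<le> exp x" by (rule exp_ge_add_one_self)
  show "mm x \<le> aa x"
  proof (cases "exp (- x) \<le> 1/4")
    case False
    then have ex: "exp x < 4" by (simp add: exp_minus field_simps)
    have "x < 3" using e ex by linarith
    have "x / 12 \<le> (1 - exp (- x)) / 4"
    proof -
      have "(3 - x) * exp x \<ge> (3 - x) * (1 + x)" using \<open>x < 3\<close> e by (intro mult_left_mono) auto
      moreover have "(3 - x) * (1 + x) \<ge> 3"
      proof -
        have "x < 2"
        proof (rule ccontr)
          assume "\<not> x < 2"
          then have "exp 2 \<le> exp x" by simp
          moreover have "exp 2 = exp 1 * exp (1::real)" by (simp flip: exp_add)
          moreover have "exp 1 * exp (1::real) \<ge> 2 * 2" using exp_ge_add_one_self[of "1::real"] by (intro mult_mono) auto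
          ultimately show False using ex by simp
        qed
        then have "x * x \<le> x * 2" using x by (intro mult_left_mono) auto
        then show ?thesis by (simp add: algebra_simps)
      qed
      ultimately have "3 \<le> (3 - x) * exp x" by simp
      then show ?thesis by (simp add: exp_minus field_simps)
    qed
    then show ?thesis using False by (simp add: aa_def mm_def)
  qed (simp add: aa_def mm_def)
  assume x1: "x < 1"
  have m: "mm x \<le> x / 12" by (simp add: mm_def)
  have "x * x < 2 * x" using x x1 by simp
  then have "3 < (3 - x) * (1 + x)" by (simp add: algebra_simps)
  also have "\<dots> \<le> (3 - x) * exp x" using x1 e by (intro mult_left_mono) auto
  finally have "x / 12 < (1 - exp (- x)) / 4" by (simp add: exp_minus field_simps)
  moreover have "x / 12 < 1/2" using x1 by simp
  ultimately show "mm x < aa x" using m by (simp add: aa_def)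
qed

lemma integrable_aa: "integrable lborel (\<lambda>x. wgt x * aa x)"
proof (rule Bochner_Integration.integrable_bound)
  show "integrable lborel (\<lambda>x. wgt x * (1 - exp (- x) ^ 1))" using coeff_b_integral[of 1] by (auto simp: has_bochner_integral_iff)
  show "AE x in lborel. norm (wgt x * aa x) \<le> norm (wgt x * (1 - exp (- x) ^ 1))"
    using aa_le aa_nonneg by (intro AE_I2) (auto simp: wgt_def indicator_def abs_mult intro!: mult_left_mono)
qed simp

lemma integrable_mm: "integrable lborel (\<lambda>x. wgt x * mm x)"
proof (rule Bochner_Integration.integrable_bound[OF integrable_aa])
  show "AE x in lborel. norm (wgt x * mm x) \<le> norm (wgt x * aa x)"
    using mm_le_aa(1) aa_nonneg by (intro AE_I2) (auto simp: wgt_def indicator_def abs_mult mm_def intro!: mult_left_mono)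
qed simp

definition "IA = integral\<^sup>L lborel (\<lambda>x. wgt x * aa x)"
definition "IM = integral\<^sup>L lborel (\<lambda>x. wgt x * mm x)"

text \<open>Equal integrals would force equal integrands almost everywhere, against strictness
  between 0 and 1. This gap is the whole stability margin of the modified scheme.\<close>

lemma IM_less: "IM < IA"
proof -
  have le: "IM \<le> IA" unfolding IM_def IA_def using mm_le_aa(1)
    by (intro integral_mono integrable_aa integrable_mm) (auto simp: wgt_def indicator_def)
  have "IM \<noteq> IA"
  proof
    assume "IM = IA"
    then have "integral\<^sup>L lborel (\<lambda>x. wgt x * aa x - wgt x * mm x) = 0" by (simp add: IM_def IA_def integrable_aa integrable_mm)
    then have "AE x in lborel. wgt x * aa x - wgt x * mm x = 0"
    proof (subst (asm) integral_nonneg_eq_0_iff_AE)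
      show "AE x in lborel. 0 \<le> wgt x * aa x - wgt x * mm x" using mm_le_aa(1) by (intro AE_I2) (auto simp: wgt_def indicator_def)
    qed (auto intro: integrable_aa integrable_mm)
    then have "AE x in lborel. x \<notin> {0<..<1::real}"
    proof (rule AE_mp, intro AE_I2 impI notI)
      fix x :: real assume "wgt x * aa x - wgt x * mm x = 0" "x \<in> {0<..<1}"
      then show False using mm_le_aa(2)[of x] by (auto simp: wgt_def)
    qed
    then have "{0<..<1::real} \<in> null_sets lborel" by (subst AE_iff_null_sets) auto
    then have "emeasure lborel {0<..<1::real} = 0" by (rule null_setsD1)
    then show False by (subst (asm) emeasure_lborel_Ioo) auto
  qed
  then show ?thesis using le by simp
qed

lemma IM_nonneg: "0 \<le> IM" unfolding IM_def by (intro integral_nonneg_AE AE_I2) (auto simp: wgt_def indicator_def mm_def)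

lemma summable_corr: "summable (\<lambda>k. (2 * real (Suc k) * pi) powr (\<alpha> - 3))"
proof -
  have "summable (\<lambda>k. (2 * pi) powr (\<alpha> - 3) * (real (Suc k)) powr (\<alpha> - 3))"
    using \<alpha> by (intro summable_mult) (subst summable_Suc_iff, simp add: summable_real_powr_iff)
  then show ?thesis by (simp add: powr_mult[symmetric] ac_simps)
qed

lemma sin_cos_pos: "sin (pi * p / 2) > 0" "cos (pi * p / 2) > 0" using pp by (auto intro!: sin_gt_zero cos_gt_zero)

lemma corr_nonneg: "0 \<le> corr"
  unfolding corr_def sin_half_beta using sin_cos_pos by (intro mult_nonneg_nonneg suminf_nonneg summable_corr) auto

text \<open>By the reflection formula, \<open>KK * corr\<close> is the integral of
  \<open>\<Sum>k\<ge>1. 2 x / (x^2 + (2 k \<pi>)^2)\<close> against \<open>x powr (\<alpha> - 3)\<close>.\<close>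

lemma corr_le: "KK * corr \<le> IM"
proof -
  \<comment> \<open>\<open>KK\<close> is \<open>Gamma p * Gamma (1 - p)\<close>; reflection and the
    double angle formula leave exactly the factor of
    \<open>nn_integral_powr_over_square\<close>.\<close>
  have KK2: "KK * (2 * sin (\<alpha> * pi / 2)) = pi / cos (pi * p / 2)"
  proof -
    have "p \<notin> \<int>\<^sub>\<le>\<^sub>0" using pp by (auto elim!: nonpos_Ints_cases)
    then have "Gamma (p + 1) = p * Gamma p" by (rule Gamma_plus1)
    moreover have "p + 1 = 3 - \<alpha>" by simp
    ultimately have "Gamma (3 - \<alpha>) = p * Gamma p" by simp
    then have "KK = Gamma p * Gamma (1 - p)" using pp by (simp add: KK_def)
    also have "\<dots> = pi / sin (pi * p)" by (rule Gamma_reflection_real)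
    also have "sin (pi * p) = 2 * sin (pi * p / 2) * cos (pi * p / 2)" using sin_double[of "pi * p / 2"] by simp
    finally show ?thesis unfolding sin_half_beta using sin_cos_pos by simp
  qed
  have "(\<Sum>k. (2 * real (Suc k) * pi) powr (\<alpha> - 3)) \<le> IM / (pi / cos (pi * p / 2))"
  proof (rule suminf_le_const[OF summable_corr])
    fix n
    let ?h = "\<lambda>k x. wgt x * (2 * x / (x^2 + (2 * real (Suc k) * pi)^2))"
    have h: "has_bochner_integral lborel (?h k) ((2 * real (Suc k) * pi) powr (\<alpha> - 3) * (pi / cos (pi * p / 2)))" for k
    proof (rule has_bochner_integral_nn_integral)
      have "(\<integral>\<^sup>+x. ennreal (?h k x) \<partial>lborel) =
        (\<integral>\<^sup>+x. ennreal (indicator {0<..} x * (x powr (- 1 - p) * (2 * x / (x^2 + (2 * real (Suc k) * pi)^2)))) \<partial>lborel)"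
        by (intro nn_integral_cong) (simp add: wgt_def mult.assoc)
      also have "\<dots> = ennreal ((2 * real (Suc k) * pi) powr (- 1 - p) * (pi / cos (pi * p / 2)))"
        by (rule nn_integral_powr_over_square) (use pp in \<open>auto intro!: mult_pos_pos\<close>)
      finally show "(\<integral>\<^sup>+x. ennreal (?h k x) \<partial>lborel) =
        ennreal ((2 * real (Suc k) * pi) powr (\<alpha> - 3) * (pi / cos (pi * p / 2)))" by simp
    qed (use sin_cos_pos in \<open>auto simp: wgt_def indicator_def\<close>)
    have "(\<Sum>k<n. (2 * real (Suc k) * pi) powr (\<alpha> - 3) * (pi / cos (pi * p / 2))) = integral\<^sup>L lborel (\<lambda>x. \<Sum>k<n. ?h k x)"
      using has_bochner_integral_sum[of "{..<n}" lborel ?h, OF h] by (simp add: has_bochner_integral_iff)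
    also have "\<dots> \<le> IM" unfolding IM_def
    proof (rule integral_mono)
      show "integrable lborel (\<lambda>x. \<Sum>k<n. ?h k x)" using h by (intro Bochner_Integration.integrable_sum) (auto simp: has_bochner_integral_iff)
      fix x show "(\<Sum>k<n. ?h k x) \<le> wgt x * mm x"
      proof (cases "x > 0")
        case True
        then have "(\<Sum>k<n. 2 * x / (x^2 + (2 * real (Suc k) * pi)^2)) \<le> mm x"
          using sum_quotient_le_half[of x n] sum_quotient_le_linear[of x n] by (simp add: mm_def)
        then show ?thesis unfolding sum_distrib_left[symmetric] by (intro mult_left_mono wgt_nonneg)
      qed (simp add: wgt_def)
    qed (rule integrable_mm)
    finally show "(\<Sum>k<n. (2 * real (Suc k) * pi) powr (\<alpha> - 3)) \<le> IM / (pi / cos (pi * p / 2))" unfolding sum_distrib_right[symmetric]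
      by (subst pos_le_divide_eq) (use sin_cos_pos in simp)
  qed
  then have "(pi / cos (pi * p / 2)) * (\<Sum>k. (2 * real (Suc k) * pi) powr (\<alpha> - 3)) \<le> IM"
  proof -
    assume le: "(\<Sum>k. (2 * real (Suc k) * pi) powr (\<alpha> - 3)) \<le> IM / (pi / cos (pi * p / 2))"
    have D: "0 < pi / cos (pi * p / 2)" using sin_cos_pos by simp
    show ?thesis using le[unfolded pos_le_divide_eq[OF D]] by (subst mult.commute)
  qed
  then show ?thesis unfolding corr_def KK2[symmetric] by (simp add: mult.assoc)
qed

lemma coeff_beta_eq: "coeff_beta \<alpha> = (\<lambda>m. 1 * coeff_b \<alpha> m + corr * (if m = 1 then 1 else 0))" by (auto simp: coeff_beta_def corr_def)

text \<open>The single-frequency certificates integrated against \<open>wgt\<close>; this is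
  legitimate since \<open>kform\<close> is linear in its coefficients.\<close>

lemma kform_b_unit: "0 \<le> KK * kform (coeff_b \<alpha>) n x + IA * kform (\<lambda>m. if m = 1 then 1 else 0) n x"
proof -
  let ?u = "kform (\<lambda>m. if m = 1 then 1 else 0) n x"
  have "has_bochner_integral lborel (\<lambda>t. wgt t * kform (\<lambda>m. 1 - exp (- t) ^ m) n x + wgt t * aa t * ?u)
     (KK * kform (coeff_b \<alpha>) n x + IA * ?u)" by (intro has_bochner_integral_add kform_coeff_b_integral has_bochner_integral_mult_left)
       (simp add: has_bochner_integral_iff IA_def integrable_aa)
  moreover have "0 \<le> wgt t * kform (\<lambda>m. 1 - exp (- t) ^ m) n x + wgt t * aa t * ?u" for t
  proof (cases "t > 0")
    case True
    have "0 \<le> wgt t * (kform (\<lambda>m. 1 - exp (- t) ^ m) n x + aa t * ?u)"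
      using True by (intro mult_nonneg_nonneg wgt_nonneg kform_geometric_unit_nonneg) (auto simp: aa_def)
    then show ?thesis by (simp add: algebra_simps)
  qed (simp add: wgt_def)
  ultimately show ?thesis by (metis (no_types, lifting) has_bochner_integral_integral_eq Bochner_Integration.integral_nonneg)
qed

lemma kform_b_nonneg: "0 \<le> kform (coeff_b \<alpha>) n x"
proof -
  have nn: "0 \<le> wgt t * kform (\<lambda>m. 1 - exp (- t) ^ m) n x" for t
  proof (cases "t > 0")
    case True
    define s where "s = rec_nat 0 (\<lambda>k s. exp (- t) * s + x k)"
    have "0 \<le> kform (\<lambda>m. 1 - exp (- t) ^ m) n x"
      by (subst kform_geometric[of s]) (use True in \<open>auto simp: s_def power_le_one intro!: add_nonneg_nonneg mult_nonneg_nonneg sum_nonneg\<close>)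
    then show ?thesis by (simp add: wgt_nonneg)
  qed (simp add: wgt_def)
  have "0 \<le> KK * kform (coeff_b \<alpha>) n x"
    using kform_coeff_b_integral[of n x] nn by (metis (no_types, lifting) has_bochner_integral_integral_eq Bochner_Integration.integral_nonneg)
  then show ?thesis using KK_pos by (simp add: zero_le_mult_iff)
qed

text \<open>Only a negative unit form u is dangerous. Then \<open>corr_le\<close> gives
  \<open>KK * corr * u \<ge> IM * u\<close>, and the fraction \<open>IM / IA\<close> of
  \<open>kform_b_unit\<close> compensates exactly this amount; the remaining fraction of the form of
  b survives.\<close>

lemma kform_beta_ge: "(1 - IM / IA) * kform (coeff_b \<alpha>) n x \<le> kform (coeff_beta \<alpha>) n x"
proof -
  define u where "u = kform (\<lambda>m. if m = 1 then 1 else 0) n x"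
  have IA: "IA > 0" using IM_less IM_nonneg by simp
  have eq: "kform (coeff_beta \<alpha>) n x = kform (coeff_b \<alpha>) n x + corr * u" unfolding coeff_beta_eq kform_lin u_def by simp
  have r: "0 \<le> IM / IA" using IA IM_nonneg by simp
  show ?thesis
  proof (cases "u \<ge> 0")
    case True
    then have "0 \<le> corr * u" using corr_nonneg by simp
    moreover have "0 \<le> (IM / IA) * kform (coeff_b \<alpha>) n x" using kform_b_nonneg r by (intro mult_nonneg_nonneg)
    ultimately show ?thesis unfolding eq by (simp add: algebra_simps)
  next
    case False
    have "IM * u \<le> KK * corr * u" using corr_le False by (intro mult_right_mono_neg) auto
    moreover have "0 \<le> (IM / IA) * (KK * kform (coeff_b \<alpha>) n x + IA * u)"
      using kform_b_unit[of n x] r unfolding u_def by (intro mult_nonneg_nonneg)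
    then have "0 \<le> (IM / IA) * (KK * kform (coeff_b \<alpha>) n x) + IM * u" using IA by (simp add: distrib_left)
    ultimately have "0 \<le> KK * ((IM / IA) * kform (coeff_b \<alpha>) n x + corr * u)" by (simp add: algebra_simps)
    then have "0 \<le> (IM / IA) * kform (coeff_b \<alpha>) n x + corr * u" using KK_pos by (simp add: zero_le_mult_iff)
    then show ?thesis unfolding eq by (simp add: algebra_simps)
  qed
qed

lemma beta_ratio_pos: "0 < 1 - IM / IA" using IM_less IM_nonneg by (simp add: field_simps)

text \<open>Concavity of the power, read off the integral representation: at each frequency the
  second difference of \<open>1 - r ^ m\<close> is
  \<open>- ((1 - r)^2 * r ^ (m - 1))\<close>.\<close>

lemma powr_second_difference: assumes "0 < m" shows "(real m + 1) powr p - 2 * real m powr p + (real m - 1) powr p \<le> 0"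
proof -
  have "has_bochner_integral lborel (\<lambda>t. - kern (\<lambda>m. wgt t * (1 - exp (- t) ^ m)) m) (- kern (\<lambda>m. KK * coeff_b \<alpha> m) m)"
    by (intro has_bochner_integral_minus kern_has_integral coeff_b_integral)
  moreover have "0 \<le> - kern (\<lambda>m. wgt t * (1 - exp (- t) ^ m)) m" for t
  proof -
    obtain i where m: "m = Suc i" using assms by (cases m) auto
    have "- kern (\<lambda>m. wgt t * (1 - exp (- t) ^ m)) m = wgt t * ((1 - exp (- t))^2 * exp (- t) ^ i)"
      by (simp add: kern_def m power2_eq_square algebra_simps)
    then show ?thesis using wgt_nonneg by simp
  qed
  ultimately have "0 \<le> - kern (\<lambda>m. KK * coeff_b \<alpha> m) m"
    by (metis (no_types, lifting) has_bochner_integral_integral_eq Bochner_Integration.integral_nonneg)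
  then have "0 \<le> - (KK * kern (coeff_b \<alpha>) m)" using assms by (simp add: kern_def algebra_simps)
  then have "kern (coeff_b \<alpha>) m \<le> 0" using KK_pos by (simp add: mult_le_0_iff)
  then have "((real m + 1) powr p - 2 * real m powr p + (real m - 1) powr p) / Gamma (3 - \<alpha>) \<le> 0"
    using assms by (simp add: kern_def coeff_b_def of_nat_diff diff_divide_distrib add_divide_distrib add.commute)
  then show ?thesis using Gpos by (simp add: divide_le_0_iff)
qed

lemma coeff_b_mono: "coeff_b \<alpha> k < coeff_b \<alpha> (k + 1)"
  unfolding coeff_b_def using Gpos pp by (intro divide_strict_right_mono powr_less_mono2) auto

text \<open>Serves the term with u_1 of the modified scheme. Two differences change, by
  \<open>corr\<close> at k = 0 and by \<open>- corr\<close> at k = 1; the second may change sign,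
  hence the absolute value. The constant has one quotient for each of them.\<close>

lemma coeff_beta_diff_le:
  obtains C where "0 \<le> C" "\<And>k. \<bar>coeff_beta \<alpha> (k + 1) - coeff_beta \<alpha> k\<bar> \<le> C * (coeff_b \<alpha> (k + 1) - coeff_b \<alpha> k)"
proof
  define d where "d k = coeff_b \<alpha> (k + 1) - coeff_b \<alpha> k" for k
  have d: "0 < d k" for k using coeff_b_mono by (simp add: d_def)
  show "0 \<le> 1 + corr / d 0 + corr / d 1" using corr_nonneg d by (simp add: less_imp_le)
  fix k :: nat
  have c: "0 \<le> corr / d 0" "0 \<le> corr / d 1" using corr_nonneg d by (simp_all add: less_imp_le)
  consider "k = 0" | "k = 1" | "k \<ge> 2" by linarith
  then have "\<bar>coeff_beta \<alpha> (k + 1) - coeff_beta \<alpha> k\<bar> \<le> (1 + corr / d 0 + corr / d 1) * d k"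
  proof cases
    case 1
    have "\<bar>coeff_beta \<alpha> (k + 1) - coeff_beta \<alpha> k\<bar> = (1 + corr / d 0) * d k"
      using 1 d[of 0] corr_nonneg unfolding coeff_beta_eq by (simp add: d_def abs_of_nonneg distrib_right)
    also have "\<dots> \<le> (1 + corr / d 0 + corr / d 1) * d k" using c d[of k] by (intro mult_right_mono) auto
    finally show ?thesis .
  next
    case 2
    have "\<bar>coeff_beta \<alpha> (k + 1) - coeff_beta \<alpha> k\<bar> \<le> d 1 + corr" using 2 d[of 1] corr_nonneg unfolding coeff_beta_eq by (simp add: d_def)
    also have "\<dots> = (1 + corr / d 1) * d k" using 2 d[of 1] by (simp add: distrib_right)
    also have "\<dots> \<le> (1 + corr / d 0 + corr / d 1) * d k" using c d[of k] by (intro mult_right_mono) auto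
    finally show ?thesis .
  next
    case 3
    have "\<bar>coeff_beta \<alpha> (k + 1) - coeff_beta \<alpha> k\<bar> = 1 * d k" using 3 d[of k] unfolding coeff_beta_eq by (simp add: d_def)
    also have "\<dots> \<le> (1 + corr / d 0 + corr / d 1) * d k" using c d[of k] by (intro mult_right_mono) auto
    finally show ?thesis .
  qed
  then show "\<bar>coeff_beta \<alpha> (k + 1) - coeff_beta \<alpha> k\<bar> \<le> (1 + corr / d 0 + corr / d 1) * (coeff_b \<alpha> (k + 1) - coeff_b \<alpha> k)"
    by (simp add: d_def)
qed

end

section \<open>Fractional seminorm of a step function\<close>

locale step_fun = order_param +
  fixes \<tau> :: real and n :: nat and x :: "nat \<Rightarrow> real"
  assumes \<tau>: "0 < \<tau>"
begin

definition "cell k = {real k * \<tau> ..< real (k + 1) * \<tau>}"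
definition "stp t = (\<Sum>k<n. x k * indicator (cell k) t)"
text \<open>Up to a constant, the primitive of the indicator of the cell; with it moving averages
  and their derivatives are explicit finite sums.\<close>

definition "clp k t = max (real k * \<tau>) (min t (real (k + 1) * \<tau>))"
text \<open>The mean of \<open>stp\<close> over \<open>{t..t + s}\<close>. It looks forward, so it
  vanishes at the final time.\<close>

definition "avg s t = (\<Sum>k<n. x k * (clp k (t + s) - clp k t)) / s"

lemma cell_unique: assumes "t \<in> cell j" "t \<in> cell k" shows "j = k"
proof -
  have "\<not> j < k" if "t \<in> cell j" "t \<in> cell k" for j k
  proof
    assume "j < k"
    then have "real (j + 1) * \<tau> \<le> real k * \<tau>" using \<tau> by (intro mult_right_mono) auto
    then show False using that by (auto simp: cell_def)
  qed
  then show ?thesis using assms by (metis linorder_neqE_nat)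
qed

lemma stp_cell: assumes "t \<in> cell k" shows "stp t = (if k < n then x k else 0)"
proof -
  have "stp t = (\<Sum>i<n. if i = k then x k else 0)" unfolding stp_def using assms cell_unique by (intro sum.cong) (auto simp: indicator_def)
  then show ?thesis by simp
qed

lemma ex_cell: assumes "0 \<le> t" shows "\<exists>k. t \<in> cell k"
proof
  have "0 \<le> t / \<tau>" using assms \<tau> by simp
  then have "real (nat \<lfloor>t / \<tau>\<rfloor>) \<le> t / \<tau>" "t / \<tau> < real (nat \<lfloor>t / \<tau>\<rfloor>) + 1" by linarith+
  then show "t \<in> cell (nat \<lfloor>t / \<tau>\<rfloor>)" using \<tau> by (auto simp: cell_def field_simps)
qed

lemma cell_lt: assumes "t \<in> cell k" "t < real n * \<tau>" shows "k < n"
proof -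
  have "real k * \<tau> < real n * \<tau>" using assms by (auto simp: cell_def)
  then show ?thesis using \<tau> by simp
qed

lemma cell_mono: assumes "t \<in> cell k" "u \<in> cell j" "t \<le> u" shows "k \<le> j"
proof (rule ccontr)
  assume "\<not> k \<le> j"
  then have "real (j + 1) * \<tau> \<le> real k * \<tau>" using \<tau> by (intro mult_right_mono) auto
  then show False using assms by (auto simp: cell_def)
qed

lemma stp_out: assumes "real n * \<tau> \<le> t \<or> t < 0" shows "stp t = 0"
proof -
  have "t \<notin> cell k" if "k < n" for k
  proof
    assume t: "t \<in> cell k"
    have "0 \<le> real k * \<tau>" "real (k + 1) * \<tau> \<le> real n * \<tau>" using that \<tau> by (auto intro!: mult_right_mono)
    then show False using t assms by (auto simp: cell_def)
  qed
  then show ?thesis by (auto simp: stp_def)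
qed

lemma stp_measurable [measurable]: "stp \<in> borel_measurable borel" unfolding stp_def cell_def by measurable

lemma clp_measurable [measurable]: "clp k \<in> borel_measurable borel" unfolding clp_def by measurable

lemma clp_has_derivative:
  assumes "u \<noteq> real k * \<tau>" "u \<noteq> real (k + 1) * \<tau>"
  shows "(clp k has_real_derivative indicator (cell k) u) (at u)"
proof -
  define a b where "a = real k * \<tau>" "b = real (k + 1) * \<tau>"
  have ab: "a < b" using \<tau> by (simp add: a_b_def)
  have clp: "clp k = (\<lambda>t. max a (min t b))" and cell: "cell k = {a..<b}" by (auto simp: clp_def cell_def a_b_def)
  consider "u < a" | "a < u" "u < b" | "b < u" using assms unfolding a_b_def[symmetric] by linarith
  then show ?thesis
  proof cases
    case 1
    have "((\<lambda>t. a) has_real_derivative 0) (at u)" by simp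
    then have "(clp k has_real_derivative 0) (at u)"
      by (rule has_field_derivative_transform_within_open[of _ _ _ "{..<a}"]) (use 1 ab in \<open>auto simp: clp\<close>)
    then show ?thesis using 1 by (simp add: cell)
  next
    case 2
    have "((\<lambda>t. t) has_real_derivative 1) (at u)" by simp
    then have "(clp k has_real_derivative 1) (at u)"
      by (rule has_field_derivative_transform_within_open[of _ _ _ "{a<..<b}"]) (use 2 ab in \<open>auto simp: clp\<close>)
    then show ?thesis using 2 by (simp add: cell)
  next
    case 3
    have "((\<lambda>t. b) has_real_derivative 0) (at u)" by simp
    then have "(clp k has_real_derivative 0) (at u)"
      by (rule has_field_derivative_transform_within_open[of _ _ _ "{b<..}"]) (use 3 ab in \<open>auto simp: clp\<close>)
    then show ?thesis using 3 by (simp add: cell)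
  qed
qed

lemma clp_continuous: "continuous_on S (clp k)" unfolding clp_def by (intro continuous_intros)

lemma cell_has_integral:
  assumes "a \<le> b" shows "((indicator (cell k) :: real \<Rightarrow> real) has_integral (clp k b - clp k a)) {a..b}"
  by (rule fundamental_theorem_of_calculus_interior_strong[of "{real k * \<tau>, real (k + 1) * \<tau>}"])
    (use assms clp_has_derivative in \<open>auto simp: has_real_derivative_iff_has_vector_derivative[symmetric] clp_continuous\<close>)

lemma stp_has_integral:
  assumes "0 < s" shows "(stp has_integral s * avg s t) {t..t + s}"
proof -
  have "((\<lambda>u. \<Sum>k<n. x k * indicator (cell k) u) has_integral (\<Sum>k<n. x k * (clp k (t + s) - clp k t))) {t..t + s}"
    using assms by (intro has_integral_sum has_integral_mult_right cell_has_integral) auto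
  then show ?thesis using assms by (simp add: stp_def[abs_def] avg_def)
qed

text \<open>Cauchy-Schwarz on an interval of length \<open>s\<close>. The bound is a nonnegative
  integral over all u, ready to be exchanged with an integral over s.\<close>

lemma avg_error:
  assumes s: "0 < s"
  shows "ennreal ((avg s t - stp t)^2)
    \<le> (\<integral>\<^sup>+u. ennreal (if t \<le> u \<and> u \<le> t + s then (stp u - stp t)^2 / s else 0) \<partial>lborel)"
proof -
  define g where "g u = \<bar>stp u - stp t\<bar>" for u
  have [measurable]: "g \<in> borel_measurable borel" unfolding g_def by measurable
  obtain B where B: "\<And>u. \<bar>stp u\<bar> \<le> B"
  proof
    fix u show "\<bar>stp u\<bar> \<le> (\<Sum>k<n. \<bar>x k\<bar>)" unfolding stp_def
      by (rule order_trans[OF sum_abs], rule sum_mono) (simp add: abs_mult indicator_def)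
  qed
  have gB: "g u \<le> 2 * B" for u using B[of u] B[of t] unfolding g_def by linarith
  have 1: "((\<lambda>u. stp u - stp t) has_integral s * avg s t - s * stp t) {t..t + s}"
    using has_integral_diff[OF stp_has_integral[OF s, of t] has_integral_const_real[of "stp t" t "t + s"]] s by simp
  have gi: "g integrable_on {t..t + s}"
  proof (rule measurable_bounded_by_integrable_imp_integrable_real)
    show "g \<in> borel_measurable (lebesgue_on {t..t + s})" by (intro borel_measurable_if_I measurable_restrict_space1) (simp add: measurable_completion)
    show "(\<lambda>u. 2 * B) integrable_on {t..t + s}" by (rule integrable_const_ivl)
  qed (auto simp: g_def gB[unfolded g_def])
  have "\<bar>s * avg s t - s * stp t\<bar> \<le> integral {t..t + s} g"
    using integral_norm_bound_integral[OF has_integral_integrable[OF 1] gi] integral_unique[OF 1] by (simp add: g_def)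
  also have "integral {t..t+s} g = enn2real (\<integral>\<^sup>+u. ennreal (g u) * indicator {t..t+s} u \<partial>lborel)"
    using nn_integral_has_integral_lebesgue'[OF _ integrable_integral[OF gi]] integral_nonneg[OF gi] by (simp add: g_def)
  finally have 2: "\<bar>s * avg s t - s * stp t\<bar> \<le> enn2real (\<integral>\<^sup>+u. ennreal (g u) * indicator {t..t+s} u \<partial>lborel)" .
  have fin: "(\<integral>\<^sup>+u. ennreal (g u) * indicator {t..t+s} u \<partial>lborel) < \<infinity>"
    using nn_integral_has_integral_lebesgue'[OF _ integrable_integral[OF gi]] by (simp add: g_def)
  have "ennreal \<bar>s * avg s t - s * stp t\<bar> \<le> (\<integral>\<^sup>+u. ennreal (g u) * indicator {t..t+s} u \<partial>lborel)"
  proof -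
    have "ennreal \<bar>s * avg s t - s * stp t\<bar> \<le> ennreal (enn2real (\<integral>\<^sup>+u. ennreal (g u) * indicator {t..t+s} u \<partial>lborel))"
      by (rule ennreal_leI[OF 2])
    also have "\<dots> = (\<integral>\<^sup>+u. ennreal (g u) * indicator {t..t+s} u \<partial>lborel)" by (rule ennreal_enn2real) (use fin in simp)
    finally show ?thesis .
  qed
  then have "(ennreal \<bar>s * avg s t - s * stp t\<bar>)^2 \<le> (\<integral>\<^sup>+u. (ennreal (g u) * indicator {t..t+s} u) * indicator {t..t+s} u \<partial>lborel)^2"
    by (intro power_mono) (auto simp: mult.assoc indicator_inter_arith[symmetric])
  also have "\<dots> \<le> (\<integral>\<^sup>+u. (ennreal (g u) * indicator {t..t+s} u)^2 \<partial>lborel) * (\<integral>\<^sup>+u. (indicator {t..t+s} u)^2 \<partial>lborel)"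
    by (rule Cauchy_Schwarz_nn_integral) auto
  also have "(\<integral>\<^sup>+u. (indicator {t..t+s} u)^2 \<partial>lborel) = (\<integral>\<^sup>+u. indicator {t..t+s} u \<partial>lborel)"
    by (intro nn_integral_cong) (auto simp: indicator_def)
  also have "\<dots> = ennreal s" using s by simp
  finally have 3: "(ennreal \<bar>s * avg s t - s * stp t\<bar>)^2 \<le> (\<integral>\<^sup>+u. (ennreal (g u) * indicator {t..t+s} u)^2 \<partial>lborel) * ennreal s" .
  have "ennreal ((avg s t - stp t)^2) = (ennreal \<bar>s * avg s t - s * stp t\<bar>)^2 * ennreal (1 / s^2)"
  proof -
    have "(avg s t - stp t)^2 = (s * avg s t - s * stp t)^2 * (1 / s^2)" using s by (simp add: power_mult_distrib flip: right_diff_distrib)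
    then show ?thesis by (simp add: ennreal_power ennreal_mult[symmetric])
  qed
  also have "\<dots> \<le> (\<integral>\<^sup>+u. (ennreal (g u) * indicator {t..t+s} u)^2 \<partial>lborel) * ennreal s * ennreal (1 / s^2)" by (intro mult_right_mono 3) simp
  also have "\<dots> = (\<integral>\<^sup>+u. (ennreal (g u) * indicator {t..t+s} u)^2 \<partial>lborel) * ennreal (1 / s)"
    using s by (simp add: mult.assoc ennreal_mult[symmetric] power2_eq_square)
  also have "\<dots> = (\<integral>\<^sup>+u. (ennreal (g u) * indicator {t..t+s} u)^2 * ennreal (1 / s) \<partial>lborel)" by (rule nn_integral_multc[symmetric]) auto
  also have "\<dots> = (\<integral>\<^sup>+u. ennreal (if t \<le> u \<and> u \<le> t + s then (stp u - stp t)^2 / s else 0) \<partial>lborel)"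
    using s by (intro nn_integral_cong) (auto simp: indicator_def g_def ennreal_power ennreal_mult[symmetric])
  finally show ?thesis .
qed

text \<open>The inner integral of the Gagliardo seminorm of order \<open>(\<alpha> - 1) / 2\<close>,
  for which the exponent is \<open>- \<alpha>\<close>. The range of u continues past the final time,
  where \<open>stp\<close> is zero; this tail produces the weight of the right endpoint.\<close>

definition "hh t = (\<integral>\<^sup>+u. ennreal (if t < u then (u - t) powr (- \<alpha>) * (stp u - stp t)^2 else 0) \<partial>lborel)"

lemma hh_measurable [measurable]: "hh \<in> borel_measurable borel" unfolding hh_def by measurable

definition "hk k t = (\<Sum>j<n. if k < j then (x j - x k)^2 * (((real j * \<tau> - t) powr (1 - \<alpha>) - (real (j + 1) * \<tau> - t) powr (1 - \<alpha>)) / (\<alpha> - 1)) else 0)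
    + (x k)^2 * ((real n * \<tau> - t) powr (1 - \<alpha>) / (\<alpha> - 1))"

lemma powr_piece: assumes "t < a" "a \<le> b"
  shows "(\<integral>\<^sup>+u. ennreal ((u - t) powr (- \<alpha>)) * indicator {a..b} u \<partial>lborel)
    = ennreal (((a - t) powr (1 - \<alpha>) - (b - t) powr (1 - \<alpha>)) / (\<alpha> - 1))"
proof -
  have "(\<integral>\<^sup>+u. ennreal ((u - t) powr (- \<alpha>)) * indicator {a..b} u \<partial>lborel)
    = ennreal (- ((b - t) powr (1 - \<alpha>) / (\<alpha> - 1)) - - ((a - t) powr (1 - \<alpha>) / (\<alpha> - 1)))"
  proof (rule nn_integral_FTC_Icc)
    fix u assume "u \<in> {a..b}"
    then have u: "u - t > 0" using assms by auto
    have "((\<lambda>u. (u - t) powr (1 - \<alpha>)) has_real_derivative (1 - \<alpha>) * (u - t) powr (1 - \<alpha> - 1) * 1) (at u)"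
      using u by (auto intro!: derivative_eq_intros)
    then have "((\<lambda>u. - ((u - t) powr (1 - \<alpha>) / (\<alpha> - 1))) has_real_derivative - ((1 - \<alpha>) * (u - t) powr (1 - \<alpha> - 1) * 1 / (\<alpha> - 1))) (at u)"
      by (intro DERIV_minus DERIV_cdivide)
    moreover have "- ((1 - \<alpha>) * (u - t) powr (1 - \<alpha> - 1) * 1 / (\<alpha> - 1)) = (u - t) powr (- \<alpha>)" using \<alpha> by (simp add: field_simps)
    ultimately show "((\<lambda>u. - ((u - t) powr (1 - \<alpha>) / (\<alpha> - 1))) has_real_derivative (u - t) powr (- \<alpha>)) (at u)" by simp
  qed (use assms in auto)
  also have "- ((b - t) powr (1 - \<alpha>) / (\<alpha> - 1)) - - ((a - t) powr (1 - \<alpha>) / (\<alpha> - 1)) = ((a - t) powr (1 - \<alpha>) - (b - t) powr (1 - \<alpha>)) / (\<alpha> - 1)"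
    by (simp add: diff_divide_distrib)
  finally show ?thesis .
qed

lemma powr_tail: assumes "t < a" and q: "1 < q"
  shows "(\<integral>\<^sup>+u. ennreal ((u - t) powr (- q)) * indicator {a..} u \<partial>lborel)
    = ennreal ((a - t) powr (1 - q) / (q - 1))"
proof -
  have lim: "((\<lambda>u. - ((u - t) powr (1 - q) / (q - 1))) \<longlongrightarrow> - (0 / (q - 1))) at_top"
  proof (intro tendsto_intros tendsto_neg_powr)
    show "filterlim (\<lambda>u. u - t) at_top at_top" using filterlim_tendsto_add_at_top[OF tendsto_const[of "- t"] filterlim_ident] by simp
  qed (use q in auto)
  have "(\<integral>\<^sup>+u. ennreal ((u - t) powr (- q)) * indicator {a..} u \<partial>lborel)
    = ennreal (- (0 / (q - 1)) - - ((a - t) powr (1 - q) / (q - 1)))"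
  proof (rule nn_integral_FTC_atLeast[OF _ _ _ lim])
    fix u assume "a \<le> u"
    then have u: "u - t > 0" using assms by auto
    have "((\<lambda>u. (u - t) powr (1 - q)) has_real_derivative (1 - q) * (u - t) powr (1 - q - 1) * 1) (at u)"
      using u by (auto intro!: derivative_eq_intros)
    then have "((\<lambda>u. - ((u - t) powr (1 - q) / (q - 1))) has_real_derivative - ((1 - q) * (u - t) powr (1 - q - 1) * 1 / (q - 1))) (at u)"
      by (intro DERIV_minus DERIV_cdivide)
    moreover have "- ((1 - q) * (u - t) powr (1 - q - 1) * 1 / (q - 1)) = (u - t) powr (- q)" using q by (simp add: field_simps)
    ultimately show "((\<lambda>u. - ((u - t) powr (1 - q) / (q - 1))) has_real_derivative (u - t) powr (- q)) (at u)" by simp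
  qed auto
  then show ?thesis by simp
qed

text \<open>Split u > t along the grid: the cell of t contributes nothing, each later cell a
  difference of powers by \<open>powr_piece\<close>, and everything past the final time a single
  power by \<open>powr_tail\<close>.\<close>

lemma hh_le: assumes t: "t \<in> cell k" "k < n" shows "hh t \<le> ennreal (hk k t)"
proof -
  have tk: "t < real (k + 1) * \<tau>" using t by (simp add: cell_def)
  have tj: "t < real j * \<tau>" if "k < j" for j
  proof -
    have "real (k + 1) * \<tau> \<le> real j * \<tau>" using that \<tau> by (intro mult_right_mono) auto
    then show ?thesis using tk by simp
  qed
  let ?F = "\<lambda>u. (\<Sum>j<n. if k < j then ennreal ((x j - x k)^2) * (ennreal ((u - t) powr (- \<alpha>)) * indicator {real j * \<tau>..real (j + 1) * \<tau>} u) else 0)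
      + ennreal ((x k)^2) * (ennreal ((u - t) powr (- \<alpha>)) * indicator {real n * \<tau>..} u)"
  have stpt: "stp t = x k" using stp_cell[OF t(1)] t(2) by simp
  have "hh t \<le> (\<integral>\<^sup>+u. ?F u \<partial>lborel)" unfolding hh_def
  proof (rule nn_integral_mono)
    fix u show "ennreal (if t < u then (u - t) powr (- \<alpha>) * (stp u - stp t)^2 else 0) \<le> ?F u"
    proof (cases "t < u")
      case tu: True
      have "0 \<le> t" using t \<tau> by (auto simp: cell_def intro: order_trans[of _ "real k * \<tau>"])
      show ?thesis
      proof (cases "real n * \<tau> \<le> u")
        case True
        have "ennreal (if t < u then (u - t) powr (- \<alpha>) * (stp u - stp t)^2 else 0)
          = ennreal ((x k)^2) * (ennreal ((u - t) powr (- \<alpha>)) * indicator {real n * \<tau>..} u)"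
          using True tu by (simp add: stp_out stpt ennreal_mult[symmetric] mult.commute)
        then show ?thesis by (simp add: add_increasing)
      next
        case False
        obtain j where j: "u \<in> cell j" using ex_cell[of u] tu \<open>0 \<le> t\<close> by auto
        have jn: "j < n" using cell_lt[OF j] False by simp
        have kj: "k \<le> j" using cell_mono[OF t(1) j] tu by simp
        show ?thesis
        proof (cases "k = j")
          case True
          then show ?thesis using stp_cell[OF j] stpt jn by simp
        next
          case False
          then have "k < j" using kj by simp
          have "ennreal (if t < u then (u - t) powr (- \<alpha>) * (stp u - stp t)^2 else 0)
            = (if k < j then ennreal ((x j - x k)^2) * (ennreal ((u - t) powr (- \<alpha>)) * indicator {real j * \<tau>..real (j + 1) * \<tau>} u) else 0)"
            using tu \<open>k < j\<close> j stp_cell[OF j] jn by (auto simp: stpt cell_def ennreal_mult[symmetric] mult.commute)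
          also have "\<dots> \<le> (\<Sum>j<n. if k < j then ennreal ((x j - x k)^2) * (ennreal ((u - t) powr (- \<alpha>)) * indicator {real j * \<tau>..real (j + 1) * \<tau>} u) else 0)"
            using jn by (intro member_le_sum) auto
          also have "\<dots> \<le> ?F u" by simp
          finally show ?thesis .
        qed
      qed
    qed simp
  qed
  also have "\<dots> = (\<Sum>j<n. if k < j then ennreal ((x j - x k)^2) * (\<integral>\<^sup>+u. ennreal ((u - t) powr (- \<alpha>)) * indicator {real j * \<tau>..real (j + 1) * \<tau>} u \<partial>lborel) else 0)
      + ennreal ((x k)^2) * (\<integral>\<^sup>+u. ennreal ((u - t) powr (- \<alpha>)) * indicator {real n * \<tau>..} u \<partial>lborel)"
    by (subst nn_integral_add) (auto simp: nn_integral_sum nn_integral_cmult if_distrib[of "\<lambda>f. nn_integral lborel f"] intro!: sum.cong)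
  also have "\<dots> = (\<Sum>j<n. if k < j then ennreal ((x j - x k)^2) * ennreal (((real j * \<tau> - t) powr (1 - \<alpha>) - (real (j + 1) * \<tau> - t) powr (1 - \<alpha>)) / (\<alpha> - 1)) else 0)
      + ennreal ((x k)^2) * ennreal ((real n * \<tau> - t) powr (1 - \<alpha>) / (\<alpha> - 1))" using powr_tail[OF tj[OF t(2)], of \<alpha>] \<alpha> powr_piece[OF tj] \<tau>
    by (intro arg_cong2[where f = "(+)"] sum.cong refl) (auto simp: mult_right_mono)
  also have "\<dots> = ennreal (hk k t)"
  proof -
    have nn: "0 \<le> ((real j * \<tau> - t) powr (1 - \<alpha>) - (real (j + 1) * \<tau> - t) powr (1 - \<alpha>)) / (\<alpha> - 1)" if "k < j" for j
      using tj[OF that] \<alpha> \<tau> by (intro divide_nonneg_nonneg) (auto intro!: powr_mono2' simp: distrib_right)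
    define P where "P j = ((real j * \<tau> - t) powr (1 - \<alpha>) - (real (j + 1) * \<tau> - t) powr (1 - \<alpha>)) / (\<alpha> - 1)" for j
    have P: "0 \<le> P j" if "k < j" for j using nn[OF that] by (simp add: P_def)
    have "(\<Sum>j<n. if k < j then ennreal ((x j - x k)^2) * ennreal (P j) else 0)
      = (\<Sum>j<n. ennreal (if k < j then (x j - x k)^2 * P j else 0))" using P by (intro sum.cong) (auto simp: ennreal_mult)
    also have "\<dots> = ennreal (\<Sum>j<n. if k < j then (x j - x k)^2 * P j else 0)" using P by (intro sum_ennreal) auto
    finally show ?thesis unfolding hk_def P_def[symmetric] using \<alpha> P
      by (subst ennreal_plus) (auto simp: ennreal_mult[symmetric] intro!: sum_nonneg)
  qed
  finally show ?thesis .
qed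

text \<open>The integral of \<open>(real j * \<tau> - t) powr (1 - \<alpha>)\<close> over the k-th
  cell for m = j - k, finite also for m = 1 because \<alpha> < 2. It is a multiple of the first
  difference of b at m, see \<open>AA_b\<close>.\<close>

definition "AA m = \<tau> powr p * (real m powr p - (real m - 1) powr p) / p"

lemma AA_integral:
  assumes "k < j"
  shows "((\<lambda>t. (real j * \<tau> - t) powr (1 - \<alpha>)) has_integral AA (j - k)) {real k * \<tau><..<real (k + 1) * \<tau>}"
proof -
  let ?F = "\<lambda>t. - ((real j * \<tau> - t) powr p / p)"
  have "((\<lambda>t. (real j * \<tau> - t) powr (1 - \<alpha>)) has_integral ?F (real (k + 1) * \<tau>) - ?F (real k * \<tau>)) {real k * \<tau>..real (k + 1) * \<tau>}"
  proof (rule fundamental_theorem_of_calculus_interior)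
    show "real k * \<tau> \<le> real (k + 1) * \<tau>" using \<tau> by simp
    have le: "real (k + 1) * \<tau> \<le> real j * \<tau>" using assms \<tau> by (intro mult_right_mono) auto
    show "continuous_on {real k * \<tau>..real (k + 1) * \<tau>} ?F" using pp le by (intro continuous_intros continuous_on_powr') auto
    fix t assume t: "t \<in> {real k * \<tau><..<real (k + 1) * \<tau>}"
    then have pos: "real j * \<tau> - t > 0" using le by auto
    have "((\<lambda>t. (real j * \<tau> - t) powr p) has_real_derivative p * (real j * \<tau> - t) powr (p - 1) * (- 1)) (at t)"
      using pos by (auto intro!: derivative_eq_intros)
    then have "(?F has_real_derivative - (p * (real j * \<tau> - t) powr (p - 1) * (- 1) / p)) (at t)" by (intro DERIV_minus DERIV_cdivide)
    moreover have "- (p * (real j * \<tau> - t) powr (p - 1) * (- 1) / p) = (real j * \<tau> - t) powr (1 - \<alpha>)" using pp by simp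
    ultimately show "(?F has_vector_derivative (real j * \<tau> - t) powr (1 - \<alpha>)) (at t)"
      by (simp add: has_real_derivative_iff_has_vector_derivative[symmetric])
  qed
  moreover have "?F (real (k + 1) * \<tau>) - ?F (real k * \<tau>) = AA (j - k)"
  proof -
    have e: "real j * \<tau> - real k * \<tau> = \<tau> * real (j - k)" "real j * \<tau> - real (k + 1) * \<tau> = \<tau> * (real (j - k) - 1)"
      using assms by (simp_all add: of_nat_diff algebra_simps)
    have q: "(\<tau> * real (j - k)) powr p = \<tau> powr p * real (j - k) powr p"
      "(\<tau> * (real (j - k) - 1)) powr p = \<tau> powr p * (real (j - k) - 1) powr p" using \<tau> assms by (auto intro!: powr_mult)
    show ?thesis unfolding e q AA_def by (simp add: diff_divide_distrib right_diff_distrib)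
  qed
  ultimately show ?thesis by (simp add: has_integral_Icc_iff_Ioo)
qed

definition "RR k = (\<Sum>j<n. if k < j then (x j - x k)^2 * ((AA (j - k) - AA (Suc j - k)) / (\<alpha> - 1)) else 0)
    + (x k)^2 * (AA (n - k) / (\<alpha> - 1))"

lemma hh_cell_integral:
  assumes k: "k < n"
  shows "(\<integral>\<^sup>+t. hh t * indicator {real k * \<tau><..<real (k + 1) * \<tau>} t \<partial>lborel) \<le> ennreal (RR k)"
proof -
  let ?I = "{real k * \<tau><..<real (k + 1) * \<tau>}"
  have hi: "(hk k has_integral RR k) ?I"
  proof -
    have "((\<lambda>t. if k < j then (x j - x k)^2 * (((real j * \<tau> - t) powr (1 - \<alpha>) - (real (j + 1) * \<tau> - t) powr (1 - \<alpha>)) / (\<alpha> - 1)) else 0)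
      has_integral (if k < j then (x j - x k)^2 * ((AA (j - k) - AA (Suc j - k)) / (\<alpha> - 1)) else 0)) ?I" for j
    proof (cases "k < j")
      case True
      then show ?thesis
        using has_integral_mult_right[OF has_integral_divide[OF has_integral_diff[OF AA_integral[of k j] AA_integral[of k "Suc j"]], of "\<alpha> - 1"], of "(x j - x k)^2"]
        by simp
    qed simp
    then show ?thesis unfolding hk_def RR_def using k
      by (intro has_integral_add has_integral_sum has_integral_mult_right has_integral_divide AA_integral) auto
  qed
  have nn: "0 \<le> hk k t" if t: "t \<in> ?I" for t
  proof -
    have "t < real j * \<tau>" if "k < j" for j
    proof -
      have "real (k + 1) * \<tau> \<le> real j * \<tau>" using that \<tau> by (intro mult_right_mono) auto
      then show ?thesis using t by auto
    qed
    then show ?thesis unfolding hk_def using \<alpha> \<tau>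
      by (intro add_nonneg_nonneg sum_nonneg) (auto intro!: mult_nonneg_nonneg divide_nonneg_nonneg powr_mono2' simp: distrib_right)
  qed
  have "(\<integral>\<^sup>+t. hh t * indicator ?I t \<partial>lborel) \<le> (\<integral>\<^sup>+t. ennreal (hk k t) * indicator ?I t \<partial>lborel)"
    using hh_le[OF _ k] by (intro nn_integral_mono) (auto simp: indicator_def cell_def)
  also have "\<dots> = ennreal (RR k)" by (rule nn_integral_has_integral_lebesgue'[OF nn hi])
  finally show ?thesis .
qed

text \<open>The factor 2 undoes the halves in \<open>kform_eq_squares\<close>; the factors \<alpha>
  - 1 and p come from integrating the power first in u and then in t.\<close>

definition "cc = 2 * Gamma (3 - \<alpha>) / (p * (\<alpha> - 1))"

lemma AA_b: "m > 0 \<Longrightarrow> AA m = \<tau> powr p / p * Gamma (3 - \<alpha>) * (coeff_b \<alpha> m - coeff_b \<alpha> (m - 1))"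
  using Gpos by (simp add: AA_def coeff_b_def of_nat_diff diff_divide_distrib right_diff_distrib)

lemma RR_nonneg: assumes "k < n" shows "0 \<le> RR k" using hh_cell_integral[OF assms]
proof -
  have d: "0 \<le> AA (j - k) - AA (Suc j - k)" if "k < j" for j
  proof -
    have m: "Suc j - k = (j - k) + 1" using that by simp
    have "(real (j - k) + 1) powr p - 2 * real (j - k) powr p + (real (j - k) - 1) powr p \<le> 0"
      using that by (intro powr_second_difference) simp
    then show ?thesis unfolding m AA_def using pp \<tau> by (simp add: divide_right_mono mult_left_mono add.commute)
  qed
  have "coeff_b \<alpha> (n - k - 1) \<le> coeff_b \<alpha> (n - k)" using assms coeff_b_mono[of "n - k - 1"] by (simp add: Suc_diff_Suc less_imp_le)
  then have "0 \<le> AA (n - k)" using assms pp \<tau> Gpos by (auto simp: AA_b intro!: divide_nonneg_nonneg mult_nonneg_nonneg)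
  then show ?thesis unfolding RR_def using d \<alpha> by (intro add_nonneg_nonneg sum_nonneg) auto
qed

text \<open>Integrating the power twice and differencing reproduces \<open>- kern\<close> of b, so
  the squared differences here match those of \<open>kform_eq_squares\<close> term by term, and the
  tails match the column weights. The row weights
  \<open>coeff_b \<alpha> (k + 1) - coeff_b \<alpha> k\<close> have no counterpart, but they are
  positive.\<close>

lemma sum_RR_le: "(\<Sum>k<n. RR k) \<le> cc * \<tau> powr p * kform (coeff_b \<alpha>) n x"
proof -
  define c0 where "c0 = Gamma (3 - \<alpha>) / (p * (\<alpha> - 1)) * \<tau> powr p"
  have c0: "0 \<le> c0" using Gpos pp \<alpha> by (simp add: c0_def)
  let ?b = "coeff_b \<alpha>"
  have A1: "(AA (j - k) - AA (Suc j - k)) / (\<alpha> - 1) = c0 * (- kern ?b (j - k))" if "k < j" for j k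
  proof -
    have m: "Suc j - k = (j - k) + 1" using that by simp
    define G where "G = \<tau> powr p / p * Gamma (3 - \<alpha>)"
    have AAG: "AA i = G * (?b i - ?b (i - 1))" if "i > 0" for i using AA_b[OF that] by (simp add: G_def)
    have "AA (j - k) - AA (Suc j - k) = G * (- kern ?b (j - k))" unfolding m using that by (simp add: AAG kern_def algebra_simps)
    then have "AA (j - k) - AA (Suc j - k) = \<tau> powr p / p * Gamma (3 - \<alpha>) * (- kern ?b (j - k))" by (simp add: G_def)
    then show ?thesis by (simp add: c0_def)
  qed
  have A2: "AA (n - k) / (\<alpha> - 1) = c0 * (?b (n - k) - ?b (n - Suc k))" if "k < n" for k using that by (simp add: AA_b c0_def)
  have "(\<Sum>k<n. RR k) = (\<Sum>k<n. \<Sum>j<n. if k < j then c0 * ((x j - x k)^2 * (- kern ?b (j - k))) else 0)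
      + (\<Sum>k<n. c0 * ((?b (n - k) - ?b (n - Suc k)) * (x k)^2))" unfolding RR_def sum.distrib
    by (intro arg_cong2[where f = "(+)"] sum.cong refl) (auto simp: A1 A2 mult_ac)
  also have "(\<Sum>k<n. \<Sum>j<n. if k < j then c0 * ((x j - x k)^2 * (- kern ?b (j - k))) else 0)
      = (\<Sum>j<n. \<Sum>k<n. if k < j then c0 * ((x j - x k)^2 * (- kern ?b (j - k))) else 0)" by (rule sum.swap)
  also have "\<dots> = (\<Sum>j<n. \<Sum>k<j. c0 * ((x j - x k)^2 * (- kern ?b (j - k))))"
  proof (rule sum.cong[OF refl])
    fix j assume "j \<in> {..<n}"
    then show "(\<Sum>k<n. if k < j then c0 * ((x j - x k)^2 * (- kern ?b (j - k))) else 0) = (\<Sum>k<j. c0 * ((x j - x k)^2 * (- kern ?b (j - k))))"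
      by (intro sum.mono_neutral_cong_right) auto
  qed
  finally have eq: "(\<Sum>k<n. RR k) = c0 * (- (\<Sum>j<n. \<Sum>k<j. kern ?b (j - k) * (x j - x k)^2)
      + (\<Sum>k<n. (?b (n - k) - ?b (n - Suc k)) * (x k)^2))" by (simp add: sum_distrib_left distrib_left right_diff_distrib sum_negf mult_ac)
  have "- (\<Sum>j<n. \<Sum>k<j. kern ?b (j - k) * (x j - x k)^2) + (\<Sum>k<n. (?b (n - k) - ?b (n - Suc k)) * (x k)^2)
     \<le> 2 * kform ?b n x"
  proof -
    have "(\<Sum>k<n. (?b (n - k) - ?b (n - Suc k)) * (x k)^2)
      \<le> (\<Sum>k<n. ((?b (k + 1) - ?b k) + (?b (n - k) - ?b (n - Suc k))) * (x k)^2)"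
      using coeff_b_mono by (intro sum_mono mult_right_mono) (auto simp: less_imp_le)
    then show ?thesis unfolding kform_eq_squares by simp
  qed
  then have "(\<Sum>k<n. RR k) \<le> c0 * (2 * kform ?b n x)" unfolding eq by (rule mult_left_mono[OF _ c0])
  then show ?thesis by (simp add: c0_def cc_def mult_ac)
qed

lemma hh_integral:
  "(\<integral>\<^sup>+t. hh t * indicator {0<..<real n * \<tau>} t \<partial>lborel) \<le> ennreal (cc * \<tau> powr p * kform (coeff_b \<alpha>) n x)"
proof -
  let ?I = "\<lambda>k. {real k * \<tau><..<real (k + 1) * \<tau>}"
  have "AE t in lborel. \<forall>k\<in>{..n}. t \<noteq> real k * \<tau>" by (subst AE_ball_countable) (auto intro!: AE_lborel_singleton)
  then have "AE t in lborel. hh t * indicator {0<..<real n * \<tau>} t \<le> (\<Sum>k<n. hh t * indicator (?I k) t)"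
  proof (rule AE_mp, intro AE_I2 impI)
    fix t assume t: "\<forall>k\<in>{..n}. t \<noteq> real k * \<tau>"
    show "hh t * indicator {0<..<real n * \<tau>} t \<le> (\<Sum>k<n. hh t * indicator (?I k) t)"
    proof (cases "t \<in> {0<..<real n * \<tau>}")
      case True
      obtain k where k: "t \<in> cell k" using ex_cell[of t] True by auto
      have kn: "k < n" using cell_lt[OF k] True by simp
      have "t \<in> ?I k" using k t kn by (auto simp: cell_def order.strict_iff_order)
      then have "hh t * indicator {0<..<real n * \<tau>} t = hh t * indicator (?I k) t" using True by simp
      also have "\<dots> \<le> (\<Sum>k<n. hh t * indicator (?I k) t)"
        by (rule member_le_sum[of k "{..<n}" "\<lambda>k. hh t * indicator (?I k) t"]) (use kn in auto)
      finally show ?thesis .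
    qed simp
  qed
  then have "(\<integral>\<^sup>+t. hh t * indicator {0<..<real n * \<tau>} t \<partial>lborel) \<le> (\<integral>\<^sup>+t. (\<Sum>k<n. hh t * indicator (?I k) t) \<partial>lborel)"
    by (rule nn_integral_mono_AE)
  also have "\<dots> = (\<Sum>k<n. \<integral>\<^sup>+t. hh t * indicator (?I k) t \<partial>lborel)" by (intro nn_integral_sum) simp
  also have "\<dots> \<le> (\<Sum>k<n. ennreal (RR k))" by (intro sum_mono hh_cell_integral) auto
  also have "\<dots> = ennreal (\<Sum>k<n. RR k)" using RR_nonneg by (intro sum_ennreal) auto
  also have "\<dots> \<le> ennreal (cc * \<tau> powr p * kform (coeff_b \<alpha>) n x)" by (intro ennreal_leI sum_RR_le)
  finally show ?thesis .
qed

lemma shift_part: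
  "(\<integral>\<^sup>+s. ennreal (if 0 < s then s powr (- \<alpha>) * (stp (t + s) - stp t)^2 else 0) \<partial>lborel) = hh t"
proof -
  have "hh t = ennreal \<bar>1\<bar> * (\<integral>\<^sup>+s. ennreal (if t < t + 1 * s then (t + 1 * s - t) powr (- \<alpha>) * (stp (t + 1 * s) - stp t)^2 else 0) \<partial>lborel)"
    unfolding hh_def by (rule nn_integral_real_affine) auto
  then show ?thesis by (simp cong: if_cong)
qed

text \<open>Insert \<open>avg_error\<close> and exchange the integrals: for fixed u the variable s
  runs over s >= u - t with exponent - (\<alpha> + 1), which returns
  \<open>(u - t) powr (- \<alpha>)\<close> divided by \<alpha>.\<close>

lemma avg_part:
  "(\<integral>\<^sup>+s. ennreal (if 0 < s then s powr (- \<alpha>) * (avg s t - stp t)^2 else 0) \<partial>lborel) \<le> ennreal (1 / \<alpha>) * hh t"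
proof -
  have "(\<integral>\<^sup>+s. ennreal (if 0 < s then s powr (- \<alpha>) * (avg s t - stp t)^2 else 0) \<partial>lborel)
    \<le> (\<integral>\<^sup>+s. \<integral>\<^sup>+u. ennreal (if 0 < s \<and> t < u \<and> u \<le> t + s then s powr (- (\<alpha> + 1)) * (stp u - stp t)^2 else 0) \<partial>lborel \<partial>lborel)"
  proof (rule nn_integral_mono)
    fix s :: real
    show "ennreal (if 0 < s then s powr (- \<alpha>) * (avg s t - stp t)^2 else 0)
      \<le> (\<integral>\<^sup>+u. ennreal (if 0 < s \<and> t < u \<and> u \<le> t + s then s powr (- (\<alpha> + 1)) * (stp u - stp t)^2 else 0) \<partial>lborel)"
    proof (cases "0 < s")
      case True
      have pw: "s powr (- (\<alpha> + 1)) = s powr (- \<alpha>) / s" using True powr_add[of s "- \<alpha>" "- 1"] by (simp add: powr_minus field_simps)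
      have "ennreal (if 0 < s then s powr (- \<alpha>) * (avg s t - stp t)^2 else 0) = ennreal (s powr (- \<alpha>)) * ennreal ((avg s t - stp t)^2)"
        using True by (simp add: ennreal_mult)
      also have "\<dots> \<le> ennreal (s powr (- \<alpha>)) * (\<integral>\<^sup>+u. ennreal (if t \<le> u \<and> u \<le> t + s then (stp u - stp t)^2 / s else 0) \<partial>lborel)"
        by (intro mult_left_mono avg_error True) simp
      also have "\<dots> = (\<integral>\<^sup>+u. ennreal (s powr (- \<alpha>)) * ennreal (if t \<le> u \<and> u \<le> t + s then (stp u - stp t)^2 / s else 0) \<partial>lborel)"
        by (rule nn_integral_cmult[symmetric]) simp
      also have "\<dots> = (\<integral>\<^sup>+u. ennreal (if 0 < s \<and> t < u \<and> u \<le> t + s then s powr (- (\<alpha> + 1)) * (stp u - stp t)^2 else 0) \<partial>lborel)"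
        by (rule nn_integral_cong) (use True pw in \<open>auto simp: ennreal_mult[symmetric]\<close>)
      finally show ?thesis .
    qed simp
  qed
  also have "\<dots> = (\<integral>\<^sup>+u. \<integral>\<^sup>+s. ennreal (if 0 < s \<and> t < u \<and> u \<le> t + s then s powr (- (\<alpha> + 1)) * (stp u - stp t)^2 else 0) \<partial>lborel \<partial>lborel)"
    by (rule lborel_pair.Fubini') simp
  also have "\<dots> = (\<integral>\<^sup>+u. ennreal (1 / \<alpha>) * ennreal (if t < u then (u - t) powr (- \<alpha>) * (stp u - stp t)^2 else 0) \<partial>lborel)"
  proof (rule nn_integral_cong)
    fix u
    show "(\<integral>\<^sup>+s. ennreal (if 0 < s \<and> t < u \<and> u \<le> t + s then s powr (- (\<alpha> + 1)) * (stp u - stp t)^2 else 0) \<partial>lborel)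
      = ennreal (1 / \<alpha>) * ennreal (if t < u then (u - t) powr (- \<alpha>) * (stp u - stp t)^2 else 0)"
    proof (cases "t < u")
      case True
      have "(\<integral>\<^sup>+s. ennreal (if 0 < s \<and> t < u \<and> u \<le> t + s then s powr (- (\<alpha> + 1)) * (stp u - stp t)^2 else 0) \<partial>lborel)
        = (\<integral>\<^sup>+s. ennreal ((stp u - stp t)^2) * (ennreal ((s - 0) powr (- (\<alpha> + 1))) * indicator {u - t..} s) \<partial>lborel)"
        by (rule nn_integral_cong) (use True in \<open>auto simp: indicator_def ennreal_mult[symmetric] mult.commute\<close>)
      also have "\<dots> = ennreal ((stp u - stp t)^2) * (\<integral>\<^sup>+s. ennreal ((s - 0) powr (- (\<alpha> + 1))) * indicator {u - t..} s \<partial>lborel)"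
        by (rule nn_integral_cmult) simp
      also have "\<dots> = ennreal ((stp u - stp t)^2) * ennreal ((u - t - 0) powr (1 - (\<alpha> + 1)) / (\<alpha> + 1 - 1))"
        by (subst powr_tail) (use True \<alpha> in auto)
      finally show ?thesis using True \<alpha> by (simp add: ennreal_mult[symmetric] mult.commute)
    qed simp
  qed
  also have "\<dots> = ennreal (1 / \<alpha>) * hh t" unfolding hh_def by (rule nn_integral_cmult) simp
  finally show ?thesis .
qed

lemma avg_measurable [measurable]: "(\<lambda>(s, t). avg s t) \<in> borel_measurable (borel \<Otimes>\<^sub>M borel)" unfolding avg_def case_prod_beta by measurable

text \<open>The weight \<open>s powr (- \<alpha>)\<close> is the squared K-method weight of order
  \<open>(\<alpha> - 1) / 2\<close>, including ds/s, for the splitting of the step function into its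
  average over length s and the rest. The first square is the error of the average, the second is
  s^2 times the square of the derivative of the average.\<close>

lemma K_bound:
  "(\<integral>\<^sup>+s. \<integral>\<^sup>+t. ennreal (if 0 < s \<and> 0 < t \<and> t < real n * \<tau> then
       s powr (- \<alpha>) * ((avg s t - stp t)^2 + (stp (t + s) - stp t)^2) else 0) \<partial>lborel \<partial>lborel)
   \<le> ennreal ((1 + 1 / \<alpha>) * cc * \<tau> powr p * kform (coeff_b \<alpha>) n x)"
proof -
  let ?A = "\<lambda>s t. ennreal (if 0 < s then s powr (- \<alpha>) * (avg s t - stp t)^2 else 0)"
  let ?B = "\<lambda>s t. ennreal (if 0 < s then s powr (- \<alpha>) * (stp (t + s) - stp t)^2 else 0)"
  let ?T = "{0<..<real n * \<tau>}"
  have [measurable]: "(\<lambda>s. avg s t) \<in> borel_measurable borel" for t unfolding avg_def by measurable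
  have "(\<integral>\<^sup>+s. \<integral>\<^sup>+t. ennreal (if 0 < s \<and> 0 < t \<and> t < real n * \<tau> then
       s powr (- \<alpha>) * ((avg s t - stp t)^2 + (stp (t + s) - stp t)^2) else 0) \<partial>lborel \<partial>lborel)
    = (\<integral>\<^sup>+t. \<integral>\<^sup>+s. ennreal (if 0 < s \<and> 0 < t \<and> t < real n * \<tau> then
       s powr (- \<alpha>) * ((avg s t - stp t)^2 + (stp (t + s) - stp t)^2) else 0) \<partial>lborel \<partial>lborel)"
    by (rule lborel_pair.Fubini'[symmetric]) measurable
  also have "\<dots> = (\<integral>\<^sup>+t. (\<integral>\<^sup>+s. ?A s t + ?B s t \<partial>lborel) * indicator ?T t \<partial>lborel)"
  proof (rule nn_integral_cong)
    fix t
    show "(\<integral>\<^sup>+s. ennreal (if 0 < s \<and> 0 < t \<and> t < real n * \<tau> then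
       s powr (- \<alpha>) * ((avg s t - stp t)^2 + (stp (t + s) - stp t)^2) else 0) \<partial>lborel)
       = (\<integral>\<^sup>+s. ?A s t + ?B s t \<partial>lborel) * indicator ?T t"
      by (cases "t \<in> ?T") (auto simp: distrib_left ennreal_plus[symmetric] simp del: ennreal_plus intro!: nn_integral_cong)
  qed
  also have "\<dots> \<le> (\<integral>\<^sup>+t. ennreal (1 + 1 / \<alpha>) * (hh t * indicator ?T t) \<partial>lborel)"
  proof (rule nn_integral_mono)
    fix t
    have "(\<integral>\<^sup>+s. ?A s t + ?B s t \<partial>lborel) = (\<integral>\<^sup>+s. ?A s t \<partial>lborel) + (\<integral>\<^sup>+s. ?B s t \<partial>lborel)" by (rule nn_integral_add) measurable
    also have "\<dots> \<le> ennreal (1 / \<alpha>) * hh t + hh t" unfolding shift_part by (intro add_right_mono avg_part)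
    also have "\<dots> = ennreal (1 + 1 / \<alpha>) * hh t" using \<alpha> by (simp add: ennreal_plus distrib_right add.commute)
    finally show "(\<integral>\<^sup>+s. ?A s t + ?B s t \<partial>lborel) * indicator ?T t \<le> ennreal (1 + 1 / \<alpha>) * (hh t * indicator ?T t)" by (cases "t \<in> ?T") auto
  qed
  also have "\<dots> = ennreal (1 + 1 / \<alpha>) * (\<integral>\<^sup>+t. hh t * indicator ?T t \<partial>lborel)" by (rule nn_integral_cmult) simp
  also have "\<dots> \<le> ennreal (1 + 1 / \<alpha>) * ennreal (cc * \<tau> powr p * kform (coeff_b \<alpha>) n x)" by (intro mult_left_mono hh_integral) simp
  also have "\<dots> = ennreal ((1 + 1 / \<alpha>) * cc * \<tau> powr p * kform (coeff_b \<alpha>) n x)"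
    by (subst ennreal_mult'[symmetric]) (use \<alpha> in \<open>simp_all add: mult.assoc\<close>)
  finally show ?thesis .
qed

end

section \<open>Bochner integrals\<close>

lemma borel_measurable_AE_LIMSEQ:
  fixes f :: "nat \<Rightarrow> 'a::euclidean_space \<Rightarrow> real"
  assumes S: "S \<in> sets lebesgue" and f: "\<And>n. f n \<in> borel_measurable (lebesgue_on S)"
    and lim: "AE t in lebesgue_on S. (\<lambda>n. f n t) \<longlonglongrightarrow> g t"
  shows "g \<in> borel_measurable (lebesgue_on S)"
proof -
  have S': "S \<inter> space lebesgue \<in> sets lebesgue" using S by simp
  have "(\<lambda>t. lim (\<lambda>n. f n t)) \<in> borel_measurable (lebesgue_on S)" using f by (rule borel_measurable_lim_metric)
  then have 1: "(\<lambda>t. indicator S t *\<^sub>R lim (\<lambda>n. f n t)) \<in> borel_measurable lebesgue"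
    by (subst (asm) borel_measurable_restrict_space_iff[OF S'])
  have "AE t in lebesgue. indicator S t *\<^sub>R lim (\<lambda>n. f n t) = indicator S t *\<^sub>R g t" using lim unfolding AE_restrict_space_iff[OF S']
    by eventually_elim (auto simp: indicator_def limI)
  then have "(\<lambda>t. indicator S t *\<^sub>R g t) \<in> borel_measurable lebesgue" by (rule borel_measurable_AE[OF 1])
  then show ?thesis by (subst borel_measurable_restrict_space_iff[OF S'])
qed

text \<open>The values are real functions, which covers functionals as well as functions on
  \<Omega>; equalities between integrals of simple functions can then be checked by evaluation at
  points, as in \<open>simple_int_diff\<close>.\<close>

locale bochner_space = seminormed_space V N
  for V :: "('c \<Rightarrow> real) set" and N :: "('c \<Rightarrow> real) \<Rightarrow> real" +
  fixes S :: "real set"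
  assumes S: "S \<in> sets lebesgue"
begin

abbreviation "M \<equiv> lebesgue_on S"

lemma S_Int: "S \<inter> space lebesgue \<in> sets lebesgue" using S by simp

lemma sets_M: "A \<in> sets M \<longleftrightarrow> A \<subseteq> S \<and> A \<in> sets lebesgue" using S by (simp add: sets_restrict_space_iff)

lemma simple_into_iff:
  "simple_into W S s \<longleftrightarrow> simple_function M s \<and> s ` S \<subseteq> W \<and> emeasure lebesgue {t\<in>S. s t \<noteq> 0} < \<infinity>"
proof -
  have e: "s -` {x} \<inter> S = {t\<in>S. s t = x}" for x by auto
  have "(\<forall>x. {t\<in>S. s t = x} \<in> sets lebesgue) \<longleftrightarrow> (\<forall>x\<in>s ` S. {t\<in>S. s t = x} \<in> sets lebesgue)"
  proof
    assume *: "\<forall>x\<in>s ` S. {t\<in>S. s t = x} \<in> sets lebesgue"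
    show "\<forall>x. {t\<in>S. s t = x} \<in> sets lebesgue"
    proof
      fix x show "{t\<in>S. s t = x} \<in> sets lebesgue"
      proof (cases "x \<in> s ` S")
        case False
        then have "{t\<in>S. s t = x} = {}" by auto
        then show ?thesis by (simp only: sets.empty_sets)
      qed (use * in auto)
    qed
  qed auto
  then show ?thesis unfolding simple_into_def simple_function_def by (auto simp: e sets_M)
qed

lemma simple_nonzero_sets: "simple_function M s \<Longrightarrow> {t\<in>S. s t \<noteq> z} \<in> sets lebesgue"
proof -
  assume s: "simple_function M s"
  have "s -` (- {z}) \<inter> space M \<in> sets M" using simple_functionD(2)[OF s] .
  moreover have "s -` (- {z}) \<inter> space M = {t\<in>S. s t \<noteq> z}" by auto
  ultimately show ?thesis by (simp add: sets_M)
qed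

lemma simple_into_mult:
  assumes s: "simple_into V S s" and f: "simple_function M f"
    and H: "\<And>y. H 0 y = 0" "\<And>x y. x \<in> V \<Longrightarrow> H x y \<in> V"
  shows "simple_into V S (\<lambda>t. H (s t) (f t))"
proof -
  have sf: "simple_function M (\<lambda>t. H (s t) (f t))" using s f unfolding simple_into_iff by (auto intro: simple_function_compose2[of M s f H])
  have "emeasure lebesgue {t\<in>S. H (s t) (f t) \<noteq> 0} \<le> emeasure lebesgue {t\<in>S. s t \<noteq> 0}"
    using s unfolding simple_into_iff by (intro emeasure_mono simple_nonzero_sets) (auto simp: H(1))
  then show ?thesis using s sf H(2) unfolding simple_into_iff by (auto simp: image_subset_iff)
qed

lemma simple_into_add:
  assumes s: "simple_into V S s" "simple_into V S r"
  shows "simple_into V S (\<lambda>t. s t + r t)"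
proof -
  have sf: "simple_function M (\<lambda>t. s t + r t)" using s unfolding simple_into_iff by (auto intro: simple_function_compose2[of M s r "(+)"])
  have "emeasure lebesgue {t\<in>S. s t + r t \<noteq> 0} \<le> emeasure lebesgue ({t\<in>S. s t \<noteq> 0} \<union> {t\<in>S. r t \<noteq> 0})"
    using s unfolding simple_into_iff by (intro emeasure_mono sets.Un simple_nonzero_sets) auto
  also have "\<dots> \<le> emeasure lebesgue {t\<in>S. s t \<noteq> 0} + emeasure lebesgue {t\<in>S. r t \<noteq> 0}"
    using s unfolding simple_into_iff by (intro emeasure_subadditive simple_nonzero_sets) auto
  also have "\<dots> < \<infinity>" using s unfolding simple_into_iff by (auto simp: ennreal_add_less_top)
  finally show ?thesis using s sf unfolding simple_into_iff by (auto simp: image_subset_iff add_mem)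
qed

lemma simple_into_scale: "simple_into V S s \<Longrightarrow> simple_into V S (\<lambda>t. c *\<^sub>R s t)"
  by (rule simple_into_mult[where H = "\<lambda>x y. c *\<^sub>R x" and f = "\<lambda>_. 0::real"]) (auto simp: scale_mem)

lemma simple_into_diff: "simple_into V S s \<Longrightarrow> simple_into V S r \<Longrightarrow> simple_into V S (\<lambda>t. s t - r t)"
  using simple_into_add[of s "\<lambda>t. (-1) *\<^sub>R r t"] simple_into_scale[of r "-1"] by simp

lemma simple_into_in: "simple_into V S s \<Longrightarrow> t \<in> S \<Longrightarrow> s t \<in> V" by (auto simp: simple_into_def)

lemma simple_into_measurable: "simple_into V S s \<Longrightarrow> (\<lambda>t. h (s t)) \<in> borel_measurable M" for h :: "_ \<Rightarrow> real" unfolding simple_into_iff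
  by (rule borel_measurable_simple_function) (auto intro: simple_function_compose1[of M s h])

definition "simple_int s = (\<Sum>x\<in>s ` S. measure lebesgue {t\<in>S. s t = x} *\<^sub>R x)"

text \<open>One statement for norms, evaluations and linear functionals alike. The condition
  \<open>h 0 = 0\<close> discards the set where \<open>s\<close> vanishes, which may have infinite
  measure.\<close>

lemma simple_has_integral:
  fixes h :: "('c \<Rightarrow> real) \<Rightarrow> real"
  assumes s: "simple_into V S s" and h: "h 0 = 0"
  shows "has_bochner_integral M (\<lambda>t. h (s t)) (\<Sum>x\<in>s ` S. measure lebesgue {t\<in>S. s t = x} * h x)"
proof -
  have fin: "finite (s ` S)" and sets: "\<And>x. {t\<in>S. s t = x} \<in> sets lebesgue" using s by (auto simp: simple_into_def)
  have "has_bochner_integral M (\<lambda>t. indicator {t\<in>S. s t = x} t * h x) (measure lebesgue {t\<in>S. s t = x} * h x)" if "x \<in> s ` S" for x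
  proof (cases "x = 0")
    case True then show ?thesis by (simp add: h has_bochner_integral_zero)
  next
    case False
    have "emeasure lebesgue {t\<in>S. s t = x} \<le> emeasure lebesgue {t\<in>S. s t \<noteq> 0}"
      using False s by (intro emeasure_mono simple_nonzero_sets) (auto simp: simple_into_iff)
    then have fin: "emeasure lebesgue {t\<in>S. s t = x} < \<infinity>" using s by (auto simp: simple_into_def)
    have "emeasure M {t\<in>S. s t = x} = emeasure lebesgue {t\<in>S. s t = x}" "measure M {t\<in>S. s t = x} = measure lebesgue {t\<in>S. s t = x}"
      using S_Int by (auto intro!: emeasure_restrict_space measure_restrict_space)
    then have "has_bochner_integral M (indicator {t\<in>S. s t = x} :: real \<Rightarrow> real) (measure lebesgue {t\<in>S. s t = x})"
      using has_bochner_integral_real_indicator[of "{t\<in>S. s t = x}" M] fin sets by (simp add: sets_M)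
    then show ?thesis by (rule has_bochner_integral_mult_left)
  qed
  then have "has_bochner_integral M (\<lambda>t. \<Sum>x\<in>s ` S. indicator {t\<in>S. s t = x} t * h x) (\<Sum>x\<in>s ` S. measure lebesgue {t\<in>S. s t = x} * h x)"
    by (rule has_bochner_integral_sum)
  moreover have "(\<Sum>x\<in>s ` S. indicator {t\<in>S. s t = x} t * h x) = h (s t)" if "t \<in> space M" for t
  proof -
    have "(\<Sum>x\<in>s ` S. indicator {t\<in>S. s t = x} t * h x) = (\<Sum>x\<in>s ` S. if x = s t then h x else 0)"
      using that by (intro sum.cong) (auto simp: indicator_def)
    then show ?thesis using that fin by simp
  qed
  ultimately show ?thesis by (rule iffD1[OF has_bochner_integral_cong[OF refl _ refl], rotated])
qed

lemma simple_int_in: "simple_into V S s \<Longrightarrow> simple_int s \<in> V"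
  unfolding simple_int_def by (intro sum_mem scale_mem) (auto simp: simple_into_def)

lemma simple_int_apply: "simple_into V S s \<Longrightarrow> has_bochner_integral M (\<lambda>t. s t c) (simple_int s c)" using simple_has_integral[of s "\<lambda>x. x c"]
proof -
  have "(\<Sum>x\<in>A. f x *\<^sub>R x) c = (\<Sum>x\<in>A. f x * x c)" for A and f :: "('c \<Rightarrow> real) \<Rightarrow> real"
    by (induction A rule: infinite_finite_induct) (auto simp: scaleR_fun_def)
  then show "simple_into V S s \<Longrightarrow> ?thesis" using simple_has_integral[of s "\<lambda>x. x c"] by (simp add: simple_int_def)
qed

lemma simple_int_linear:
  fixes l :: "('c \<Rightarrow> real) \<Rightarrow> real"
  assumes s: "simple_into V S s" and add: "\<And>u v. u \<in> V \<Longrightarrow> v \<in> V \<Longrightarrow> l (u + v) = l u + l v"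
    and sc: "\<And>c u. u \<in> V \<Longrightarrow> l (c *\<^sub>R u) = c * l u"
  shows "has_bochner_integral M (\<lambda>t. l (s t)) (l (simple_int s))"
proof -
  have l0: "l 0 = 0" using sc[OF zero_mem, of 0] by simp
  have "l (\<Sum>x\<in>A. f x *\<^sub>R x) = (\<Sum>x\<in>A. f x * l x)" if "A \<subseteq> V" for A and f :: "('c \<Rightarrow> real) \<Rightarrow> real" using that
  proof (induction A rule: infinite_finite_induct)
    case (insert a A)
    then have "l (f a *\<^sub>R a + (\<Sum>x\<in>A. f x *\<^sub>R x)) = f a * l a + l (\<Sum>x\<in>A. f x *\<^sub>R x)" by (subst add) (auto simp: sc intro!: scale_mem sum_mem)
    moreover have "(\<Sum>x\<in>insert a A. f x *\<^sub>R x) = f a *\<^sub>R a + (\<Sum>x\<in>A. f x *\<^sub>R x)" by (rule sum.insert) (use insert in auto)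
    moreover have "(\<Sum>x\<in>insert a A. f x * l x) = f a * l a + (\<Sum>x\<in>A. f x * l x)" by (rule sum.insert) (use insert in auto)
    ultimately show ?case using insert by (simp only: insert_subset)
  qed (auto simp: l0)
  then show ?thesis using simple_has_integral[of s l] s l0 by (simp add: simple_int_def simple_into_def)
qed

lemma simple_int_diff:
  assumes "simple_into V S s" "simple_into V S r"
  shows "simple_int (\<lambda>t. s t - r t) = simple_int s - simple_int r"
proof
  fix c
  have "has_bochner_integral M (\<lambda>t. s t c - r t c) (simple_int s c - simple_int r c)"
    using assms by (intro has_bochner_integral_diff simple_int_apply)
  moreover have "has_bochner_integral M (\<lambda>t. s t c - r t c) (simple_int (\<lambda>t. s t - r t) c)"
    using simple_int_apply[OF simple_into_diff[OF assms], of c] by simp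
  ultimately have "simple_int s c - simple_int r c = simple_int (\<lambda>t. s t - r t) c" by (rule has_bochner_integral_eq)
  then show "simple_int (\<lambda>t. s t - r t) c = (simple_int s - simple_int r) c" by simp
qed

lemma simple_int_norm:
  assumes s: "simple_into V S s"
  shows "ennreal (N (simple_int s)) \<le> (\<integral>\<^sup>+t. ennreal (N (s t)) \<partial>M)"
proof -
  have "N (simple_int s) \<le> (\<Sum>x\<in>s ` S. N (measure lebesgue {t\<in>S. s t = x} *\<^sub>R x))"
    unfolding simple_int_def using s by (intro N_sum_le scale_mem) (auto simp: simple_into_def)
  also have "\<dots> = (\<Sum>x\<in>s ` S. measure lebesgue {t\<in>S. s t = x} * N x)" using s by (intro sum.cong) (auto simp: simple_into_def N_scale)
  also have "\<dots> = integral\<^sup>L M (\<lambda>t. N (s t))" using simple_has_integral[OF s, of N] N_zero by (simp add: has_bochner_integral_integral_eq)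
  also have "ennreal \<dots> = (\<integral>\<^sup>+t. ennreal (N (s t)) \<partial>M)" using simple_has_integral[OF s, of N] N_zero s
    by (intro nn_integral_eq_integral[symmetric] AE_I2) (auto simp: has_bochner_integral_iff simple_into_in N_nonneg)
  finally show ?thesis by (simp add: ennreal_leI)
qed

lemma smeas_in: "strongly_measurable V N S w \<Longrightarrow> t \<in> S \<Longrightarrow> w t \<in> V" by (simp add: strongly_measurable_def)

lemma smeas_lipschitz:
  fixes h :: "('c \<Rightarrow> real) \<Rightarrow> real"
  assumes w: "strongly_measurable V N S w"
    and h: "\<And>u v. u \<in> V \<Longrightarrow> v \<in> V \<Longrightarrow> \<bar>h u - h v\<bar> \<le> C * N (u - v)"
  shows "(\<lambda>t. h (w t)) \<in> borel_measurable M"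
proof -
  obtain s where s: "\<And>n. simple_into V S (s n)" "AE t in M. (\<lambda>n. N (s n t - w t)) \<longlonglongrightarrow> 0" using w unfolding strongly_measurable_def by auto
  have "AE t in M. (\<lambda>n. h (s n t)) \<longlonglongrightarrow> h (w t)" using s(2) AE_space
  proof eventually_elim
    case (elim t)
    have "(\<lambda>n. C * N (s n t - w t)) \<longlonglongrightarrow> 0" using tendsto_mult_left[OF elim(1), of C] by simp
    then have "(\<lambda>n. h (s n t) - h (w t)) \<longlonglongrightarrow> 0" by (rule Lim_null_comparison[rotated])
        (use elim s w in \<open>auto intro!: always_eventually h simp: simple_into_in smeas_in\<close>)
    then show ?case by (simp add: LIM_zero_iff)
  qed
  then show ?thesis by (rule borel_measurable_AE_LIMSEQ[OF S simple_into_measurable[OF s(1)]])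
qed

lemma smeas_norm: "strongly_measurable V N S w \<Longrightarrow> (\<lambda>t. N (w t)) \<in> borel_measurable M"
  by (rule smeas_lipschitz[where C = 1]) (auto simp: N_abs_diff)

lemma smeas_linear:
  fixes l :: "('c \<Rightarrow> real) \<Rightarrow> real"
  assumes w: "strongly_measurable V N S w" and add: "\<And>u v. u \<in> V \<Longrightarrow> v \<in> V \<Longrightarrow> l (u + v) = l u + l v"
    and b: "\<And>u. u \<in> V \<Longrightarrow> \<bar>l u\<bar> \<le> C * N u"
  shows "(\<lambda>t. l (w t)) \<in> borel_measurable M"
proof (rule smeas_lipschitz[OF w])
  fix u v assume uv: "u \<in> V" "v \<in> V"
  have "l u - l v = l (u - v)" using add[of "u - v" v] uv by (simp add: diff_mem)
  then show "\<bar>l u - l v\<bar> \<le> C * N (u - v)" using b[OF diff_mem[OF uv]] by simp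
qed

lemma smeas_add:
  assumes w: "strongly_measurable V N S w" "strongly_measurable V N S v"
  shows "strongly_measurable V N S (\<lambda>t. w t + v t)"
proof -
  obtain s where s: "\<And>n. simple_into V S (s n)" "AE t in M. (\<lambda>n. N (s n t - w t)) \<longlonglongrightarrow> 0" using w(1) unfolding strongly_measurable_def by auto
  obtain r where r: "\<And>n. simple_into V S (r n)" "AE t in M. (\<lambda>n. N (r n t - v t)) \<longlonglongrightarrow> 0" using w(2) unfolding strongly_measurable_def by auto
  have "AE t in M. (\<lambda>n. N ((s n t + r n t) - (w t + v t))) \<longlonglongrightarrow> 0" using s(2) r(2) AE_space
  proof eventually_elim
    case (elim t)
    have mem: "s n t \<in> V" "r n t \<in> V" "w t \<in> V" "v t \<in> V" for n using elim s r w by (auto simp: simple_into_in smeas_in)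
    have l0: "(\<lambda>n. N (s n t - w t) + N (r n t - v t)) \<longlonglongrightarrow> 0" using tendsto_add[OF elim(1,2)] by simp
    show ?case
    proof (rule tendsto_sandwich[OF _ _ tendsto_const l0])
      have "N ((s n t + r n t) - (w t + v t)) \<le> N (s n t - w t) + N (r n t - v t)" for n
        using N_triangle[of "s n t - w t" "r n t - v t"] mem by (simp add: diff_mem algebra_simps)
      then show "\<forall>\<^sub>F n in sequentially. N ((s n t + r n t) - (w t + v t)) \<le> N (s n t - w t) + N (r n t - v t)" by simp
    qed (auto intro!: always_eventually N_nonneg diff_mem add_mem mem)
  qed
  then show ?thesis unfolding strongly_measurable_def
    using w s(1) r(1) by (auto intro!: add_mem exI[of _ "\<lambda>n t. s n t + r n t"] simple_into_add simp: smeas_in)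
qed

lemma smeas_mult:
  assumes w: "strongly_measurable V N S w" and f: "f \<in> borel_measurable M"
  shows "strongly_measurable V N S (\<lambda>t. f t *\<^sub>R w t)"
proof -
  obtain s where s: "\<And>n. simple_into V S (s n)" "AE t in M. (\<lambda>n. N (s n t - w t)) \<longlonglongrightarrow> 0" using w(1) unfolding strongly_measurable_def by auto
  obtain F where F: "\<And>i. simple_function M (F i)" "\<And>t. t \<in> space M \<Longrightarrow> (\<lambda>i. F i t) \<longlonglongrightarrow> f t"
    using borel_measurable_implies_sequence_metric[OF f, of 0] by blast
  have "AE t in M. (\<lambda>n. N (F n t *\<^sub>R s n t - f t *\<^sub>R w t)) \<longlonglongrightarrow> 0" using s(2) AE_space
  proof eventually_elim
    case (elim t)
    have mem: "s n t \<in> V" "w t \<in> V" for n using elim s w by (auto simp: simple_into_in smeas_in)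
    have "(\<lambda>n. \<bar>F n t\<bar> * N (s n t - w t) + \<bar>F n t - f t\<bar> * N (w t)) \<longlonglongrightarrow> \<bar>f t\<bar> * 0 + \<bar>f t - f t\<bar> * N (w t)"
      using elim by (intro tendsto_intros F) auto
    then have l0: "(\<lambda>n. \<bar>F n t\<bar> * N (s n t - w t) + \<bar>F n t - f t\<bar> * N (w t)) \<longlonglongrightarrow> 0" by simp
    show ?case
    proof (rule tendsto_sandwich[OF _ _ tendsto_const l0])
      have "N (F n t *\<^sub>R s n t - f t *\<^sub>R w t) \<le> \<bar>F n t\<bar> * N (s n t - w t) + \<bar>F n t - f t\<bar> * N (w t)" for n
      proof -
        have "F n t *\<^sub>R s n t - f t *\<^sub>R w t = F n t *\<^sub>R (s n t - w t) + (F n t - f t) *\<^sub>R w t" by (simp add: algebra_simps)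
        then show ?thesis using N_triangle[of "F n t *\<^sub>R (s n t - w t)" "(F n t - f t) *\<^sub>R w t"] mem
          by (simp add: diff_mem scale_mem N_scale)
      qed
      then show "\<forall>\<^sub>F n in sequentially. N (F n t *\<^sub>R s n t - f t *\<^sub>R w t) \<le> \<bar>F n t\<bar> * N (s n t - w t) + \<bar>F n t - f t\<bar> * N (w t)" by simp
    qed (auto intro!: always_eventually N_nonneg diff_mem scale_mem mem)
  qed
  moreover have "simple_into V S (\<lambda>t. F n t *\<^sub>R s n t)" for n
    by (rule simple_into_mult[OF s(1) F(1), where H = "\<lambda>x y. y *\<^sub>R x"]) (auto simp: scale_mem)
  ultimately show ?thesis unfolding strongly_measurable_def
    using w by (auto intro!: scale_mem exI[of _ "\<lambda>n t. F n t *\<^sub>R s n t"] simp: smeas_in)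
qed

lemma smeas_scale: "strongly_measurable V N S w \<Longrightarrow> strongly_measurable V N S (\<lambda>t. c *\<^sub>R w t)" by (rule smeas_mult) auto

lemma smeas_diff: "strongly_measurable V N S w \<Longrightarrow> strongly_measurable V N S v \<Longrightarrow> strongly_measurable V N S (\<lambda>t. w t - v t)"
  using smeas_add[of w "\<lambda>t. (-1) *\<^sub>R v t"] smeas_scale[of v "-1"] by simp

text \<open>Simple functions must vanish off a set of finite measure, so on an unbounded
  \<open>S\<close> the constant is approximated by its truncations to
  \<open>{- real n..real n}\<close>.\<close>

lemma smeas_const: assumes g: "g \<in> V" shows "strongly_measurable V N S (\<lambda>t. g)"
proof -
  define A where "A n = S \<inter> {- real n..real n}" for n
  have A: "A n \<in> sets M" for n unfolding A_def sets_M using S by auto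
  have "simple_into V S (\<lambda>t. indicator (A n) t *\<^sub>R g)" for n unfolding simple_into_iff
  proof (intro conjI)
    have "simple_function M (indicator (A n) :: real \<Rightarrow> real)" using A by (rule simple_function_indicator)
    then show "simple_function M (\<lambda>t. indicator (A n) t *\<^sub>R g)" by (rule simple_function_compose1[of M _ "\<lambda>c. c *\<^sub>R g"])
    show "(\<lambda>t. indicat_real (A n) t *\<^sub>R g) ` S \<subseteq> V" using g by (auto intro!: scale_mem)
    have "emeasure lebesgue {t\<in>S. indicat_real (A n) t *\<^sub>R g \<noteq> 0} \<le> emeasure lebesgue {- real n..real n}"
      by (rule emeasure_mono) (auto simp: A_def indicator_def split: if_splits)
    then show "emeasure lebesgue {t\<in>S. indicat_real (A n) t *\<^sub>R g \<noteq> 0} < \<infinity>" by (rule order_le_less_trans) simp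
  qed
  moreover have "(\<lambda>n. N (indicator (A n) t *\<^sub>R g - g)) \<longlonglongrightarrow> 0" if "t \<in> S" for t
  proof (rule tendsto_eventually)
    obtain m where m: "\<bar>t\<bar> \<le> real m" using real_arch_simple by blast
    show "\<forall>\<^sub>F n in sequentially. N (indicator (A n) t *\<^sub>R g - g) = 0" using eventually_ge_at_top[of m]
    proof eventually_elim
      case (elim n)
      then have "real m \<le> real n" by simp
      then have "t \<in> A n" using m that by (auto simp: A_def abs_le_iff)
      then show ?case by (simp add: N_zero)
    qed
  qed
  ultimately show ?thesis unfolding strongly_measurable_def using g by (auto intro!: exI[of _ "\<lambda>n t. indicator (A n) t *\<^sub>R g"] AE_I2)
qed

lemma smeas_sum: "(\<And>i. i \<in> I \<Longrightarrow> strongly_measurable V N S (w i)) \<Longrightarrow> strongly_measurable V N S (\<lambda>t. \<Sum>i\<in>I. w i t)"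
  by (induction I rule: infinite_finite_induct) (auto intro: smeas_const[OF zero_mem] smeas_add)

text \<open>The pointwise approximants are set to zero where their norm exceeds
  \<open>2 * N (w t)\<close>. This keeps the convergence and supplies the dominating function
  \<open>3 * N (w t)\<close>. Where \<open>N (w t) = 0\<close> the truncated values have norm zero
  themselves.\<close>

lemma approx_L1:
  assumes w: "strongly_measurable V N S w" and fin: "(\<integral>\<^sup>+t. ennreal (N (w t)) \<partial>M) < \<infinity>"
  shows "\<exists>s. (\<forall>n. simple_into V S (s n)) \<and> (\<lambda>n::nat. \<integral>\<^sup>+t. ennreal (N (s n t - w t)) \<partial>M) \<longlonglongrightarrow> 0"
proof -
  obtain s where s: "\<And>n. simple_into V S (s n)" "AE t in M. (\<lambda>n. N (s n t - w t)) \<longlonglongrightarrow> 0" using w unfolding strongly_measurable_def by auto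
  define A where "A n = {t\<in>S. N (s n t) \<le> 2 * N (w t)}" for n
  define r where "r n t = indicator (A n) t *\<^sub>R s n t" for n t
  have A: "A n \<in> sets M" for n
  proof -
    have [measurable]: "(\<lambda>t. N (s n t)) \<in> borel_measurable M" "(\<lambda>t. N (w t)) \<in> borel_measurable M"
      by (rule simple_into_measurable[OF s(1)], rule smeas_norm[OF w])
    have "{t\<in>space M. N (s n t) \<le> 2 * N (w t)} \<in> sets M" by measurable
    then show ?thesis by (simp add: A_def)
  qed
  have rs: "simple_into V S (r n)" for n unfolding r_def
    by (rule simple_into_mult[OF s(1) simple_function_indicator[OF A], where H = "\<lambda>x y. y *\<^sub>R x"]) (auto simp: scale_mem)
  have "(\<lambda>n. \<integral>\<^sup>+t. ennreal (N (r n t - w t)) \<partial>M) \<longlonglongrightarrow> (\<integral>\<^sup>+t. ennreal 0 \<partial>M)"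
  proof (rule nn_integral_dominated_convergence[where w = "\<lambda>t. ennreal (3 * N (w t))"])
    fix n
    have "strongly_measurable V N S (r n)" unfolding strongly_measurable_def
      using rs[of n] by (auto intro!: exI[of _ "\<lambda>_. r n"] simp: simple_into_in N_zero)
    then show "(\<lambda>t. ennreal (N (r n t - w t))) \<in> borel_measurable M" using smeas_norm[OF smeas_diff[OF _ w]] by measurable
    show "AE t in M. ennreal (N (r n t - w t)) \<le> ennreal (3 * N (w t))"
    proof (rule AE_I2, rule ennreal_leI)
      fix t assume t: "t \<in> space M"
      have mem: "s n t \<in> V" "w t \<in> V" using t s w by (auto simp: simple_into_in smeas_in)
      show "N (r n t - w t) \<le> 3 * N (w t)"
      proof (cases "t \<in> A n")
        case True
        then show ?thesis using N_diff_le[OF mem] by (auto simp: r_def A_def)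
      next
        case False
        then show ?thesis using N_minus[OF mem(2)] N_nonneg[OF mem(2)] by (simp add: r_def)
      qed
    qed
  next
    show "(\<lambda>t. ennreal (3 * N (w t))) \<in> borel_measurable M" using smeas_norm[OF w] by measurable
    have "(\<integral>\<^sup>+t. ennreal (3 * N (w t)) \<partial>M) = (\<integral>\<^sup>+t. ennreal 3 * ennreal (N (w t)) \<partial>M)" by (intro nn_integral_cong) (simp add: ennreal_mult')
    also have "\<dots> = 3 * (\<integral>\<^sup>+t. ennreal (N (w t)) \<partial>M)" using smeas_norm[OF w] by (subst nn_integral_cmult) auto
    finally show "(\<integral>\<^sup>+t. ennreal (3 * N (w t)) \<partial>M) < \<infinity>" using fin by (simp add: ennreal_mult_less_top)
    show "AE t in M. (\<lambda>n. ennreal (N (r n t - w t))) \<longlonglongrightarrow> ennreal 0" using s(2) AE_space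
    proof eventually_elim
      case (elim t)
      have mem: "s n t \<in> V" "w t \<in> V" for n using elim s w by (auto simp: simple_into_in smeas_in)
      have "(\<lambda>n. N (r n t - w t)) \<longlonglongrightarrow> 0"
      proof (cases "N (w t) = 0")
        case True
        have "N (r n t - w t) = 0" for n
        proof (cases "t \<in> A n")
          case inA: True
          then show ?thesis using N_diff_le[OF mem, of n] N_nonneg[OF diff_mem[OF mem], of n] True by (auto simp: r_def A_def)
        next
          case False
          then show ?thesis using N_minus[OF mem(2)] True by (simp add: r_def)
        qed
        then show ?thesis by simp
      next
        case False
        then have p: "N (w t) > 0" using N_nonneg[OF mem(2)] by simp
        have "\<forall>\<^sub>F n in sequentially. N (s n t - w t) = N (r n t - w t)" using order_tendstoD(2)[OF elim(1) p]
        proof eventually_elim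
          case (elim n)
          then have "N (s n t) \<le> 2 * N (w t)" using N_abs_diff[OF mem, of n] by linarith
          then show ?case using \<open>t \<in> space M\<close> by (simp add: r_def A_def)
        qed
        then show ?thesis using elim(1) by (rule Lim_transform_eventually[rotated])
      qed
      then show ?case by (rule tendsto_ennrealI)
    qed
  qed auto
  then show ?thesis using rs by auto
qed

text \<open>The integrals of the simple approximants form a Cauchy sequence. Completeness is a
  premise because it has a different proof in each use: pointwise limits in a dual space,
  Riesz-Fischer in L2.\<close>

lemma has_integral_exists:
  assumes complete: "\<And>f. (\<And>n. f n \<in> V) \<Longrightarrow> (\<And>e. e > 0 \<Longrightarrow> \<exists>K::nat. \<forall>m\<ge>K. \<forall>n\<ge>K. N (f m - f n) < e) \<Longrightarrow>
      \<exists>y\<in>V. (\<lambda>n. N (f n - y)) \<longlonglongrightarrow> 0"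
    and w: "strongly_measurable V N S w" and fin: "(\<integral>\<^sup>+t. ennreal (N (w t)) \<partial>M) < \<infinity>"
  shows "\<exists>y. has_integral_into V N S w y"
proof -
  obtain s where s: "\<And>n. simple_into V S (s n)" and lim: "(\<lambda>n. \<integral>\<^sup>+t. ennreal (N (s n t - w t)) \<partial>M) \<longlonglongrightarrow> 0" using approx_L1[OF w fin] by auto
  have sm: "strongly_measurable V N S (s n)" for n unfolding strongly_measurable_def
    using s[of n] by (auto intro!: exI[of _ "\<lambda>_. s n"] simp: simple_into_in N_zero)
  have "\<exists>y\<in>V. (\<lambda>n. N (simple_int (s n) - y)) \<longlonglongrightarrow> 0"
  proof (rule complete)
    show "simple_int (s n) \<in> V" for n by (rule simple_int_in[OF s])
    fix e :: real assume e: "e > 0"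
    have "\<forall>\<^sub>F n in sequentially. (\<integral>\<^sup>+t. ennreal (N (s n t - w t)) \<partial>M) < ennreal (e / 2)" using lim e by (intro order_tendstoD) auto
    then obtain K where K: "\<And>n. n \<ge> K \<Longrightarrow> (\<integral>\<^sup>+t. ennreal (N (s n t - w t)) \<partial>M) < ennreal (e / 2)" by (auto simp: eventually_sequentially)
    show "\<exists>K. \<forall>m\<ge>K. \<forall>n\<ge>K. N (simple_int (s m) - simple_int (s n)) < e"
    proof (intro exI[of _ K] allI impI)
      fix m n assume mn: "m \<ge> K" "n \<ge> K"
      have "ennreal (N (simple_int (s m) - simple_int (s n))) \<le> (\<integral>\<^sup>+t. ennreal (N (s m t - s n t)) \<partial>M)"
        using simple_int_norm[OF simple_into_diff[OF s s]] by (simp add: simple_int_diff s)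
      also have "\<dots> \<le> (\<integral>\<^sup>+t. ennreal (N (s m t - w t)) + ennreal (N (s n t - w t)) \<partial>M)"
      proof (rule nn_integral_mono)
        fix t assume t: "t \<in> space M"
        have mem: "s n t \<in> V" "w t \<in> V" for n using t s w by (auto simp: simple_into_in smeas_in)
        have "N (s m t - s n t) \<le> N (s m t - w t) + N (s n t - w t)"
          using N_diff_triangle[of "s m t" "w t" "s n t"] mem N_diff_comm[of "w t" "s n t"] by simp
        then show "ennreal (N (s m t - s n t)) \<le> ennreal (N (s m t - w t)) + ennreal (N (s n t - w t))"
          using mem by (subst ennreal_plus[symmetric]) (auto intro!: ennreal_leI N_nonneg diff_mem)
      qed
      also have "\<dots> = (\<integral>\<^sup>+t. ennreal (N (s m t - w t)) \<partial>M) + (\<integral>\<^sup>+t. ennreal (N (s n t - w t)) \<partial>M)"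
        using smeas_norm[OF smeas_diff[OF sm w]] by (intro nn_integral_add) auto
      also have "\<dots> < ennreal (e / 2) + ennreal (e / 2)" using K[OF mn(1)] K[OF mn(2)] by (rule add_strict_mono)
      also have "\<dots> = ennreal e" using e by (simp flip: ennreal_plus)
      finally show "N (simple_int (s m) - simple_int (s n)) < e" using e by (simp add: ennreal_less_iff N_nonneg diff_mem simple_int_in s)
    qed
  qed
  then show ?thesis unfolding has_integral_into_def simple_int_def using w s lim by blast
qed

text \<open>Bounded functionals commute with the integral. As \<open>N\<close> is only a seminorm,
  the integral is determined up to norm zero, a difference that such functionals do not see.\<close>

lemma has_integral_functional:
  fixes l :: "('c \<Rightarrow> real) \<Rightarrow> real"
  assumes w: "has_integral_into V N S w y"
    and add: "\<And>u v. u \<in> V \<Longrightarrow> v \<in> V \<Longrightarrow> l (u + v) = l u + l v"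
    and sc: "\<And>c u. u \<in> V \<Longrightarrow> l (c *\<^sub>R u) = c * l u" and b: "\<And>u. u \<in> V \<Longrightarrow> \<bar>l u\<bar> \<le> C * N u"
  shows "has_bochner_integral M (\<lambda>t. l (w t)) (l y)"
proof -
  obtain s where y: "y \<in> V" and wm: "strongly_measurable V N S w" and s: "\<And>n. simple_into V S (s n)"
    and lim: "(\<lambda>n. \<integral>\<^sup>+t. ennreal (N (s n t - w t)) \<partial>M) \<longlonglongrightarrow> 0"
    and limy: "(\<lambda>n. N (simple_int (s n) - y)) \<longlonglongrightarrow> 0" using w unfolding has_integral_into_def simple_int_def by auto
  have ld: "l u - l v = l (u - v)" if "u \<in> V" "v \<in> V" for u v using add[of "u - v" v] that by (simp add: diff_mem)
  have int: "has_bochner_integral M (\<lambda>t. l (s n t)) (l (simple_int (s n)))" for n by (rule simple_int_linear[OF s add sc])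
  have lm: "(\<lambda>t. l (w t)) \<in> borel_measurable M" by (rule smeas_linear[OF wm add b])
  have bound: "(\<integral>\<^sup>+t. ennreal (norm (l (s n t) - l (w t))) \<partial>M) \<le> ennreal \<bar>C\<bar> * (\<integral>\<^sup>+t. ennreal (N (s n t - w t)) \<partial>M)" for n
  proof -
    have sm: "strongly_measurable V N S (s n)" unfolding strongly_measurable_def
      using s[of n] by (auto intro!: exI[of _ "\<lambda>_. s n"] simp: simple_into_in N_zero)
    have "(\<integral>\<^sup>+t. ennreal (norm (l (s n t) - l (w t))) \<partial>M) \<le> (\<integral>\<^sup>+t. ennreal \<bar>C\<bar> * ennreal (N (s n t - w t)) \<partial>M)"
    proof (rule nn_integral_mono)
      fix t assume t: "t \<in> space M"
      have mem: "s n t \<in> V" "w t \<in> V" using t s wm by (auto simp: simple_into_in smeas_in)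
      have "\<bar>l (s n t) - l (w t)\<bar> \<le> C * N (s n t - w t)" unfolding ld[OF mem] by (intro b diff_mem mem)
      also have "\<dots> \<le> \<bar>C\<bar> * N (s n t - w t)" by (intro mult_right_mono N_nonneg diff_mem mem) simp
      finally show "ennreal (norm (l (s n t) - l (w t))) \<le> ennreal \<bar>C\<bar> * ennreal (N (s n t - w t))"
        by (simp add: ennreal_mult'[symmetric] ennreal_leI)
    qed
    also have "\<dots> = ennreal \<bar>C\<bar> * (\<integral>\<^sup>+t. ennreal (N (s n t - w t)) \<partial>M)"
      using smeas_norm[OF smeas_diff[OF sm wm]] by (intro nn_integral_cmult) auto
    finally show ?thesis .
  qed
  have lim2: "(\<lambda>n. \<integral>\<^sup>+t. ennreal (norm (l (s n t) - l (w t))) \<partial>M) \<longlonglongrightarrow> 0"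
  proof (rule tendsto_sandwich[OF _ _ tendsto_const])
    show "(\<lambda>n. ennreal \<bar>C\<bar> * (\<integral>\<^sup>+t. ennreal (N (s n t - w t)) \<partial>M)) \<longlonglongrightarrow> 0" using ennreal_tendsto_cmult[OF _ lim, of "ennreal \<bar>C\<bar>"] by simp
    show "\<forall>\<^sub>F n in sequentially. (\<integral>\<^sup>+t. ennreal (norm (l (s n t) - l (w t))) \<partial>M) \<le> ennreal \<bar>C\<bar> * (\<integral>\<^sup>+t. ennreal (N (s n t - w t)) \<partial>M)"
      by (intro always_eventually allI bound)
  qed simp
  have li: "integrable M (\<lambda>t. l (w t))"
  proof -
    have "\<forall>\<^sub>F n in sequentially. (\<integral>\<^sup>+t. ennreal (norm (l (s n t) - l (w t))) \<partial>M) < 1" using lim2 by (intro order_tendstoD) auto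
    then obtain n where n: "(\<integral>\<^sup>+t. ennreal (norm (l (s n t) - l (w t))) \<partial>M) < 1" by (auto simp: eventually_sequentially)
    have sn: "integrable M (\<lambda>t. l (s n t))" using int by (auto simp: has_bochner_integral_iff)
    have "integrable M (\<lambda>t. l (s n t) - l (w t))" using n lm borel_measurable_integrable[OF sn]
      by (intro integrableI_bounded) (auto intro: order_less_trans[OF _ ennreal_one_less_top])
    then have "integrable M (\<lambda>t. l (s n t) - (l (s n t) - l (w t)))" using sn by (rule Bochner_Integration.integrable_diff[rotated])
    then show ?thesis by simp
  qed
  have "(\<lambda>n. integral\<^sup>L M (\<lambda>t. l (s n t))) \<longlonglongrightarrow> integral\<^sup>L M (\<lambda>t. l (w t))"
    by (rule tendsto_L1_int[OF _ li lim2]) (use int in \<open>auto simp: has_bochner_integral_iff\<close>)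
  then have "(\<lambda>n. l (simple_int (s n))) \<longlonglongrightarrow> integral\<^sup>L M (\<lambda>t. l (w t))" by (simp add: has_bochner_integral_integral_eq[OF int])
  moreover have "(\<lambda>n. l (simple_int (s n))) \<longlonglongrightarrow> l y"
  proof -
    have "(\<lambda>n. C * N (simple_int (s n) - y)) \<longlonglongrightarrow> 0" using tendsto_mult_left[OF limy, of C] by simp
    then have "(\<lambda>n. l (simple_int (s n)) - l y) \<longlonglongrightarrow> 0"
    proof (rule Lim_null_comparison[rotated])
      have "\<bar>l (simple_int (s n)) - l y\<bar> \<le> C * N (simple_int (s n) - y)" for n
        unfolding ld[OF simple_int_in[OF s] y] by (intro b diff_mem simple_int_in s y)
      then show "\<forall>\<^sub>F n in sequentially. norm (l (simple_int (s n)) - l y) \<le> C * N (simple_int (s n) - y)" by simp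
    qed
    then show ?thesis by (simp add: LIM_zero_iff)
  qed
  ultimately have "integral\<^sup>L M (\<lambda>t. l (w t)) = l y" by (rule LIMSEQ_unique)
  then show ?thesis using li by (simp add: has_bochner_integral_iff)
qed

lemma bochner_L2_D:
  assumes "w \<in> bochner_L2 V N S"
  shows "strongly_measurable V N S w" "integrable M (\<lambda>t. (N (w t))^2)" "\<And>t. t \<in> S \<Longrightarrow> w t \<in> V"
  using assms by (auto simp: bochner_L2_def smeas_in)

end

section \<open>The lemma of du Bois-Reymond\<close>

text \<open>Positive and negative part of \<open>g\<close> are densities of measures that agree on
  boxes, an intersection-stable generator; so the measures agree, and densities are unique.\<close>

lemma AE_zero_if_box_integrals_zero:
  fixes g :: "'a::euclidean_space \<Rightarrow> real"
  assumes g: "integrable lborel g" and z: "\<And>a b. (\<integral>x. indicator (box a b) x * g x \<partial>lborel) = 0"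
  shows "AE x in lborel. g x = 0"
proof -
  have gm[measurable]: "g \<in> borel_measurable borel" using borel_measurable_integrable[OF g] by simp
  define P Q where "P x = max 0 (g x)" "Q x = max 0 (- g x)" for x
  have [measurable]: "P \<in> borel_measurable borel" "Q \<in> borel_measurable borel" unfolding P_Q_def by measurable
  have iP: "integrable lborel P" and iQ: "integrable lborel Q" unfolding P_Q_def[abs_def] using g by (auto intro: integrable_max)
  have eqb: "(\<integral>\<^sup>+x. ennreal (P x) * indicator (box a b) x \<partial>lborel) = (\<integral>\<^sup>+x. ennreal (Q x) * indicator (box a b) x \<partial>lborel)"
    and finb: "(\<integral>\<^sup>+x. ennreal (P x) * indicator (box a b) x \<partial>lborel) < \<infinity>" for a b
  proof -
    have i: "integrable lborel (\<lambda>x. indicator (box a b) x * P x)" "integrable lborel (\<lambda>x. indicator (box a b) x * Q x)"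
      using iP iQ by (auto intro!: integrable_real_mult_indicator simp: mult.commute[of "indicator _ _"])
    have c: "(\<integral>\<^sup>+x. ennreal (R x) * indicator (box a b) x \<partial>lborel) = ennreal (\<integral>x. indicator (box a b) x * R x \<partial>lborel)"
      if "integrable lborel (\<lambda>x. indicator (box a b) x * R x)" "\<And>x. R x \<ge> 0" for R
      using that by (subst nn_integral_eq_integral[symmetric]) (auto intro!: nn_integral_cong simp: indicator_def)
    have "(\<integral>x. indicator (box a b) x * P x \<partial>lborel) - (\<integral>x. indicator (box a b) x * Q x \<partial>lborel)
       = (\<integral>x. indicator (box a b) x * P x - indicator (box a b) x * Q x \<partial>lborel)" using i by simp
    also have "\<dots> = (\<integral>x. indicator (box a b) x * g x \<partial>lborel)"
      by (intro Bochner_Integration.integral_cong) (auto simp: P_Q_def indicator_def max_def)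
    finally have e: "(\<integral>x. indicator (box a b) x * P x \<partial>lborel) = (\<integral>x. indicator (box a b) x * Q x \<partial>lborel)" by (simp add: z)
    have "\<And>x. P x \<ge> 0" "\<And>x. Q x \<ge> 0" by (auto simp: P_Q_def)
    then show "(\<integral>\<^sup>+x. ennreal (P x) * indicator (box a b) x \<partial>lborel) = (\<integral>\<^sup>+x. ennreal (Q x) * indicator (box a b) x \<partial>lborel)"
      "(\<integral>\<^sup>+x. ennreal (P x) * indicator (box a b) x \<partial>lborel) < \<infinity>" using c[OF i(1)] c[OF i(2)] e by auto
  qed
  have "density lborel P = density lborel Q"
  proof (rule measure_eqI_generator_eq)
    let ?E = "range (\<lambda>(a, b). box a b :: 'a set)"
    show "Int_stable ?E" by (auto simp: Int_stable_def box_Int_box)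
    show "sets (density lborel P) = sigma_sets UNIV ?E" "sets (density lborel Q) = sigma_sets UNIV ?E" by (simp_all add: borel_eq_box)
    let ?A = "\<lambda>n::nat. box (- (real n *\<^sub>R One)) (real n *\<^sub>R One) :: 'a set"
    show "range ?A \<subseteq> ?E" by auto
    show "(\<Union>i. ?A i) = UNIV" unfolding UN_box_eq_UNIV by auto
    show "emeasure (density lborel P) (?A i) \<noteq> \<infinity>" for i
      using finb[of "- (real i *\<^sub>R One)" "real i *\<^sub>R One"] by (subst emeasure_density) auto
    fix X assume "X \<in> ?E"
    then show "emeasure (density lborel P) X = emeasure (density lborel Q) X" using eqb by (auto simp: emeasure_density)
  qed auto
  then have "AE x in lborel. ennreal (P x) = ennreal (Q x)"
    by (subst (asm) sigma_finite_measure.density_unique_iff) (auto intro: sigma_finite_lborel)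
  then show ?thesis by eventually_elim (auto simp: P_Q_def max_def split: if_splits)
qed

text \<open>Testing with \<open>box_bump\<close> and passing to the limit makes the integral of
  \<open>g\<close> over every box inside \<open>S\<close> vanish; countably many closed boxes cover
  \<open>S\<close>.\<close>

lemma du_Bois_Reymond:
  fixes g :: "'a::euclidean_space \<Rightarrow> real"
  assumes S: "open S" and int: "\<And>a b. cbox a b \<subseteq> S \<Longrightarrow> integrable (lebesgue_on (cbox a b)) g"
    and z: "\<And>\<phi>. \<phi> \<in> test_functions S \<Longrightarrow> integral\<^sup>L (lebesgue_on S) (\<lambda>x. g x * \<phi> x) = 0"
  shows "AE x in lebesgue_on S. g x = 0"
proof -
  have Sl: "S \<inter> space lebesgue \<in> sets lebesgue" using S by simp
  have boxz: "(\<integral>x. indicator (box a b) x * g x \<partial>lebesgue) = 0" if ab: "cbox a b \<subseteq> S" for a b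
  proof -
    have gi: "integrable lebesgue (\<lambda>x. indicator (cbox a b) x * g x)" using int[OF ab] by (simp add: integrable_restrict_space)
    have "(\<lambda>m. \<integral>x. box_bump a b m x * (indicator (cbox a b) x * g x) \<partial>lebesgue)
        \<longlonglongrightarrow> (\<integral>x. indicator (box a b) x * (indicator (cbox a b) x * g x) \<partial>lebesgue)"
    proof (rule integral_dominated_convergence[where w = "\<lambda>x. \<bar>indicator (cbox a b) x * g x\<bar>"])
      have bm: "box_bump a b m \<in> borel_measurable borel" for m
        using Ck_continuous[OF Ck_box_bump[of 0 a b m]] by (rule borel_measurable_continuous_onI)
      have bl: "box_bump a b m \<in> borel_measurable lebesgue" for m by (rule measurable_completion) (simp add: bm)
      show "(\<lambda>x. box_bump a b m x * (indicator (cbox a b) x * g x)) \<in> borel_measurable lebesgue" for m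
        by (rule borel_measurable_times[OF bl borel_measurable_integrable[OF gi]])
      show "(\<lambda>x. indicator (box a b) x * (indicator (cbox a b) x * g x)) \<in> borel_measurable lebesgue"
        by (rule borel_measurable_times[OF borel_measurable_indicator borel_measurable_integrable[OF gi]]) simp
      show "AE x in lebesgue. (\<lambda>m. box_bump a b m x * (indicator (cbox a b) x * g x)) \<longlonglongrightarrow> indicator (box a b) x * (indicator (cbox a b) x * g x)"
        by (intro AE_I2 tendsto_mult_right box_bump_limit)
      show "AE x in lebesgue. norm (box_bump a b m x * (indicator (cbox a b) x * g x)) \<le> \<bar>indicator (cbox a b) x * g x\<bar>" for m
        using box_bump_bounds[of a b m] by (intro AE_I2) (auto simp: abs_mult indicator_def intro!: mult_left_le_one_le)
    qed (use gi in auto)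
    moreover have "(\<integral>x. box_bump a b m x * (indicator (cbox a b) x * g x) \<partial>lebesgue) = 0" for m
    proof -
      have "(\<integral>x. box_bump a b m x * (indicator (cbox a b) x * g x) \<partial>lebesgue) = (\<integral>x. indicator S x *\<^sub>R (g x * box_bump a b m x) \<partial>lebesgue)"
      proof (rule Bochner_Integration.integral_cong[OF refl])
        fix x
        have "x \<notin> cbox a b \<Longrightarrow> box_bump a b m x = 0" using box_bump_support[of a b m] box_subset_cbox by blast
        then show "box_bump a b m x * (indicator (cbox a b) x * g x) = indicator S x *\<^sub>R (g x * box_bump a b m x)"
          using ab by (auto simp: indicator_def)
      qed
      also have "\<dots> = 0" using z[OF box_bump_test[OF ab], of m] integral_restrict_space[OF Sl, of "\<lambda>x. g x * box_bump a b m x"] by simp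
      finally show ?thesis .
    qed
    ultimately have "(\<integral>x. indicator (box a b) x * (indicator (cbox a b) x * g x) \<partial>lebesgue) = 0"
      using LIMSEQ_unique[OF _ tendsto_const] by fastforce
    moreover have "indicator (box a b) x * (indicator (cbox a b) x * g x) = indicator (box a b) x * g x" for x
      using box_subset_cbox[of a b] by (auto simp: indicator_def)
    ultimately show ?thesis by simp
  qed
  have ae: "AE x in lebesgue. x \<in> cbox a b \<longrightarrow> g x = 0" if ab: "cbox a b \<subseteq> S" for a b
  proof -
    define G where "G x = indicator (box a b) x * g x" for x
    have "integrable lebesgue (\<lambda>x. indicator (box a b) x *\<^sub>R (indicator (cbox a b) x * g x))"
      using int[OF ab] by (intro integrable_mult_indicator) (auto simp: integrable_restrict_space)
    moreover have "indicator (box a b) x *\<^sub>R (indicator (cbox a b) x * g x) = G x" for x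
      using box_subset_cbox[of a b] by (auto simp: indicator_def G_def)
    ultimately have Gi: "integrable lebesgue G" by simp
    \<comment> \<open>The uniqueness of densities is used for Borel functions, so the Lebesgue
      measurable function is replaced by a Borel version.\<close>
    obtain G' where G': "G' \<in> borel_measurable lborel" "AE x in lborel. G x = G' x"
      using completion_ex_borel_measurable_real borel_measurable_integrable[OF Gi] by blast
    have ae': "AE x in lebesgue. G x = G' x" using G'(2) by (rule AE_completion)
    have "integrable lebesgue G'"
      using Gi by (subst integrable_cong_AE[where g = G]) (use ae' G' borel_measurable_integrable[OF Gi] in \<open>auto simp: measurable_completion\<close>)
    then have G'i: "integrable lborel G'" using G'(1) by (simp add: integrable_completion)
    have "AE x in lborel. G' x = 0"
    proof (rule AE_zero_if_box_integrals_zero[OF G'i])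
      fix c d :: 'a
      define a' b' where "a' = (\<Sum>i\<in>Basis. max (a \<bullet> i) (c \<bullet> i) *\<^sub>R i)" "b' = (\<Sum>i\<in>Basis. min (b \<bullet> i) (d \<bullet> i) *\<^sub>R i)"
      have sub: "cbox a' b' \<subseteq> S" using ab by (rule order_trans[rotated]) (auto simp: mem_box a'_b'_def)
      have bi: "box a b \<inter> box c d = box a' b'" unfolding a'_b'_def by (rule box_Int_box)
      have m: "(\<lambda>x. indicator (box c d) x * G' x) \<in> borel_measurable lborel" using G'(1) by measurable
      have "(\<integral>x. indicator (box c d) x * G' x \<partial>lborel) = (\<integral>x. indicator (box c d) x * G' x \<partial>lebesgue)"
        using integral_completion[OF m] by simp
      also have "\<dots> = (\<integral>x. indicator (box c d) x * G x \<partial>lebesgue)"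
      proof (rule integral_cong_AE)
        show "(\<lambda>x. indicator (box c d) x * G' x) \<in> borel_measurable lebesgue" using m by (rule measurable_completion)
        show "(\<lambda>x. indicator (box c d) x * G x) \<in> borel_measurable lebesgue"
          by (rule borel_measurable_times[OF borel_measurable_indicator borel_measurable_integrable[OF Gi]]) simp
        show "AE x in lebesgue. indicator (box c d) x * G' x = indicator (box c d) x * G x" using ae' by eventually_elim simp
      qed
      also have "\<dots> = (\<integral>x. indicator (box a' b') x * g x \<partial>lebesgue)"
        unfolding G_def bi[symmetric] by (intro Bochner_Integration.integral_cong) (auto simp: indicator_def)
      also have "\<dots> = 0" by (rule boxz[OF sub])
      finally show "(\<integral>x. indicator (box c d) x * G' x \<partial>lborel) = 0" .
    qed
    then have 1: "AE x in lebesgue. G x = 0" using ae' by (auto dest: AE_completion)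
    have "cbox a b - box a b \<in> null_sets lebesgue" using negligible_frontier_interval[of a b] by (simp add: negligible_iff_null_sets)
    then have "AE x in lebesgue. x \<notin> cbox a b - box a b" by (rule AE_not_in)
    with 1 show ?thesis by eventually_elim (auto simp: G_def)
  qed
  obtain D where D: "countable D" "D \<subseteq> Pow S" "\<And>X. X \<in> D \<Longrightarrow> \<exists>a b. X = cbox a b" "\<Union>D = S" using open_countable_Union_open_cbox[OF S] by metis
  have "AE x in lebesgue. \<forall>X\<in>D. x \<in> X \<longrightarrow> g x = 0" using D ae by (subst AE_ball_countable) (auto, blast)
  then show ?thesis unfolding AE_restrict_space_iff[OF Sl] by eventually_elim (use D(4) in auto)
qed

section \<open>Weak time derivatives in a dual space\<close>

lemma integrable_inner_square:
  fixes p q :: "'a \<Rightarrow> 'b::euclidean_space"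
  assumes p: "p \<in> borel_measurable M" "integrable M (\<lambda>x. (norm (p x))^2)"
    and q: "q \<in> borel_measurable M" "integrable M (\<lambda>x. (norm (q x))^2)"
  shows "integrable M (\<lambda>x. p x \<bullet> q x)"
proof (rule Bochner_Integration.integrable_bound)
  show "integrable M (\<lambda>x. ((norm (p x))^2 + (norm (q x))^2) / 2)" using p q by auto
  show "AE x in M. norm (p x \<bullet> q x) \<le> norm (((norm (p x))^2 + (norm (q x))^2) / 2)"
  proof (rule AE_I2)
    fix x
    have "\<bar>p x \<bullet> q x\<bar> \<le> norm (p x) * norm (q x)" by (rule Cauchy_Schwarz_ineq2)
    also have "\<dots> \<le> ((norm (p x))^2 + (norm (q x))^2) / 2" using sum_squares_bound[of "norm (p x)" "norm (q x)"] by simp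
    finally show "norm (p x \<bullet> q x) \<le> norm (((norm (p x))^2 + (norm (q x))^2) / 2)" by simp
  qed
qed (use p q in measurable)

text \<open>Stated over an arbitrary measure: it yields L2 on \<Omega> and, through
  \<open>real_Minkowski\<close>, the triangle inequalities for the norms in time and of the
  K-method.\<close>

lemma square_integrable_semi_inner:
  "semi_inner_space {u \<in> borel_measurable M. integrable M (\<lambda>x. (norm (u x))^2)}
     (\<lambda>p q. \<integral>x. p x \<bullet> q x \<partial>M) (\<lambda>u :: 'a \<Rightarrow> 'b::euclidean_space. sqrt (\<integral>x. u x \<bullet> u x \<partial>M))"
proof
  fix u v w :: "'a \<Rightarrow> 'b" and c :: real
  let ?V = "{u \<in> borel_measurable M. integrable M (\<lambda>x. (norm (u x))^2)}"
  assume u: "u \<in> ?V"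
  have "(\<lambda>x. c *\<^sub>R u x) \<in> borel_measurable M" using u by auto
  moreover have "integrable M (\<lambda>x. (norm (c *\<^sub>R u x))^2)" using u by (simp add: power_mult_distrib)
  ultimately show "c *\<^sub>R u \<in> ?V" by (simp add: scaleR_fun_def)
  show "0 \<le> (\<integral>x. u x \<bullet> u x \<partial>M)" by (intro Bochner_Integration.integral_nonneg) simp
  assume v: "v \<in> ?V"
  show "(\<integral>x. u x \<bullet> v x \<partial>M) = (\<integral>x. v x \<bullet> u x \<partial>M)" by (simp add: inner_commute)
  show "(\<integral>x. (c *\<^sub>R u) x \<bullet> v x \<partial>M) = c * (\<integral>x. u x \<bullet> v x \<partial>M)" by (simp add: scaleR_fun_def)
  have "integrable M (\<lambda>x. u x \<bullet> v x)" using u v by (intro integrable_inner_square) auto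
  then have "integrable M (\<lambda>x. (norm (u x))^2 + 2 * (u x \<bullet> v x) + (norm (v x))^2)" using u v by auto
  moreover have "(norm (u x + v x))^2 = (norm (u x))^2 + 2 * (u x \<bullet> v x) + (norm (v x))^2" for x
    by (simp add: power2_norm_eq_inner inner_add inner_commute algebra_simps)
  ultimately have "integrable M (\<lambda>x. (norm ((u + v) x))^2)" by simp
  moreover have "u + v \<in> borel_measurable M" using u v by (auto simp: plus_fun_def)
  ultimately show "u + v \<in> ?V" by simp
  assume w: "w \<in> ?V"
  have "integrable M (\<lambda>x. u x \<bullet> w x)" "integrable M (\<lambda>x. v x \<bullet> w x)" using u v w by (auto intro!: integrable_inner_square)
  then show "(\<integral>x. (u + v) x \<bullet> w x \<partial>M) = (\<integral>x. u x \<bullet> w x \<partial>M) + (\<integral>x. v x \<bullet> w x \<partial>M)" by (simp add: inner_add_left)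
qed (auto simp: zero_fun_def)

lemma real_Minkowski:
  fixes f g :: "'a \<Rightarrow> real"
  assumes f: "f \<in> borel_measurable M" "integrable M (\<lambda>x. (f x)^2)"
    and g: "g \<in> borel_measurable M" "integrable M (\<lambda>x. (g x)^2)"
  shows "integrable M (\<lambda>x. (f x + g x)^2)"
    "sqrt (\<integral>x. (f x + g x)^2 \<partial>M) \<le> sqrt (\<integral>x. (f x)^2 \<partial>M) + sqrt (\<integral>x. (g x)^2 \<partial>M)"
proof -
  interpret semi_inner_space "{u \<in> borel_measurable M. integrable M (\<lambda>x. (norm (u x))^2)}"
    "\<lambda>p q. \<integral>x. p x \<bullet> q x \<partial>M" "\<lambda>u :: 'a \<Rightarrow> real. sqrt (\<integral>x. u x \<bullet> u x \<partial>M)" by (rule square_integrable_semi_inner)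
  have m: "f \<in> {u \<in> borel_measurable M. integrable M (\<lambda>x. (norm (u x))^2)}"
    "g \<in> {u \<in> borel_measurable M. integrable M (\<lambda>x. (norm (u x))^2)}" using f g by auto
  show "integrable M (\<lambda>x. (f x + g x)^2)" using add_mem[OF m] by simp
  show "sqrt (\<integral>x. (f x + g x)^2 \<partial>M) \<le> sqrt (\<integral>x. (f x)^2 \<partial>M) + sqrt (\<integral>x. (g x)^2 \<partial>M)" using N_triangle[OF m] by (simp add: power2_eq_square)
qed

context bochner_space
begin

lemma L2_seminormed: "seminormed_space (bochner_L2 V N S) (bochner_L2_norm N S)"
proof
  show "0 \<in> bochner_L2 V N S" using smeas_const[OF zero_mem] by (simp add: bochner_L2_def zero_fun_def N_zero[unfolded zero_fun_def])
next
  fix u v assume u: "u \<in> bochner_L2 V N S" and v: "v \<in> bochner_L2 V N S"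
  note uD = bochner_L2_D[OF u] and vD = bochner_L2_D[OF v]
  note nu = smeas_norm[OF uD(1)] and nv = smeas_norm[OF vD(1)]
  have sm: "strongly_measurable V N S (u + v)" using smeas_add[OF uD(1) vD(1)] by (simp add: plus_fun_def)
  note Mk = real_Minkowski[OF nu uD(2) nv vD(2)]
  have le: "(N ((u + v) t))^2 \<le> (N (u t) + N (v t))^2" if "t \<in> S" for t
    using N_triangle[of "u t" "v t"] uD(3) vD(3) that by (intro power_mono) (auto intro: N_nonneg add_mem)
  have int: "integrable M (\<lambda>t. (N ((u + v) t))^2)"
  proof (rule Bochner_Integration.integrable_bound[OF Mk(1)])
    show "(\<lambda>t. (N ((u + v) t))^2) \<in> borel_measurable M" using smeas_norm[OF sm] by measurable
    show "AE t in M. norm ((N ((u + v) t))^2) \<le> norm ((N (u t) + N (v t))^2)" using le by (intro AE_I2) simp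
  qed
  then show "u + v \<in> bochner_L2 V N S" using sm by (simp add: bochner_L2_def)
  have "bochner_L2_norm N S (u + v) \<le> sqrt (\<integral>t. (N (u t) + N (v t))^2 \<partial>M)" unfolding bochner_L2_norm_def using le int Mk(1)
    by (intro real_sqrt_le_mono integral_mono) auto
  also have "\<dots> \<le> bochner_L2_norm N S u + bochner_L2_norm N S v" using Mk(2) by (simp add: bochner_L2_norm_def)
  finally show "bochner_L2_norm N S (u + v) \<le> bochner_L2_norm N S u + bochner_L2_norm N S v" .
next
  fix u c assume u: "u \<in> bochner_L2 V N S"
  note uD = bochner_L2_D[OF u]
  have sm: "strongly_measurable V N S (c *\<^sub>R u)" using smeas_scale[OF uD(1), of c] by (simp add: scaleR_fun_def[of c u])
  have eq: "(N ((c *\<^sub>R u) t))^2 = c^2 * (N (u t))^2" if "t \<in> S" for t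
    using N_scale[OF uD(3)[OF that]] by (simp add: scaleR_fun_def[of c u] power_mult_distrib)
  have "integrable M (\<lambda>t. c^2 * (N (u t))^2)" using uD(2) by simp
  then have "integrable M (\<lambda>t. (N ((c *\<^sub>R u) t))^2)"
    by (rule Bochner_Integration.integrable_cong[THEN iffD1, OF refl _, rotated]) (simp add: eq)
  then show "c *\<^sub>R u \<in> bochner_L2 V N S" using sm by (simp add: bochner_L2_def)
  have "(\<integral>t. (N ((c *\<^sub>R u) t))^2 \<partial>M) = (\<integral>t. c^2 * (N (u t))^2 \<partial>M)" by (rule Bochner_Integration.integral_cong) (simp_all add: eq)
  then show "bochner_L2_norm N S (c *\<^sub>R u) = \<bar>c\<bar> * bochner_L2_norm N S u" by (simp add: bochner_L2_norm_def real_sqrt_mult)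
  show "0 \<le> bochner_L2_norm N S u" by (simp add: bochner_L2_norm_def)
qed

lemma L2_norm_cong_AE:
  assumes "u \<in> bochner_L2 V N S" "v \<in> bochner_L2 V N S" "AE t in M. N (u t - v t) = 0"
  shows "bochner_L2_norm N S u = bochner_L2_norm N S v"
proof -
  note uD = bochner_L2_D[OF assms(1)] and vD = bochner_L2_D[OF assms(2)]
  have "AE t in M. (N (u t))^2 = (N (v t))^2" using assms(3) AE_space
  proof eventually_elim
    case (elim t)
    then show ?case using N_abs_diff[OF uD(3) vD(3), of t t] by simp
  qed
  then show ?thesis unfolding bochner_L2_norm_def using smeas_norm[OF uD(1)] smeas_norm[OF vD(1)]
    by (intro arg_cong[where f = sqrt] integral_cong_AE) auto
qed

end

lemma test_square_integrable:
  fixes \<phi> :: "'a::euclidean_space \<Rightarrow> real"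
  assumes S: "S \<in> sets lebesgue" and phi: "\<phi> \<in> test_functions S'"
  shows "\<phi> \<in> borel_measurable (lebesgue_on S)" "integrable (lebesgue_on S) (\<lambda>x. (\<phi> x)^2)" "integrable (lebesgue_on S) \<phi>"
proof -
  have c: "continuous_on UNIV \<phi>" using test_smooth[OF phi] by (rule Ck_continuous[of 0])
  then have bm: "\<phi> \<in> borel_measurable borel" by (rule borel_measurable_continuous_onI)
  have bl: "\<phi> \<in> borel_measurable lebesgue" by (rule measurable_completion) (simp add: bm)
  then show "\<phi> \<in> borel_measurable (lebesgue_on S)" by (rule measurable_restrict_space1)
  define K where "K = closure {x. \<phi> x \<noteq> 0}"
  have K: "compact K" using phi by (simp add: K_def test_functions_def)
  have z: "\<phi> x = 0" if "x \<notin> K" for x using that closure_subset[of "{x. \<phi> x \<noteq> 0}"] by (auto simp: K_def)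
  have gen: "integrable (lebesgue_on S) f" if f: "continuous_on UNIV f" "\<And>x. x \<notin> K \<Longrightarrow> f x = 0" for f :: "'a \<Rightarrow> real"
  proof -
    have "integrable lborel (\<lambda>x. indicator K x *\<^sub>R f x)" using K f(1) by (intro borel_integrable_compact) (auto intro: continuous_on_subset)
    moreover have "(\<lambda>x. indicator K x *\<^sub>R f x) = f" using f(2) by (auto simp: indicator_def fun_eq_iff)
    ultimately have "integrable lborel f" by (simp only:)
    then have "integrable lebesgue f" using borel_measurable_continuous_onI[OF f(1)] by (simp add: integrable_completion)
    then have "integrable lebesgue (\<lambda>x. indicator S x *\<^sub>R f x)" using S by (intro integrable_mult_indicator)
    then show ?thesis using S by (simp add: integrable_restrict_space)
  qed
  show "integrable (lebesgue_on S) (\<lambda>x. (\<phi> x)^2)" by (rule gen) (auto intro!: continuous_intros c simp: z)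
  show "integrable (lebesgue_on S) \<phi>" by (rule gen) (auto intro!: c simp: z)
qed

lemma test_deriv:
  fixes \<phi> :: "real \<Rightarrow> real"
  assumes "\<phi> \<in> test_functions S"
  shows "(\<phi> has_real_derivative deriv \<phi> t) (at t)" "deriv \<phi> \<in> test_functions S"
    "deriv \<phi> t = frechet_derivative \<phi> (at t) 1"
proof -
  have lin: "frechet_derivative \<phi> (at t) y = frechet_derivative \<phi> (at t) 1 * y" for y t
    using linear_scale[OF linear_frechet_derivative, of \<phi> "at t" y 1] test_smooth[OF assms, of 1] by (simp add: mult.commute)
  have d: "(\<phi> has_real_derivative frechet_derivative \<phi> (at t) 1) (at t)" for t
    using test_has_derivative[OF assms, of t] unfolding has_field_derivative_def by (rule has_derivative_eq_rhs) (rule ext, rule lin)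
  then show e: "deriv \<phi> t = frechet_derivative \<phi> (at t) 1" for t by (rule DERIV_imp_deriv)
  show "(\<phi> has_real_derivative deriv \<phi> t) (at t)" using d e by simp
  show "deriv \<phi> \<in> test_functions S" using test_partial[OF assms, of 1] by (simp add: e[abs_def])
qed

section \<open>Functions of time with values in a dual space\<close>

locale dual_bochner = X: seminormed_space X NX
  for X :: "'x::real_vector set" and NX :: "'x \<Rightarrow> real" +
  fixes S :: "real set"
  assumes open_S: "open S"
begin

abbreviation "V \<equiv> dual_space X NX"
abbreviation "N \<equiv> dual_norm X NX"

sublocale bochner_space V N S
proof -
  interpret D: seminormed_space V N by (rule X.dual_seminormed)
  show "bochner_space V N S" by unfold_locales (use open_S in auto)
qed

text \<open>The limit is taken pointwise; the Cauchy estimate is uniform on \<open>X\<close> in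
  units of \<open>NX\<close>, so it survives the limit.\<close>

lemma dual_complete:
  assumes f: "\<And>n. f n \<in> V" and C: "\<And>e. e > 0 \<Longrightarrow> \<exists>K::nat. \<forall>m\<ge>K. \<forall>n\<ge>K. N (f m - f n) < e"
  shows "\<exists>y\<in>V. (\<lambda>n. N (f n - y)) \<longlonglongrightarrow> 0"
proof -
  have bnd: "\<bar>f m u - f n u\<bar> \<le> N (f m - f n) * NX u" if "u \<in> X" for m n u using X.dual_norm_bound[OF diff_mem[OF f f] that, of m n] by simp
  have "Cauchy (\<lambda>n. f n u)" if u: "u \<in> X" for u
  proof (rule metric_CauchyI)
    fix e :: real assume e: "0 < e"
    have p: "0 < e / (NX u + 1)" using e X.N_nonneg[OF u] by simp
    obtain K where K: "\<forall>m\<ge>K. \<forall>n\<ge>K. N (f m - f n) < e / (NX u + 1)" using C[OF p] by auto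
    have "dist (f m u) (f n u) < e" if "m \<ge> K" "n \<ge> K" for m n
    proof -
      have "\<bar>f m u - f n u\<bar> \<le> N (f m - f n) * NX u" by (rule bnd[OF u])
      also have "\<dots> \<le> e / (NX u + 1) * NX u" using K that X.N_nonneg[OF u] by (intro mult_right_mono) (auto simp: less_imp_le)
      also have "\<dots> < e / (NX u + 1) * (NX u + 1)" using p by (intro mult_strict_left_mono) auto
      also have "\<dots> = e" using X.N_nonneg[OF u] by simp
      finally show ?thesis by (simp add: dist_real_def)
    qed
    then show "\<exists>K. \<forall>m\<ge>K. \<forall>n\<ge>K. dist (f m u) (f n u) < e" by blast
  qed
  then have conv: "(\<lambda>n. f n u) \<longlonglongrightarrow> lim (\<lambda>n. f n u)" if "u \<in> X" for u using that by (simp add: Cauchy_convergent_iff convergent_LIMSEQ_iff)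
  define y where "y u = (if u \<in> X then lim (\<lambda>n. f n u) else 0)" for u
  have yl: "(\<lambda>n. f n u) \<longlonglongrightarrow> y u" if "u \<in> X" for u using conv[OF that] that by (simp add: y_def)
  have close: "\<bar>f n u - y u\<bar> \<le> e * NX u" if K: "\<forall>m\<ge>K. \<forall>n\<ge>K. N (f m - f n) < e" and n: "n \<ge> K" and u: "u \<in> X" for n u e K
  proof (rule LIMSEQ_le_const2)
    show "(\<lambda>m. \<bar>f n u - f m u\<bar>) \<longlonglongrightarrow> \<bar>f n u - y u\<bar>" by (intro tendsto_intros yl u)
    have "\<bar>f n u - f m u\<bar> \<le> e * NX u" if m: "m \<ge> K" for m
    proof -
      have "\<bar>f n u - f m u\<bar> \<le> N (f n - f m) * NX u" by (rule bnd[OF u])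
      also have "\<dots> \<le> e * NX u" using K n m X.N_nonneg[OF u] by (intro mult_right_mono) (auto simp: less_imp_le)
      finally show ?thesis .
    qed
    then show "\<exists>K. \<forall>m\<ge>K. \<bar>f n u - f m u\<bar> \<le> e * NX u" by blast
  qed
  have yV: "y \<in> V" unfolding dual_space_def
  proof (intro CollectI conjI ballI allI impI)
    fix u v a b assume uv: "u \<in> X" "v \<in> X"
    have m: "a *\<^sub>R u + b *\<^sub>R v \<in> X" using uv by (intro X.add_mem X.scale_mem)
    have "(\<lambda>n. f n (a *\<^sub>R u + b *\<^sub>R v)) \<longlonglongrightarrow> a * y u + b * y v"
      using uv by (simp add: X.dual_space_add[OF f] X.dual_space_scale[OF f] X.scale_mem)
        (intro tendsto_intros yl uv)
    then show "y (a *\<^sub>R u + b *\<^sub>R v) = a * y u + b * y v" using yl[OF m] LIMSEQ_unique by blast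
  next
    obtain K where K: "\<forall>m\<ge>K. \<forall>n\<ge>K. N (f m - f n) < 1" using C[of 1] by auto
    show "\<exists>B. \<forall>u\<in>X. \<bar>y u\<bar> \<le> B * NX u"
    proof (intro exI ballI)
      fix u assume u: "u \<in> X"
      have "\<bar>f K u - y u\<bar> \<le> 1 * NX u" by (rule close[OF K _ u]) simp
      moreover have "\<bar>f K u\<bar> \<le> N (f K) * NX u" by (rule X.dual_norm_bound[OF f u])
      ultimately show "\<bar>y u\<bar> \<le> (N (f K) + 1) * NX u" by (simp add: distrib_right)
    qed
  qed (simp add: y_def)
  have "(\<lambda>n. N (f n - y)) \<longlonglongrightarrow> 0"
  proof (rule LIMSEQ_I)
    fix e :: real assume e: "0 < e"
    obtain K where K: "\<forall>m\<ge>K. \<forall>n\<ge>K. N (f m - f n) < e / 2" using C[of "e / 2"] e by auto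
    have "norm (N (f n - y) - 0) < e" if "n \<ge> K" for n
    proof -
      have "N (f n - y) \<le> e / 2" using close[OF K that] e by (intro X.dual_norm_least') auto
      then show ?thesis using e N_nonneg[OF diff_mem[OF f yV], of n] by simp
    qed
    then show "\<exists>no. \<forall>n\<ge>no. norm (N (f n - y) - 0) < e" by blast
  qed
  then show ?thesis using yV by blast
qed

lemma dual_integral:
  assumes w: "has_integral_into V N S w y" and u: "u \<in> X"
  shows "has_bochner_integral M (\<lambda>t. w t u) (y u)" by (rule has_integral_functional[OF w, where l = "\<lambda>F. F u" and C = "NX u"])
    (use X.dual_norm_bound[OF _ u] in \<open>auto simp: scaleR_fun_def mult.commute\<close>)

lemma dual_integral_exists:
  assumes "strongly_measurable V N S w" "(\<integral>\<^sup>+t. ennreal (N (w t)) \<partial>M) < \<infinity>"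
  shows "\<exists>y. has_integral_into V N S w y" by (rule has_integral_exists[OF dual_complete assms])

lemma has_integral_into_mem: "has_integral_into V N S w y \<Longrightarrow> y \<in> V" by (simp add: has_integral_into_def)

lemma L2_eval:
  assumes w: "w \<in> bochner_L2 V N S" and u: "u \<in> X"
  shows "(\<lambda>t. w t u) \<in> borel_measurable M" "integrable M (\<lambda>t. (w t u)^2)"
proof -
  note D = bochner_L2_D[OF w]
  show m: "(\<lambda>t. w t u) \<in> borel_measurable M" by (rule smeas_linear[OF D(1), where l = "\<lambda>F. F u" and C = "NX u"])
      (use X.dual_norm_bound[OF _ u] in \<open>auto simp: mult.commute\<close>)
  show "integrable M (\<lambda>t. (w t u)^2)"
  proof (rule Bochner_Integration.integrable_bound)
    show "integrable M (\<lambda>t. (NX u)^2 * (N (w t))^2)" using D(2) by simp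
    show "(\<lambda>t. (w t u)^2) \<in> borel_measurable M" using m by measurable
    show "AE t in M. norm ((w t u)^2) \<le> norm ((NX u)^2 * (N (w t))^2)"
    proof (rule AE_I2)
      fix t assume "t \<in> space M"
      then have "\<bar>w t u\<bar> \<le> \<bar>N (w t) * NX u\<bar>" using X.dual_norm_bound[OF D(3) u, of t] by simp
      then show "norm ((w t u)^2) \<le> norm ((NX u)^2 * (N (w t))^2)"
        using power_mono[of "\<bar>w t u\<bar>" "\<bar>N (w t) * NX u\<bar>" 2] by (simp add: power_mult_distrib mult.commute)
    qed
  qed
qed

lemma test_mult_integral:
  assumes v: "v \<in> bochner_L2 V N S" and phi: "\<phi> \<in> test_functions S'"
  shows "\<exists>y. has_integral_into V N S (\<lambda>t. \<phi> t *\<^sub>R v t) y"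
proof (rule dual_integral_exists)
  note D = bochner_L2_D[OF v]
  note T = test_square_integrable[OF S phi]
  show "strongly_measurable V N S (\<lambda>t. \<phi> t *\<^sub>R v t)" by (rule smeas_mult[OF D(1) T(1)])
  have "(\<integral>\<^sup>+t. ennreal (N (\<phi> t *\<^sub>R v t)) \<partial>M) \<le> (\<integral>\<^sup>+t. ennreal (norm (\<phi> t * N (v t))) \<partial>M)"
    using N_nonneg by (intro nn_integral_mono ennreal_leI) (simp add: D(3) N_scale abs_mult)
  also have "\<dots> < \<infinity>" using integrable_inner_square[OF T(1) _ smeas_norm[OF D(1)]] T(2) D(2) by (simp add: integrable_iff_bounded)
  finally show "(\<integral>\<^sup>+t. ennreal (N (\<phi> t *\<^sub>R v t)) \<partial>M) < \<infinity>" .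
qed

text \<open>Reduces an identity of Bochner integrals to scalar ones, one for each u in
  \<open>X\<close>. The integrals exist because a test function times an L2 function is integrable,
  and two functionals that agree on \<open>X\<close> are equal since both vanish off
  \<open>X\<close>.\<close>

lemma weak_derivative_iff:
  assumes v: "v \<in> bochner_L2 V N S" and g: "g \<in> bochner_L2 V N S"
  shows "is_weak_time_derivative V N S v g \<longleftrightarrow>
    (\<forall>\<phi>\<in>test_functions S. \<forall>u\<in>X. integral\<^sup>L M (\<lambda>t. deriv \<phi> t * v t u) = - integral\<^sup>L M (\<lambda>t. \<phi> t * g t u))"
proof
  assume w: "is_weak_time_derivative V N S v g"
  show "\<forall>\<phi>\<in>test_functions S. \<forall>u\<in>X. integral\<^sup>L M (\<lambda>t. deriv \<phi> t * v t u) = - integral\<^sup>L M (\<lambda>t. \<phi> t * g t u)"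
  proof (intro ballI)
    fix \<phi> u assume phi: "\<phi> \<in> test_functions S" and u: "u \<in> X"
    obtain y where y: "has_integral_into V N S (\<lambda>t. deriv \<phi> t *\<^sub>R v t) y"
      "has_integral_into V N S (\<lambda>t. \<phi> t *\<^sub>R g t) (- y)" using w phi unfolding is_weak_time_derivative_def by blast
    show "integral\<^sup>L M (\<lambda>t. deriv \<phi> t * v t u) = - integral\<^sup>L M (\<lambda>t. \<phi> t * g t u)" using dual_integral[OF y(1) u] dual_integral[OF y(2) u]
      by (simp add: scaleR_fun_def has_bochner_integral_iff)
  qed
next
  assume eq: "\<forall>\<phi>\<in>test_functions S. \<forall>u\<in>X. integral\<^sup>L M (\<lambda>t. deriv \<phi> t * v t u) = - integral\<^sup>L M (\<lambda>t. \<phi> t * g t u)"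
  show "is_weak_time_derivative V N S v g" unfolding is_weak_time_derivative_def
  proof
    fix \<phi> assume phi: "\<phi> \<in> test_functions S"
    obtain y where y: "has_integral_into V N S (\<lambda>t. deriv \<phi> t *\<^sub>R v t) y" using test_mult_integral[OF v test_deriv(2)[OF phi]] by blast
    obtain z where z: "has_integral_into V N S (\<lambda>t. \<phi> t *\<^sub>R g t) z" using test_mult_integral[OF g phi] by blast
    have "z = - y"
    proof
      fix u show "z u = (- y) u"
      proof (cases "u \<in> X")
        case True
        then show ?thesis using dual_integral[OF y True] dual_integral[OF z True] eq phi
          by (simp add: scaleR_fun_def has_bochner_integral_iff)
      next
        case False
        then show ?thesis using has_integral_into_mem[OF y] has_integral_into_mem[OF z] by (simp add: dual_space_def)
      qed
    qed
    then show "\<exists>y. has_integral_into V N S (\<lambda>t. deriv \<phi> t *\<^sub>R v t) y \<and> has_integral_into V N S (\<lambda>t. \<phi> t *\<^sub>R g t) (- y)" using y z by auto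
  qed
qed

text \<open>The exceptional null set depends on u, and \<open>X\<close> may be uncountable. Strong
  measurability confines the approximants to the countable set \<open>R\<close>, and countably many
  u nearly attain the norms of all its elements. Off a single null set every F in \<open>R\<close>
  then satisfies \<open>N F \<le> N (F - h t)\<close>, which forces \<open>N (h t)\<close> below
  twice the approximation error.\<close>

lemma eval_zero_imp_norm_zero:
  assumes h: "strongly_measurable V N S h" and z: "\<And>u. u \<in> X \<Longrightarrow> AE t in M. h t u = 0"
  shows "AE t in M. N (h t) = 0"
proof -
  obtain s where s: "\<And>n. simple_into V S (s n)" "AE t in M. (\<lambda>n. N (s n t - h t)) \<longlonglongrightarrow> 0" using h unfolding strongly_measurable_def by auto
  define R where "R = (\<Union>n. s n ` S)"
  have R: "countable R" unfolding R_def using s(1) by (intro countable_UN) (auto simp: simple_into_def countable_finite)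
  have RV: "R \<subseteq> V" unfolding R_def using s(1) by (auto simp: simple_into_in)
  have "\<forall>F\<in>R. \<forall>k::nat. \<exists>u\<in>X. NX u \<le> 1 \<and> N F - 1 / real (Suc k) < \<bar>F u\<bar>"
  proof (intro ballI allI)
    fix F k assume F: "F \<in> R"
    show "\<exists>u\<in>X. NX u \<le> 1 \<and> N F - 1 / real (Suc k) < \<bar>F u\<bar>"
    proof (rule ccontr)
      assume "\<not> ?thesis"
      then have "N F \<le> N F - 1 / real (Suc k)" by (intro X.dual_norm_least) force
      then show False by simp
    qed
  qed
  then obtain U where U: "\<And>F k. F \<in> R \<Longrightarrow> U F k \<in> X" "\<And>F k. F \<in> R \<Longrightarrow> NX (U F k) \<le> 1"
      "\<And>F k. F \<in> R \<Longrightarrow> N F - 1 / real (Suc k) < \<bar>F (U F k)\<bar>" by metis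
  have "AE t in M. \<forall>F\<in>R. \<forall>k. h t (U F k) = 0" using R z[OF U(1)] by (simp add: AE_ball_countable AE_all_countable)
  then show ?thesis using s(2) AE_space
  proof eventually_elim
    case (elim t)
    have t: "t \<in> S" using elim by simp
    have hV: "h t \<in> V" using h t by (rule smeas_in)
    have "N F \<le> N (F - h t)" if F: "F \<in> R" for F
    proof (rule LIMSEQ_le_const2)
      have "(\<lambda>k. N F - 1 / real (Suc k)) \<longlonglongrightarrow> N F - 0" by (intro tendsto_intros LIMSEQ_Suc lim_1_over_n)
      then show "(\<lambda>k. N F - 1 / real (Suc k)) \<longlonglongrightarrow> N F" by simp
      have "N F - 1 / real (Suc k) \<le> N (F - h t)" for k
      proof -
        have "\<bar>F (U F k)\<bar> = \<bar>(F - h t) (U F k)\<bar>" using elim(1) F by simp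
        also have "\<dots> \<le> N (F - h t) * NX (U F k)" using RV F U(1) hV by (intro X.dual_norm_bound diff_mem) auto
        also have "\<dots> \<le> N (F - h t) * 1" using U(2)[OF F] N_nonneg[OF diff_mem] RV F hV by (intro mult_left_mono) auto
        finally show ?thesis using U(3)[OF F, of k] by simp
      qed
      then show "\<exists>K. \<forall>k\<ge>K. N F - 1 / real (Suc k) \<le> N (F - h t)" by blast
    qed
    then have le: "N (s n t) \<le> N (s n t - h t)" for n using t by (auto simp: R_def)
    have b: "N (h t) \<le> 2 * N (s n t - h t)" for n using N_abs_diff[OF simple_into_in[OF s(1) t] hV, of n] le[of n] by linarith
    have "(\<lambda>n. 2 * N (s n t - h t)) \<longlonglongrightarrow> 2 * 0" by (intro tendsto_mult_left elim)
    then have "N (h t) \<le> 2 * 0" by (rule LIMSEQ_le_const) (use b in blast)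
    then show ?case using N_nonneg[OF hV] by simp
  qed
qed

lemma weak_derivative_unique:
  assumes v: "v \<in> bochner_L2 V N S" and g: "g \<in> bochner_L2 V N S" "is_weak_time_derivative V N S v g"
    and g': "g' \<in> bochner_L2 V N S" "is_weak_time_derivative V N S v g'"
  shows "AE t in M. N (g t - g' t) = 0"
proof (rule eval_zero_imp_norm_zero)
  show "strongly_measurable V N S (\<lambda>t. g t - g' t)" using bochner_L2_D(1)[OF g(1)] bochner_L2_D(1)[OF g'(1)] by (rule smeas_diff)
  fix u assume u: "u \<in> X"
  note ev = L2_eval[OF g(1) u] and ev' = L2_eval[OF g'(1) u]
  show "AE t in M. (g t - g' t) u = 0"
  proof (rule du_Bois_Reymond[OF open_S])
    fix a b :: real assume ab: "cbox a b \<subseteq> S"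
    have one: "integrable (lebesgue_on (cbox a b)) (\<lambda>_. 1 :: real)" by (simp add: integrable_restrict_space)
    have sub: "integrable (lebesgue_on (cbox a b)) (\<lambda>t. w t u)" if w: "(\<lambda>t. w t u) \<in> borel_measurable M" "integrable M (\<lambda>t. (w t u)^2)" for w :: "real \<Rightarrow> 'x \<Rightarrow> real"
    proof -
      have m: "(\<lambda>t. w t u) \<in> borel_measurable (lebesgue_on (cbox a b))" by (rule measurable_restrict_mono[OF w(1) ab])
      have "integrable (lebesgue_on (cbox a b)) (\<lambda>t. (w t u)^2)"
      proof -
        have "integrable lebesgue (\<lambda>t. indicator (cbox a b) t *\<^sub>R (indicator S t *\<^sub>R (w t u)^2))"
          by (rule integrable_mult_indicator) (use w(2) S_Int in \<open>auto simp: integrable_restrict_space\<close>)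
        moreover have "(\<lambda>t. indicator (cbox a b) t *\<^sub>R (indicator S t *\<^sub>R (w t u)^2)) = (\<lambda>t. indicator (cbox a b) t *\<^sub>R (w t u)^2)"
          using ab by (auto simp: indicator_def fun_eq_iff)
        ultimately have "integrable lebesgue (\<lambda>t. indicator (cbox a b) t *\<^sub>R (w t u)^2)" by (simp only:)
        then show ?thesis by (subst integrable_restrict_space) auto
      qed
      then have "integrable (lebesgue_on (cbox a b)) (\<lambda>t. (norm (w t u))^2)" by simp
      moreover have "integrable (lebesgue_on (cbox a b)) (\<lambda>_. (norm (1::real))^2)" using one by simp
      ultimately have "integrable (lebesgue_on (cbox a b)) (\<lambda>t. 1 \<bullet> w t u)" by (intro integrable_inner_square m) auto
      then show ?thesis by simp
    qed
    show "integrable (lebesgue_on (cbox a b)) (\<lambda>t. (g t - g' t) u)" using sub[of g, OF ev] sub[of g', OF ev'] by simp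
  next
    fix \<phi> :: "real \<Rightarrow> real" assume phi: "\<phi> \<in> test_functions S"
    note T = test_square_integrable[OF S phi]
    have i: "integrable M (\<lambda>t. \<phi> t * g t u)" "integrable M (\<lambda>t. \<phi> t * g' t u)"
      using integrable_inner_square[OF T(1) _ ev(1)] integrable_inner_square[OF T(1) _ ev'(1)] T(2) ev(2) ev'(2) by auto
    have "integral\<^sup>L M (\<lambda>t. \<phi> t * g t u) = integral\<^sup>L M (\<lambda>t. \<phi> t * g' t u)"
      using g(2) g'(2) phi u unfolding weak_derivative_iff[OF v g(1)] weak_derivative_iff[OF v g'(1)] by force
    then show "integral\<^sup>L M (\<lambda>t. (g t - g' t) u * \<phi> t) = 0" using i by (simp add: right_diff_distrib mult.commute)
  qed
qed

text \<open>Frees the H1 norm from the choice hidden in \<open>weak_time_derivative\<close>: any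
  explicit weak derivative computes it.\<close>

lemma weak_time_derivative_norm:
  assumes v: "v \<in> bochner_L2 V N S" and g: "g \<in> bochner_L2 V N S" "is_weak_time_derivative V N S v g"
  shows "bochner_L2_norm N S (weak_time_derivative V N S v) = bochner_L2_norm N S g"
proof -
  have "weak_time_derivative V N S v \<in> bochner_L2 V N S \<and> is_weak_time_derivative V N S v (weak_time_derivative V N S v)"
    unfolding weak_time_derivative_def by (rule someI[of _ g]) (use g in auto)
  then show ?thesis using weak_derivative_unique[OF v _ _ g] g by (intro L2_norm_cong_AE) auto
qed

end

section \<open>The K-method\<close>

locale interpolation_couple = A: seminormed_space X0 N0 + B: seminormed_space X1 N1
  for X0 X1 :: "'z::real_vector set" and N0 N1 :: "'z \<Rightarrow> real"
begin

abbreviation "K \<equiv> K_functional X0 N0 X1 N1"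

definition "decomposable w \<longleftrightarrow> (\<exists>w0\<in>X0. \<exists>w1\<in>X1. w = w0 + w1)"

lemma K_le: "0 \<le> s \<Longrightarrow> w0 \<in> X0 \<Longrightarrow> w1 \<in> X1 \<Longrightarrow> K s (w0 + w1) \<le> N0 w0 + s * N1 w1" unfolding K_functional_def
  by (intro cInf_lower bdd_belowI[of _ 0]) (auto intro!: add_nonneg_nonneg mult_nonneg_nonneg A.N_nonneg B.N_nonneg)

lemma K_greatest:
  assumes "decomposable w" "\<And>w0 w1. w0 \<in> X0 \<Longrightarrow> w1 \<in> X1 \<Longrightarrow> w = w0 + w1 \<Longrightarrow> b \<le> N0 w0 + s * N1 w1"
  shows "b \<le> K s w" unfolding K_functional_def using assms by (intro cInf_greatest) (auto simp: decomposable_def)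

lemma K_nonneg: "0 \<le> s \<Longrightarrow> decomposable w \<Longrightarrow> 0 \<le> K s w"
  by (rule K_greatest) (auto intro!: add_nonneg_nonneg mult_nonneg_nonneg A.N_nonneg B.N_nonneg)

lemma K_mono: "0 \<le> s \<Longrightarrow> s \<le> t \<Longrightarrow> decomposable w \<Longrightarrow> K s w \<le> K t w"
proof (rule K_greatest)
  fix w0 w1 assume h: "0 \<le> s" "s \<le> t" "w0 \<in> X0" "w1 \<in> X1" "w = w0 + w1"
  have "K s w \<le> N0 w0 + s * N1 w1" unfolding h(5) by (intro K_le h)
  also have "\<dots> \<le> N0 w0 + t * N1 w1" using h B.N_nonneg by (intro add_left_mono mult_right_mono) auto
  finally show "K s w \<le> N0 w0 + t * N1 w1" .
qed

lemma decomposable_add: "decomposable u \<Longrightarrow> decomposable v \<Longrightarrow> decomposable (u + v)" unfolding decomposable_def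
proof (elim bexE)
  fix u0 u1 v0 v1 assume h: "u0 \<in> X0" "u1 \<in> X1" "u = u0 + u1" "v0 \<in> X0" "v1 \<in> X1" "v = v0 + v1"
  have "u + v = (u0 + v0) + (u1 + v1)" using h by (simp add: algebra_simps)
  then show "\<exists>w0\<in>X0. \<exists>w1\<in>X1. u + v = w0 + w1" using h A.add_mem B.add_mem by blast
qed

lemma decomposable_scale: "decomposable u \<Longrightarrow> decomposable (c *\<^sub>R u)"
  unfolding decomposable_def by (metis A.scale_mem B.scale_mem scaleR_add_right)

lemma K_scale_le: assumes "0 \<le> s" "decomposable u" shows "K s (c *\<^sub>R u) \<le> \<bar>c\<bar> * K s u"
proof (cases "c = 0")
  case True
  then show ?thesis using K_le[OF assms(1) A.zero_mem B.zero_mem] by (simp add: A.N_zero B.N_zero)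
next
  case False
  have "K s (c *\<^sub>R u) / \<bar>c\<bar> \<le> K s u"
  proof (rule K_greatest[OF assms(2)])
    fix w0 w1 assume h: "w0 \<in> X0" "w1 \<in> X1" "u = w0 + w1"
    have "K s (c *\<^sub>R w0 + c *\<^sub>R w1) \<le> N0 (c *\<^sub>R w0) + s * N1 (c *\<^sub>R w1)" by (intro K_le assms A.scale_mem B.scale_mem h)
    also have "\<dots> = \<bar>c\<bar> * (N0 w0 + s * N1 w1)" by (simp add: A.N_scale B.N_scale h algebra_simps)
    finally show "K s (c *\<^sub>R u) / \<bar>c\<bar> \<le> N0 w0 + s * N1 w1" using False h(3) by (simp add: scaleR_add_right divide_le_eq mult.commute)
  qed
  then show ?thesis using False by (simp add: divide_le_eq mult.commute)
qed

lemma K_scale: assumes "0 \<le> s" "decomposable u" shows "K s (c *\<^sub>R u) = \<bar>c\<bar> * K s u"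
proof (cases "c = 0")
  case True
  then show ?thesis using K_scale_le[OF assms, of 0] K_nonneg[OF assms(1) decomposable_scale[OF assms(2)], of 0] by simp
next
  case False
  have "K s u \<le> \<bar>1 / c\<bar> * K s (c *\<^sub>R u)" using K_scale_le[OF assms(1) decomposable_scale[OF assms(2)], of "1 / c" c] False by simp
  then have "\<bar>c\<bar> * K s u \<le> K s (c *\<^sub>R u)" using False by (simp add: field_simps)
  then show ?thesis using K_scale_le[OF assms, of c] by simp
qed

lemma K_add: assumes "0 \<le> s" "decomposable u" "decomposable v" shows "K s (u + v) \<le> K s u + K s v"
proof -
  have "K s (u + v) - K s v \<le> K s u"
  proof (rule K_greatest[OF assms(2)])
    fix u0 u1 assume u: "u0 \<in> X0" "u1 \<in> X1" "u = u0 + u1"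
    have "K s (u + v) - (N0 u0 + s * N1 u1) \<le> K s v"
    proof (rule K_greatest[OF assms(3)])
      fix v0 v1 assume v: "v0 \<in> X0" "v1 \<in> X1" "v = v0 + v1"
      have "K s ((u0 + v0) + (u1 + v1)) \<le> N0 (u0 + v0) + s * N1 (u1 + v1)" by (intro K_le assms A.add_mem B.add_mem u v)
      also have "\<dots> \<le> (N0 u0 + N0 v0) + s * (N1 u1 + N1 v1)" by (intro add_mono mult_left_mono A.N_triangle B.N_triangle u v assms)
      finally have "K s ((u0 + v0) + (u1 + v1)) \<le> (N0 u0 + N0 v0) + s * (N1 u1 + N1 v1)" .
      moreover have "u + v = (u0 + v0) + (u1 + v1)" using u v by (simp add: algebra_simps)
      ultimately show "K s (u + v) - (N0 u0 + s * N1 u1) \<le> N0 v0 + s * N1 v1" by (simp add: algebra_simps)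
    qed
    then show "K s (u + v) - K s v \<le> N0 u0 + s * N1 u1" by simp
  qed
  then show ?thesis by simp
qed

text \<open>The K-functional is monotone in s, hence Borel.\<close>

lemma K_measurable: assumes "decomposable w" shows "(\<lambda>s. K s w) \<in> borel_measurable (lebesgue_on {0<..})"
proof -
  have "mono_on {0<..} (\<lambda>s. K s w)" using K_mono assms by (auto simp: mono_on_def)
  then have "(\<lambda>s. K s w) \<in> borel_measurable (restrict_space borel {0<..})" by (rule borel_measurable_mono_on_fnc)
  then have "(\<lambda>s. indicator {0<..} s *\<^sub>R K s w) \<in> borel_measurable borel" by (subst (asm) borel_measurable_restrict_space_iff) auto
  then have "(\<lambda>s. indicator {0<..} s *\<^sub>R K s w) \<in> borel_measurable lebesgue" by (intro measurable_completion) simp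
  then show ?thesis by (subst borel_measurable_restrict_space_iff) auto
qed

lemma interp_measurable:
  assumes "decomposable w" shows "(\<lambda>s. (s powr (- \<theta>) * K s w)^2 / s) \<in> borel_measurable (lebesgue_on {0<..})"
proof -
  have [measurable]: "(\<lambda>s::real. s) \<in> borel_measurable (lebesgue_on {0<..})"
    by (intro measurable_restrict_space1 measurable_completion) simp
  note K_measurable[OF assms, measurable]
  show ?thesis by measurable
qed

lemma interp_space_iff: "w \<in> interp_space X0 N0 X1 N1 \<theta> \<longleftrightarrow> decomposable w \<and>
    integrable (lebesgue_on {0<..}) (\<lambda>s. (s powr (- \<theta>) * K s w)^2 / s)" by (simp add: interp_space_def decomposable_def)

lemma interp_space_scale:
  assumes u: "u \<in> interp_space X0 N0 X1 N1 \<theta>"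
  shows "c *\<^sub>R u \<in> interp_space X0 N0 X1 N1 \<theta>"
    "interp_norm X0 N0 X1 N1 \<theta> (c *\<^sub>R u) = \<bar>c\<bar> * interp_norm X0 N0 X1 N1 \<theta> u"
proof -
  have d: "decomposable u" using u by (simp add: interp_space_iff)
  have eq: "(s powr (- \<theta>) * K s (c *\<^sub>R u))^2 / s = c^2 * ((s powr (- \<theta>) * K s u)^2 / s)" if "s \<in> space (lebesgue_on {0<..})" for s
    using that by (simp add: K_scale d power_mult_distrib)
  have "integrable (lebesgue_on {0<..}) (\<lambda>s. c^2 * ((s powr (- \<theta>) * K s u)^2 / s))"
    by (rule integrable_mult_right) (use u in \<open>simp add: interp_space_iff\<close>)
  then have "integrable (lebesgue_on {0<..}) (\<lambda>s. (s powr (- \<theta>) * K s (c *\<^sub>R u))^2 / s)"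
    by (subst Bochner_Integration.integrable_cong[OF refl eq])
  then show "c *\<^sub>R u \<in> interp_space X0 N0 X1 N1 \<theta>" using decomposable_scale[OF d] by (simp add: interp_space_iff)
  have "integral\<^sup>L (lebesgue_on {0<..}) (\<lambda>s. (s powr (- \<theta>) * K s (c *\<^sub>R u))^2 / s)
    = integral\<^sup>L (lebesgue_on {0<..}) (\<lambda>s. c^2 * ((s powr (- \<theta>) * K s u)^2 / s))" by (rule Bochner_Integration.integral_cong[OF refl eq])
  also have "\<dots> = c^2 * integral\<^sup>L (lebesgue_on {0<..}) (\<lambda>s. (s powr (- \<theta>) * K s u)^2 / s)" by (rule integral_mult_right_zero)
  finally show "interp_norm X0 N0 X1 N1 \<theta> (c *\<^sub>R u) = \<bar>c\<bar> * interp_norm X0 N0 X1 N1 \<theta> u" by (simp add: interp_norm_def real_sqrt_mult)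
qed

lemma interp_norm_nonneg: "0 \<le> interp_norm X0 N0 X1 N1 \<theta> u"
  unfolding interp_norm_def by (intro real_sqrt_ge_zero integral_nonneg_AE AE_I2) simp

text \<open>The exponent \<open>- 2 * \<theta> - 1\<close> collects the squared weight and the
  measure ds/s. With a majorant of the squared K-functional, one concrete splitting for each s gives
  membership and the norm bound at once.\<close>

lemma interp_spaceI:
  assumes d: "decomposable w" and B: "\<And>s. s > 0 \<Longrightarrow> (K s w)^2 \<le> B s"
    and le: "(\<integral>\<^sup>+s. ennreal (if 0 < s then s powr (- 2 * \<theta> - 1) * B s else 0) \<partial>lborel) \<le> ennreal C" and C: "0 \<le> C"
  shows "w \<in> interp_space X0 N0 X1 N1 \<theta>" "interp_norm X0 N0 X1 N1 \<theta> w \<le> sqrt C"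
proof -
  let ?f = "\<lambda>s. (s powr (- \<theta>) * K s w)^2 / s"
  have f: "?f s \<le> s powr (- 2 * \<theta> - 1) * B s" if s: "s > 0" for s
  proof -
    have "?f s = s powr (- 2 * \<theta> - 1) * (K s w)^2"
    proof -
      have "(s powr (- \<theta>))^2 = s powr (- 2 * \<theta>)" using s by (simp add: power2_eq_square flip: powr_add)
      then show ?thesis using s by (simp add: power_mult_distrib powr_diff)
    qed
    then show ?thesis using B[OF s] by (simp add: mult_left_mono)
  qed
  have "(\<integral>\<^sup>+s. ennreal (?f s) \<partial>lebesgue_on {0<..}) = (\<integral>\<^sup>+s. ennreal (?f s) * indicator {0<..} s \<partial>lebesgue)"
    by (rule nn_integral_restrict_space) simp
  also have "\<dots> \<le> (\<integral>\<^sup>+s. ennreal (if 0 < s then s powr (- 2 * \<theta> - 1) * B s else 0) \<partial>lebesgue)"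
    using f by (intro nn_integral_mono) (auto simp: indicator_def intro!: ennreal_leI)
  also have "\<dots> \<le> ennreal C" using le by (simp add: nn_integral_completion)
  finally have bound: "(\<integral>\<^sup>+s. ennreal (?f s) \<partial>lebesgue_on {0<..}) \<le> ennreal C" .
  have nn: "AE s in lebesgue_on {0<..}. 0 \<le> ?f s" by (rule AE_I2) simp
  have int: "integrable (lebesgue_on {0<..}) ?f"
    using bound by (intro integrableI_nonneg interp_measurable d nn) (auto intro: order_le_less_trans)
  then show "w \<in> interp_space X0 N0 X1 N1 \<theta>" using d by (simp add: interp_space_iff)
  have "ennreal (integral\<^sup>L (lebesgue_on {0<..}) ?f) \<le> ennreal C" using bound nn_integral_eq_integral[OF int nn] by simp
  then have "integral\<^sup>L (lebesgue_on {0<..}) ?f \<le> C" using C by simp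
  then show "interp_norm X0 N0 X1 N1 \<theta> w \<le> sqrt C" unfolding interp_norm_def by (rule real_sqrt_le_mono)
qed

end

text \<open>The interpolation property: an additive map carries a splitting of \<open>w\<close> to a
  splitting of the image that costs no more, so the K-functionals compare at every s.\<close>

lemma interp_map:
  assumes AB: "interpolation_couple X0 X1 N0 N1" and CD: "interpolation_couple Y0 Y1 M0 M1"
    and E: "\<And>u v. E (u + v) = E u + E v"
    and E0: "\<And>u. u \<in> X0 \<Longrightarrow> E u \<in> Y0 \<and> M0 (E u) \<le> N0 u"
    and E1: "\<And>u. u \<in> X1 \<Longrightarrow> E u \<in> Y1 \<and> M1 (E u) \<le> N1 u"
    and w: "w \<in> interp_space X0 N0 X1 N1 \<theta>"
  shows "E w \<in> interp_space Y0 M0 Y1 M1 \<theta>" "interp_norm Y0 M0 Y1 M1 \<theta> (E w) \<le> interp_norm X0 N0 X1 N1 \<theta> w"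
proof -
  interpret A: interpolation_couple X0 X1 N0 N1 by fact
  interpret C: interpolation_couple Y0 Y1 M0 M1 by fact
  have dw: "A.decomposable w" using w by (simp add: A.interp_space_iff)
  then have dE: "C.decomposable (E w)" unfolding A.decomposable_def C.decomposable_def using E E0 E1 by metis
  have le: "C.K s (E w) \<le> A.K s w" if s: "s > 0" for s
  proof (rule A.K_greatest[OF dw])
    fix w0 w1 assume h: "w0 \<in> X0" "w1 \<in> X1" "w = w0 + w1"
    have "C.K s (E w0 + E w1) \<le> M0 (E w0) + s * M1 (E w1)" using s E0 E1 h by (intro C.K_le) auto
    also have "\<dots> \<le> N0 w0 + s * N1 w1" using s E0 E1 h by (intro add_mono mult_left_mono) auto
    finally show "C.K s (E w) \<le> N0 w0 + s * N1 w1" by (simp add: h(3) E)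
  qed
  have le2: "(s powr (- \<theta>) * C.K s (E w))^2 / s \<le> (s powr (- \<theta>) * A.K s w)^2 / s" if s: "s \<in> space (lebesgue_on {0<..})" for s
    using s le[of s] C.K_nonneg[OF _ dE, of s] by (auto intro!: divide_right_mono power_mono mult_left_mono)
  have int: "integrable (lebesgue_on {0<..}) (\<lambda>s. (s powr (- \<theta>) * A.K s w)^2 / s)" using w by (simp add: A.interp_space_iff)
  have intE: "integrable (lebesgue_on {0<..}) (\<lambda>s. (s powr (- \<theta>) * C.K s (E w))^2 / s)"
    by (rule Bochner_Integration.integrable_bound[OF int C.interp_measurable[OF dE]])
      (use le2 in \<open>auto intro!: AE_I2\<close>)
  then show "E w \<in> interp_space Y0 M0 Y1 M1 \<theta>" using dE by (simp add: C.interp_space_iff)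
  show "interp_norm Y0 M0 Y1 M1 \<theta> (E w) \<le> interp_norm X0 N0 X1 N1 \<theta> w"
    unfolding interp_norm_def by (intro real_sqrt_le_mono integral_mono intE int le2)
qed

lemma einterval_0: "einterval 0 (ereal T) = {0<..<T}" "einterval 0 \<infinity> = {0<..}" by (auto simp: zero_ereal_def einterval_def)

lemma tendsto_at_left_ereal_iff:
  "((\<lambda>t. f (real_of_ereal t)) \<longlongrightarrow> (0::real)) (at_left (ereal T)) \<longleftrightarrow> (f \<longlongrightarrow> 0) (at_left T)"
  by (simp add: at_left_ereal tendsto_compose_filtermap filterlim_filtermap)

lemma tendsto_at_left_infty:
  assumes "\<And>t. t \<ge> T \<Longrightarrow> f t = 0"
  shows "((\<lambda>t. f (real_of_ereal t)) \<longlongrightarrow> (0::real)) (at_left \<infinity>)"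
proof -
  have "(f \<longlongrightarrow> 0) at_top" by (rule tendsto_eventually, rule eventually_mono[OF eventually_ge_at_top[of T]]) (rule assms)
  then show ?thesis by (simp add: at_left_PInf filterlim_filtermap)
qed

context dual_bochner
begin

lemma weak_derivative_add:
  assumes "v \<in> bochner_L2 V N S" "g \<in> bochner_L2 V N S" "is_weak_time_derivative V N S v g"
    "v' \<in> bochner_L2 V N S" "g' \<in> bochner_L2 V N S" "is_weak_time_derivative V N S v' g'"
  shows "is_weak_time_derivative V N S (v + v') (g + g')"
proof -
  interpret L: seminormed_space "bochner_L2 V N S" "bochner_L2_norm N S" by (rule L2_seminormed)
  have i: "integrable M (\<lambda>t. \<phi> t * w t u)" if "\<phi> \<in> test_functions S'" "w \<in> bochner_L2 V N S" "u \<in> X" for \<phi> S' w u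
    using integrable_inner_square[OF test_square_integrable(1)[OF S that(1)] _ L2_eval(1)[OF that(2,3)]]
      test_square_integrable(2)[OF S that(1)] L2_eval(2)[OF that(2,3)] by simp
  show ?thesis unfolding weak_derivative_iff[OF L.add_mem[OF assms(1,4)] L.add_mem[OF assms(2,5)]]
  proof (intro ballI)
    fix \<phi> u assume phi: "\<phi> \<in> test_functions S" and u: "u \<in> X"
    have "integral\<^sup>L M (\<lambda>t. deriv \<phi> t * (v + v') t u) = integral\<^sup>L M (\<lambda>t. deriv \<phi> t * v t u) + integral\<^sup>L M (\<lambda>t. deriv \<phi> t * v' t u)"
      using i[OF test_deriv(2)[OF phi] assms(1) u] i[OF test_deriv(2)[OF phi] assms(4) u] by (simp add: distrib_left)
    also have "\<dots> = - integral\<^sup>L M (\<lambda>t. \<phi> t * g t u) + - integral\<^sup>L M (\<lambda>t. \<phi> t * g' t u)"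
      using assms(3,6) phi u unfolding weak_derivative_iff[OF assms(1,2)] weak_derivative_iff[OF assms(4,5)] by simp
    also have "\<dots> = - integral\<^sup>L M (\<lambda>t. \<phi> t * (g + g') t u)" using i[OF phi assms(2) u] i[OF phi assms(5) u] by (simp add: distrib_left)
    finally show "integral\<^sup>L M (\<lambda>t. deriv \<phi> t * (v + v') t u) = - integral\<^sup>L M (\<lambda>t. \<phi> t * (g + g') t u)" .
  qed
qed

lemma weak_derivative_scale:
  assumes "v \<in> bochner_L2 V N S" "g \<in> bochner_L2 V N S" "is_weak_time_derivative V N S v g"
  shows "is_weak_time_derivative V N S (c *\<^sub>R v) (c *\<^sub>R g)"
proof -
  interpret L: seminormed_space "bochner_L2 V N S" "bochner_L2_norm N S" by (rule L2_seminormed)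
  have e: "deriv \<phi> t * (c *\<^sub>R v) t u = c * (deriv \<phi> t * v t u)" "\<phi> t * (c *\<^sub>R g) t u = c * (\<phi> t * g t u)" for \<phi> t u
    by (simp_all add: scaleR_fun_def)
  show ?thesis unfolding weak_derivative_iff[OF L.scale_mem[OF assms(1)] L.scale_mem[OF assms(2)]] e
    using assms(3) unfolding weak_derivative_iff[OF assms(1,2)] by simp
qed

end

section \<open>First order and interpolation spaces in time for dual-valued functions\<close>

locale dual_time = X: seminormed_space X NX
  for X :: "'x::real_vector set" and NX :: "'x \<Rightarrow> real"
begin

abbreviation "V \<equiv> dual_space X NX"
abbreviation "N \<equiv> dual_norm X NX"

sublocale D: seminormed_space V N by (rule X.dual_seminormed)

lemma dual_bochner: "open S \<Longrightarrow> dual_bochner X NX S" by unfold_locales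

definition "cont_rep S b v c \<longleftrightarrow> (\<forall>t\<in>S. c t \<in> V) \<and>
  (\<forall>t\<in>S. ((\<lambda>s. N (c s - c t)) \<longlongrightarrow> 0) (at t within S)) \<and>
  (AE t in lebesgue_on S. N (v t - c t) = 0) \<and> ((\<lambda>t. N (c (real_of_ereal t))) \<longlongrightarrow> 0) (at_left b)"

lemma H1_right_iff: "v \<in> H1_right V N a b \<longleftrightarrow> v \<in> bochner_L2 V N (einterval a b) \<and>
   (\<exists>g\<in>bochner_L2 V N (einterval a b). is_weak_time_derivative V N (einterval a b) v g) \<and>
   (\<exists>c. cont_rep (einterval a b) b v c)" by (simp add: H1_right_def cont_rep_def)

lemma H1_right_norm_eq:
  assumes "v \<in> bochner_L2 V N (einterval a b)" "g \<in> bochner_L2 V N (einterval a b)"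
    "is_weak_time_derivative V N (einterval a b) v g"
  shows "H1_right_norm V N a b v = bochner_L2_norm N (einterval a b) g"
proof -
  interpret B: dual_bochner X NX "einterval a b" by (rule dual_bochner) simp
  show ?thesis unfolding H1_right_norm_def by (rule B.weak_time_derivative_norm[OF assms])
qed

lemma eventually_einterval: assumes "a < b" shows "\<forall>\<^sub>F t in at_left b. real_of_ereal t \<in> einterval a b"
proof -
  have "\<forall>\<^sub>F t in at_left b. t \<in> {a<..<b}" using assms by (rule eventually_at_leftI[rotated]) auto
  then show ?thesis by eventually_elim (auto simp: einterval_def ereal_real)
qed

lemma cont_rep_add:
  assumes ab: "a < b" and c: "cont_rep (einterval a b) b v c" "cont_rep (einterval a b) b v' c'"
    and v: "\<And>t. t \<in> einterval a b \<Longrightarrow> v t \<in> V" "\<And>t. t \<in> einterval a b \<Longrightarrow> v' t \<in> V"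
  shows "cont_rep (einterval a b) b (v + v') (c + c')"
proof -
  let ?S = "einterval a b"
  have mem: "c t \<in> V" "c' t \<in> V" if "t \<in> ?S" for t using c that by (auto simp: cont_rep_def)
  show ?thesis unfolding cont_rep_def
  proof (intro conjI ballI)
    fix t assume t: "t \<in> ?S"
    show "(c + c') t \<in> V" using mem[OF t] by (simp add: D.add_mem)
    have l: "((\<lambda>s. N (c s - c t) + N (c' s - c' t)) \<longlongrightarrow> 0) (at t within ?S)"
      using tendsto_add[of "\<lambda>s. N (c s - c t)" 0 _ "\<lambda>s. N (c' s - c' t)" 0] c t by (simp add: cont_rep_def)
    show "((\<lambda>s. N ((c + c') s - (c + c') t)) \<longlongrightarrow> 0) (at t within ?S)"
    proof (rule tendsto_sandwich[OF _ _ tendsto_const l])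
      show "\<forall>\<^sub>F s in at t within ?S. 0 \<le> N ((c + c') s - (c + c') t)" unfolding eventually_at_filter
      proof (intro always_eventually allI impI)
        fix s assume "s \<in> ?S"
        then show "0 \<le> N ((c + c') s - (c + c') t)" using mem t by (simp add: D.N_nonneg D.diff_mem D.add_mem)
      qed
      show "\<forall>\<^sub>F s in at t within ?S. N ((c + c') s - (c + c') t) \<le> N (c s - c t) + N (c' s - c' t)" unfolding eventually_at_filter
      proof (intro always_eventually allI impI)
        fix s assume "s \<in> ?S"
        then have "N ((c s - c t) + (c' s - c' t)) \<le> N (c s - c t) + N (c' s - c' t)" using mem t by (intro D.N_triangle D.diff_mem) auto
        moreover have "(c + c') s - (c + c') t = (c s - c t) + (c' s - c' t)" by (simp add: algebra_simps)
        ultimately show "N ((c + c') s - (c + c') t) \<le> N (c s - c t) + N (c' s - c' t)" by (simp only:)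
      qed
    qed
  next
    have "AE t in lebesgue_on ?S. N (v t - c t) = 0" "AE t in lebesgue_on ?S. N (v' t - c' t) = 0" using c by (auto simp: cont_rep_def)
    then show "AE t in lebesgue_on ?S. N ((v + v') t - (c + c') t) = 0" using AE_space
    proof eventually_elim
      case (elim t)
      then have t: "t \<in> ?S" by simp
      have "N ((v t - c t) + (v' t - c' t)) \<le> 0" using D.N_triangle[of "v t - c t" "v' t - c' t"] elim mem[OF t] v[OF t]
        by (simp add: D.diff_mem)
      moreover have "(v + v') t - (c + c') t = (v t - c t) + (v' t - c' t)" by (simp add: algebra_simps)
      moreover have "0 \<le> N ((v t - c t) + (v' t - c' t))" using mem[OF t] v[OF t] by (intro D.N_nonneg D.add_mem D.diff_mem)
      ultimately show ?case by (simp only:)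
    qed
  next
    have l: "((\<lambda>t. N (c (real_of_ereal t)) + N (c' (real_of_ereal t))) \<longlongrightarrow> 0) (at_left b)"
      using tendsto_add[of "\<lambda>t. N (c (real_of_ereal t))" 0 "at_left b" "\<lambda>t. N (c' (real_of_ereal t))" 0] c by (simp add: cont_rep_def)
    show "((\<lambda>t. N ((c + c') (real_of_ereal t))) \<longlongrightarrow> 0) (at_left b)"
    proof (rule tendsto_sandwich[OF _ _ tendsto_const l])
      show "\<forall>\<^sub>F t in at_left b. 0 \<le> N ((c + c') (real_of_ereal t))"
        using eventually_einterval[OF ab] by eventually_elim (simp add: mem D.N_nonneg D.add_mem)
      show "\<forall>\<^sub>F t in at_left b. N ((c + c') (real_of_ereal t)) \<le> N (c (real_of_ereal t)) + N (c' (real_of_ereal t))"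
        using eventually_einterval[OF ab] by eventually_elim (simp add: mem D.N_triangle)
    qed
  qed
qed

lemma cont_rep_scale:
  assumes ab: "a < b" and c: "cont_rep (einterval a b) b v c" and v: "\<And>t. t \<in> einterval a b \<Longrightarrow> v t \<in> V"
  shows "cont_rep (einterval a b) b (k *\<^sub>R v) (k *\<^sub>R c)"
proof -
  let ?S = "einterval a b"
  have mem: "c t \<in> V" if "t \<in> ?S" for t using c that by (auto simp: cont_rep_def)
  have e: "(k *\<^sub>R f) t = k *\<^sub>R f t" for f :: "real \<Rightarrow> 'x \<Rightarrow> real" and t by (simp add: scaleR_fun_def[of k f])
  have d: "N (k *\<^sub>R x - k *\<^sub>R y) = \<bar>k\<bar> * N (x - y)" if "x \<in> V" "y \<in> V" for x y
    using D.N_scale[OF D.diff_mem[OF that], of k] by (simp add: scaleR_diff_right)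
  show ?thesis unfolding cont_rep_def e
  proof (intro conjI ballI)
    fix t assume t: "t \<in> ?S"
    show "k *\<^sub>R c t \<in> V" using mem[OF t] by (rule D.scale_mem)
    have "((\<lambda>s. \<bar>k\<bar> * N (c s - c t)) \<longlongrightarrow> \<bar>k\<bar> * 0) (at t within ?S)" using c t by (intro tendsto_mult_left) (simp add: cont_rep_def)
    then have "((\<lambda>s. \<bar>k\<bar> * N (c s - c t)) \<longlongrightarrow> 0) (at t within ?S)" by simp
    then show "((\<lambda>s. N (k *\<^sub>R c s - k *\<^sub>R c t)) \<longlongrightarrow> 0) (at t within ?S)"
      by (rule Lim_transform_eventually) (use mem t d in \<open>auto simp: eventually_at_filter intro!: always_eventually\<close>)
  next
    have "AE t in lebesgue_on ?S. N (v t - c t) = 0" using c by (auto simp: cont_rep_def)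
    then show "AE t in lebesgue_on ?S. N (k *\<^sub>R v t - k *\<^sub>R c t) = 0" using AE_space by eventually_elim (simp add: d mem v)
  next
    have "((\<lambda>t. \<bar>k\<bar> * N (c (real_of_ereal t))) \<longlongrightarrow> \<bar>k\<bar> * 0) (at_left b)" using c by (intro tendsto_mult_left) (simp add: cont_rep_def)
    then have "((\<lambda>t. \<bar>k\<bar> * N (c (real_of_ereal t))) \<longlongrightarrow> 0) (at_left b)" by simp
    then show "((\<lambda>t. N (k *\<^sub>R c (real_of_ereal t))) \<longlongrightarrow> 0) (at_left b)" by (rule Lim_transform_eventually)
        (use eventually_einterval[OF ab] in eventually_elim, simp add: mem D.N_scale)
  qed
qed

lemma H1_seminormed:
  assumes ab: "a < b"
  shows "seminormed_space (H1_right V N a b) (H1_right_norm V N a b)"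
proof -
  let ?S = "einterval a b"
  interpret B: dual_bochner X NX ?S by (rule dual_bochner) simp
  interpret L: seminormed_space "bochner_L2 V N ?S" "bochner_L2_norm N ?S" by (rule B.L2_seminormed)
  have DH: "\<exists>g c. v \<in> bochner_L2 V N ?S \<and> g \<in> bochner_L2 V N ?S \<and> is_weak_time_derivative V N ?S v g \<and> cont_rep ?S b v c \<and>
      H1_right_norm V N a b v = bochner_L2_norm N ?S g" if "v \<in> H1_right V N a b" for v
    using that unfolding H1_right_iff using H1_right_norm_eq by blast
  show ?thesis
  proof
    fix v assume "v \<in> H1_right V N a b"
    then obtain g c where v: "v \<in> bochner_L2 V N ?S" "g \<in> bochner_L2 V N ?S" "is_weak_time_derivative V N ?S v g"
      "cont_rep ?S b v c" "H1_right_norm V N a b v = bochner_L2_norm N ?S g" using DH by blast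
    have vt: "v t \<in> V" if "t \<in> ?S" for t using B.bochner_L2_D(3)[OF v(1) that] .
    show "0 \<le> H1_right_norm V N a b v" unfolding v(5) by (rule L.N_nonneg[OF v(2)])
    fix k
    have kw: "is_weak_time_derivative V N ?S (k *\<^sub>R v) (k *\<^sub>R g)" by (rule B.weak_derivative_scale[OF v(1-3)])
    show "k *\<^sub>R v \<in> H1_right V N a b" unfolding H1_right_iff
      using L.scale_mem[OF v(1)] L.scale_mem[OF v(2)] kw cont_rep_scale[OF ab v(4) vt] by blast
    show "H1_right_norm V N a b (k *\<^sub>R v) = \<bar>k\<bar> * H1_right_norm V N a b v"
      unfolding H1_right_norm_eq[OF L.scale_mem[OF v(1)] L.scale_mem[OF v(2)] kw] v(5) by (rule L.N_scale[OF v(2)])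
    fix v' assume "v' \<in> H1_right V N a b"
    then obtain g' c' where v': "v' \<in> bochner_L2 V N ?S" "g' \<in> bochner_L2 V N ?S" "is_weak_time_derivative V N ?S v' g'"
      "cont_rep ?S b v' c'" "H1_right_norm V N a b v' = bochner_L2_norm N ?S g'" using DH by blast
    have vt': "v' t \<in> V" if "t \<in> ?S" for t using B.bochner_L2_D(3)[OF v'(1) that] .
    have w: "is_weak_time_derivative V N ?S (v + v') (g + g')" by (rule B.weak_derivative_add[OF v(1-3) v'(1-3)])
    show "v + v' \<in> H1_right V N a b" unfolding H1_right_iff
      using L.add_mem[OF v(1) v'(1)] L.add_mem[OF v(2) v'(2)] w cont_rep_add[OF ab v(4) v'(4) vt vt'] by blast
    show "H1_right_norm V N a b (v + v') \<le> H1_right_norm V N a b v + H1_right_norm V N a b v'"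
      unfolding H1_right_norm_eq[OF L.add_mem[OF v(1) v'(1)] L.add_mem[OF v(2) v'(2)] w] v(5) v'(5) by (rule L.N_triangle[OF v(2) v'(2)])
  next
    have z: "is_weak_time_derivative V N ?S 0 0" unfolding B.weak_derivative_iff[OF L.zero_mem L.zero_mem] by simp
    have "cont_rep ?S b 0 0" unfolding cont_rep_def by (simp add: D.zero_mem D.N_zero)
    then show "0 \<in> H1_right V N a b" unfolding H1_right_iff using L.zero_mem z by blast
  qed
qed

lemma couple:
  assumes ab: "a < b"
  shows "interpolation_couple (bochner_L2 V N (einterval a b)) (H1_right V N a b)
     (bochner_L2_norm N (einterval a b)) (H1_right_norm V N a b)"
proof -
  interpret B: dual_bochner X NX "einterval a b" by (rule dual_bochner) simp
  interpret L: seminormed_space "bochner_L2 V N (einterval a b)" "bochner_L2_norm N (einterval a b)" by (rule B.L2_seminormed)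
  interpret H: seminormed_space "H1_right V N a b" "H1_right_norm V N a b" by (rule H1_seminormed[OF ab])
  show ?thesis by unfold_locales
qed

end

section \<open>Extension by zero in time\<close>

lemma test_bounded:
  fixes \<phi> :: "'a::euclidean_space \<Rightarrow> real"
  assumes phi: "\<phi> \<in> test_functions S"
  obtains P where "0 < P" "\<And>x. \<bar>\<phi> x\<bar> \<le> P"
proof -
  define K where "K = closure {x. \<phi> x \<noteq> 0}"
  have K: "compact K" using phi by (simp add: K_def test_functions_def)
  have c: "continuous_on UNIV \<phi>" using test_smooth[OF phi] by (rule Ck_continuous[of 0])
  have "bounded (\<phi> ` K)" using K by (intro compact_imp_bounded compact_continuous_image continuous_on_subset[OF c]) auto
  then obtain B where B: "\<And>x. x \<in> K \<Longrightarrow> norm (\<phi> x) \<le> B" unfolding bounded_iff by auto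
  show ?thesis
  proof
    fix x show "\<bar>\<phi> x\<bar> \<le> \<bar>B\<bar> + 1"
    proof (cases "x \<in> K")
      case True then show ?thesis using B[of x] by simp
    next
      case False
      then have "\<phi> x = 0" using closure_subset[of "{x. \<phi> x \<noteq> 0}"] by (auto simp: K_def)
      then show ?thesis by simp
    qed
  qed simp
qed

lemma test_mult_integrable:
  assumes S: "S \<in> sets lebesgue" and phi: "\<phi> \<in> test_functions S'"
    and f: "f \<in> borel_measurable (lebesgue_on S)" "integrable (lebesgue_on S) (\<lambda>x. (f x)^2)"
  shows "integrable (lebesgue_on S) (\<lambda>x. \<phi> x * f x)" using integrable_inner_square[OF test_square_integrable(1)[OF S phi] _ f(1)]
    test_square_integrable(2)[OF S phi] f(2) by simp

lemma restrict_subset: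
  assumes S: "S \<in> sets lebesgue" "S2 \<in> sets lebesgue" "S \<subseteq> S2"
  shows "AE t in lebesgue_on S2. P t \<Longrightarrow> AE t in lebesgue_on S. P t"
    and "integrable (lebesgue_on S2) h \<Longrightarrow> integrable (lebesgue_on S) (h :: 'a::euclidean_space \<Rightarrow> real)"
proof -
  show "AE t in lebesgue_on S2. P t \<Longrightarrow> AE t in lebesgue_on S. P t" using S by (auto simp: AE_restrict_space_iff elim!: eventually_mono)
  assume h: "integrable (lebesgue_on S2) h"
  have "integrable lebesgue (\<lambda>t. indicator S t *\<^sub>R (indicator S2 t *\<^sub>R h t))"
    by (rule integrable_mult_indicator) (use S h in \<open>auto simp: integrable_restrict_space\<close>)
  moreover have "(\<lambda>t. indicator S t *\<^sub>R (indicator S2 t *\<^sub>R h t)) = (\<lambda>t. indicator S t *\<^sub>R h t)"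
    using S(3) by (auto simp: indicator_def fun_eq_iff)
  ultimately have "integrable lebesgue (\<lambda>t. indicator S t *\<^sub>R h t)" by (simp only:)
  then show "integrable (lebesgue_on S) h" using S by (subst integrable_restrict_space) auto
qed

text \<open>Multiply \<phi> by a cutoff that vanishes near \<open>T\<close>. The only new term
  contains the derivative of the cutoff: close to \<open>T\<close> the cutoff drops by at most 1 in
  total and \<open>f\<close> is small because of its zero end value, away from \<open>T\<close> the
  derivative tends to 0 uniformly. So no boundary term arises at \<open>T\<close>.\<close>

lemma weak_derivative_extend:
  fixes f g c :: "real \<Rightarrow> real" and T :: real
  defines "M \<equiv> lebesgue_on {0<..<T}"
  assumes T: "0 < T" and f: "f \<in> borel_measurable M" "integrable M (\<lambda>t. (f t)^2)"
    and g: "g \<in> borel_measurable M" "integrable M (\<lambda>t. (g t)^2)"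
    and fc: "AE t in M. f t = c t" and c0: "(c \<longlongrightarrow> 0) (at_left T)"
    and weak: "\<And>\<phi>. \<phi> \<in> test_functions {0<..<T} \<Longrightarrow> integral\<^sup>L M (\<lambda>t. deriv \<phi> t * f t) = - integral\<^sup>L M (\<lambda>t. \<phi> t * g t)"
    and phi: "\<phi> \<in> test_functions {0<..}"
  shows "integral\<^sup>L M (\<lambda>t. deriv \<phi> t * f t) = - integral\<^sup>L M (\<lambda>t. \<phi> t * g t)"
proof -
  have S: "{0<..<T} \<in> sets lebesgue" by simp
  define q where "q m = real (Suc m)" for m
  have q: "q m > 0" for m by (simp add: q_def)
  \<comment> \<open>The factor \<open>(q m)^2\<close> outweighs the shift \<open>1 / q m\<close>:
    the argument tends to infinity for every t < T, so the cutoff tends to 1, although its support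
    stays to the left of \<open>T - 1 / q m\<close>.\<close>
  define a where "a m t = (q m)^2 * (T - 1 / q m - t)" for m t
  define chi where "chi m t = bmp 0 (a m t)" for m t
  define chi' where "chi' m t = - ((q m)^2) * bmp 2 (a m t)" for m t
  have comp: "Ck k (\<lambda>t. bmp n (a m t))" for k n m using Ck_compose_affine[OF Ck_bmp[of k n], of "- ((q m)^2)" "(q m)^2 * (T - 1 / q m)"]
    by (simp add: a_def algebra_simps)
  have Ck: "Ck k (chi m)" "Ck k (chi' m)" for k m unfolding chi_def chi'_def by (intro comp Ck_cmult)+
  have chi_b: "0 \<le> chi m t" "chi m t \<le> 1" for m t by (simp_all add: chi_def bmp_bounds)
  have chi'_s: "chi' m t \<le> 0" for m t by (simp add: chi'_def bmp_def)
  have dchi: "(chi m has_real_derivative chi' m t) (at t)" for m t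
  proof -
    have "(a m has_real_derivative - ((q m)^2)) (at t)" unfolding a_def by (auto intro!: derivative_eq_intros)
    from DERIV_chain2[OF bmp_has_derivative[of 0 "a m t"] this]
    show ?thesis by (simp add: chi_def[abs_def] chi'_def mult.commute numeral_2_eq_2)
  qed
  have dphi: "(\<phi> has_real_derivative deriv \<phi> t) (at t)" for t by (rule test_deriv[OF phi])
  have tphi': "deriv \<phi> \<in> test_functions {0<..}" by (rule test_deriv[OF phi])
  have eq: "integral\<^sup>L M (\<lambda>t. (deriv \<phi> t * chi m t) * f t) + integral\<^sup>L M (\<lambda>t. (\<phi> t * chi' m t) * f t)
      = - integral\<^sup>L M (\<lambda>t. (\<phi> t * chi m t) * g t)" for m
  proof -
    have t: "(\<lambda>t. \<phi> t * chi m t) \<in> test_functions {0<..<T}"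
    proof -
      let ?K = "closure {x. \<phi> x \<noteq> 0}"
      have sub: "closure {x. \<phi> x * chi m x \<noteq> 0} \<subseteq> ?K \<inter> {..T - 1 / q m}"
      proof (rule closure_minimal)
        show "{x. \<phi> x * chi m x \<noteq> 0} \<subseteq> ?K \<inter> {..T - 1 / q m}" using closure_subset[of "{x. \<phi> x \<noteq> 0}"] q[of m]
          by (auto simp: chi_def bmp_def a_def zero_less_mult_iff split: if_splits)
      qed (intro closed_Int closed_closure closed_atMost)
      have K: "?K \<subseteq> {0<..}" "compact ?K" using phi by (auto simp: test_functions_def)
      have Tq: "T - 1 / q m < T" using q[of m] by simp
      have "closure {x. \<phi> x * chi m x \<noteq> 0} \<subseteq> {0<..<T}"
      proof
        fix x assume "x \<in> closure {x. \<phi> x * chi m x \<noteq> 0}"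
        then have "x \<in> ?K" "x \<le> T - 1 / q m" using sub by auto
        moreover from this have "x < T" using Tq by linarith
        ultimately show "x \<in> {0<..<T}" using K(1) by auto
      qed
      then show ?thesis using test_mult[OF phi Ck(1), of m] unfolding test_functions_def by simp
    qed
    have d: "deriv (\<lambda>t. \<phi> t * chi m t) t = deriv \<phi> t * chi m t + \<phi> t * chi' m t" for t
      using DERIV_mult[OF dphi[of t] dchi[of m t]] by (intro DERIV_imp_deriv) (simp add: mult.commute add.commute)
    have "integrable M (\<lambda>t. (deriv \<phi> t * chi m t) * f t)" "integrable M (\<lambda>t. (\<phi> t * chi' m t) * f t)"
      unfolding M_def using f unfolding M_def by (auto intro!: test_mult_integrable[OF S] test_mult[OF tphi'] test_mult[OF phi] Ck)
    then show ?thesis using weak[OF t] unfolding d by (simp add: distrib_right)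
  qed
  have chilim: "(\<lambda>m. chi m t) \<longlonglongrightarrow> 1" if t: "t < T" for t
  proof -
    have "(\<lambda>m. exp (- inverse (a m t))) \<longlonglongrightarrow> exp (- 0)"
    proof (intro tendsto_intros)
      have "filterlim (\<lambda>m. a m t) at_top sequentially" unfolding a_def q_def using t by real_asymp
      then show "(\<lambda>m. inverse (a m t)) \<longlonglongrightarrow> 0" by (rule tendsto_inverse_0_at_top)
    qed
    moreover have "\<forall>\<^sub>F m in sequentially. exp (- inverse (a m t)) = chi m t"
    proof -
      have "filterlim (\<lambda>m. a m t) at_top sequentially" unfolding a_def q_def using t by real_asymp
      then have "\<forall>\<^sub>F m in sequentially. 0 < a m t" by (simp add: filterlim_at_top_dense)
      then show ?thesis by eventually_elim (simp add: chi_def bmp_def)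
    qed
    ultimately show ?thesis using Lim_transform_eventually by fastforce
  qed
  have limA: "(\<lambda>m. integral\<^sup>L M (\<lambda>t. (w t * chi m t) * h t)) \<longlonglongrightarrow> integral\<^sup>L M (\<lambda>t. w t * h t)"
    if w: "w \<in> test_functions {0<..}" and h: "h \<in> borel_measurable M" "integrable M (\<lambda>t. (h t)^2)" for w h
  proof (rule integral_dominated_convergence[where w = "\<lambda>t. \<bar>w t * h t\<bar>"])
    have i: "integrable M (\<lambda>t. w t * h t)" "integrable M (\<lambda>t. (w t * chi m t) * h t)" for m
      unfolding M_def using h unfolding M_def by (auto intro!: test_mult_integrable[OF S] test_mult[OF w] w Ck)
    show "(\<lambda>t. w t * h t) \<in> borel_measurable M" "(\<lambda>t. (w t * chi m t) * h t) \<in> borel_measurable M" for m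
      using i by (auto intro: borel_measurable_integrable)
    show "integrable M (\<lambda>t. \<bar>w t * h t\<bar>)" using i by auto
    show "AE t in M. (\<lambda>m. w t * chi m t * h t) \<longlonglongrightarrow> w t * h t"
    proof (rule AE_I2)
      fix t assume "t \<in> space M"
      then have "t < T" by (simp add: M_def)
      then have "(\<lambda>m. w t * chi m t * h t) \<longlonglongrightarrow> w t * 1 * h t" by (intro tendsto_intros chilim)
      then show "(\<lambda>m. w t * chi m t * h t) \<longlonglongrightarrow> w t * h t" by simp
    qed
    show "AE t in M. norm (w t * chi m t * h t) \<le> \<bar>w t * h t\<bar>" for m
    proof (rule AE_I2)
      fix t
      have "\<bar>w t * h t\<bar> * chi m t \<le> \<bar>w t * h t\<bar> * 1" using chi_b by (intro mult_left_mono) auto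
      then show "norm (w t * chi m t * h t) \<le> \<bar>w t * h t\<bar>" using chi_b by (simp add: abs_mult mult_ac)
    qed
  qed
  have limB: "(\<lambda>m. integral\<^sup>L M (\<lambda>t. (\<phi> t * chi' m t) * f t)) \<longlonglongrightarrow> 0"
  proof (rule LIMSEQ_I)
    fix e :: real assume e: "0 < e"
    obtain P where P: "0 < P" "\<And>t. \<bar>\<phi> t\<bar> \<le> P" using test_bounded[OF phi] by blast
    define L where "L = integral\<^sup>L M (\<lambda>t. \<bar>\<phi> t * f t\<bar>)"
    have iL: "integrable M (\<lambda>t. \<phi> t * f t)" unfolding M_def using f unfolding M_def by (intro test_mult_integrable[OF S phi])
    have p: "0 < e / (2 * P)" using e P by simp
    have "\<forall>\<^sub>F t in at_left T. \<bar>c t\<bar> < e / (2 * P)" using tendstoD[OF c0 p] by (simp add: dist_real_def)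
    then obtain b where b: "b < T" "\<And>t. b < t \<Longrightarrow> t < T \<Longrightarrow> \<bar>c t\<bar> < e / (2 * P)" unfolding eventually_at_left_field by auto
    define d where "d = T - b"
    have d: "d > 0" using b by (simp add: d_def)
    have "(\<lambda>m. 4 / ((q m)^2 * d^2) * L) \<longlonglongrightarrow> 0" unfolding q_def using d by real_asymp
    then have ev1: "\<forall>\<^sub>F m in sequentially. 4 / ((q m)^2 * d^2) * L < e / 2" using e by (intro order_tendstoD) auto
    have "(\<lambda>m. 1 / q m) \<longlonglongrightarrow> 0" unfolding q_def by real_asymp
    then have ev2: "\<forall>\<^sub>F m in sequentially. 1 / q m < d / 2" using d by (intro order_tendstoD) auto
    have "\<forall>\<^sub>F m in sequentially. norm (integral\<^sup>L M (\<lambda>t. (\<phi> t * chi' m t) * f t) - 0) < e" using ev1 ev2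
    proof eventually_elim
      case (elim m)
      have chi'i: "integrable M (\<lambda>t. \<bar>chi' m t\<bar>)" and chi'le: "integral\<^sup>L M (\<lambda>t. \<bar>chi' m t\<bar>) \<le> 1"
      proof -
        have "continuous_on (cbox 0 T) (chi' m)" by (rule continuous_on_subset[OF Ck_continuous[OF Ck(2)[of 0]]]) simp
        then have "integrable (lebesgue_on (cbox 0 T)) (chi' m)" by (rule continuous_imp_integrable)
        then have ci: "integrable M (chi' m)" unfolding M_def by (rule restrict_subset(2)[rotated 3]) auto
        have abs: "\<bar>chi' m t\<bar> = - chi' m t" for t using chi'_s[of m t] by simp
        show "integrable M (\<lambda>t. \<bar>chi' m t\<bar>)" unfolding abs using ci by simp
        have "(chi' m has_integral (chi m T - chi m 0)) {0..T}" using T dchi by (intro fundamental_theorem_of_calculus)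
            (auto simp: has_real_derivative_iff_has_vector_derivative[symmetric] intro: has_field_derivative_at_within)
        then have "integral\<^sup>L M (chi' m) = chi m T - chi m 0"
          using ci by (simp add: M_def lebesgue_integral_eq_integral integral_open_interval_real[symmetric] integral_unique)
        then show "integral\<^sup>L M (\<lambda>t. \<bar>chi' m t\<bar>) \<le> 1" unfolding abs using chi_b[of m T] chi_b[of m 0] by simp
      qed
      have i: "integrable M (\<lambda>t. (\<phi> t * chi' m t) * f t)"
        unfolding M_def using f unfolding M_def by (auto intro!: test_mult_integrable[OF S] test_mult[OF phi] Ck)
      \<comment> \<open>Right of \<open>b\<close> the smallness of \<open>f\<close> is used, left of
        it the bound \<open>1 / ((q m)^2 * s^2)\<close> on the derivative of the cutoff with s >= d
        / 2.\<close>
      have pt: "AE t in M. \<bar>(\<phi> t * chi' m t) * f t\<bar> \<le> 4 / ((q m)^2 * d^2) * \<bar>\<phi> t * f t\<bar> + (e / 2) * \<bar>chi' m t\<bar>" using fc AE_space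
      proof eventually_elim
        case (elim t)
        have tT: "t < T" using elim(2) by (simp add: M_def)
        have n: "0 \<le> 4 / ((q m)^2 * d^2) * \<bar>\<phi> t * f t\<bar>" "0 \<le> (e / 2) * \<bar>chi' m t\<bar>" using e by auto
        show ?case
        proof (cases "b < t")
          case True
          have "\<bar>\<phi> t\<bar> * \<bar>f t\<bar> \<le> P * (e / (2 * P))" using P b(2)[OF True tT] elim(1) by (intro mult_mono) auto
          also have "\<dots> = e / 2" using P by simp
          finally have "\<bar>\<phi> t\<bar> * \<bar>f t\<bar> * \<bar>chi' m t\<bar> \<le> (e / 2) * \<bar>chi' m t\<bar>" by (rule mult_right_mono) simp
          moreover have "\<bar>(\<phi> t * chi' m t) * f t\<bar> = \<bar>\<phi> t\<bar> * \<bar>f t\<bar> * \<bar>chi' m t\<bar>" by (simp only: abs_mult mult_ac)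
          ultimately show ?thesis using n(1) by linarith
        next
          case False
          define s where "s = T - 1 / q m - t"
          have s: "d / 2 \<le> s" using False \<open>1 / q m < d / 2\<close> by (simp add: s_def d_def)
          then have s0: "s > 0" using d by simp
          have as: "a m t = (q m)^2 * s" by (simp add: a_def s_def)
          have "\<bar>chi' m t\<bar> = (q m)^2 * bmp 2 ((q m)^2 * s)" by (simp add: chi'_def as abs_mult bmp_def)
          also have "\<dots> \<le> (q m)^2 * inverse ((q m)^2 * s) ^ 2"
            using s0 q[of m] by (intro mult_left_mono) (simp_all add: bmp_def mult_left_le)
          also have "\<dots> = 1 / ((q m)^2 * s^2)" using q[of m] s0 by (simp add: power2_eq_square field_simps)
          also have "\<dots> \<le> 1 / ((q m)^2 * (d / 2)^2)"
            using q[of m] s d by (intro divide_left_mono mult_left_mono power_mono mult_pos_pos) auto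
          also have "\<dots> = 4 / ((q m)^2 * d^2)" by (simp add: power_divide)
          finally have "\<bar>chi' m t\<bar> * \<bar>\<phi> t * f t\<bar> \<le> 4 / ((q m)^2 * d^2) * \<bar>\<phi> t * f t\<bar>" by (rule mult_right_mono) simp
          moreover have "\<bar>(\<phi> t * chi' m t) * f t\<bar> = \<bar>chi' m t\<bar> * \<bar>\<phi> t * f t\<bar>" by (simp only: abs_mult mult_ac)
          ultimately show ?thesis using n(2) by linarith
        qed
      qed
      have "\<bar>integral\<^sup>L M (\<lambda>t. (\<phi> t * chi' m t) * f t)\<bar> \<le> integral\<^sup>L M (\<lambda>t. \<bar>(\<phi> t * chi' m t) * f t\<bar>)"
        using integral_norm_bound[of M "\<lambda>t. (\<phi> t * chi' m t) * f t"] by simp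
      also have "\<dots> \<le> integral\<^sup>L M (\<lambda>t. 4 / ((q m)^2 * d^2) * \<bar>\<phi> t * f t\<bar> + (e / 2) * \<bar>chi' m t\<bar>)"
        using i iL chi'i pt by (intro integral_mono_AE) auto
      also have "\<dots> = 4 / ((q m)^2 * d^2) * L + (e / 2) * integral\<^sup>L M (\<lambda>t. \<bar>chi' m t\<bar>)" using iL chi'i by (simp add: L_def)
      also have "\<dots> < e / 2 + (e / 2) * 1" using elim(1) chi'le e by (intro add_less_le_mono mult_left_mono) auto
      finally show ?case by simp
    qed
    then show "\<exists>no. \<forall>n\<ge>no. norm (integral\<^sup>L M (\<lambda>t. (\<phi> t * chi' n t) * f t) - 0) < e" by (simp add: eventually_sequentially)
  qed
  have "(\<lambda>m. integral\<^sup>L M (\<lambda>t. (deriv \<phi> t * chi m t) * f t) + integral\<^sup>L M (\<lambda>t. (\<phi> t * chi' m t) * f t))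
      \<longlonglongrightarrow> integral\<^sup>L M (\<lambda>t. deriv \<phi> t * f t) + 0" by (intro tendsto_add limA[OF tphi' f] limB)
  moreover have "(\<lambda>m. - integral\<^sup>L M (\<lambda>t. (\<phi> t * chi m t) * g t)) \<longlonglongrightarrow> - integral\<^sup>L M (\<lambda>t. \<phi> t * g t)" by (intro tendsto_minus limA[OF phi g])
  ultimately show ?thesis unfolding eq using LIMSEQ_unique by fastforce
qed

lemma strongly_measurable_restrict:
  assumes S: "S \<in> sets lebesgue" "S2 \<in> sets lebesgue" "S \<subseteq> S2" and w: "strongly_measurable V N S2 w"
  shows "strongly_measurable V N S w"
proof -
  obtain s where s: "\<And>n. simple_into V S2 (s n)" "AE t in lebesgue_on S2. (\<lambda>n::nat. N (s n t - w t)) \<longlonglongrightarrow> 0"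
    using w unfolding strongly_measurable_def by auto
  have "simple_into V S (s n)" for n unfolding simple_into_def
  proof (intro conjI allI)
    have sn: "finite (s n ` S2)" "s n ` S2 \<subseteq> V" "\<And>x. {t\<in>S2. s n t = x} \<in> sets lebesgue"
      "emeasure lebesgue {t\<in>S2. s n t \<noteq> 0} < \<infinity>" using s(1)[of n] by (auto simp: simple_into_def)
    have im: "s n ` S \<subseteq> s n ` S2" using S(3) by (rule image_mono)
    show "finite (s n ` S)" using im sn(1) by (rule finite_subset)
    show "s n ` S \<subseteq> V" using im sn(2) by (rule order_trans)
    have eq: "{t\<in>S. s n t = x} = S \<inter> {t\<in>S2. s n t = x}" for x using S(3) by auto
    show "{t\<in>S. s n t = x} \<in> sets lebesgue" for x unfolding eq using S(1) sn(3) by auto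
    have "{t\<in>S2. s n t \<noteq> 0} = S2 - {t\<in>S2. s n t = 0}" by auto
    then have "{t\<in>S2. s n t \<noteq> 0} \<in> sets lebesgue" using S(2) sn(3)[of 0] by auto
    then have "emeasure lebesgue {t\<in>S. s n t \<noteq> 0} \<le> emeasure lebesgue {t\<in>S2. s n t \<noteq> 0}" using S(3) by (intro emeasure_mono) auto
    then show "emeasure lebesgue {t\<in>S. s n t \<noteq> 0} < \<infinity>" using sn(4) by (rule order_le_less_trans)
  qed
  then show ?thesis using w S(3) restrict_subset(1)[OF S s(2)] unfolding strongly_measurable_def by blast
qed

lemma strongly_measurable_extend:
  assumes S: "S \<in> sets lebesgue" "S2 \<in> sets lebesgue" "S \<subseteq> S2" and V: "0 \<in> V" "N 0 = 0"
    and w: "strongly_measurable V N S w"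
  shows "strongly_measurable V N S2 (\<lambda>t. if t \<in> S then w t else 0)"
proof -
  obtain s where s: "\<And>n. simple_into V S (s n)" "AE t in lebesgue_on S. (\<lambda>n::nat. N (s n t - w t)) \<longlonglongrightarrow> 0"
    using w unfolding strongly_measurable_def by auto
  have "simple_into V S2 (\<lambda>t. if t \<in> S then s n t else 0)" for n unfolding simple_into_def
  proof (intro conjI allI)
    have sn: "finite (s n ` S)" "s n ` S \<subseteq> V" "\<And>x. {t\<in>S. s n t = x} \<in> sets lebesgue"
      "emeasure lebesgue {t\<in>S. s n t \<noteq> 0} < \<infinity>" using s(1)[of n] by (auto simp: simple_into_def)
    have im: "(\<lambda>t. if t \<in> S then s n t else 0) ` S2 \<subseteq> insert 0 (s n ` S)" by auto
    show "finite ((\<lambda>t. if t \<in> S then s n t else 0) ` S2)" by (rule finite_subset[OF im]) (use sn in auto)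
    show "(\<lambda>t. if t \<in> S then s n t else 0) ` S2 \<subseteq> V" using im sn(2) V(1) by auto
    fix x
    have "{t\<in>S2. (if t \<in> S then s n t else 0) = x} = {t\<in>S. s n t = x} \<union> (if x = 0 then S2 - S else {})" using S(3) by auto
    then show "{t\<in>S2. (if t \<in> S then s n t else 0) = x} \<in> sets lebesgue" using sn(3)[of x] S by auto
    have "{t\<in>S2. (if t \<in> S then s n t else 0) \<noteq> 0} = {t\<in>S. s n t \<noteq> 0}" using S(3) by auto
    then show "emeasure lebesgue {t\<in>S2. (if t \<in> S then s n t else 0) \<noteq> 0} < \<infinity>" using sn(4) by simp
  qed
  moreover have "AE t in lebesgue_on S2. (\<lambda>n. N ((if t \<in> S then s n t else 0) - (if t \<in> S then w t else 0))) \<longlonglongrightarrow> 0"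
    using s(2) S by (auto simp: AE_restrict_space_iff V elim!: eventually_mono)
  moreover have "\<forall>t\<in>S2. (if t \<in> S then w t else 0) \<in> V" using w V(1) by (auto simp: strongly_measurable_def)
  ultimately show ?thesis unfolding strongly_measurable_def by (intro conjI exI[of _ "\<lambda>n t. if t \<in> S then s n t else 0"] allI)
qed

context interpolation_couple
begin

text \<open>The triangle inequality is that of the K-functional followed by Minkowski for the square
  roots \<open>F w\<close> of the integrand.\<close>

lemma interp_seminormed: "seminormed_space (interp_space X0 N0 X1 N1 \<theta>) (interp_norm X0 N0 X1 N1 \<theta>)"
proof
  have "decomposable 0" unfolding decomposable_def using A.zero_mem B.zero_mem by force
  moreover have "K s 0 = 0" if "s > 0" for s using K_scale[of s 0 0] that calculation by simp
  then have "integrable (lebesgue_on {0<..}) (\<lambda>s. (s powr (- \<theta>) * K s 0)^2 / s)"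
    by (subst Bochner_Integration.integrable_cong[OF refl, where g = "\<lambda>_. 0"]) auto
  ultimately show "0 \<in> interp_space X0 N0 X1 N1 \<theta>" by (simp add: interp_space_iff)
next
  fix u v assume u: "u \<in> interp_space X0 N0 X1 N1 \<theta>" and v: "v \<in> interp_space X0 N0 X1 N1 \<theta>"
  let ?M = "lebesgue_on {0<..} :: real measure"
  have d: "decomposable u" "decomposable v" using u v by (auto simp: interp_space_iff)
  define F where "F w s = s powr (- \<theta>) * K s w / sqrt s" for w s
  have sq: "(F w s)^2 = (s powr (- \<theta>) * K s w)^2 / s" if "s \<in> space ?M" for w s using that by (simp add: F_def power_divide)
  have m: "F w \<in> borel_measurable ?M" if "decomposable w" for w
  proof -
    have [measurable]: "(\<lambda>s::real. s) \<in> borel_measurable ?M" by (intro measurable_restrict_space1 measurable_completion) simp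
    note K_measurable[OF that, measurable]
    show ?thesis unfolding F_def by measurable
  qed
  have i: "integrable ?M (\<lambda>s. (F w s)^2)" if "w \<in> interp_space X0 N0 X1 N1 \<theta>" for w
    using that by (subst Bochner_Integration.integrable_cong[OF refl sq]) (auto simp: interp_space_iff)
  have n: "interp_norm X0 N0 X1 N1 \<theta> w = sqrt (\<integral>s. (F w s)^2 \<partial>?M)" for w
    unfolding interp_norm_def by (intro arg_cong[where f = sqrt] Bochner_Integration.integral_cong) (auto simp: sq)
  note Mk = real_Minkowski[OF m[OF d(1)] i[OF u] m[OF d(2)] i[OF v]]
  have le: "0 \<le> F (u + v) s \<and> F (u + v) s \<le> F u s + F v s" if "s \<in> space ?M" for s
    using K_add[of s u v] K_nonneg[OF _ decomposable_add[OF d], of s] that d unfolding F_def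
    by (simp add: add_divide_distrib[symmetric] distrib_left[symmetric] divide_right_mono mult_left_mono)
  then have le2: "(F (u + v) s)^2 \<le> (F u s + F v s)^2" if "s \<in> space ?M" for s using that by (simp add: power_mono)
  have iuv: "integrable ?M (\<lambda>s. (F (u + v) s)^2)" by (rule Bochner_Integration.integrable_bound[OF Mk(1)])
      (use m[OF decomposable_add[OF d]] le2 in \<open>auto intro!: AE_I2\<close>)
  then have "integrable ?M (\<lambda>s. (s powr (- \<theta>) * K s (u + v))^2 / s)" by (subst (asm) Bochner_Integration.integrable_cong[OF refl sq])
  then show "u + v \<in> interp_space X0 N0 X1 N1 \<theta>" by (simp add: interp_space_iff decomposable_add[OF d])
  have "(\<integral>s. (F (u + v) s)^2 \<partial>?M) \<le> (\<integral>s. (F u s + F v s)^2 \<partial>?M)" by (rule integral_mono[OF iuv Mk(1) le2])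
  then show "interp_norm X0 N0 X1 N1 \<theta> (u + v) \<le> interp_norm X0 N0 X1 N1 \<theta> u + interp_norm X0 N0 X1 N1 \<theta> v"
    unfolding n using Mk(2) by (meson order_trans real_sqrt_le_mono)
qed (auto intro: interp_space_scale interp_norm_nonneg)

end

context dual_time
begin

definition zext :: "real \<Rightarrow> (real \<Rightarrow> 'x \<Rightarrow> real) \<Rightarrow> real \<Rightarrow> 'x \<Rightarrow> real" where
  "zext T w = (\<lambda>t. if t \<in> {0<..<T} then w t else 0)"

lemma zext_add: "zext T (u + v) = zext T u + zext T v" by (auto simp: zext_def fun_eq_iff)

lemma zext_scale: "zext T (c *\<^sub>R u) = c *\<^sub>R zext T u" by (auto simp: zext_def fun_eq_iff scaleR_fun_def)

lemma zext_L2: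
  assumes w: "w \<in> bochner_L2 V N {0<..<T}"
  shows "zext T w \<in> bochner_L2 V N {0<..}" "bochner_L2_norm N {0<..} (zext T w) = bochner_L2_norm N {0<..<T} w"
proof -
  have sm: "strongly_measurable V N {0<..} (zext T w)" unfolding zext_def
    by (rule strongly_measurable_extend) (use w D.zero_mem D.N_zero in \<open>auto simp: bochner_L2_def\<close>)
  have e: "(\<lambda>t. indicator {0<..} t *\<^sub>R (N (zext T w t))^2) = (\<lambda>t. indicator {0<..<T} t *\<^sub>R (N (w t))^2)"
    by (auto simp: zext_def indicator_def D.N_zero fun_eq_iff)
  have "integrable lebesgue (\<lambda>t. indicator {0<..<T} t *\<^sub>R (N (w t))^2)" using w by (simp add: bochner_L2_def integrable_restrict_space)
  then have "integrable (lebesgue_on {0<..}) (\<lambda>t. (N (zext T w t))^2)" by (subst integrable_restrict_space) (simp_all only: e, simp)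
  then show "zext T w \<in> bochner_L2 V N {0<..}" using sm by (simp add: bochner_L2_def)
  have "integral\<^sup>L (lebesgue_on {0<..}) (\<lambda>t. (N (zext T w t))^2) = integral\<^sup>L (lebesgue_on {0<..<T}) (\<lambda>t. (N (w t))^2)"
    by (subst (1 2) integral_restrict_space) (simp_all only: e, simp_all)
  then show "bochner_L2_norm N {0<..} (zext T w) = bochner_L2_norm N {0<..<T} w" by (simp add: bochner_L2_norm_def)
qed

lemma zext_eval_integral:
  "integral\<^sup>L (lebesgue_on {0<..}) (\<lambda>t. h t * zext T w t u) = integral\<^sup>L (lebesgue_on {0<..<T}) (\<lambda>t. h t * w t u)"
proof -
  have e: "(\<lambda>t. indicator {0<..} t *\<^sub>R (h t * zext T w t u)) = (\<lambda>t. indicator {0<..<T} t *\<^sub>R (h t * w t u))"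
    by (auto simp: zext_def indicator_def fun_eq_iff)
  show ?thesis by (subst (1 2) integral_restrict_space) (simp_all only: e, simp_all)
qed

text \<open>Vanishing at \<open>T\<close> makes the extension continuous across \<open>T\<close>
  and, by \<open>weak_derivative_extend\<close>, weakly differentiable with the extended derivative.
  Extension by zero is therefore isometric on both ends of the couple and can be
  interpolated.\<close>

lemma zext_H1:
  assumes T: "0 < T" and v: "v \<in> H1_right V N 0 (ereal T)"
  shows "zext T v \<in> H1_right V N 0 \<infinity>" "H1_right_norm V N 0 \<infinity> (zext T v) = H1_right_norm V N 0 (ereal T) v"
proof -
  let ?S = "{0<..<T}"
  interpret B1: dual_bochner X NX ?S by (rule dual_bochner) simp
  interpret B2: dual_bochner X NX "{0<..}" by (rule dual_bochner) simp
  obtain g c where vL: "v \<in> bochner_L2 V N ?S" and gL: "g \<in> bochner_L2 V N ?S"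
    and w: "is_weak_time_derivative V N ?S v g" and c: "cont_rep ?S (ereal T) v c" using v unfolding H1_right_iff einterval_0 by blast
  have cV: "c t \<in> V" if "t \<in> ?S" for t using c that by (simp add: cont_rep_def)
  have cT: "((\<lambda>t. N (c t)) \<longlongrightarrow> 0) (at_left T)" using c tendsto_at_left_ereal_iff[of "\<lambda>t. N (c t)" T] by (simp add: cont_rep_def)
  note zL = zext_L2[OF vL] and zg = zext_L2[OF gL]
  have evS: "\<forall>\<^sub>F t in at_left T. t \<in> ?S" using T by (rule eventually_at_leftI[rotated]) auto
  have weak: "is_weak_time_derivative V N {0<..} (zext T v) (zext T g)" unfolding B2.weak_derivative_iff[OF zL(1) zg(1)] zext_eval_integral
  proof (intro ballI)
    fix \<phi> :: "real \<Rightarrow> real" and u assume phi: "\<phi> \<in> test_functions {0<..}" and u: "u \<in> X"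
    show "integral\<^sup>L (lebesgue_on ?S) (\<lambda>t. deriv \<phi> t * v t u) = - integral\<^sup>L (lebesgue_on ?S) (\<lambda>t. \<phi> t * g t u)"
    proof (rule weak_derivative_extend[OF T B1.L2_eval[OF vL u] B1.L2_eval[OF gL u], where c = "\<lambda>t. c t u"])
      have "AE t in lebesgue_on ?S. N (v t - c t) = 0" using c by (simp add: cont_rep_def)
      then show "AE t in lebesgue_on ?S. v t u = c t u" using AE_space
      proof eventually_elim
        case (elim t)
        then have "\<bar>(v t - c t) u\<bar> \<le> N (v t - c t) * NX u" using B1.bochner_L2_D(3)[OF vL] cV by (intro X.dual_norm_bound D.diff_mem u) auto
        then show ?case using elim by simp
      qed
      show "((\<lambda>t. c t u) \<longlongrightarrow> 0) (at_left T)"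
      proof (rule Lim_null_comparison)
        show "\<forall>\<^sub>F t in at_left T. norm (c t u) \<le> N (c t) * NX u" using evS by eventually_elim (use X.dual_norm_bound[OF cV u] in simp)
        show "((\<lambda>t. N (c t) * NX u) \<longlongrightarrow> 0) (at_left T)" using tendsto_mult_right[OF cT, of "NX u"] by simp
      qed
      show "integral\<^sup>L (lebesgue_on ?S) (\<lambda>t. deriv \<psi> t * v t u) = - integral\<^sup>L (lebesgue_on ?S) (\<lambda>t. \<psi> t * g t u)"
        if "\<psi> \<in> test_functions ?S" for \<psi> using w that u unfolding B1.weak_derivative_iff[OF vL gL] by blast
    qed (rule phi)
  qed
  have cr: "cont_rep {0<..} \<infinity> (zext T v) (zext T c)" unfolding cont_rep_def
  proof (intro conjI ballI)
    fix t :: real assume t: "t \<in> {0<..}"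
    show "zext T c t \<in> V" using cV D.zero_mem by (simp add: zext_def)
    have "((\<lambda>s. N (zext T c s - zext T c t)) \<longlongrightarrow> 0) (at t)"
    proof -
      consider "t < T" | "t = T" | "T < t" by linarith
      then show ?thesis
      proof cases
        case 1
        have "((\<lambda>s. N (c s - c t)) \<longlongrightarrow> 0) (at t within ?S)" using c t 1 by (simp add: cont_rep_def)
        then have l: "((\<lambda>s. N (c s - c t)) \<longlongrightarrow> 0) (at t)" using t 1 by (simp add: at_within_open[of t ?S])
        have "\<forall>\<^sub>F s in at t. s \<in> ?S" using t 1 by (intro eventually_at_in_open') auto
        then have "\<forall>\<^sub>F s in at t. N (c s - c t) = N (zext T c s - zext T c t)" by eventually_elim (use t 1 in \<open>simp add: zext_def\<close>)
        with l show ?thesis by (rule Lim_transform_eventually)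
      next
        case 2
        have "\<forall>\<^sub>F s in at_left T. N (c s) = N (zext T c s - zext T c t)" using evS by eventually_elim (use 2 in \<open>simp add: zext_def\<close>)
        with cT have "((\<lambda>s. N (zext T c s - zext T c t)) \<longlongrightarrow> 0) (at_left T)" by (rule Lim_transform_eventually)
        moreover have "((\<lambda>s. N (zext T c s - zext T c t)) \<longlongrightarrow> 0) (at_right T)"
          by (rule tendsto_eventually) (use 2 in \<open>auto simp: zext_def eventually_at_filter D.N_zero\<close>)
        ultimately show ?thesis using 2 by (simp add: filterlim_split_at)
      next
        case 3
        have "\<forall>\<^sub>F s in at t. s \<in> {T<..}" using 3 by (intro eventually_at_in_open') auto
        then have "\<forall>\<^sub>F s in at t. N (zext T c s - zext T c t) = 0" by eventually_elim (use 3 in \<open>simp add: zext_def D.N_zero\<close>)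
        then show ?thesis by (rule tendsto_eventually)
      qed
    qed
    then show "((\<lambda>s. N (zext T c s - zext T c t)) \<longlongrightarrow> 0) (at t within {0<..})" by (rule tendsto_within_subset) simp
  next
    have "AE t in lebesgue. t \<in> ?S \<longrightarrow> N (v t - c t) = 0" using c by (simp add: cont_rep_def AE_restrict_space_iff)
    then show "AE t in lebesgue_on {0<..}. N (zext T v t - zext T c t) = 0"
      by (auto simp: AE_restrict_space_iff zext_def D.N_zero elim!: eventually_mono)
  next
    show "((\<lambda>t. N (zext T c (real_of_ereal t))) \<longlongrightarrow> 0) (at_left \<infinity>)"
      by (rule tendsto_at_left_infty[of T]) (simp add: zext_def D.N_zero D.N_zero[unfolded zero_fun_def])
  qed
  show "zext T v \<in> H1_right V N 0 \<infinity>" unfolding H1_right_iff einterval_0 using zL(1) zg(1) weak cr by blast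
  show "H1_right_norm V N 0 \<infinity> (zext T v) = H1_right_norm V N 0 (ereal T) v"
    using H1_right_norm_eq[of v 0 "ereal T" g] H1_right_norm_eq[of "zext T v" 0 \<infinity> "zext T g"]
      vL gL w zL zg weak unfolding einterval_0 by simp
qed

lemma couple_T: "0 < T \<Longrightarrow> interpolation_couple (bochner_L2 V N {0<..<T}) (H1_right V N 0 (ereal T))
     (bochner_L2_norm N {0<..<T}) (H1_right_norm V N 0 (ereal T))" using couple[of 0 "ereal T"] by (simp add: einterval_0)

lemma couple_inf: "interpolation_couple (bochner_L2 V N {0<..}) (H1_right V N 0 \<infinity>)
     (bochner_L2_norm N {0<..}) (H1_right_norm V N 0 \<infinity>)" using couple[of 0 \<infinity>] by (simp add: einterval_0)

lemma zext_Hfrac: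
  assumes T: "0 < T" and w: "w \<in> Hfrac_right \<gamma> V N 0 (ereal T)"
  shows "zext T w \<in> Hfrac_right \<gamma> V N 0 \<infinity>" "Hfrac_right_norm \<gamma> V N 0 \<infinity> (zext T w) \<le> Hfrac_right_norm \<gamma> V N 0 (ereal T) w"
proof -
  note m = interp_map[OF couple_T[OF T] couple_inf, of "zext T" w \<gamma>]
  show "zext T w \<in> Hfrac_right \<gamma> V N 0 \<infinity>" "Hfrac_right_norm \<gamma> V N 0 \<infinity> (zext T w) \<le> Hfrac_right_norm \<gamma> V N 0 (ereal T) w"
    using w unfolding Hfrac_right_def Hfrac_right_norm_def einterval_0 by (auto intro!: m simp: zext_add zext_L2 zext_H1[OF T])
qed

lemma Hfrac_seminormed:
  assumes T: "0 < T" shows "seminormed_space (Hfrac_right \<gamma> V N 0 (ereal T)) (Hfrac_right_norm \<gamma> V N 0 (ereal T))"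
proof -
  interpret C: interpolation_couple "bochner_L2 V N {0<..<T}" "H1_right V N 0 (ereal T)"
     "bochner_L2_norm N {0<..<T}" "H1_right_norm V N 0 (ereal T)" by (rule couple_T[OF T])
  show ?thesis unfolding Hfrac_right_def Hfrac_right_norm_def einterval_0 by (rule C.interp_seminormed)
qed

lemma Hfrac_inf_seminormed: "seminormed_space (Hfrac_right \<gamma> V N 0 \<infinity>) (Hfrac_right_norm \<gamma> V N 0 \<infinity>)"
proof -
  interpret C: interpolation_couple "bochner_L2 V N {0<..}" "H1_right V N 0 \<infinity>"
     "bochner_L2_norm N {0<..}" "H1_right_norm V N 0 \<infinity>" by (rule couple_inf)
  show ?thesis unfolding Hfrac_right_def Hfrac_right_norm_def einterval_0 by (rule C.interp_seminormed)
qed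

text \<open>Composition with the extension by zero restricts the functional of \<open>f\<close> from
  the half line to (0, T). This shows that the functional selected in \<open>Hneg_time_norm\<close>
  on (0, T) exists.\<close>

lemma neg_extension_restrict:
  assumes T: "0 < T" and F: "neg_extension \<gamma> V N 0 \<infinity> f F"
  shows "neg_extension \<gamma> V N 0 (ereal T) f (\<lambda>w. if w \<in> Hfrac_right \<gamma> V N 0 (ereal T) then F (zext T w) else 0)"
proof -
  let ?H = "Hfrac_right \<gamma> V N 0 (ereal T)" and ?n = "Hfrac_right_norm \<gamma> V N 0 (ereal T)"
  let ?F = "\<lambda>w. if w \<in> ?H then F (zext T w) else 0"
  interpret H: seminormed_space ?H ?n by (rule Hfrac_seminormed[OF T])
  interpret I: seminormed_space "Hfrac_right \<gamma> V N 0 \<infinity>" "Hfrac_right_norm \<gamma> V N 0 \<infinity>" by (rule Hfrac_inf_seminormed)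
  have Fd: "F \<in> dual_space (Hfrac_right \<gamma> V N 0 \<infinity>) (Hfrac_right_norm \<gamma> V N 0 \<infinity>)" using F by (simp add: neg_extension_def)
  have "?F \<in> dual_space ?H ?n" unfolding dual_space_def[of ?H]
  proof (intro CollectI conjI ballI allI impI)
    fix u v a b assume uv: "u \<in> ?H" "v \<in> ?H"
    have m: "a *\<^sub>R u + b *\<^sub>R v \<in> ?H" using uv by (intro H.add_mem H.scale_mem)
    show "?F (a *\<^sub>R u + b *\<^sub>R v) = a * ?F u + b * ?F v"
      using uv m zext_Hfrac(1)[OF T] by (simp add: zext_add zext_scale I.dual_space_add[OF Fd] I.dual_space_scale[OF Fd] I.scale_mem)
  next
    let ?C = "dual_norm (Hfrac_right \<gamma> V N 0 \<infinity>) (Hfrac_right_norm \<gamma> V N 0 \<infinity>) F"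
    show "\<exists>C. \<forall>v\<in>?H. \<bar>?F v\<bar> \<le> C * ?n v"
    proof (intro exI ballI)
      fix v assume v: "v \<in> ?H"
      have "\<bar>F (zext T v)\<bar> \<le> ?C * Hfrac_right_norm \<gamma> V N 0 \<infinity> (zext T v)" by (rule I.dual_norm_bound[OF Fd zext_Hfrac(1)[OF T v]])
      also have "\<dots> \<le> ?C * ?n v" by (intro mult_left_mono zext_Hfrac(2)[OF T v] I.dual_norm_nonneg Fd)
      finally show "\<bar>?F v\<bar> \<le> ?C * ?n v" using v by simp
    qed
  qed simp
  moreover have "?F w = integral\<^sup>L (lebesgue_on {0<..<T}) (\<lambda>t. polar_inner N (f t) (w t))"
    if w: "w \<in> ?H" and b: "\<exists>B. AE t in lebesgue_on {0<..<T}. N (w t) \<le> B" for w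
  proof -
    obtain B where B: "AE t in lebesgue_on {0<..<T}. N (w t) \<le> B" using b by blast
    have "AE t in lebesgue_on {0<..}. N (zext T w t) \<le> max B 0"
      using B by (auto simp: AE_restrict_space_iff zext_def D.N_zero elim!: eventually_mono)
    then have "F (zext T w) = integral\<^sup>L (lebesgue_on {0<..}) (\<lambda>t. polar_inner N (f t) (zext T w t))"
      using F zext_Hfrac(1)[OF T w] unfolding neg_extension_def einterval_0 by blast
    also have "\<dots> = integral\<^sup>L (lebesgue_on {0<..<T}) (\<lambda>t. polar_inner N (f t) (w t))"
    proof -
      have e: "(\<lambda>t. indicator {0<..} t *\<^sub>R polar_inner N (f t) (zext T w t)) = (\<lambda>t. indicator {0<..<T} t *\<^sub>R polar_inner N (f t) (w t))"
        by (auto simp: zext_def indicator_def fun_eq_iff polar_inner_def)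
      show ?thesis by (subst (1 2) integral_restrict_space) (simp_all only: e, simp_all)
    qed
    finally show ?thesis using w by simp
  qed
  ultimately show ?thesis unfolding neg_extension_def einterval_0 by blast
qed

text \<open>\<open>Hneg_time_norm\<close> refers to a selected functional; existence suffices,
  because every candidate agrees with the integral pairing on bounded \<open>w\<close>. Step
  functions are bounded, which is the case of interest.\<close>

lemma Hneg_time_norm_bound:
  assumes T: "0 < T" and f: "f \<in> Hneg_time \<gamma> V N 0 \<infinity>"
    and w: "w \<in> Hfrac_right \<gamma> V N 0 (ereal T)" and b: "\<And>t. t \<in> {0<..<T} \<Longrightarrow> N (w t) \<le> B"
  shows "\<bar>integral\<^sup>L (lebesgue_on {0<..<T}) (\<lambda>t. polar_inner N (f t) (w t))\<bar>
    \<le> Hneg_time_norm \<gamma> V N 0 (ereal T) f * Hfrac_right_norm \<gamma> V N 0 (ereal T) w"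
    "0 \<le> Hneg_time_norm \<gamma> V N 0 (ereal T) f"
proof -
  interpret H: seminormed_space "Hfrac_right \<gamma> V N 0 (ereal T)" "Hfrac_right_norm \<gamma> V N 0 (ereal T)" by (rule Hfrac_seminormed[OF T])
  obtain F where "neg_extension \<gamma> V N 0 \<infinity> f F" using f by (auto simp: Hneg_time_def)
  then have "\<exists>F. neg_extension \<gamma> V N 0 (ereal T) f F" using neg_extension_restrict[OF T] by blast
  then have G: "neg_extension \<gamma> V N 0 (ereal T) f (SOME F. neg_extension \<gamma> V N 0 (ereal T) f F)" by (rule someI_ex)
  let ?G = "SOME F. neg_extension \<gamma> V N 0 (ereal T) f F"
  have Gd: "?G \<in> dual_space (Hfrac_right \<gamma> V N 0 (ereal T)) (Hfrac_right_norm \<gamma> V N 0 (ereal T))" using G by (simp add: neg_extension_def)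
  have "AE t in lebesgue_on {0<..<T}. N (w t) \<le> B" using b by (intro AE_I2) simp
  then have "?G w = integral\<^sup>L (lebesgue_on {0<..<T}) (\<lambda>t. polar_inner N (f t) (w t))"
    using G w unfolding neg_extension_def einterval_0 by blast
  then show "\<bar>integral\<^sup>L (lebesgue_on {0<..<T}) (\<lambda>t. polar_inner N (f t) (w t))\<bar>
    \<le> Hneg_time_norm \<gamma> V N 0 (ereal T) f * Hfrac_right_norm \<gamma> V N 0 (ereal T) w"
    using H.dual_norm_bound[OF Gd w] by (simp add: Hneg_time_norm_def)
  show "0 \<le> Hneg_time_norm \<gamma> V N 0 (ereal T) f" unfolding Hneg_time_norm_def by (rule H.dual_norm_nonneg[OF Gd])
qed

end

section \<open>Step functions of Riesz representers\<close>

lemma integrable_bounded_finite: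
  fixes f :: "real \<Rightarrow> real"
  assumes f: "f \<in> borel_measurable (lebesgue_on {a<..<b})" and B: "\<And>t. t \<in> {a<..<b} \<Longrightarrow> \<bar>f t\<bar> \<le> B"
  shows "integrable (lebesgue_on {a<..<b}) f"
proof -
  interpret finite_measure "lebesgue_on {a<..<b}" by (rule finite_measure_lebesgue_on) (rule lmeasurable_box[of a b, unfolded box_real])
  show ?thesis by (rule integrable_const_bound[where B = B, OF _ f]) (use B in \<open>auto intro!: AE_I2\<close>)
qed

text \<open>In the application \<open>z k\<close> is the inverse discrete Laplacian of an increment
  and \<open>E\<close> an orthonormal basis of the finite element space, represented by the
  expansion of each \<open>z k\<close>.\<close>

locale riesz_step = order_param \<alpha> + H: semi_inner_space X ip NX
  for \<alpha> :: real and X :: "'x::real_vector set" and ip :: "'x \<Rightarrow> 'x \<Rightarrow> real" and NX :: "'x \<Rightarrow> real" +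
  fixes \<tau> :: real and n :: nat and z :: "nat \<Rightarrow> 'x" and E :: "'x set"
  assumes \<tau>: "0 < \<tau>" and n: "0 < n" and zX: "\<And>k. z k \<in> X" and E: "finite E" "E \<subseteq> X"
    and zE: "\<And>k. z k = (\<Sum>e\<in>E. ip (z k) e *\<^sub>R e)"
begin

sublocale dual_time X NX by (rule dual_time.intro) (rule H.seminormed_space_axioms)

abbreviation "T \<equiv> real n * \<tau>"
abbreviation "cell \<equiv> step_fun.cell \<tau>"
abbreviation "clp \<equiv> step_fun.clp \<tau>"
abbreviation "coord e \<equiv> (\<lambda>k. ip (z k) e)"

lemma T: "0 < T" using \<tau> n by simp

sublocale S: step_fun \<alpha> \<tau> n "coord e" for e by unfold_locales (rule \<tau>)

sublocale B: dual_bochner X NX "{0<..<T}" by (rule dual_bochner) simp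

definition "comb a = (\<Sum>k<n. a k *\<^sub>R H.riesz (z k))"

lemma riesz_z: "H.riesz (z k) \<in> V" by (rule H.riesz_mem[OF zX])

lemma comb_mem: "comb a \<in> V" unfolding comb_def by (intro D.sum_mem D.scale_mem riesz_z)

lemma comb_diff: "comb a - comb b = comb (\<lambda>k. a k - b k)" by (simp add: comb_def sum_subtractf scaleR_diff_left)

lemma comb_eval: "comb a u = (\<Sum>k<n. a k * H.riesz (z k) u)" unfolding comb_def by (induction n) (simp_all add: scaleR_fun_def)

lemma comb_norm_le: "N (comb a) \<le> (\<Sum>k<n. \<bar>a k\<bar> * NX (z k))"
proof -
  have "N (comb a) \<le> (\<Sum>k<n. N (a k *\<^sub>R H.riesz (z k)))" unfolding comb_def by (intro D.N_sum_le D.scale_mem riesz_z)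
  also have "\<dots> = (\<Sum>k<n. \<bar>a k\<bar> * NX (z k))" by (simp add: D.N_scale riesz_z H.riesz_norm zX)
  finally show ?thesis .
qed

text \<open>Parseval: through the expansion in \<open>E\<close> the dual norm of a combination of
  Riesz images becomes a sum over scalar step functions, one for each element of
  \<open>E\<close>.\<close>

lemma comb_norm: "(N (comb a))^2 = (\<Sum>e\<in>E. (\<Sum>k<n. coord e k * a k)^2)"
proof -
  define y where "y = (\<Sum>k<n. a k *\<^sub>R z k)"
  have yX: "y \<in> X" unfolding y_def by (intro H.sum_mem H.scale_mem zX)
  have eX: "e \<in> X" if "e \<in> E" for e using E that by auto
  have "comb a = H.riesz y" unfolding comb_def y_def by (simp add: H.riesz_sum H.riesz_scale H.scale_mem zX)
  then have "(N (comb a))^2 = ip y y" by (simp add: H.riesz_norm yX H.N_sq)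
  also have "\<dots> = (\<Sum>k<n. a k * ip y (z k))" by (subst (2) y_def) (simp add: H.ip_sum_right H.ip_scale_right H.scale_mem zX yX)
  also have "\<dots> = (\<Sum>k<n. \<Sum>e\<in>E. ip y e * (coord e k * a k))"
  proof (rule sum.cong[OF refl])
    fix k
    have "ip y (z k) = ip y (\<Sum>e\<in>E. ip (z k) e *\<^sub>R e)" using zE[of k] by simp
    also have "\<dots> = (\<Sum>e\<in>E. ip (z k) e * ip y e)" by (simp add: H.ip_sum_right H.ip_scale_right H.scale_mem eX yX)
    finally show "a k * ip y (z k) = (\<Sum>e\<in>E. ip y e * (coord e k * a k))" by (simp add: sum_distrib_left mult_ac)
  qed
  also have "\<dots> = (\<Sum>e\<in>E. ip y e * (\<Sum>k<n. coord e k * a k))" by (subst sum.swap) (simp add: sum_distrib_left)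
  also have "\<dots> = (\<Sum>e\<in>E. (\<Sum>k<n. coord e k * a k)^2)"
  proof (rule sum.cong[OF refl])
    fix e assume "e \<in> E"
    then have "ip y e = (\<Sum>k<n. coord e k * a k)" unfolding y_def by (simp add: H.ip_sum H.ip_scale H.scale_mem zX eX mult.commute)
    then show "ip y e * (\<Sum>k<n. coord e k * a k) = (\<Sum>k<n. coord e k * a k)^2" by (simp add: power2_eq_square)
  qed
  finally show ?thesis .
qed

lemma comb_L2:
  assumes a: "\<And>k. a k \<in> borel_measurable borel" and C: "\<And>k t. t \<in> {0<..<T} \<Longrightarrow> \<bar>a k t\<bar> \<le> C"
  shows "(\<lambda>t. comb (\<lambda>k. a k t)) \<in> bochner_L2 V N {0<..<T}"
proof -
  have aM: "a k \<in> borel_measurable (lebesgue_on {0<..<T})" for k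
    by (rule measurable_restrict_space1, rule measurable_completion) (simp add: a)
  have sm: "strongly_measurable V N {0<..<T} (\<lambda>t. comb (\<lambda>k. a k t))"
    unfolding comb_def by (intro B.smeas_sum B.smeas_mult B.smeas_const riesz_z aM)
  moreover have "integrable (lebesgue_on {0<..<T}) (\<lambda>t. (N (comb (\<lambda>k. a k t)))^2)"
  proof (rule integrable_bounded_finite)
    show "(\<lambda>t. (N (comb (\<lambda>k. a k t)))^2) \<in> borel_measurable (lebesgue_on {0<..<T})" by (intro borel_measurable_power B.smeas_norm sm)
    fix t assume t: "t \<in> {0<..<T}"
    have "N (comb (\<lambda>k. a k t)) \<le> (\<Sum>k<n. C * NX (z k))"
      by (rule order_trans[OF comb_norm_le]) (intro sum_mono mult_right_mono C[OF t] H.N_nonneg zX)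
    then show "\<bar>(N (comb (\<lambda>k. a k t)))^2\<bar> \<le> (\<Sum>k<n. C * NX (z k))^2" using D.N_nonneg[OF comb_mem] by (simp add: power_mono)
  qed
  ultimately show ?thesis by (simp add: bochner_L2_def)
qed

text \<open>\<open>W\<close> is the step function with the Riesz images of \<open>z k\<close> as
  values, \<open>W1 s\<close> its forward average over length s, and \<open>G s\<close> the time
  derivative of this average.\<close>

definition "W t = comb (\<lambda>k. indicator (cell k) t)"
definition "W1 s t = comb (\<lambda>k. (clp k (t + s) - clp k t) / s)"
definition "G s t = comb (\<lambda>k. (indicator (cell k) (t + s) - indicator (cell k) t) / s)"

lemma cell_measurable [measurable]: "cell k \<in> sets borel" by (simp add: S.cell_def)

lemma W_cell: assumes "t \<in> cell k" "k < n" shows "W t = H.riesz (z k)"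
proof -
  have "W t = (\<Sum>i<n. if i = k then H.riesz (z k) else 0)"
    unfolding W_def comb_def using assms S.cell_unique by (intro sum.cong) (auto simp: indicator_def)
  then show ?thesis using assms by simp
qed

lemma W_bound: "N (W t) \<le> (\<Sum>k<n. NX (z k))" unfolding W_def
  by (rule order_trans[OF comb_norm_le]) (intro sum_mono, use H.N_nonneg[OF zX] in \<open>auto simp: indicator_def\<close>)

lemma W1_norm: assumes "s > 0"
  shows "(N (W t - W1 s t))^2 = (\<Sum>e\<in>E. (S.avg e s t - S.stp e t)^2)"
proof -
  have "(\<Sum>k<n. c k * (i k - d k / s)) = (\<Sum>k<n. c k * i k) - (\<Sum>k<n. c k * d k) / s" for c i d :: "nat \<Rightarrow> real"
    by (simp add: right_diff_distrib sum_subtractf sum_divide_distrib)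
  then show ?thesis unfolding W_def W1_def comb_diff comb_norm S.stp_def S.avg_def by (simp only: power2_commute)
qed

lemma G_norm: assumes "s > 0"
  shows "s^2 * (N (G s t))^2 = (\<Sum>e\<in>E. (S.stp e (t + s) - S.stp e t)^2)"
proof -
  have "(\<Sum>k<n. c k * ((i k - j k) / s)) = ((\<Sum>k<n. c k * i k) - (\<Sum>k<n. c k * j k)) / s" for c i j :: "nat \<Rightarrow> real"
    by (simp add: right_diff_distrib sum_subtractf flip: sum_divide_distrib)
  moreover have "s^2 * (y / s)^2 = y^2" for y using assms by (simp add: power_divide)
  ultimately show ?thesis unfolding G_def comb_norm S.stp_def sum_distrib_left by (simp only:)
qed

lemma clp_bound: "\<bar>clp k t\<bar> \<le> real (k + 1) * \<tau>"
proof -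
  have "0 \<le> real k * \<tau>" "real k * \<tau> \<le> real (k + 1) * \<tau>" using \<tau> by (auto intro!: mult_right_mono)
  then show ?thesis unfolding S.clp_def by (auto simp: max_def min_def)
qed

lemma W_L2: "W \<in> bochner_L2 V N {0<..<T}" unfolding W_def[abs_def] by (rule comb_L2[where C = 1]) (auto simp: indicator_def)

lemma G_L2: assumes "s > 0" shows "G s \<in> bochner_L2 V N {0<..<T}" unfolding G_def[abs_def]
  by (rule comb_L2[where C = "1 / s"]) (use assms in \<open>measurable, auto simp: indicator_def divide_simps\<close>)

lemma W1_L2: assumes s: "s > 0" shows "W1 s \<in> bochner_L2 V N {0<..<T}"
proof -
  \<comment> \<open>\<open>comb\<close> reads only indices below \<open>n\<close>; cutting off the
    others provides the uniform bound that \<open>comb_L2\<close> asks for.\<close>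
  have "comb (\<lambda>k. if k < n then a k else 0) = comb a" for a by (simp add: comb_def)
  from this[symmetric] have e: "W1 s = (\<lambda>t. comb (\<lambda>k. if k < n then (clp k (t + s) - clp k t) / s else 0))"
    unfolding W1_def[abs_def] by (intro ext) (simp only:)
  show ?thesis unfolding e
  proof (rule comb_L2[where C = "2 * T / s"])
    fix k show "(\<lambda>t. if k < n then (clp k (t + s) - clp k t) / s else 0) \<in> borel_measurable borel" by measurable
    fix t :: real
    show "\<bar>if k < n then (clp k (t + s) - clp k t) / s else 0\<bar> \<le> 2 * T / s"
    proof (cases "k < n")
      case True
      have "\<bar>clp k (t + s) - clp k t\<bar> \<le> 2 * (real (k + 1) * \<tau>)" using clp_bound[of k t] clp_bound[of k "t + s"] by linarith
      also have "\<dots> \<le> 2 * T" using True \<tau> by (intro mult_left_mono mult_right_mono) auto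
      finally show ?thesis using True s by (simp add: divide_right_mono)
    next
      case False then show ?thesis using s T by simp
    qed
  qed
qed

text \<open>Integration by parts via the fundamental theorem with two exceptional points, the
  corners of the shifted clamp; \<phi> vanishes at both ends. The shift \<open>c\<close> is s or 0
  in the difference quotient \<open>W1 s\<close>.\<close>

lemma clp_parts:
  assumes c: "0 \<le> c" and phi: "\<phi> \<in> test_functions {0<..<T}"
  shows "integral\<^sup>L (lebesgue_on {0<..<T}) (\<lambda>t. deriv \<phi> t * clp k (t + c))
     = - integral\<^sup>L (lebesgue_on {0<..<T}) (\<lambda>t. \<phi> t * indicator (cell k) (t + c))"
    "integrable (lebesgue_on {0<..<T}) (\<lambda>t. deriv \<phi> t * clp k (t + c))"
    "integrable (lebesgue_on {0<..<T}) (\<lambda>t. \<phi> t * indicator (cell k) (t + c))"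
proof -
  let ?M = "lebesgue_on {0<..<T}"
  have bnd: "h \<in> borel_measurable ?M \<and> integrable ?M (\<lambda>t. (h t)^2)"
    if m: "h \<in> borel_measurable borel" and b: "\<And>t. \<bar>h t\<bar> \<le> C" for h :: "real \<Rightarrow> real" and C
  proof
    show hM: "h \<in> borel_measurable ?M" by (rule measurable_restrict_space1, rule measurable_completion) (simp add: m)
    show "integrable ?M (\<lambda>t. (h t)^2)"
    proof (rule integrable_bounded_finite)
      show "(\<lambda>t. (h t)^2) \<in> borel_measurable ?M" using hM by measurable
      show "\<bar>(h t)^2\<bar> \<le> C^2" for t using power_mono[OF b[of t], of 2] by simp
    qed
  qed
  have clpm: "(\<lambda>t. clp k (t + c)) \<in> borel_measurable borel" by measurable
  have indm: "(\<lambda>t. indicator (cell k) (t + c) :: real) \<in> borel_measurable borel" by measurable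
  note b1 = bnd[OF clpm clp_bound]
  note dphi = test_deriv[OF phi]
  show i1: "integrable ?M (\<lambda>t. deriv \<phi> t * clp k (t + c))"
    by (rule test_mult_integrable[OF _ dphi(2) conjunct1[OF b1] conjunct2[OF b1]]) simp
  have ind1: "\<bar>indicator (cell k) (t + c)\<bar> \<le> (1::real)" for t by (simp add: indicator_def)
  note b2 = bnd[OF indm ind1]
  show i2: "integrable ?M (\<lambda>t. \<phi> t * indicator (cell k) (t + c))"
    by (rule test_mult_integrable[OF _ phi conjunct1[OF b2] conjunct2[OF b2]]) simp
  have z: "\<phi> t = 0" if "t \<notin> {0<..<T}" for t
  proof (rule ccontr)
    assume "\<phi> t \<noteq> 0"
    then have "t \<in> closure {x. \<phi> x \<noteq> 0}" by (intro subsetD[OF closure_subset]) simp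
    then show False using phi that by (simp only: test_functions_def mem_Collect_eq) blast
  qed
  have z0: "\<phi> 0 = 0" "\<phi> T = 0" by (rule z, simp)+
  have "((\<lambda>t. deriv \<phi> t * clp k (t + c) + \<phi> t * indicator (cell k) (t + c)) has_integral
      (\<phi> T * clp k (T + c) - \<phi> 0 * clp k (0 + c))) {0..T}"
  proof (rule fundamental_theorem_of_calculus_interior_strong[where S = "{real k * \<tau> - c, real (k + 1) * \<tau> - c}" and f = "\<lambda>t. \<phi> t * clp k (t + c)"])
    show "continuous_on {0..T} (\<lambda>t. \<phi> t * clp k (t + c))"
    proof (intro continuous_on_mult)
      show "continuous_on {0..T} \<phi>" by (rule continuous_on_subset[OF Ck_continuous[OF test_smooth[OF phi, of 0]]]) simp
      show "continuous_on {0..T} (\<lambda>t. clp k (t + c))" unfolding S.clp_def by (intro continuous_intros)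
    qed
    fix t assume t: "t \<in> {0<..<T} - {real k * \<tau> - c, real (k + 1) * \<tau> - c}"
    have "((\<lambda>t. t + c) has_real_derivative 1) (at t)" by (auto intro!: derivative_eq_intros)
    moreover have "(clp k has_real_derivative indicator (cell k) (t + c)) (at (t + c))" by (rule S.clp_has_derivative) (use t in auto)
    ultimately have "((\<lambda>t. clp k (t + c)) has_real_derivative indicator (cell k) (t + c)) (at t)"
      using DERIV_chain2[of "clp k" "indicator (cell k) (t + c)" "\<lambda>t. t + c" t 1] by simp
    from DERIV_mult[OF dphi(1) this]
    have "((\<lambda>t. \<phi> t * clp k (t + c)) has_real_derivative deriv \<phi> t * clp k (t + c) + \<phi> t * indicator (cell k) (t + c)) (at t)"
      by (simp add: mult.commute)
    then show "((\<lambda>t. \<phi> t * clp k (t + c)) has_vector_derivative deriv \<phi> t * clp k (t + c) + \<phi> t * indicator (cell k) (t + c)) (at t)"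
      by (simp add: has_real_derivative_iff_has_vector_derivative)
  qed (use T in auto)
  then have "integral {0<..<T} (\<lambda>t. deriv \<phi> t * clp k (t + c) + \<phi> t * indicator (cell k) (t + c)) = 0"
    using z0 by (simp add: integral_open_interval_real[symmetric] integral_unique)
  then have "integral\<^sup>L ?M (\<lambda>t. deriv \<phi> t * clp k (t + c) + \<phi> t * indicator (cell k) (t + c)) = 0"
    using i1 i2 by (subst lebesgue_integral_eq_integral) auto
  then show "integral\<^sup>L ?M (\<lambda>t. deriv \<phi> t * clp k (t + c)) = - integral\<^sup>L ?M (\<lambda>t. \<phi> t * indicator (cell k) (t + c))" using i1 i2 by simp
qed

lemma W1_weak: assumes s: "s > 0" shows "is_weak_time_derivative V N {0<..<T} (W1 s) (G s)"
  unfolding B.weak_derivative_iff[OF W1_L2[OF s] G_L2[OF s]]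
proof (intro ballI)
  let ?M = "lebesgue_on {0<..<T}"
  fix \<phi> :: "real \<Rightarrow> real" and u assume phi: "\<phi> \<in> test_functions {0<..<T}"
  have s0: "0 \<le> s" using s by simp
  note a = clp_parts[OF s0 phi] and b = clp_parts[of 0, OF order_refl phi, simplified add_0_right]
  let ?r = "\<lambda>k. H.riesz (z k) u / s"
  have e1: "deriv \<phi> t * W1 s t u = (\<Sum>k<n. ?r k * (deriv \<phi> t * clp k (t + s)) - ?r k * (deriv \<phi> t * clp k t))" for t
    by (simp add: W1_def comb_eval sum_distrib_left diff_divide_distrib algebra_simps)
  have e2: "\<phi> t * G s t u = (\<Sum>k<n. ?r k * (\<phi> t * indicator (cell k) (t + s)) - ?r k * (\<phi> t * indicator (cell k) t))" for t
    by (simp add: G_def comb_eval sum_distrib_left diff_divide_distrib algebra_simps)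
  show "integral\<^sup>L ?M (\<lambda>t. deriv \<phi> t * W1 s t u) = - integral\<^sup>L ?M (\<lambda>t. \<phi> t * G s t u)" unfolding e1 e2
    by (simp add: a(2,3) b(2,3) a(1) b(1) sum_negf[symmetric] Bochner_Integration.integral_sum Bochner_Integration.integral_diff
        del: times_divide_eq_left)
qed

text \<open>The average is continuous with explicit weak derivative, and it is zero at
  \<open>T\<close> because it looks forward past the last cell; this is the end condition of
  \<open>H1_right\<close>.\<close>

lemma W1_H1: assumes s: "s > 0" shows "W1 s \<in> H1_right V N 0 (ereal T)"
    "H1_right_norm V N 0 (ereal T) (W1 s) = bochner_L2_norm N {0<..<T} (G s)"
proof -
  have lim: "((\<lambda>r. N (W1 s r - W1 s t)) \<longlongrightarrow> 0) F" if F: "F \<le> nhds t" for t F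
  proof (rule Lim_null_comparison)
    show "\<forall>\<^sub>F r in F. norm (N (W1 s r - W1 s t))
        \<le> (\<Sum>k<n. \<bar>(clp k (r + s) - clp k r) / s - (clp k (t + s) - clp k t) / s\<bar> * NX (z k))"
      unfolding W1_def comb_diff using comb_norm_le D.N_nonneg[OF comb_mem] by (intro always_eventually) simp
    have c: "((\<lambda>r. clp k (r + d)) \<longlongrightarrow> clp k (t + d)) F" for k d
    proof (rule tendsto_mono[OF F])
      have "isCont (\<lambda>r. clp k (r + d)) t" unfolding S.clp_def by (intro continuous_intros)
      then show "((\<lambda>r. clp k (r + d)) \<longlongrightarrow> clp k (t + d)) (nhds t)" by (simp add: isCont_def tendsto_at_iff_tendsto_nhds[of "\<lambda>r. clp k (r + d)" t])
    qed
    have "((\<lambda>r. \<Sum>k<n. \<bar>(clp k (r + s) - clp k r) / s - (clp k (t + s) - clp k t) / s\<bar> * NX (z k))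
       \<longlongrightarrow> (\<Sum>k<n. \<bar>(clp k (t + s) - clp k t) / s - (clp k (t + s) - clp k t) / s\<bar> * NX (z k))) F"
      using s c[of _ 0] by (intro tendsto_intros c) auto
    then show "((\<lambda>r. \<Sum>k<n. \<bar>(clp k (r + s) - clp k r) / s - (clp k (t + s) - clp k t) / s\<bar> * NX (z k)) \<longlongrightarrow> 0) F" by simp
  qed
  have z0: "W1 s T = 0"
  proof -
    have "clp k (T + s) - clp k T = 0" if "k < n" for k
    proof -
      have "real (k + 1) * \<tau> \<le> T" using that \<tau> by (intro mult_right_mono) auto
      then show ?thesis using s by (simp add: S.clp_def)
    qed
    then show ?thesis by (simp add: W1_def comb_def)
  qed
  have "cont_rep {0<..<T} (ereal T) (W1 s) (W1 s)" unfolding cont_rep_def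
  proof (intro conjI ballI)
    show "W1 s t \<in> V" for t unfolding W1_def by (rule comb_mem)
    show "((\<lambda>r. N (W1 s r - W1 s t)) \<longlongrightarrow> 0) (at t within {0<..<T})" for t by (rule lim) (simp add: at_within_def)
    show "AE t in lebesgue_on {0<..<T}. N (W1 s t - W1 s t) = 0" by (simp add: D.N_zero)
    show "((\<lambda>t. N (W1 s (real_of_ereal t))) \<longlongrightarrow> 0) (at_left (ereal T))"
      using lim[of "at_left T" T] z0 tendsto_at_left_ereal_iff[of "\<lambda>t. N (W1 s t)" T] by (simp add: at_within_def)
  qed
  then show "W1 s \<in> H1_right V N 0 (ereal T)" unfolding H1_right_iff einterval_0 using W1_L2[OF s] G_L2[OF s] W1_weak[OF s] by blast
  show "H1_right_norm V N 0 (ereal T) (W1 s) = bochner_L2_norm N {0<..<T} (G s)"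
    using H1_right_norm_eq[of "W1 s" 0 "ereal T" "G s"] W1_L2[OF s] G_L2[OF s] W1_weak[OF s] by (simp add: einterval_0)
qed

abbreviation "gam \<equiv> (\<alpha> - 1) / 2"

text \<open>At each s split \<open>W\<close> into \<open>W - W1 s\<close> in L2 and
  \<open>W1 s\<close> in H1. By Parseval both norms are sums over \<open>E\<close> of the squares in
  \<open>K_bound\<close>; the factor 2 comes from (a + b)^2 <= 2 (a^2 + b^2).\<close>

lemma W_Hfrac:
  shows "W \<in> Hfrac_right gam V N 0 (ereal T)"
    "Hfrac_right_norm gam V N 0 (ereal T) W
      \<le> sqrt (2 * ((1 + 1 / \<alpha>) * S.cc * \<tau> powr p) * (\<Sum>e\<in>E. kform (coeff_b \<alpha>) n (coord e)))"
proof -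
  let ?M = "lebesgue_on {0<..<T}"
  interpret C: interpolation_couple "bochner_L2 V N {0<..<T}" "H1_right V N 0 (ereal T)"
     "bochner_L2_norm N {0<..<T}" "H1_right_norm V N 0 (ereal T)" by (rule couple_T[OF T])
  define q where "q e s t = (S.avg e s t - S.stp e t)^2 + (S.stp e (t + s) - S.stp e t)^2" for e s t
  define Bs where "Bs s = 2 * (\<Sum>e\<in>E. integral\<^sup>L ?M (q e s))" for s
  have L: "W - W1 s \<in> bochner_L2 V N {0<..<T}" if "s > 0" for s by (rule C.A.diff_mem[OF W_L2 W1_L2[OF that]])
  have qi1: "integrable ?M (\<lambda>t. (S.avg e s t - S.stp e t)^2)" and qi2: "integrable ?M (\<lambda>t. (S.stp e (t + s) - S.stp e t)^2)"
    if s: "s > 0" and e: "e \<in> E" for e s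
  proof -
    have mm: "(\<lambda>t. h t) \<in> borel_measurable borel \<Longrightarrow> h \<in> borel_measurable ?M" for h :: "real \<Rightarrow> real"
      by (rule measurable_restrict_space1, rule measurable_completion) simp
    show "integrable ?M (\<lambda>t. (S.avg e s t - S.stp e t)^2)"
    proof (rule Bochner_Integration.integrable_bound[OF B.bochner_L2_D(2)[OF L[OF s]]])
      have [measurable]: "(\<lambda>t. S.avg e s t) \<in> borel_measurable borel" unfolding S.avg_def by measurable
      show "(\<lambda>t. (S.avg e s t - S.stp e t)^2) \<in> borel_measurable ?M" by (rule mm) measurable
      show "AE t in ?M. norm ((S.avg e s t - S.stp e t)^2) \<le> norm ((N ((W - W1 s) t))^2)"
        using W1_norm[OF s] member_le_sum[OF e _ E(1), of "\<lambda>e. (S.avg e s _ - S.stp e _)^2"] by (intro AE_I2) (simp add: sum_nonneg)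
    qed
    have "integrable ?M (\<lambda>t. s^2 * (N (G s t))^2)" using B.bochner_L2_D(2)[OF G_L2[OF s]] by simp
    then show "integrable ?M (\<lambda>t. (S.stp e (t + s) - S.stp e t)^2)"
    proof (rule Bochner_Integration.integrable_bound)
      show "(\<lambda>t. (S.stp e (t + s) - S.stp e t)^2) \<in> borel_measurable ?M" by (rule mm) measurable
      show "AE t in ?M. norm ((S.stp e (t + s) - S.stp e t)^2) \<le> norm (s^2 * (N (G s t))^2)"
        unfolding G_norm[OF s] using member_le_sum[OF e _ E(1), of "\<lambda>e. (S.stp e (_ + s) - S.stp e _)^2"]
        by (intro AE_I2) (simp add: sum_nonneg)
    qed
  qed
  have qi: "integrable ?M (q e s)" if "s > 0" "e \<in> E" for e s unfolding q_def[abs_def] using qi1[OF that] qi2[OF that] by simp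
  have q0: "0 \<le> q e s t" for e s t by (simp add: q_def)
  have W_eq: "W = (W - W1 s) + W1 s" for s by simp
  have dec: "C.decomposable W" unfolding C.decomposable_def using W_eq[of 1] L[of 1] W1_H1(1)[of 1] by (metis zero_less_one)
  have KB: "(C.K s W)^2 \<le> Bs s" if s: "s > 0" for s
  proof -
    have "C.K s W \<le> bochner_L2_norm N {0<..<T} (W - W1 s) + s * H1_right_norm V N 0 (ereal T) (W1 s)"
      using C.K_le[OF less_imp_le[OF s] L[OF s] W1_H1(1)[OF s]] by simp
    then have k: "C.K s W \<le> bochner_L2_norm N {0<..<T} (W - W1 s) + s * bochner_L2_norm N {0<..<T} (G s)" by (simp add: W1_H1(2)[OF s])
    have a: "(bochner_L2_norm N {0<..<T} (W - W1 s))^2 = (\<Sum>e\<in>E. integral\<^sup>L ?M (\<lambda>t. (S.avg e s t - S.stp e t)^2))"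
      by (simp add: bochner_L2_norm_def W1_norm[OF s] qi1[OF s] sum_nonneg)
    have "s^2 * (bochner_L2_norm N {0<..<T} (G s))^2 = integral\<^sup>L ?M (\<lambda>t. s^2 * (N (G s t))^2)" by (simp add: bochner_L2_norm_def)
    then have b: "(s * bochner_L2_norm N {0<..<T} (G s))^2 = (\<Sum>e\<in>E. integral\<^sup>L ?M (\<lambda>t. (S.stp e (t + s) - S.stp e t)^2))"
      by (simp add: power_mult_distrib G_norm[OF s] qi2[OF s])
    have "Bs s = 2 * ((bochner_L2_norm N {0<..<T} (W - W1 s))^2 + (s * bochner_L2_norm N {0<..<T} (G s))^2)"
      unfolding a b Bs_def q_def sum.distrib[symmetric]
      by (intro arg_cong[where f = "\<lambda>x. 2 * x"] sum.cong refl Bochner_Integration.integral_add qi1[OF s] qi2[OF s])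
    moreover have "(C.K s W)^2 \<le> (bochner_L2_norm N {0<..<T} (W - W1 s) + s * bochner_L2_norm N {0<..<T} (G s))^2"
      by (rule power_mono[OF k C.K_nonneg[OF less_imp_le[OF s] dec]])
    moreover have "(a + b)^2 \<le> 2 * (a^2 + b^2)" for a b :: real
      using zero_le_power2[of "a - b"] by (simp add: power2_eq_square algebra_simps)
    ultimately show ?thesis by (simp only: order_trans)
  qed
  let ?c = "(1 + 1 / \<alpha>) * S.cc * \<tau> powr p"
  let ?k = "\<lambda>e. kform (coeff_b \<alpha>) n (coord e)"
  \<comment> \<open>The K-method exponent of order \<open>gam\<close> is exactly the Gagliardo
    exponent.\<close>
  have ga: "- 2 * gam - 1 = - \<alpha>" by (simp add: field_simps)
  have c0: "0 \<le> ?c" using pp \<alpha> by (simp add: S.cc_def)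
  have k0: "0 \<le> ?k e" for e by (rule kform_b_nonneg)
  have "(\<integral>\<^sup>+s. ennreal (if 0 < s then s powr (- 2 * gam - 1) * Bs s else 0) \<partial>lborel)
     = (\<integral>\<^sup>+s. (\<Sum>e\<in>E. 2 * (\<integral>\<^sup>+t. ennreal (if 0 < s \<and> 0 < t \<and> t < T then s powr (- \<alpha>) * q e s t else 0) \<partial>lborel)) \<partial>lborel)"
  proof (rule nn_integral_cong)
    fix s :: real
    show "ennreal (if 0 < s then s powr (- 2 * gam - 1) * Bs s else 0) =
      (\<Sum>e\<in>E. 2 * (\<integral>\<^sup>+t. ennreal (if 0 < s \<and> 0 < t \<and> t < T then s powr (- \<alpha>) * q e s t else 0) \<partial>lborel))"
    proof (cases "0 < s")
      case True
      have i: "(\<integral>\<^sup>+t. ennreal (if 0 < s \<and> 0 < t \<and> t < T then s powr (- \<alpha>) * q e s t else 0) \<partial>lborel)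
          = ennreal (s powr (- \<alpha>) * integral\<^sup>L ?M (q e s))" if e: "e \<in> E" for e
      proof -
        have "(\<integral>\<^sup>+t. ennreal (if 0 < s \<and> 0 < t \<and> t < T then s powr (- \<alpha>) * q e s t else 0) \<partial>lborel)
          = (\<integral>\<^sup>+t. ennreal (if 0 < s \<and> 0 < t \<and> t < T then s powr (- \<alpha>) * q e s t else 0) \<partial>lebesgue)" by (simp add: nn_integral_completion)
        also have "\<dots> = (\<integral>\<^sup>+t. ennreal (s powr (- \<alpha>) * q e s t) * indicator {0<..<T} t \<partial>lebesgue)"
          using True by (intro nn_integral_cong) (auto simp: indicator_def)
        also have "\<dots> = (\<integral>\<^sup>+t. ennreal (s powr (- \<alpha>) * q e s t) \<partial>?M)" by (rule nn_integral_restrict_space[symmetric]) simp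
        also have "\<dots> = ennreal (integral\<^sup>L ?M (\<lambda>t. s powr (- \<alpha>) * q e s t))" using qi[OF True e] q0 by (intro nn_integral_eq_integral) auto
        finally show ?thesis by simp
      qed
      have i0: "0 \<le> integral\<^sup>L ?M (q e s)" for e using q0 by simp
      have "ennreal (if 0 < s then s powr (- 2 * gam - 1) * Bs s else 0) = ennreal (\<Sum>e\<in>E. 2 * (s powr (- \<alpha>) * integral\<^sup>L ?M (q e s)))"
        using True by (simp only: ga Bs_def if_True sum_distrib_left mult_ac)
      also have "\<dots> = (\<Sum>e\<in>E. ennreal (2 * (s powr (- \<alpha>) * integral\<^sup>L ?M (q e s))))" using i0 by (intro sum_ennreal[symmetric]) simp
      also have "\<dots> = (\<Sum>e\<in>E. 2 * (\<integral>\<^sup>+t. ennreal (if 0 < s \<and> 0 < t \<and> t < T then s powr (- \<alpha>) * q e s t else 0) \<partial>lborel))"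
        by (intro sum.cong refl) (simp only: i, simp add: ennreal_mult' i0)
      finally show ?thesis .
    qed simp
  qed
  also have "\<dots> = (\<Sum>e\<in>E. 2 * (\<integral>\<^sup>+s. \<integral>\<^sup>+t. ennreal (if 0 < s \<and> 0 < t \<and> t < T then s powr (- \<alpha>) * q e s t else 0) \<partial>lborel \<partial>lborel))"
  proof -
    have [measurable]: "(\<lambda>(s, t). q e s t) \<in> borel_measurable (borel \<Otimes>\<^sub>M borel)" for e
      unfolding q_def case_prod_beta using S.avg_measurable[of e] unfolding case_prod_beta by measurable
    have [measurable]: "(\<lambda>s. \<integral>\<^sup>+t. ennreal (if 0 < s \<and> 0 < t \<and> t < T then s powr (- \<alpha>) * q e s t else 0) \<partial>lborel) \<in> borel_measurable lborel" for e
      by measurable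
    show ?thesis by (subst nn_integral_sum) (simp_all add: nn_integral_cmult)
  qed
  also have "\<dots> \<le> (\<Sum>e\<in>E. 2 * ennreal (?c * ?k e))" unfolding q_def by (intro sum_mono mult_left_mono S.K_bound) simp
  also have "\<dots> = (\<Sum>e\<in>E. ennreal (2 * (?c * ?k e)))" using c0 k0 by (intro sum.cong refl) (simp add: ennreal_mult')
  also have "\<dots> = ennreal (\<Sum>e\<in>E. 2 * (?c * ?k e))" using c0 k0 by (intro sum_ennreal) simp
  also have "(\<Sum>e\<in>E. 2 * (?c * ?k e)) = 2 * ?c * (\<Sum>e\<in>E. ?k e)" by (simp add: sum_distrib_left mult.assoc)
  finally have le: "(\<integral>\<^sup>+s. ennreal (if 0 < s then s powr (- 2 * gam - 1) * Bs s else 0) \<partial>lborel) \<le> ennreal (2 * ?c * (\<Sum>e\<in>E. ?k e))" .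
  have nn: "0 \<le> 2 * ?c * (\<Sum>e\<in>E. ?k e)" using c0 k0 by (simp add: sum_nonneg)
  show "W \<in> Hfrac_right gam V N 0 (ereal T)"
    "Hfrac_right_norm gam V N 0 (ereal T) W \<le> sqrt (2 * ?c * (\<Sum>e\<in>E. ?k e))" unfolding Hfrac_right_def Hfrac_right_norm_def einterval_0
    using C.interp_spaceI[OF dec KB le nn] by auto
qed

end

section \<open>Square integrable functions\<close>

lemma L2_semi_inner: "semi_inner_space (L2_space \<Omega>) (L2_inner \<Omega>) (L2_norm \<Omega> :: ('a::euclidean_space \<Rightarrow> 'b::euclidean_space) \<Rightarrow> real)"
  using square_integrable_semi_inner[of "lebesgue_on \<Omega>"] unfolding L2_space_def L2_norm_def[abs_def] L2_inner_def[abs_def] .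

lemma L2_spaceD:
  assumes "u \<in> L2_space \<Omega>"
  shows "u \<in> borel_measurable (lebesgue_on \<Omega>)" "integrable (lebesgue_on \<Omega>) (\<lambda>x. (norm (u x))^2)" using assms by (auto simp: L2_space_def)

lemma L2_inner_integrable:
  assumes "u \<in> L2_space \<Omega>" "v \<in> L2_space \<Omega>"
  shows "integrable (lebesgue_on \<Omega>) (\<lambda>x. u x \<bullet> v x)" by (rule integrable_inner_square[OF L2_spaceD[OF assms(1)] L2_spaceD[OF assms(2)]])

lemma L2_norm_sq: "(L2_norm \<Omega> u)^2 = integral\<^sup>L (lebesgue_on \<Omega>) (\<lambda>x. (norm (u x))^2)"
  by (simp add: L2_norm_def L2_inner_def power2_norm_eq_inner)

lemma L2_norm_nonneg: "0 \<le> L2_norm \<Omega> u" by (simp add: L2_norm_def L2_inner_def)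

lemma L2_inner_cong_AE:
  assumes "p \<in> L2_space \<Omega>" "p' \<in> L2_space \<Omega>" "q \<in> L2_space \<Omega>" "AE x in lebesgue_on \<Omega>. p x = p' x"
  shows "L2_inner \<Omega> p q = L2_inner \<Omega> p' q" unfolding L2_inner_def
  by (rule integral_cong_AE) (use assms in \<open>auto intro!: borel_measurable_integrable L2_inner_integrable\<close>)

section \<open>L2 on a bounded open set, its completeness and L2-valued integrals\<close>

locale bounded_domain =
  fixes \<Omega> :: "'a::euclidean_space set"
  assumes op: "open \<Omega>" and bd: "bounded \<Omega>"
begin

abbreviation "M \<equiv> lebesgue_on \<Omega>"
abbreviation L2 :: "('a \<Rightarrow> real) set" where "L2 \<equiv> L2_space \<Omega>"
abbreviation NL :: "('a \<Rightarrow> real) \<Rightarrow> real" where "NL \<equiv> L2_norm \<Omega>"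
abbreviation "LI \<equiv> L2_inner \<Omega>"
abbreviation NH :: "('a \<Rightarrow> real) \<Rightarrow> real" where "NH \<equiv> H10_norm \<Omega>"

sublocale L2: semi_inner_space L2 "LI" NL by (rule L2_semi_inner)

lemma sets_Omega: "\<Omega> \<in> sets lebesgue" using op by simp

lemma finite_M: "finite_measure M"
proof -
  have "\<Omega> \<in> lmeasurable" using bd op by (intro bounded_set_imp_lmeasurable) auto
  then show ?thesis by (rule finite_measure_lebesgue_on)
qed

lemma const_L2: "(\<lambda>x. c) \<in> L2"
proof -
  interpret finite_measure M by (rule finite_M)
  show ?thesis by (simp add: L2_space_def)
qed

lemma L2_integrable: "u \<in> L2 \<Longrightarrow> integrable M u" using L2_inner_integrable[OF _ const_L2[of 1], of u] by simp

text \<open>Riesz-Fischer: a subsequence has increments of norm at most \<open>(1/2)^k\<close>,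
  summable in L1 since \<Omega> has finite measure, so it converges almost everywhere; Fatou bounds
  the distance to the limit.\<close>

lemma L2_complete:
  assumes f: "\<And>n. f n \<in> L2" and C: "\<And>e. e > 0 \<Longrightarrow> \<exists>K::nat. \<forall>m\<ge>K. \<forall>n\<ge>K. NL (f m - f n) < e"
  shows "\<exists>y\<in>L2. (\<lambda>n. NL (f n - y)) \<longlonglongrightarrow> 0"
proof -
  have "\<forall>k. \<exists>K. \<forall>m\<ge>K. \<forall>n\<ge>K. NL (f m - f n) < (1/2)^k" using C by simp
  then obtain K where K: "\<And>k m n. m \<ge> K k \<Longrightarrow> n \<ge> K k \<Longrightarrow> NL (f m - f n) < (1/2)^k" by metis
  \<comment> \<open>Partial sums of the thresholds: an index sequence that dominates
    \<open>K j\<close> for all j <= k without a separate monotone choice.\<close>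
  define r where "r k = (\<Sum>i\<le>k. K i)" for k :: nat
  have rK: "K j \<le> r k" if "j \<le> k" for j k unfolding r_def using that by (intro member_le_sum) auto
  define g where "g k x = f (r (Suc k)) x - f (r k) x" for k x
  have gL: "g k \<in> L2" for k using L2.diff_mem[OF f f, of "r (Suc k)" "r k"] by (simp add: g_def[abs_def] fun_diff_def)
  have gN: "NL (g k) \<le> (1/2)^k" for k using K[of k "r (Suc k)" "r k"] rK[of k k] rK[of k "Suc k"] by (simp add: g_def[abs_def] fun_diff_def)
  define c where "c = NL (\<lambda>x. 1)"
  have c0: "0 \<le> c" unfolding c_def by (rule L2.N_nonneg[OF const_L2])
  have absL: "(\<lambda>x. \<bar>g k x\<bar>) \<in> L2" for k using gL[of k] by (auto simp: L2_space_def)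
  have gI: "(\<integral>\<^sup>+x. ennreal \<bar>g k x\<bar> \<partial>M) \<le> ennreal (c * (1/2)^k)" for k
  proof -
    have "(\<integral>\<^sup>+x. ennreal \<bar>g k x\<bar> \<partial>M) = ennreal (\<integral>x. \<bar>g k x\<bar> \<partial>M)" using L2_integrable[OF gL] by (intro nn_integral_eq_integral) auto
    also have "(\<integral>x. \<bar>g k x\<bar> \<partial>M) = LI (\<lambda>x. \<bar>g k x\<bar>) (\<lambda>x. 1)" by (simp add: L2_inner_def)
    also have "\<dots> \<le> NL (\<lambda>x. \<bar>g k x\<bar>) * c"
      unfolding c_def using L2.cauchy_schwarz[OF absL const_L2[of 1]] by (rule order_trans[OF abs_ge_self])
    also have "NL (\<lambda>x. \<bar>g k x\<bar>) = NL (g k)" by (simp add: L2_norm_def L2_inner_def)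
    also have "NL (g k) * c \<le> (1/2)^k * c" using gN c0 by (rule mult_right_mono)
    finally show ?thesis by (simp add: mult.commute ennreal_leI)
  qed
  have gm: "g k \<in> borel_measurable M" for k by (rule L2_spaceD(1)[OF gL])
  have "(\<integral>\<^sup>+x. (\<Sum>k. ennreal \<bar>g k x\<bar>) \<partial>M) = (\<Sum>k. \<integral>\<^sup>+x. ennreal \<bar>g k x\<bar> \<partial>M)" using gm by (intro nn_integral_suminf) measurable
  also have "\<dots> \<le> (\<Sum>k. ennreal (c * (1/2)^k))" by (intro suminf_le gI) auto
  also have "\<dots> = ennreal (\<Sum>k. c * (1/2)^k)" using c0 by (intro suminf_ennreal2) (auto intro!: summable_mult summable_geometric)
  finally have "(\<integral>\<^sup>+x. (\<Sum>k. ennreal \<bar>g k x\<bar>) \<partial>M) \<noteq> \<infinity>" by (auto simp: top_unique)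
  then have "AE x in M. (\<Sum>k. ennreal \<bar>g k x\<bar>) \<noteq> \<infinity>" using gm by (intro nn_integral_PInf_AE) measurable
  then have lim: "AE x in M. (\<lambda>k. f (r k) x) \<longlonglongrightarrow> lim (\<lambda>k. f (r k) x)"
  proof eventually_elim
    case (elim x)
    then have "summable (\<lambda>k. \<bar>g k x\<bar>)" by (intro summable_suminf_not_top) auto
    then have s: "summable (\<lambda>k. g k x)" by (rule summable_rabs_cancel)
    have e: "(\<Sum>i<k. g i x) + f (r 0) x = f (r k) x" for k unfolding g_def using sum_lessThan_telescope[of "\<lambda>k. f (r k) x" k] by simp
    have "(\<lambda>k. (\<Sum>i<k. g i x) + f (r 0) x) \<longlonglongrightarrow> (\<Sum>i. g i x) + f (r 0) x" by (intro tendsto_intros summable_LIMSEQ s)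
    then have "convergent (\<lambda>k. f (r k) x)" unfolding e by (auto simp: convergent_def)
    then show ?case by (simp add: convergent_LIMSEQ_iff)
  qed
  define y where "y x = lim (\<lambda>k. f (r k) x)" for x
  have fm: "f n \<in> borel_measurable M" for n by (rule L2_spaceD(1)[OF f])
  have ym: "y \<in> borel_measurable M" unfolding y_def by (rule borel_measurable_AE_LIMSEQ[OF sets_Omega fm lim])
  have fat: "(\<integral>\<^sup>+x. ennreal ((f m x - y x)^2) \<partial>M) \<le> ennreal (((1/2)^j)^2)" if m: "m \<ge> K j" for m j
  proof -
    have "(\<integral>\<^sup>+x. ennreal ((f m x - y x)^2) \<partial>M) = (\<integral>\<^sup>+x. liminf (\<lambda>k. ennreal ((f m x - f (r k) x)^2)) \<partial>M)"
    proof (rule nn_integral_cong_AE)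
      show "AE x in M. ennreal ((f m x - y x)^2) = liminf (\<lambda>k. ennreal ((f m x - f (r k) x)^2))" using lim
      proof eventually_elim
        case (elim x)
        have "(\<lambda>k. ennreal ((f m x - f (r k) x)^2)) \<longlonglongrightarrow> ennreal ((f m x - y x)^2)"
          unfolding y_def by (intro tendsto_ennrealI tendsto_intros elim)
        then show ?case using lim_imp_Liminf[OF sequentially_bot] by fastforce
      qed
    qed
    also have "\<dots> \<le> liminf (\<lambda>k. \<integral>\<^sup>+x. ennreal ((f m x - f (r k) x)^2) \<partial>M)" using fm by (intro nn_integral_liminf) measurable
    also have "\<dots> \<le> liminf (\<lambda>k. ennreal (((1/2)^j)^2))"
    proof (rule Liminf_mono)
      show "\<forall>\<^sub>F k in sequentially. (\<integral>\<^sup>+x. ennreal ((f m x - f (r k) x)^2) \<partial>M) \<le> ennreal (((1/2)^j)^2)" using eventually_ge_at_top[of j]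
      proof eventually_elim
        case (elim k)
        have d: "f m - f (r k) \<in> L2" by (rule L2.diff_mem[OF f f])
        have "(\<integral>\<^sup>+x. ennreal ((f m x - f (r k) x)^2) \<partial>M) = ennreal (\<integral>x. (f m x - f (r k) x)^2 \<partial>M)"
          using L2_spaceD(2)[OF d] by (intro nn_integral_eq_integral) auto
        also have "(\<integral>x. (f m x - f (r k) x)^2 \<partial>M) = (NL (f m - f (r k)))^2" by (simp add: L2_norm_sq)
        also have "\<dots> \<le> ((1/2)^j)^2"
          using K[OF m order_trans[OF rK[of j j] ]] K[OF m rK[OF elim]] L2.N_nonneg[OF d] by (intro power_mono) auto
        finally show ?case by (simp add: ennreal_leI)
      qed
    qed
    also have "\<dots> = ennreal (((1/2)^j)^2)" by (rule Liminf_const) simp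
    finally show ?thesis .
  qed
  have dL: "f m - y \<in> L2" "NL (f m - y) \<le> (1/2)^j" if m: "m \<ge> K j" for m j
  proof -
    have me: "(\<lambda>x. (f m x - y x)^2) \<in> borel_measurable M" using fm ym by measurable
    have i: "integrable M (\<lambda>x. (f m x - y x)^2)" using fat[OF m] me by (intro integrableI_nonneg) (auto intro: order_le_less_trans)
    show "f m - y \<in> L2" using i fm[of m] ym by (simp add: L2_space_def fun_diff_def)
    have "ennreal (\<integral>x. (f m x - y x)^2 \<partial>M) \<le> ennreal (((1/2)^j)^2)" using fat[OF m] nn_integral_eq_integral[OF i] by simp
    then have "(NL (f m - y))^2 \<le> ((1/2)^j)^2" by (simp add: L2_norm_sq)
    then show "NL (f m - y) \<le> (1/2)^j" by (rule power2_le_imp_le) simp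
  qed
  have "f (K 0) - (f (K 0) - y) \<in> L2" by (rule L2.diff_mem[OF f dL(1)[OF order_refl]])
  then have yL: "y \<in> L2" by simp
  have "(\<lambda>n. NL (f n - y)) \<longlonglongrightarrow> 0"
  proof (rule LIMSEQ_I)
    fix e :: real assume "0 < e"
    then obtain j where j: "(1/2)^j < e" using real_arch_pow_inv[of e "1/2"] by auto
    have "norm (NL (f n - y) - 0) < e" if "n \<ge> K j" for n using dL[OF that] L2.N_nonneg[OF dL(1)[OF that]] j by simp
    then show "\<exists>no. \<forall>n\<ge>no. norm (NL (f n - y) - 0) < e" by blast
  qed
  then show ?thesis using yL by blast
qed

lemma bochner_integral_L2:
  assumes S: "S \<in> sets lebesgue" and f: "f \<in> bochner_L1 L2 NL S"
  shows "integral_into L2 NL S f \<in> L2"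
    "v \<in> L2 \<Longrightarrow> has_bochner_integral (lebesgue_on S) (\<lambda>t. LI (f t) v) (LI (integral_into L2 NL S f) v)"
proof -
  interpret B: bochner_space L2 NL S by unfold_locales (rule S)
  have "\<exists>y. has_integral_into L2 NL S f y" by (rule B.has_integral_exists[OF L2_complete])
      (use f in \<open>auto simp: bochner_L1_def integrable_iff_bounded L2_norm_nonneg\<close>)
  then have y: "has_integral_into L2 NL S f (integral_into L2 NL S f)" unfolding integral_into_def by (rule someI_ex)
  then show "integral_into L2 NL S f \<in> L2" by (simp add: has_integral_into_def)
  show "has_bochner_integral (lebesgue_on S) (\<lambda>t. LI (f t) v) (LI (integral_into L2 NL S f) v)"
    if v: "v \<in> L2"
  proof (rule B.has_integral_functional[OF y, where l = "\<lambda>u. LI u v" and C = "NL v"])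
    show "\<bar>LI u v\<bar> \<le> NL v * NL u" if "u \<in> L2" for u using L2.cauchy_schwarz[OF that v] by (simp add: mult.commute)
  qed (simp_all add: L2.ip_add L2.ip_scale v)
qed

lemma bochner_L1_restrict:
  assumes S: "S \<in> sets lebesgue" "S2 \<in> sets lebesgue" "S \<subseteq> S2" and f: "f \<in> bochner_L1 V N S2"
  shows "f \<in> bochner_L1 V N S" using f strongly_measurable_restrict[OF S] restrict_subset(2)[OF S] by (auto simp: bochner_L1_def)

end

section \<open>Weak gradients and the Poincare inequality\<close>

lemma translation_integral:
  fixes f :: "'a::euclidean_space \<Rightarrow> real"
  assumes f: "integrable lborel f"
  shows "integrable lborel (\<lambda>x. f (x + c))" "(\<integral>x. f (x + c) \<partial>lborel) = (\<integral>x. f x \<partial>lborel)"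
proof -
  have m: "(+) c \<in> measurable lborel borel" by measurable
  have fb: "f \<in> borel_measurable borel" using f by auto
  have "integrable (distr lborel borel ((+) c)) f" using f by (simp add: lborel_distr_plus)
  then show "integrable lborel (\<lambda>x. f (x + c))" using integrable_distr_eq[OF m fb] by (simp add: add.commute)
  have "(\<integral>x. f x \<partial>lborel) = (\<integral>x. f x \<partial>distr lborel borel ((+) c))" by (simp add: lborel_distr_plus)
  also have "\<dots> = (\<integral>x. f (c + x) \<partial>lborel)" by (rule integral_distr[OF m fb])
  finally show "(\<integral>x. f (x + c) \<partial>lborel) = (\<integral>x. f x \<partial>lborel)" by (simp add: add.commute)
qed

lemma test_lborel:
  fixes \<phi> :: "'a::euclidean_space \<Rightarrow> real"
  assumes "\<phi> \<in> test_functions S" shows "integrable lborel \<phi>"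
proof -
  have c: "continuous_on UNIV \<phi>" using test_smooth[OF assms] by (rule Ck_continuous[of 0])
  have "integrable (lebesgue_on UNIV) \<phi>" by (rule test_square_integrable(3)[OF _ assms]) simp
  then show ?thesis using borel_measurable_continuous_onI[OF c] by (simp add: integrable_completion lebesgue_on_UNIV_eq)
qed

lemma partial_line_derivative:
  fixes \<phi> :: "'a::euclidean_space \<Rightarrow> real"
  assumes phi: "\<phi> \<in> test_functions S"
  shows "((\<lambda>s. \<phi> (x + s *\<^sub>R e)) has_real_derivative frechet_derivative \<phi> (at (x + s *\<^sub>R e)) e) (at s)"
proof -
  let ?F = "frechet_derivative \<phi> (at (x + s *\<^sub>R e))"
  have d: "(\<phi> has_derivative ?F) (at (x + s *\<^sub>R e))" by (rule test_has_derivative[OF phi])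
  have "((\<lambda>s. x + s *\<^sub>R e) has_derivative (\<lambda>h. h *\<^sub>R e)) (at s)" by (auto intro!: derivative_eq_intros)
  from has_derivative_compose[OF this d] have "((\<lambda>s. \<phi> (x + s *\<^sub>R e)) has_derivative (\<lambda>h. ?F (h *\<^sub>R e))) (at s)" .
  moreover have "?F (h *\<^sub>R e) = ?F e * h" for h using linear_scale[OF has_derivative_linear[OF d], of h e] by (simp add: mult.commute)
  ultimately show ?thesis by (simp add: has_field_derivative_def)
qed

text \<open>Difference quotients have integral zero by translation invariance.\<close>
lemma integral_partial_zero:
  fixes \<phi> :: "'a::euclidean_space \<Rightarrow> real"
  assumes phi: "\<phi> \<in> test_functions S" and e: "e \<in> Basis"
  shows "(\<integral>x. frechet_derivative \<phi> (at x) e \<partial>lborel) = 0"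
proof -
  define D where "D x = frechet_derivative \<phi> (at x) e" for x
  define h where "h n = 1 / real (Suc n)" for n
  have h: "0 < h n" "h n \<le> 1" for n by (auto simp: h_def)
  define q where "q n x = (\<phi> (x + h n *\<^sub>R e) - \<phi> x) / h n" for n x
  have Dt: "D \<in> test_functions S" unfolding D_def[abs_def] by (rule test_partial[OF phi e])
  obtain P where P: "0 < P" "\<And>x. \<bar>D x\<bar> \<le> P" using test_bounded[OF Dt] by blast
  have "bounded (closure {x. \<phi> x \<noteq> 0})" using phi by (auto simp: test_functions_def intro: compact_imp_bounded)
  then obtain R where R: "\<And>x. x \<in> closure {x. \<phi> x \<noteq> 0} \<Longrightarrow> norm x \<le> R" unfolding bounded_iff by blast
  have z: "\<phi> x = 0" if "R < norm x" for x using R[of x] closure_subset[of "{x. \<phi> x \<noteq> 0}"] that by force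
  have dom: "norm (q n x) \<le> P * indicator (cball 0 (R + 1)) x" for n x
  proof (cases "x \<in> cball 0 (R + 1)")
    case True
    obtain s where "\<phi> (x + h n *\<^sub>R e) - \<phi> (x + 0 *\<^sub>R e) = (h n - 0) * frechet_derivative \<phi> (at (x + s *\<^sub>R e)) e"
      using MVT2[OF h(1) partial_line_derivative[OF phi], of n x e] by blast
    then have "q n x = D (x + s *\<^sub>R e)" using h(1)[of n] by (simp add: q_def D_def)
    then show ?thesis using P True by simp
  next
    case False
    have "norm x - norm (h n *\<^sub>R e) \<le> norm (x + h n *\<^sub>R e)" using norm_diff_ineq[of x "h n *\<^sub>R e"] by simp
    moreover have "norm (h n *\<^sub>R e) \<le> 1" using e h[of n] by simp
    ultimately have "q n x = 0" using False z[of x] z[of "x + h n *\<^sub>R e"] by (simp add: q_def)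
    then show ?thesis using P by simp
  qed
  have li: "integrable lborel \<phi>" by (rule test_lborel[OF phi])
  have qi: "integrable lborel (q n)" "(\<integral>x. q n x \<partial>lborel) = 0" for n
    unfolding q_def[abs_def] using translation_integral[OF li, of "h n *\<^sub>R e"] li by simp_all
  have "(\<lambda>n. \<integral>x. q n x \<partial>lborel) \<longlonglongrightarrow> (\<integral>x. D x \<partial>lborel)"
  proof (rule integral_dominated_convergence[where w = "\<lambda>x. P * indicator (cball 0 (R + 1)) x"])
    show "D \<in> borel_measurable lborel" using test_lborel[OF Dt] by auto
    show "q n \<in> borel_measurable lborel" for n using qi(1)[of n] by auto
    show "integrable lborel (\<lambda>x. P * indicator (cball 0 (R + 1)) x)"
      by (rule integrable_mult_right, rule integrable_real_indicator[OF _ emeasure_bounded_finite[OF bounded_cball]]) simp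
    show "AE x in lborel. norm (q n x) \<le> P * indicator (cball 0 (R + 1)) x" for n by (rule AE_I2, rule dom)
    show "AE x in lborel. (\<lambda>n. q n x) \<longlonglongrightarrow> D x"
    proof (rule AE_I2)
      fix x
      have "((\<lambda>s. \<phi> (x + s *\<^sub>R e)) has_real_derivative D x) (at 0)" using partial_line_derivative[OF phi, of x e 0] by (simp add: D_def)
      then have "(\<lambda>k. (\<phi> (x + (0 + k) *\<^sub>R e) - \<phi> (x + 0 *\<^sub>R e)) / k) \<midarrow>0\<rightarrow> D x" by (simp only: DERIV_def)
      moreover have "filterlim h (at 0) sequentially"
      proof (rule filterlim_atI)
        show "h \<longlonglongrightarrow> 0" unfolding h_def[abs_def] using LIMSEQ_inverse_real_of_nat by (simp add: inverse_eq_divide)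
        show "\<forall>\<^sub>F n in sequentially. h n \<noteq> 0" using h(1) by (auto simp: less_imp_neq[symmetric])
      qed
      ultimately have "(\<lambda>n. (\<phi> (x + (0 + h n) *\<^sub>R e) - \<phi> (x + 0 *\<^sub>R e)) / h n) \<longlonglongrightarrow> D x" by (rule filterlim_compose)
      then show "(\<lambda>n. q n x) \<longlonglongrightarrow> D x" by (simp add: q_def)
    qed
  qed
  then have "(\<integral>x. D x \<partial>lborel) = 0" unfolding qi(2) by (simp add: LIMSEQ_const_iff)
  then show ?thesis by (simp add: D_def)
qed

section \<open>Weak gradients, first order Sobolev spaces and the embedding of L2 into the
  dual\<close>

context bounded_domain
begin

abbreviation pd :: "'a \<Rightarrow> ('a \<Rightarrow> real) \<Rightarrow> 'a \<Rightarrow> real" where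
  "pd e \<phi> x \<equiv> frechet_derivative \<phi> (at x) e"

lemma test_integral_M:
  assumes "\<phi> \<in> test_functions \<Omega>" shows "integral\<^sup>L M \<phi> = integral\<^sup>L lborel \<phi>"
proof -
  have "(\<lambda>x. indicator \<Omega> x *\<^sub>R \<phi> x) = \<phi>"
    using assms closure_subset[of "{x. \<phi> x \<noteq> 0}"] by (auto simp: test_functions_def indicator_def fun_eq_iff)
  then have "integral\<^sup>L M \<phi> = integral\<^sup>L lebesgue \<phi>" using sets_Omega by (simp add: integral_restrict_space del: real_scaleR_def)
  also have "\<dots> = integral\<^sup>L lborel \<phi>" using test_lborel[OF assms] by (intro integral_completion) auto
  finally show ?thesis .
qed

lemma test_integral_partial: "\<phi> \<in> test_functions \<Omega> \<Longrightarrow> e \<in> Basis \<Longrightarrow> integral\<^sup>L M (pd e \<phi>) = 0"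
  using test_integral_M[OF test_partial] integral_partial_zero by metis

lemma pd_mult:
  assumes "Ck 1 \<phi>" "Ck 1 \<psi>"
  shows "pd e (\<lambda>x. \<phi> x * \<psi> x) x = \<phi> x * pd e \<psi> x + pd e \<phi> x * \<psi> x"
proof -
  have d: "(\<phi> has_derivative frechet_derivative \<phi> (at x)) (at x)" "(\<psi> has_derivative frechet_derivative \<psi> (at x)) (at x)"
    using assms by (auto intro!: Ck_has_derivative[of 0])
  show ?thesis using frechet_derivative_at[OF has_derivative_mult[OF d]] by (simp add: fun_eq_iff)
qed

lemma test_L2: "\<phi> \<in> test_functions S \<Longrightarrow> \<phi> \<in> L2" using test_square_integrable[OF sets_Omega] by (auto simp: L2_space_def)

lemma integration_by_parts:
  assumes phi: "\<phi> \<in> test_functions \<Omega>" and psi: "\<psi> \<in> test_functions \<Omega>" and e: "e \<in> Basis"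
  shows "LI \<phi> (pd e \<psi>) = - LI (pd e \<phi>) \<psi>"
proof -
  have t: "(\<lambda>x. \<phi> x * \<psi> x) \<in> test_functions \<Omega>" by (rule test_mult[OF phi test_smooth[OF psi]])
  have eq: "pd e (\<lambda>x. \<phi> x * \<psi> x) = (\<lambda>x. \<phi> x * pd e \<psi> x + pd e \<phi> x * \<psi> x)"
    by (rule ext, rule pd_mult[OF test_smooth[OF phi] test_smooth[OF psi]])
  have "integral\<^sup>L M (\<lambda>x. \<phi> x * pd e \<psi> x + pd e \<phi> x * \<psi> x) = 0" using test_integral_partial[OF t e] unfolding eq .
  moreover have "integrable M (\<lambda>x. \<phi> x * pd e \<psi> x)" "integrable M (\<lambda>x. pd e \<phi> x * \<psi> x)"
    using L2_inner_integrable[OF test_L2[OF phi] test_L2[OF test_partial[OF psi e]]]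
      L2_inner_integrable[OF test_L2[OF test_partial[OF phi e]] test_L2[OF psi]] by simp_all
  ultimately show ?thesis by (simp add: L2_inner_def)
qed

abbreviation L2v :: "('a \<Rightarrow> 'a) set" where "L2v \<equiv> L2_space \<Omega>"

sublocale L2v: semi_inner_space L2v "LI" "L2_norm \<Omega>" by (rule L2_semi_inner)

lemma comp_L2: assumes "g \<in> L2v" shows "(\<lambda>x. g x \<bullet> e) \<in> L2"
proof -
  note g = L2_spaceD[OF assms]
  have m: "(\<lambda>x. g x \<bullet> e) \<in> borel_measurable M" using g(1) by measurable
  moreover have "integrable M (\<lambda>x. (norm (g x \<bullet> e))^2)"
  proof (rule Bochner_Integration.integrable_bound)
    show "integrable M (\<lambda>x. (norm e)^2 * (norm (g x))^2)" using g(2) by simp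
    show "(\<lambda>x. (norm (g x \<bullet> e))^2) \<in> borel_measurable M" using m by measurable
    show "AE x in M. norm ((norm (g x \<bullet> e))^2) \<le> norm ((norm e)^2 * (norm (g x))^2)"
    proof (rule AE_I2)
      fix x
      have "(norm (g x \<bullet> e))^2 \<le> (norm (g x) * norm e)^2" using Cauchy_Schwarz_ineq2[of "g x" e] by (intro power_mono) auto
      then show "norm ((norm (g x \<bullet> e))^2) \<le> norm ((norm e)^2 * (norm (g x))^2)" by (simp add: power_mult_distrib mult.commute)
    qed
  qed
  ultimately show ?thesis by (simp add: L2_space_def)
qed

text \<open>The lemma of du Bois-Reymond in each coordinate. It makes the choice in
  \<open>grad\<close> harmless almost everywhere.\<close>

lemma weak_gradient_unique:
  assumes g: "g \<in> L2v" "g' \<in> L2v" and w: "is_weak_gradient \<Omega> v g" "is_weak_gradient \<Omega> v g'"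
  shows "AE x in M. g x = g' x"
proof -
  have "AE x in M. (g - g') x \<bullet> e = 0" if e: "e \<in> Basis" for e
  proof (rule du_Bois_Reymond[OF op])
    have c: "(\<lambda>x. (g - g') x \<bullet> e) \<in> L2" by (rule comp_L2[OF L2v.diff_mem[OF g]])
    show "integrable (lebesgue_on (cbox a b)) (\<lambda>x. (g - g') x \<bullet> e)" if "cbox a b \<subseteq> \<Omega>" for a b
      by (rule restrict_subset(2)[OF _ sets_Omega that L2_integrable[OF c]]) simp
    show "integral\<^sup>L M (\<lambda>x. (g - g') x \<bullet> e * \<phi> x) = 0" if phi: "\<phi> \<in> test_functions \<Omega>" for \<phi>
    proof -
      have "LI (\<lambda>x. g x \<bullet> e) \<phi> = LI (\<lambda>x. g' x \<bullet> e) \<phi>" using w phi e unfolding is_weak_gradient_def by (metis neg_equal_iff_equal)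
      moreover have "LI ((\<lambda>x. g x \<bullet> e) - (\<lambda>x. g' x \<bullet> e)) \<phi> = LI (\<lambda>x. g x \<bullet> e) \<phi> - LI (\<lambda>x. g' x \<bullet> e) \<phi>"
        by (rule L2.ip_diff[OF comp_L2[OF g(1)] comp_L2[OF g(2)] test_L2[OF phi]])
      ultimately show ?thesis by (simp add: L2_inner_def inner_diff_left)
    qed
  qed
  then have "AE x in M. \<forall>e\<in>Basis. (g - g') x \<bullet> e = 0" by (intro AE_finite_allI) auto
  then show ?thesis by eventually_elim (auto simp: inner_diff_left intro: euclidean_eqI)
qed

abbreviation H1 :: "('a \<Rightarrow> real) set" where "H1 \<equiv> H1_space \<Omega>"
abbreviation gr :: "('a \<Rightarrow> real) \<Rightarrow> 'a \<Rightarrow> 'a" where "gr \<equiv> grad \<Omega>"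
abbreviation gi :: "('a \<Rightarrow> real) \<Rightarrow> ('a \<Rightarrow> real) \<Rightarrow> real" where "gi u v \<equiv> LI (gr u) (gr v)"

lemma grad_spec: assumes "v \<in> H1" shows "gr v \<in> L2v" "is_weak_gradient \<Omega> v (gr v)"
proof -
  have "\<exists>g. g \<in> L2v \<and> is_weak_gradient \<Omega> v g" using assms by (auto simp: H1_space_def)
  from someI_ex[OF this] show "gr v \<in> L2v" "is_weak_gradient \<Omega> v (gr v)" by (auto simp: grad_def)
qed

lemma grad_eqI: assumes "v \<in> L2" "g \<in> L2v" "is_weak_gradient \<Omega> v g"
  shows "v \<in> H1" "AE x in M. gr v x = g x"
proof -
  show v: "v \<in> H1" using assms by (auto simp: H1_space_def)
  show "AE x in M. gr v x = g x" by (rule weak_gradient_unique[OF grad_spec(1)[OF v] assms(2) grad_spec(2)[OF v] assms(3)])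
qed

lemma H1_L2: "v \<in> H1 \<Longrightarrow> v \<in> L2" by (simp add: H1_space_def)

lemma weak_gradient_add:
  assumes uv: "u \<in> L2" "v \<in> L2" and g: "g \<in> L2v" "g' \<in> L2v" and w: "is_weak_gradient \<Omega> u g" "is_weak_gradient \<Omega> v g'"
  shows "is_weak_gradient \<Omega> (u + v) (g + g')" unfolding is_weak_gradient_def
proof (intro ballI)
  fix \<phi> e assume phi: "\<phi> \<in> test_functions \<Omega>" and e: "(e::'a) \<in> Basis"
  have eq: "(\<lambda>x. (g + g') x \<bullet> e) = (\<lambda>x. g x \<bullet> e) + (\<lambda>x. g' x \<bullet> e)" by (auto simp: inner_add_left)
  show "LI (u + v) (pd e \<phi>) = - LI (\<lambda>x. (g + g') x \<bullet> e) \<phi>" unfolding eq L2.ip_add[OF comp_L2[OF g(1)] comp_L2[OF g(2)] test_L2[OF phi]]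
      L2.ip_add[OF uv test_L2[OF test_partial[OF phi e]]] using w phi e unfolding is_weak_gradient_def by simp
qed

lemma weak_gradient_scale:
  assumes u: "u \<in> L2" and g: "g \<in> L2v" and w: "is_weak_gradient \<Omega> u g"
  shows "is_weak_gradient \<Omega> (c *\<^sub>R u) (c *\<^sub>R g)" unfolding is_weak_gradient_def
proof (intro ballI)
  fix \<phi> e assume phi: "\<phi> \<in> test_functions \<Omega>" and e: "(e::'a) \<in> Basis"
  have eq: "(\<lambda>x. (c *\<^sub>R g) x \<bullet> e) = c *\<^sub>R (\<lambda>x. g x \<bullet> e)" by (auto simp: scaleR_fun_def)
  show "LI (c *\<^sub>R u) (pd e \<phi>) = - LI (\<lambda>x. (c *\<^sub>R g) x \<bullet> e) \<phi>"
    unfolding eq L2.ip_scale[OF comp_L2[OF g] test_L2[OF phi]] L2.ip_scale[OF u test_L2[OF test_partial[OF phi e]]]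
    using w phi e unfolding is_weak_gradient_def by simp
qed

lemma H1_add: assumes u: "u \<in> H1" and v: "v \<in> H1"
  shows "u + v \<in> H1" "AE x in M. gr (u + v) x = (gr u + gr v) x"
  by (rule grad_eqI[OF L2.add_mem[OF H1_L2[OF u] H1_L2[OF v]] L2v.add_mem[OF grad_spec(1)[OF u] grad_spec(1)[OF v]]
    weak_gradient_add[OF H1_L2[OF u] H1_L2[OF v] grad_spec(1)[OF u] grad_spec(1)[OF v] grad_spec(2)[OF u] grad_spec(2)[OF v]]])+

lemma H1_scale: assumes u: "u \<in> H1" shows "c *\<^sub>R u \<in> H1" "AE x in M. gr (c *\<^sub>R u) x = (c *\<^sub>R gr u) x"
  by (rule grad_eqI[OF L2.scale_mem[OF H1_L2[OF u]] L2v.scale_mem[OF grad_spec(1)[OF u]]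
    weak_gradient_scale[OF H1_L2[OF u] grad_spec[OF u]]])+

lemma zero_H1: "0 \<in> H1" by (rule grad_eqI(1)[OF L2.zero_mem L2v.zero_mem]) (simp add: is_weak_gradient_def L2_inner_def)

sublocale H1: semi_inner_space H1 gi "NH"
proof
  fix u v w :: "'a \<Rightarrow> real" and c :: real
  assume u: "u \<in> H1"
  show "c *\<^sub>R u \<in> H1" by (rule H1_scale[OF u])
  show "0 \<le> gi u u" by (rule L2v.ip_nonneg[OF grad_spec(1)[OF u]])
  assume v: "v \<in> H1"
  show "u + v \<in> H1" by (rule H1_add[OF u v])
  show "gi u v = gi v u" by (rule L2v.ip_sym) (use u v in \<open>auto intro: grad_spec\<close>)
  show "gi (c *\<^sub>R u) v = c * gi u v"
    using L2_inner_cong_AE[OF grad_spec(1)[OF H1_scale(1)[OF u]] L2v.scale_mem[OF grad_spec(1)[OF u]] grad_spec(1)[OF v] H1_scale(2)[OF u]]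
      L2v.ip_scale[OF grad_spec(1)[OF u] grad_spec(1)[OF v]] by simp
  assume w: "w \<in> H1"
  show "gi (u + v) w = gi u w + gi v w"
    by (rule trans[OF L2_inner_cong_AE[OF grad_spec(1)[OF H1_add(1)[OF u v]] L2v.add_mem[OF grad_spec(1)[OF u] grad_spec(1)[OF v]] grad_spec(1)[OF w] H1_add(2)[OF u v]]
      L2v.ip_add[OF grad_spec(1)[OF u] grad_spec(1)[OF v] grad_spec(1)[OF w]]])
qed (auto simp: zero_H1 H10_norm_def L2_norm_def)

definition cg :: "('a \<Rightarrow> real) \<Rightarrow> 'a \<Rightarrow> 'a" where "cg \<phi> x = (\<Sum>e\<in>Basis. pd e \<phi> x *\<^sub>R e)"

lemma cg_inner: "e \<in> Basis \<Longrightarrow> cg \<phi> x \<bullet> e = pd e \<phi> x" by (simp add: cg_def inner_sum_left inner_Basis if_distrib sum.delta cong: if_cong)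

lemma test_gradient:
  assumes phi: "\<phi> \<in> test_functions \<Omega>"
  shows "cg \<phi> \<in> L2v" "\<phi> \<in> H1" "AE x in M. gr \<phi> x = cg \<phi> x"
proof -
  have "(\<lambda>x. pd e \<phi> x *\<^sub>R e) \<in> L2v" if e: "e \<in> Basis" for e using test_L2[OF test_partial[OF phi e]] e by (auto simp: L2_space_def)
  then have "(\<Sum>e\<in>Basis. (\<lambda>x. pd e \<phi> x *\<^sub>R e)) \<in> L2v" by (rule L2v.sum_mem)
  moreover have "(\<Sum>e\<in>B. (\<lambda>x. pd e \<phi> x *\<^sub>R e)) = (\<lambda>x. \<Sum>e\<in>B. pd e \<phi> x *\<^sub>R e)" for B by (induction B rule: infinite_finite_induct) auto
  ultimately show c: "cg \<phi> \<in> L2v" by (simp add: cg_def[abs_def])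
  have w: "is_weak_gradient \<Omega> \<phi> (cg \<phi>)" unfolding is_weak_gradient_def using integration_by_parts[OF phi] by (simp add: cg_inner)
  show "\<phi> \<in> H1" "AE x in M. gr \<phi> x = cg \<phi> x" by (rule grad_eqI[OF test_L2[OF phi] c w])+
qed

text \<open>\<open>grad\<close> selects representatives and is linear only almost everywhere;
  expanding both sides into inner products avoids comparing the representatives.\<close>

lemma grad_diff_norm:
  assumes u: "u \<in> H1" and v: "v \<in> H1"
  shows "L2_norm \<Omega> (gr u - gr v) = NH (u - v)"
proof -
  note g = grad_spec(1)[OF u] grad_spec(1)[OF v]
  have "(L2_norm \<Omega> (gr u - gr v))^2 = gi u u - 2 * gi u v + gi v v"
    using L2v.N_sq[OF L2v.diff_mem[OF g]] L2v.ip_sym[OF g] by (simp add: L2v.ip_diff L2v.ip_diff_right L2v.diff_mem g)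
  also have "\<dots> = (NH (u - v))^2"
    using H1.N_sq[OF H1.diff_mem[OF u v]] H1.ip_sym[OF u v] by (simp add: H1.ip_diff H1.ip_diff_right H1.diff_mem u v)
  finally show ?thesis using H1.N_nonneg[OF H1.diff_mem[OF u v]] L2v.N_nonneg[OF L2v.diff_mem[OF g]] by simp
qed

abbreviation H10 :: "('a \<Rightarrow> real) set" where "H10 \<equiv> H10_space \<Omega>"

lemma H10_iff: "v \<in> H10 \<longleftrightarrow> v \<in> H1 \<and> (\<exists>\<phi>. (\<forall>n::nat. \<phi> n \<in> test_functions \<Omega>) \<and>
    (\<lambda>n. NL (\<phi> n - v)) \<longlonglongrightarrow> 0 \<and> (\<lambda>n. NH (\<phi> n - v)) \<longlonglongrightarrow> 0)" unfolding H10_space_def using test_gradient(2) by (auto simp: grad_diff_norm)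

lemma H10_H1: "v \<in> H10 \<Longrightarrow> v \<in> H1" by (simp add: H10_iff)

lemma test_seq_combine:
  assumes u: "u \<in> H10" and v: "v \<in> H10" shows "a *\<^sub>R u + b *\<^sub>R v \<in> H10"
proof -
  obtain p where p: "\<And>n::nat. p n \<in> test_functions \<Omega>" "(\<lambda>n. NL (p n - u)) \<longlonglongrightarrow> 0" "(\<lambda>n. NH (p n - u)) \<longlonglongrightarrow> 0" using u by (auto simp: H10_iff)
  obtain q where q: "\<And>n::nat. q n \<in> test_functions \<Omega>" "(\<lambda>n. NL (q n - v)) \<longlonglongrightarrow> 0" "(\<lambda>n. NH (q n - v)) \<longlonglongrightarrow> 0" using v by (auto simp: H10_iff)
  define r where "r n = a *\<^sub>R p n + b *\<^sub>R q n" for n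
  have r: "r n \<in> test_functions \<Omega>" for n
    using test_add[OF test_scale[OF p(1), of a n] test_scale[OF q(1), of b n]] by (simp add: r_def scaleR_fun_def plus_fun_def)
  have eq: "r n - (a *\<^sub>R u + b *\<^sub>R v) = a *\<^sub>R (p n - u) + b *\<^sub>R (q n - v)" for n by (simp add: r_def algebra_simps)
  have gen: "(\<lambda>n. N (r n - (a *\<^sub>R u + b *\<^sub>R v))) \<longlonglongrightarrow> 0"
    if S: "seminormed_space W N" and m: "\<And>n. p n - u \<in> W" "\<And>n. q n - v \<in> W"
      and l: "(\<lambda>n. N (p n - u)) \<longlonglongrightarrow> 0" "(\<lambda>n. N (q n - v)) \<longlonglongrightarrow> 0" for W N
  proof -
    interpret S: seminormed_space W N by (rule S)
    show ?thesis
    proof (rule Lim_null_comparison)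
      have "norm (N (r n - (a *\<^sub>R u + b *\<^sub>R v))) \<le> \<bar>a\<bar> * N (p n - u) + \<bar>b\<bar> * N (q n - v)" for n
        unfolding eq using S.N_triangle[OF S.scale_mem[OF m(1)] S.scale_mem[OF m(2)], of a n b n]
          S.N_nonneg[OF S.add_mem[OF S.scale_mem[OF m(1)] S.scale_mem[OF m(2)]], of a n b n] by (simp add: S.N_scale m)
      then show "\<forall>\<^sub>F n in sequentially. norm (N (r n - (a *\<^sub>R u + b *\<^sub>R v))) \<le> \<bar>a\<bar> * N (p n - u) + \<bar>b\<bar> * N (q n - v)" by simp
      show "(\<lambda>n. \<bar>a\<bar> * N (p n - u) + \<bar>b\<bar> * N (q n - v)) \<longlonglongrightarrow> 0"
        using tendsto_add[OF tendsto_mult_left[OF l(1), of "\<bar>a\<bar>"] tendsto_mult_left[OF l(2), of "\<bar>b\<bar>"]] by simp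
    qed
  qed
  have h: "u \<in> H1" "v \<in> H1" using u v by (auto intro: H10_H1)
  have "(\<lambda>n. NL (r n - (a *\<^sub>R u + b *\<^sub>R v))) \<longlonglongrightarrow> 0"
    by (rule gen[OF L2.seminormed_space_axioms L2.diff_mem[OF test_L2[OF p(1)] H1_L2[OF h(1)]] L2.diff_mem[OF test_L2[OF q(1)] H1_L2[OF h(2)]] p(2) q(2)])
  moreover have "(\<lambda>n. NH (r n - (a *\<^sub>R u + b *\<^sub>R v))) \<longlonglongrightarrow> 0"
    by (rule gen[OF H1.seminormed_space_axioms H1.diff_mem[OF test_gradient(2)[OF p(1)] h(1)] H1.diff_mem[OF test_gradient(2)[OF q(1)] h(2)] p(3) q(3)])
  ultimately show ?thesis unfolding H10_iff using r h by (auto intro!: H1.add_mem H1.scale_mem)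
qed

lemma zero_H10: "0 \<in> H10" unfolding H10_iff
proof (intro conjI exI[of _ "\<lambda>n. 0"])
  show "\<forall>n::nat. (0::'a \<Rightarrow> real) \<in> test_functions \<Omega>" using test_zero by (simp add: zero_fun_def)
qed (simp_all add: zero_H1 L2.N_zero H1.N_zero)

sublocale H10: semi_inner_space H10 gi "NH"
proof
  fix u v w :: "'a \<Rightarrow> real" and c :: real
  assume u: "u \<in> H10"
  show "c *\<^sub>R u \<in> H10" using test_seq_combine[OF u u, of c 0] by simp
  show "0 \<le> gi u u" by (rule H1.ip_nonneg[OF H10_H1[OF u]])
  assume v: "v \<in> H10"
  show "u + v \<in> H10" using test_seq_combine[OF u v, of 1 1] by simp
  show "gi u v = gi v u" using u v by (intro H1.ip_sym H10_H1)
  show "gi (c *\<^sub>R u) v = c * gi u v" using u v by (intro H1.ip_scale H10_H1)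
  assume w: "w \<in> H10"
  show "gi (u + v) w = gi u w + gi v w" using u v w by (intro H1.ip_add H10_H1)
qed (auto simp: zero_H10 H1.N_eq H10_norm_def L2_norm_def)

lemma Ck_inner: "Ck k (\<lambda>x. x \<bullet> (e::'a))"
proof (cases k)
  case 0 then show ?thesis by (auto intro!: continuous_intros)
next
  case (Suc m)
  show ?thesis unfolding Suc by (rule Ck_SucI[where f' = "\<lambda>x y. y \<bullet> e"]) (auto intro!: derivative_eq_intros Ck_const)
qed

text \<open>Integrate the \<open>e\<close>-derivative of \<open>(x \<bullet> e) \<phi>^2\<close>.\<close>
lemma Poincare_test:
  assumes R: "\<And>x. x \<in> \<Omega> \<Longrightarrow> norm x \<le> R" "0 \<le> R" and phi: "\<phi> \<in> test_functions \<Omega>"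
  shows "NL \<phi> \<le> 2 * R * NH \<phi>"
proof -
  obtain e :: 'a where e: "e \<in> Basis" using nonempty_Basis by blast
  define p where "p x = \<phi> x * (x \<bullet> e)" for x
  have p: "p \<in> test_functions \<Omega>" unfolding p_def[abs_def] by (rule test_mult[OF phi Ck_inner])
  have pdx: "pd e (\<lambda>x. x \<bullet> e) x = 1" for x
  proof -
    have "((\<lambda>x. x \<bullet> e) has_derivative (\<lambda>y. y \<bullet> e)) (at x)" by (auto intro!: derivative_eq_intros)
    from frechet_derivative_at[OF this, symmetric] show ?thesis using e by (simp add: inner_Basis)
  qed
  have pdp: "pd e p x = \<phi> x + pd e \<phi> x * (x \<bullet> e)" for x
    unfolding p_def[abs_def] using pd_mult[OF test_smooth[OF phi] Ck_inner, of e x e] pdx by simp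
  have L: "\<phi> \<in> L2" "pd e \<phi> \<in> L2" "p \<in> L2" using test_L2[OF phi] test_L2[OF test_partial[OF phi e]] test_L2[OF p] by auto
  have ipp: "LI p (pd e \<phi>) = LI (\<lambda>x. pd e \<phi> x * (x \<bullet> e)) \<phi>" by (simp add: L2_inner_def p_def mult_ac)
  have q: "(\<lambda>x. pd e \<phi> x * (x \<bullet> e)) \<in> L2" by (rule test_L2[OF test_mult[OF test_partial[OF phi e] Ck_inner]])
  have "LI p (pd e \<phi>) = - LI (pd e p) \<phi>" by (rule integration_by_parts[OF p phi e])
  also have "pd e p = \<phi> + (\<lambda>x. pd e \<phi> x * (x \<bullet> e))" by (rule ext) (simp add: pdp)
  also have "LI (\<phi> + (\<lambda>x. pd e \<phi> x * (x \<bullet> e))) \<phi> = LI \<phi> \<phi> + LI p (pd e \<phi>)" unfolding ipp by (rule L2.ip_add[OF L(1) q L(1)])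
  finally have "LI \<phi> \<phi> = - 2 * LI p (pd e \<phi>)" by simp
  then have "(NL \<phi>)^2 \<le> 2 * \<bar>LI p (pd e \<phi>)\<bar>" using L2.N_sq[OF L(1)] by simp
  also have "\<dots> \<le> 2 * (NL p * NL (pd e \<phi>))" using L2.cauchy_schwarz[OF L(3,2)] by simp
  also have "\<dots> \<le> 2 * ((R * NL \<phi>) * NH \<phi>)"
  proof (intro mult_left_mono mult_mono)
    have "(NL p)^2 \<le> (\<integral>x. R^2 * (norm (\<phi> x))^2 \<partial>M)" unfolding L2_norm_sq
    proof (rule integral_mono)
      show "integrable M (\<lambda>x. (norm (p x))^2)" "integrable M (\<lambda>x. R^2 * (norm (\<phi> x))^2)" using L2_spaceD(2)[OF L(3)] L2_spaceD(2)[OF L(1)] by auto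
      fix x assume "x \<in> space M"
      then have "\<bar>x \<bullet> e\<bar> \<le> R" using R(1)[of x] Basis_le_norm[OF e, of x] by simp
      then have "(x \<bullet> e)^2 \<le> R^2" using R(2) by (simp add: abs_le_square_iff[symmetric])
      then show "(norm (p x))^2 \<le> R^2 * (norm (\<phi> x))^2"
        using mult_left_mono[of "(x \<bullet> e)^2" "R^2" "(\<phi> x)^2"] by (simp add: p_def power_mult_distrib mult.commute)
    qed
    also have "\<dots> = (R * NL \<phi>)^2" by (simp add: power_mult_distrib L2_norm_sq)
    finally show "NL p \<le> R * NL \<phi>" using R(2) L2.N_nonneg[OF L(1)] by (rule_tac power2_le_imp_le) auto
    have "(NL (pd e \<phi>))^2 \<le> (L2_norm \<Omega> (cg \<phi>))^2" unfolding L2_norm_sq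
    proof (rule integral_mono)
      show "integrable M (\<lambda>x. (norm (pd e \<phi> x))^2)" "integrable M (\<lambda>x. (norm (cg \<phi> x))^2)"
        using L2_spaceD(2)[OF L(2)] L2_spaceD(2)[OF test_gradient(1)[OF phi]] by auto
      fix x show "(norm (pd e \<phi> x))^2 \<le> (norm (cg \<phi> x))^2"
        using Basis_le_norm[OF e, of "cg \<phi> x"] by (simp add: cg_inner[OF e] abs_le_square_iff[symmetric])
    qed
    also have "(L2_norm \<Omega> (cg \<phi>))^2 = (L2_norm \<Omega> (gr \<phi>))^2" unfolding L2_norm_sq
    proof (rule integral_cong_AE)
      show "(\<lambda>x. (norm (cg \<phi> x))^2) \<in> borel_measurable M" "(\<lambda>x. (norm (gr \<phi> x))^2) \<in> borel_measurable M"
        using L2_spaceD(2)[OF test_gradient(1)[OF phi]] L2_spaceD(2)[OF grad_spec(1)[OF test_gradient(2)[OF phi]]] by auto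
      show "AE x in M. (norm (cg \<phi> x))^2 = (norm (gr \<phi> x))^2" using test_gradient(3)[OF phi] by eventually_elim simp
    qed
    finally show "NL (pd e \<phi>) \<le> NH \<phi>" unfolding H10_norm_def
      by (rule power2_le_imp_le) (simp add: L2_norm_def L2v.ip_nonneg[OF grad_spec(1)[OF test_gradient(2)[OF phi]]])
  qed (use R(2) L2.N_nonneg[OF L(1)] L2.N_nonneg[OF L(2)] in auto)
  finally have "NL \<phi> * NL \<phi> \<le> (2 * R * NH \<phi>) * NL \<phi>" by (simp add: power2_eq_square mult_ac)
  then show ?thesis
  proof (cases "NL \<phi> = 0")
    case True then show ?thesis using R(2) H1.N_nonneg[OF test_gradient(2)[OF phi]] by simp
  next
    case False
    then have "0 < NL \<phi>" using L2.N_nonneg[OF L(1)] by simp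
    then show ?thesis using \<open>NL \<phi> * NL \<phi> \<le> _\<close> by (rule mult_right_le_imp_le[rotated])
  qed
qed

lemma Poincare: obtains C where "0 \<le> C" "\<And>v. v \<in> H10 \<Longrightarrow> NL v \<le> C * NH v"
proof -
  obtain R where R: "\<And>x. x \<in> \<Omega> \<Longrightarrow> norm x \<le> R" using bd unfolding bounded_iff by blast
  define C where "C = 2 * \<bar>R\<bar>"
  have Rp: "norm x \<le> \<bar>R\<bar>" if "x \<in> \<Omega>" for x using R[OF that] by simp
  have "NL v \<le> C * NH v" if v: "v \<in> H10" for v
  proof -
    obtain p where p: "\<And>n::nat. p n \<in> test_functions \<Omega>" "(\<lambda>n. NL (p n - v)) \<longlonglongrightarrow> 0" "(\<lambda>n. NH (p n - v)) \<longlonglongrightarrow> 0" using v by (auto simp: H10_iff)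
    have vH: "v \<in> H1" by (rule H10_H1[OF v])
    have "NL v \<le> C * NH v + (NL (p n - v) + C * NH (p n - v))" for n
    proof -
      have pH: "p n \<in> H1" by (rule test_gradient(2)[OF p(1)])
      have "NL v \<le> NL (p n) + NL (p n - v)" using L2.N_abs_diff[OF H1_L2[OF pH] H1_L2[OF vH]] by linarith
      moreover have "NL (p n) \<le> C * NH (p n)" unfolding C_def by (rule Poincare_test[OF Rp _ p(1)]) simp_all
      moreover have "C * NH (p n) \<le> C * (NH v + NH (p n - v))" using H1.N_abs_diff[OF pH vH] by (intro mult_left_mono) (auto simp: C_def)
      ultimately show ?thesis by (simp add: distrib_left)
    qed
    moreover have "(\<lambda>n. C * NH v + (NL (p n - v) + C * NH (p n - v))) \<longlonglongrightarrow> C * NH v + (0 + C * 0)" by (intro tendsto_intros p)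
    ultimately show ?thesis using LIMSEQ_le_const by fastforce
  qed
  then show ?thesis by (intro that[of C]) (auto simp: C_def)
qed

text \<open>Boundedness of the L2 pairing in the gradient norm is the Poincare inequality.\<close>

lemma to_Hm1_mem: assumes u: "u \<in> L2" shows "to_Hm1 \<Omega> u \<in> dual_space H10 (NH)"
proof -
  obtain C where C: "0 \<le> C" "\<And>v. v \<in> H10 \<Longrightarrow> NL v \<le> C * NH v" using Poincare by blast
  have vL: "v \<in> L2" if "v \<in> H10" for v using that by (intro H1_L2 H10_H1)
  show ?thesis unfolding dual_space_def
  proof (intro CollectI conjI ballI allI impI)
    fix v w a b assume vw: "v \<in> H10" "w \<in> H10"
    then show "to_Hm1 \<Omega> u (a *\<^sub>R v + b *\<^sub>R w) = a * to_Hm1 \<Omega> u v + b * to_Hm1 \<Omega> u w"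
      by (simp add: to_Hm1_def test_seq_combine L2.ip_add_right L2.ip_scale_right L2.scale_mem vL u)
  next
    show "\<exists>B. \<forall>v\<in>H10. \<bar>to_Hm1 \<Omega> u v\<bar> \<le> B * NH v"
    proof (intro exI ballI)
      fix v assume v: "v \<in> H10"
      have "\<bar>LI u v\<bar> \<le> NL u * NL v" by (rule L2.cauchy_schwarz[OF u vL[OF v]])
      also have "\<dots> \<le> NL u * (C * NH v)" by (intro mult_left_mono C v L2.N_nonneg u)
      finally show "\<bar>to_Hm1 \<Omega> u v\<bar> \<le> (NL u * C) * NH v" using v by (simp add: to_Hm1_def mult.assoc)
    qed
  qed (simp add: to_Hm1_def)
qed

lemma Hm1_bound:
  assumes "u \<in> L2" "v \<in> H10" shows "\<bar>LI u v\<bar> \<le> Hm1_norm \<Omega> (to_Hm1 \<Omega> u) * NH v"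
  using H10.dual_norm_bound[OF to_Hm1_mem[OF assms(1)] assms(2)] assms(2) by (simp add: Hm1_norm_def to_Hm1_def)

lemma H10_norm_zero: assumes "v \<in> H10" "NH v = 0" shows "NL v = 0"
proof -
  obtain C where "NL v \<le> C * NH v" using Poincare assms(1) by metis
  then show ?thesis using assms(2) L2.N_nonneg[OF H1_L2[OF H10_H1[OF assms(1)]]] by simp
qed

end

section \<open>The finite element space\<close>

text \<open>Induction on the points: either all elements vanish at p, or some w with
  \<open>w p\<close> nonzero reduces every element to the subspace vanishing at p. Applied to the
  vertices of the mesh it gives the finite dimension of the finite element space.\<close>

lemma finite_basis_of_separating_points:
  fixes W :: "('c \<Rightarrow> real) set"
  assumes "finite P" "0 \<in> W" "\<And>u v. u \<in> W \<Longrightarrow> v \<in> W \<Longrightarrow> u + v \<in> W" "\<And>c u. u \<in> W \<Longrightarrow> c *\<^sub>R u \<in> W"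
    and "\<And>v. v \<in> W \<Longrightarrow> (\<And>x. x \<in> P \<Longrightarrow> v x = 0) \<Longrightarrow> v = 0"
  shows "\<exists>B. finite B \<and> B \<subseteq> W \<and> W \<subseteq> span B" using assms
proof (induction P arbitrary: W rule: finite_induct)
  case empty
  have "v = 0" if "v \<in> W" for v by (rule empty.prems(4)[OF that]) simp
  then have "W \<subseteq> span {}" by (auto simp only: span_empty)
  then show ?case by (intro exI[of _ "{}"]) auto
next
  case (insert p P)
  define W0 where "W0 = {v \<in> W. v p = 0}"
  have "\<exists>B. finite B \<and> B \<subseteq> W0 \<and> W0 \<subseteq> span B"
  proof (rule insert.IH)
    show "0 \<in> W0" unfolding W0_def by (intro CollectI conjI insert.prems(1)) simp
    show "u + v \<in> W0" if "u \<in> W0" "v \<in> W0" for u v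
      unfolding W0_def by (intro CollectI conjI insert.prems(2)) (use that in \<open>auto simp: W0_def\<close>)
    show "c *\<^sub>R u \<in> W0" if "u \<in> W0" for c u
    proof -
      have "c *\<^sub>R u \<in> W" using that insert.prems(3)[of u c] by (simp add: W0_def)
      moreover have "(c *\<^sub>R u) p = 0" using that by (simp add: W0_def scaleR_fun_def)
      ultimately show ?thesis by (simp add: W0_def)
    qed
    show "v = 0" if "v \<in> W0" and z: "\<And>x. x \<in> P \<Longrightarrow> v x = 0" for v
    proof (rule insert.prems(4))
      show "v \<in> W" using that(1) by (simp add: W0_def)
      show "v x = 0" if "x \<in> insert p P" for x using that \<open>v \<in> W0\<close> z[of x] by (auto simp: W0_def)
    qed
  qed
  then obtain B where B: "finite B" "B \<subseteq> W0" "W0 \<subseteq> span B" by blast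
  show ?case
  proof (cases "\<exists>w\<in>W. w p \<noteq> 0")
    case False
    then have "W0 = W" by (auto simp: W0_def)
    then show ?thesis using B by blast
  next
    case True
    then obtain w where w: "w \<in> W" "w p \<noteq> 0" by blast
    have "v \<in> span (insert w B)" if v: "v \<in> W" for v
    proof -
      define u where "u = v + (- (v p / w p)) *\<^sub>R w"
      have "u \<in> W" unfolding u_def by (intro insert.prems v w)
      moreover have "u p = 0" using w(2) by (simp add: u_def scaleR_fun_def)
      ultimately have "u \<in> span (insert w B)" using B(3) span_mono[of B "insert w B"] by (auto simp: W0_def)
      moreover have "v = u + (v p / w p) *\<^sub>R w" by (simp add: u_def)
      ultimately show ?thesis by (metis span_add span_scale span_base insertI1)
    qed
    then show ?thesis using B w by (intro exI[of _ "insert w B"]) (auto simp: W0_def)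
  qed
qed

lemma affine_zero_on_open:
  fixes a :: "'a::euclidean_space"
  assumes U: "open U" "x0 \<in> U" and z: "\<And>x. x \<in> U \<Longrightarrow> a \<bullet> x + c = 0"
  shows "a = 0" "c = 0"
proof -
  obtain e where e: "e > 0" "ball x0 e \<subseteq> U" using U by (auto simp: open_contains_ball)
  define t where "t = e / (2 * (norm a + 1))"
  have na: "norm a + 1 > 0" using norm_ge_zero[of a] by linarith
  have t: "t > 0" using e na by (simp add: t_def)
  have "t * norm a < t * (2 * (norm a + 1))" using t na by (intro mult_strict_left_mono) auto
  moreover have "t * (2 * (norm a + 1)) = e" using na by (simp add: t_def)
  ultimately have "t * norm a < e" by (simp only:)
  then have "norm (t *\<^sub>R a) < e" using t by simp
  then have "x0 + t *\<^sub>R a \<in> U" using e(2) by (auto simp: dist_norm subset_iff)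
  from z[OF this] z[OF U(2)] have "t * (a \<bullet> a) = 0" unfolding inner_add_right inner_scaleR_right by linarith
  then show a: "a = 0" using t by simp
  show "c = 0" using z[OF U(2)] a by simp
qed

lemma AE_zero_continuous:
  fixes g :: "'a::euclidean_space \<Rightarrow> real"
  assumes U: "open U" "U \<subseteq> S" "S \<in> sets lebesgue" and g: "continuous_on U g" and z: "AE x in lebesgue_on S. g x = 0" and x: "x \<in> U"
  shows "g x = 0"
proof (rule ccontr)
  assume n: "g x \<noteq> 0"
  define Q where "Q = {y \<in> U. g y \<noteq> 0}"
  have Q: "open Q" unfolding Q_def using continuous_open_preimage[OF g U(1), of "- {0}"] by (auto simp: vimage_def Int_def)
  have "AE y in lebesgue. y \<notin> Q" using z U(2,3) by (auto simp: AE_restrict_space_iff Q_def elim!: eventually_mono)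
  then have "Q \<in> null_sets lebesgue" using Q by (subst AE_iff_null_sets) auto
  then have "negligible Q" by (simp add: negligible_iff_null_sets)
  moreover have "Q \<noteq> {}" using n x by (auto simp: Q_def)
  ultimately show False using Q open_not_negligible by blast
qed

locale fe_mesh = bounded_domain \<Omega> for \<Omega> :: "'a::euclidean_space set" +
  fixes \<K> :: "'a set set"
  assumes mesh: "simplicial_mesh \<Omega> \<K>"
begin

abbreviation "Sh \<equiv> fe_space \<Omega> \<K>"

lemma Sh_H10: "v \<in> Sh \<Longrightarrow> v \<in> H10" by (simp add: fe_space_def)
lemma Sh_L2: "v \<in> Sh \<Longrightarrow> v \<in> L2" by (intro H1_L2 H10_H1 Sh_H10)

lemma Sh_affine: "v \<in> Sh \<Longrightarrow> K \<in> \<K> \<Longrightarrow> \<exists>a c. \<forall>x\<in>K. v x = a \<bullet> x + c" unfolding fe_space_def by blast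

lemma Sh_outside: "v \<in> Sh \<Longrightarrow> x \<notin> \<Union>\<K> \<Longrightarrow> v x = 0" by (simp add: fe_space_def)

lemma zero_Sh: "0 \<in> Sh" unfolding fe_space_def by (auto simp: H10.zero_mem intro!: exI[of _ 0])

lemma add_Sh: assumes "u \<in> Sh" "v \<in> Sh" shows "u + v \<in> Sh"
proof -
  have "\<exists>a c. \<forall>x\<in>K. (u + v) x = a \<bullet> x + c" if K: "K \<in> \<K>" for K
  proof -
    obtain a c a' c' where "\<forall>x\<in>K. u x = a \<bullet> x + c" "\<forall>x\<in>K. v x = a' \<bullet> x + c'"
      using Sh_affine[OF assms(1) K] Sh_affine[OF assms(2) K] by blast
    then show ?thesis by (intro exI[of _ "a + a'"] exI[of _ "c + c'"]) (simp add: inner_add_left)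
  qed
  then show ?thesis using assms by (simp add: fe_space_def H10.add_mem)
qed

lemma scale_Sh: assumes "u \<in> Sh" shows "k *\<^sub>R u \<in> Sh"
proof -
  have "\<exists>a c. \<forall>x\<in>K. (k *\<^sub>R u) x = a \<bullet> x + c" if K: "K \<in> \<K>" for K
  proof -
    obtain a c where "\<forall>x\<in>K. u x = a \<bullet> x + c" using Sh_affine[OF assms K] by blast
    then show ?thesis by (intro exI[of _ "k *\<^sub>R a"] exI[of _ "k * c"]) (simp add: scaleR_fun_def distrib_left)
  qed
  moreover have "k *\<^sub>R u \<in> H10" by (rule H10.scale_mem[OF Sh_H10[OF assms]])
  moreover have "\<forall>x. x \<notin> \<Union>\<K> \<longrightarrow> (k *\<^sub>R u) x = 0" using Sh_outside[OF assms] by (simp add: scaleR_fun_def)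
  ultimately show ?thesis unfolding fe_space_def by blast
qed

lemma fin_mesh: "finite \<K>" and simplex_mesh: "K \<in> \<K> \<Longrightarrow> int DIM('a) simplex K" and Un_mesh: "\<Union>\<K> = closure \<Omega>"
  using mesh by (auto simp: simplicial_mesh_def triangulation_def)

lemma Sh_basis: "\<exists>B. finite B \<and> B \<subseteq> Sh \<and> Sh \<subseteq> span B"
proof -
  have "\<forall>K\<in>\<K>. \<exists>C. finite C \<and> K = convex hull C" using simplex_mesh unfolding simplex by blast
  then obtain C where C: "\<And>K. K \<in> \<K> \<Longrightarrow> finite (C K)" "\<And>K. K \<in> \<K> \<Longrightarrow> K = convex hull (C K)" by metis
  show ?thesis
  proof (rule finite_basis_of_separating_points[of "\<Union>K\<in>\<K>. C K"])
    show "finite (\<Union>K\<in>\<K>. C K)" using fin_mesh C by auto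
    fix v assume v: "v \<in> Sh" and z: "\<And>x. x \<in> (\<Union>K\<in>\<K>. C K) \<Longrightarrow> v x = 0"
    show "v = 0"
    proof
      fix x
      show "v x = 0 x"
      proof (cases "x \<in> \<Union>\<K>")
        case True
        then obtain K where K: "K \<in> \<K>" "x \<in> K" by blast
        obtain a c where ac: "\<And>y. y \<in> K \<Longrightarrow> v y = a \<bullet> y + c" using Sh_affine[OF v K(1)] by blast
        have sub: "C K \<subseteq> K" using C(2)[OF K(1)] hull_subset[of "C K" convex] by blast
        have "convex hull (C K) \<subseteq> {y. a \<bullet> y = - c}"
        proof (rule hull_minimal)
          show "C K \<subseteq> {y. a \<bullet> y = - c}"
          proof
            fix y assume y: "y \<in> C K"
            then have "v y = 0" "y \<in> K" using z K(1) sub by auto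
            then show "y \<in> {y. a \<bullet> y = - c}" using ac[of y] by simp
          qed
        qed (rule convex_hyperplane)
        then show ?thesis using K(2) C(2)[OF K(1)] ac[OF K(2)] by auto
      next
        case False then show ?thesis using Sh_outside[OF v] by simp
      qed
    qed
  qed (simp_all add: zero_Sh add_Sh scale_Sh)
qed

text \<open>The definite descriptions in the schemes require null elements to be literally zero. The
  interior of each simplex meets \<Omega>; there v is affine and zero almost everywhere, hence zero
  on the whole simplex, and off the mesh it is zero by the normalization in
  \<open>fe_space\<close>.\<close>

lemma Sh_definite: assumes v: "v \<in> Sh" and N: "NL v = 0" shows "v = 0"
proof
  have "integral\<^sup>L M (\<lambda>x. (norm (v x))^2) = 0" using N L2_norm_sq[of \<Omega> v] by simp
  then have "AE x in M. (norm (v x))^2 = 0" using integral_nonneg_eq_0_iff_AE[OF L2_spaceD(2)[OF Sh_L2[OF v]]] by simp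
  then have z: "AE x in M. v x = 0" by simp
  fix x
  show "v x = 0 x"
  proof (cases "x \<in> \<Union>\<K>")
    case True
    then obtain K where K: "K \<in> \<K>" "x \<in> K" by blast
    obtain a c where ac: "\<And>y. y \<in> K \<Longrightarrow> v y = a \<bullet> y + c" using Sh_affine[OF v K(1)] by blast
    have conv: "convex K" using simplex_mesh[OF K(1)] by (auto simp: simplex_def)
    have "aff_dim K = DIM('a)" by (rule aff_dim_simplex[OF simplex_mesh[OF K(1)]])
    then have "rel_interior K = interior K" by (intro rel_interior_interior) (simp add: aff_dim_eq_full)
    then have "interior K \<noteq> {}" using rel_interior_eq_empty[OF conv] K(2) by auto
    moreover have "interior K \<subseteq> closure \<Omega>" using interior_subset[of K] Un_mesh K(1) by blast
    ultimately have "interior K \<inter> \<Omega> \<noteq> {}" using open_Int_closure_eq_empty[of "interior K" \<Omega>] by auto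
    then obtain x0 where x0: "x0 \<in> interior K \<inter> \<Omega>" by blast
    have o: "open (interior K \<inter> \<Omega>)" using op by auto
    have z0: "a \<bullet> y + c = 0" if y: "y \<in> interior K \<inter> \<Omega>" for y
    proof -
      have eqv: "v y = a \<bullet> y + c" if "y \<in> interior K \<inter> \<Omega>" for y using that interior_subset[of K] by (intro ac) auto
      have "continuous_on (interior K \<inter> \<Omega>) (\<lambda>y. a \<bullet> y + c)" by (intro continuous_intros)
      then have "continuous_on (interior K \<inter> \<Omega>) v" by (subst continuous_on_cong[OF refl eqv])
      from AE_zero_continuous[OF o _ sets_Omega this z y] show ?thesis using eqv[OF y] by simp
    qed
    show ?thesis using ac[OF K(2)] affine_zero_on_open[OF o x0 z0] by simp
  next
    case False then show ?thesis using Sh_outside[OF v] by simp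
  qed
qed

sublocale SL: semi_inner_space Sh "LI" NL
  by unfold_locales (simp_all add: zero_Sh add_Sh scale_Sh Sh_L2 L2.ip_add L2.ip_scale L2.ip_nonneg L2.N_eq, metis L2.ip_sym Sh_L2)

sublocale SG: semi_inner_space Sh gi "NH"
  by unfold_locales (simp_all add: zero_Sh add_Sh scale_Sh Sh_H10 H10.ip_add H10.ip_scale H10.ip_nonneg H10.N_eq, metis H10.ip_sym Sh_H10)

lemma SL_definite: "u \<in> Sh \<Longrightarrow> LI u u = 0 \<Longrightarrow> u = 0" using Sh_definite by (simp add: L2_norm_def)

lemma SG_definite: assumes u: "u \<in> Sh" and z: "gi u u = 0" shows "u = 0"
proof -
  have "NH u = 0" using z by (simp add: H10_norm_def L2_norm_def)
  then show ?thesis using H10_norm_zero[OF Sh_H10[OF u]] Sh_definite[OF u] by simp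
qed

lemma Sh_expansion:
  assumes S: "semi_inner_space Sh ip N" and def: "\<And>u. u \<in> Sh \<Longrightarrow> ip u u = 0 \<Longrightarrow> u = 0"
  shows "\<exists>E. finite E \<and> E \<subseteq> Sh \<and> (\<forall>w\<in>Sh. w = (\<Sum>e\<in>E. ip w e *\<^sub>R e))"
proof -
  interpret S: semi_inner_space Sh ip N by (rule S)
  obtain B where B: "finite B" "B \<subseteq> Sh" "Sh \<subseteq> span B" using Sh_basis by blast
  obtain E where E: "finite E" "E \<subseteq> span B" "\<And>w. w \<in> span B \<Longrightarrow> w = (\<Sum>e\<in>E. ip w e *\<^sub>R e)"
    using S.finite_orthonormal_expansion[OF B(1,2) def] by blast
  have "subspace Sh" by (simp add: subspace_def zero_Sh add_Sh scale_Sh)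
  then have "span B \<subseteq> Sh" using B(2) by (rule span_minimal[rotated])
  then show ?thesis using E B(3) by blast
qed

text \<open>Riesz representation in finite dimension: the orthonormal expansion gives the
  representer, definiteness its uniqueness. With the L2 product it justifies the projection and the
  discrete Laplacian, with the gradient product it inverts the latter.\<close>

lemma Sh_representation:
  assumes S: "semi_inner_space Sh ip N" and def: "\<And>u. u \<in> Sh \<Longrightarrow> ip u u = 0 \<Longrightarrow> u = 0"
    and add: "\<And>u v. u \<in> Sh \<Longrightarrow> v \<in> Sh \<Longrightarrow> l (u + v) = l u + l v"
    and sc: "\<And>c u. u \<in> Sh \<Longrightarrow> l (c *\<^sub>R u) = c * l u"
  shows "\<exists>!y. y \<in> Sh \<and> (\<forall>w\<in>Sh. ip y w = l w)"
proof -
  interpret S: semi_inner_space Sh ip N by (rule S)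
  obtain E where E: "finite E" "E \<subseteq> Sh" "\<And>w. w \<in> Sh \<Longrightarrow> w = (\<Sum>e\<in>E. ip w e *\<^sub>R e)" using Sh_expansion[OF S def] by blast
  have eS: "e \<in> Sh" if "e \<in> E" for e using that E(2) by auto
  have l0: "l 0 = 0" using sc[OF zero_Sh, of 0] by simp
  have ls: "l (\<Sum>e\<in>I. c e *\<^sub>R e) = (\<Sum>e\<in>I. c e * l e)" if "I \<subseteq> E" for I c using finite_subset[OF that E(1)] that
  proof (induction I rule: finite_induct)
    case (insert x F)
    have x: "x \<in> Sh" using insert.prems eS by simp
    have "(\<Sum>e\<in>F. c e *\<^sub>R e) \<in> Sh" using insert.prems eS by (intro S.sum_mem S.scale_mem) auto
    then have "l (c x *\<^sub>R x + (\<Sum>e\<in>F. c e *\<^sub>R e)) = c x * l x + l (\<Sum>e\<in>F. c e *\<^sub>R e)" by (simp only: add[OF S.scale_mem[OF x]] sc[OF x])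
    then show ?case using insert.IH insert.prems by (simp only: sum.insert[OF insert.hyps] insert_subset)
  qed (simp add: l0)
  define y where "y = (\<Sum>e\<in>E. l e *\<^sub>R e)"
  have y: "y \<in> Sh" unfolding y_def by (intro S.sum_mem S.scale_mem eS)
  have yl: "ip y w = l w" if w: "w \<in> Sh" for w
  proof -
    have "ip y w = (\<Sum>e\<in>E. l e * ip e w)" unfolding y_def by (simp add: S.ip_sum S.ip_scale S.scale_mem eS w)
    also have "\<dots> = (\<Sum>e\<in>E. ip w e * l e)" by (intro sum.cong refl) (simp add: S.ip_sym[OF w] eS)
    also have "\<dots> = l (\<Sum>e\<in>E. ip w e *\<^sub>R e)" by (rule ls[symmetric]) simp
    also have "(\<Sum>e\<in>E. ip w e *\<^sub>R e) = w" by (rule E(3)[OF w, symmetric])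
    finally show ?thesis .
  qed
  show ?thesis
  proof (intro ex1I conjI ballI)
    show "y \<in> Sh" by (rule y)
    show "ip y w = l w" if "w \<in> Sh" for w by (rule yl[OF that])
    fix y' assume y': "y' \<in> Sh \<and> (\<forall>w\<in>Sh. ip y' w = l w)"
    have m: "y' - y \<in> Sh" using y' y by (intro S.diff_mem) auto
    have "ip (y' - y) (y' - y) = 0" using y' y yl[OF m] m by (simp add: S.ip_diff)
    then have "y' - y = 0" by (rule def[OF m])
    then show "y' = y" by simp
  qed
qed

lemma L2_projection:
  assumes u: "u \<in> L2"
  shows "L2_projection \<Omega> \<K> u \<in> Sh" "w \<in> Sh \<Longrightarrow> LI (L2_projection \<Omega> \<K> u) w = LI u w"
proof -
  have "\<exists>!p. p \<in> Sh \<and> (\<forall>w\<in>Sh. LI p w = LI u w)" by (rule Sh_representation[OF SL.semi_inner_space_axioms SL_definite])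
      (auto simp: L2.ip_add_right L2.ip_scale_right Sh_L2 u)
  from theI'[OF this] show "L2_projection \<Omega> \<K> u \<in> Sh" "w \<in> Sh \<Longrightarrow> LI (L2_projection \<Omega> \<K> u) w = LI u w" by (auto simp: L2_projection_def)
qed

lemma L2_projection_norm: assumes u: "u \<in> L2" shows "NL (L2_projection \<Omega> \<K> u) \<le> NL u"
proof -
  let ?p = "L2_projection \<Omega> \<K> u"
  note p = L2_projection(1)[OF u]
  have "NL ?p * NL ?p = LI u ?p" using L2_projection(2)[OF u p] SL.N_sq[OF p] by (simp add: power2_eq_square)
  also have "\<dots> \<le> NL u * NL ?p" using L2.cauchy_schwarz[OF u Sh_L2[OF p]] by linarith
  finally have le: "NL ?p * NL ?p \<le> NL u * NL ?p" .
  show ?thesis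
  proof (cases "NL ?p = 0")
    case False
    then have "0 < NL ?p" using L2_norm_nonneg[of \<Omega> ?p] by simp
    with le show ?thesis by simp
  qed (simp add: L2_norm_nonneg)
qed

lemma discrete_laplacian:
  assumes v: "v \<in> Sh"
  shows "discrete_laplacian \<Omega> \<K> v \<in> Sh" "w \<in> Sh \<Longrightarrow> LI (discrete_laplacian \<Omega> \<K> v) w = - gi v w"
proof -
  have 1: "\<exists>!y. y \<in> Sh \<and> (\<forall>w\<in>Sh. LI y w = - gi v w)" by (rule Sh_representation[OF SL.semi_inner_space_axioms SL_definite])
      (auto simp: SG.ip_add_right SG.ip_scale_right v)
  have "(y \<in> Sh \<and> (\<forall>w\<in>Sh. LI y w = - gi v w)) \<longleftrightarrow> (y \<in> Sh \<and> (\<forall>w\<in>Sh. LI (- y) w = gi v w))" for y by (auto simp: SL.ip_minus)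
  then have "\<exists>!z. z \<in> Sh \<and> (\<forall>w\<in>Sh. LI (- z) w = gi v w)" using 1 by simp
  from theI'[OF this] have z: "discrete_laplacian \<Omega> \<K> v \<in> Sh" "\<forall>w\<in>Sh. LI (- discrete_laplacian \<Omega> \<K> v) w = gi v w"
    by (auto simp: discrete_laplacian_def)
  then show "discrete_laplacian \<Omega> \<K> v \<in> Sh" "w \<in> Sh \<Longrightarrow> LI (discrete_laplacian \<Omega> \<K> v) w = - gi v w" by (auto simp: SL.ip_minus)
qed

end

section \<open>The energy estimate\<close>

context order_param
begin

lemma kern_b_nonpos: assumes "0 < i" shows "kern (coeff_b \<alpha>) i \<le> 0"
proof -
  have r: "real (i + 1) = real i + 1" "real (i - 1) = real i - 1" using assms by auto
  have "kern (coeff_b \<alpha>) i = ((real i + 1) powr p - 2 * real i powr p + (real i - 1) powr p) / Gamma (3 - \<alpha>)"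
    unfolding kern_def coeff_b_def r using assms by (simp add: add_divide_distrib diff_divide_distrib)
  then show ?thesis using powr_second_difference[OF assms] Gpos by (simp add: divide_nonpos_pos)
qed

text \<open>Keeps the row-sum weights of \<open>kform_eq_squares\<close>; the column weights and the
  squared differences enter with the good sign. It controls the term with u_1, whose factors are
  these very weights.\<close>

lemma sum_squares_le_kform: "(\<Sum>k<n. (coeff_b \<alpha> (k + 1) - coeff_b \<alpha> k) * (x k)^2) \<le> 2 * kform (coeff_b \<alpha>) n x"
proof -
  have "(\<Sum>k<n. (coeff_b \<alpha> (k + 1) - coeff_b \<alpha> k) * (x k)^2)
    \<le> (\<Sum>k<n. ((coeff_b \<alpha> (k + 1) - coeff_b \<alpha> k) + (coeff_b \<alpha> (n - k) - coeff_b \<alpha> (n - Suc k))) * (x k)^2)"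
  proof (rule sum_mono)
    fix k assume "k \<in> {..<n}"
    then have "n - k = (n - Suc k) + 1" by auto
    then have "0 \<le> coeff_b \<alpha> (n - k) - coeff_b \<alpha> (n - Suc k)" using coeff_b_mono[of "n - Suc k"] by simp
    then show "(coeff_b \<alpha> (k + 1) - coeff_b \<alpha> k) * (x k)^2
      \<le> ((coeff_b \<alpha> (k + 1) - coeff_b \<alpha> k) + (coeff_b \<alpha> (n - k) - coeff_b \<alpha> (n - Suc k))) * (x k)^2" by (intro mult_right_mono) auto
  qed
  moreover have "(\<Sum>k<n. \<Sum>j<k. kern (coeff_b \<alpha>) (k - j) * (x k - x j)^2) \<le> 0" by (intro sum_nonpos mult_nonpos_nonneg kern_b_nonpos) auto
  ultimately show ?thesis unfolding kform_eq_squares by simp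
qed

end

text \<open>Young's inequality as s q D <= \<epsilon> q^2 + s^2 D^2 / (4 \<epsilon>), with q the
  square root of \<open>Q\<close>: the form is absorbed entirely, and then \<open>s^2\<close>
  cancels, which removes the time step from the constant.\<close>

lemma energy_young:
  fixes \<epsilon> Q s D u v :: real
  assumes e: "0 < \<epsilon>" and s: "0 < s" and Q: "0 \<le> Q" and D: "0 \<le> D" and u: "0 \<le> u" and v: "0 \<le> v"
    and le: "\<epsilon> * Q + s^2 / 2 * (u^2 - v^2) \<le> s * sqrt Q * D"
  shows "u \<le> v + sqrt (1 / (2 * \<epsilon>)) * D"
proof -
  define q where "q = sqrt Q"
  have Qq: "Q = q^2" and q0: "0 \<le> q" using Q by (simp_all add: q_def)
  have "0 \<le> (2 * \<epsilon> * q - s * D)^2" by simp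
  then have "4 * \<epsilon> * (s * q * D) \<le> 4 * \<epsilon> * (\<epsilon> * q^2) + s^2 * D^2" by (simp add: power2_eq_square algebra_simps)
  moreover have "4 * \<epsilon> * (\<epsilon> * q^2 + s^2 / 2 * (u^2 - v^2)) \<le> 4 * \<epsilon> * (s * q * D)" using le e by (intro mult_left_mono) (simp_all add: Qq q0)
  moreover have "4 * \<epsilon> * (\<epsilon> * q^2 + s^2 / 2 * (u^2 - v^2)) = 4 * \<epsilon> * (\<epsilon> * q^2) + s^2 * (2 * \<epsilon> * (u^2 - v^2))" by (simp add: algebra_simps)
  ultimately have "s^2 * (2 * \<epsilon> * (u^2 - v^2)) \<le> s^2 * D^2" by linarith
  then have "2 * \<epsilon> * (u^2 - v^2) \<le> D^2" using s by simp
  then have "u^2 \<le> v^2 + 1 / (2 * \<epsilon>) * D^2" using e by (simp add: field_simps)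
  also have "1 / (2 * \<epsilon>) * D^2 = (sqrt (1 / (2 * \<epsilon>)) * D)^2" using e by (simp add: power_mult_distrib power_divide)
  also have "v^2 + (sqrt (1 / (2 * \<epsilon>)) * D)^2 \<le> (v + sqrt (1 / (2 * \<epsilon>)) * D)^2"
    unfolding power2_sum using e D v by (simp del: real_sqrt_divide)
  finally show ?thesis by (rule power2_le_imp_le) (use e D v in simp)
qed

section \<open>The energy estimate for any coefficient sequence comparable with b\<close>

locale scheme_energy = fe_mesh \<Omega> \<K> + order_param \<alpha>
  for \<Omega> :: "'a::euclidean_space set" and \<K> and \<alpha> +
  fixes \<tau> :: real and c :: "nat \<Rightarrow> real" and \<epsilon> B :: real and u0 u1 :: "'a \<Rightarrow> real" and f :: "real \<Rightarrow> 'a \<Rightarrow> real"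
    and U :: "nat \<Rightarrow> 'a \<Rightarrow> real"
  assumes \<tau>: "0 < \<tau>" and u0: "u0 \<in> L2" and u1: "u1 \<in> L2" and f: "f \<in> bochner_L1 L2 NL {0<..}"
    and fneg: "(\<lambda>t. to_Hm1 \<Omega> (f t)) \<in> Hneg_time ((\<alpha> - 1) / 2) (Hm1_space \<Omega>) (Hm1_norm \<Omega>) 0 \<infinity>"
    and U: "is_scheme_solution c \<alpha> \<Omega> \<K> \<tau> u0 u1 f U"
    and \<epsilon>: "0 < \<epsilon>" "\<And>n x. \<epsilon> * kform (coeff_b \<alpha>) n x \<le> kform c n x"
    and B: "0 \<le> B" "\<And>k. \<bar>c (k + 1) - c k\<bar> \<le> B * (coeff_b \<alpha> (k + 1) - coeff_b \<alpha> k)"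
begin

abbreviation "A \<equiv> Hm1_norm \<Omega> (to_Hm1 \<Omega> u1)"
abbreviation "Fneg T \<equiv> Hneg_time_norm ((\<alpha> - 1) / 2) (Hm1_space \<Omega>) (Hm1_norm \<Omega>) 0 (ereal T) (\<lambda>t. to_Hm1 \<Omega> (f t))"
abbreviation "F k \<equiv> integral_into L2 NL {real k * \<tau><..<real (k + 1) * \<tau>} f"

lemma A_nonneg: "0 \<le> A" unfolding Hm1_norm_def by (rule H10.dual_norm_nonneg[OF to_Hm1_mem[OF u1]])

lemma U_Sh: "U k \<in> Sh" using U L2_projection(1)[OF u0] by (cases k) (auto simp: is_scheme_solution_def)

lemma step_interval_pos: "{real k * \<tau><..<real (k + 1) * \<tau>} \<subseteq> {0<..}"
proof -
  have "0 \<le> real k * \<tau>" using \<tau> by simp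
  then show ?thesis by (meson greaterThanLessThan_iff greaterThan_iff le_less_trans subsetI)
qed

lemma f_step: "f \<in> bochner_L1 L2 NL {real k * \<tau><..<real (k + 1) * \<tau>}" by (rule bochner_L1_restrict[OF _ _ step_interval_pos f]) simp_all

lemma F_L2: "F k \<in> L2" by (rule bochner_integral_L2(1)[OF _ f_step]) simp

text \<open>Turns the pairing on (0, T) into the integrals of f over single steps. Values of
  \<open>g\<close> are prescribed only inside the open cells, as grid points are null; its
  measurability follows from agreement almost everywhere with a sum over cells.\<close>

lemma pairing_sum:
  assumes z: "\<And>k. z k \<in> L2"
    and g: "\<And>k t. k < n \<Longrightarrow> real k * \<tau> < t \<Longrightarrow> t < real (k + 1) * \<tau> \<Longrightarrow> g t = LI (f t) (z k)"
  shows "integral\<^sup>L (lebesgue_on {0<..<real n * \<tau>}) g = (\<Sum>k<n. LI (F k) (z k))"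
proof -
  interpret S: step_fun \<alpha> \<tau> n "\<lambda>_. 0" by unfold_locales (rule \<tau>)
  let ?S = "{0<..<real n * \<tau>}"
  define I where "I k = {real k * \<tau><..<real (k + 1) * \<tau>}" for k
  define h where "h k t = indicator (I k) t *\<^sub>R LI (f t) (z k)" for k t
  have IS: "I k \<subseteq> ?S" if "k < n" for k
  proof
    fix t assume t: "t \<in> I k"
    have "real (k + 1) * \<tau> \<le> real n * \<tau>" using that \<tau> by (intro mult_right_mono) auto
    then show "t \<in> ?S" using t step_interval_pos[of k] by (auto simp: I_def)
  qed
  have hb: "has_bochner_integral (lebesgue_on ?S) (h k) (LI (F k) (z k))" if k: "k < n" for k
  proof -
    have "has_bochner_integral (lebesgue_on (I k)) (\<lambda>t. LI (f t) (z k)) (LI (F k) (z k))"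
      unfolding I_def by (rule bochner_integral_L2(2)[OF _ f_step z]) simp
    then have "has_bochner_integral lebesgue (h k) (LI (F k) (z k))"
      by (subst (asm) has_bochner_integral_restrict_space) (simp_all add: I_def h_def[abs_def])
    moreover have "(\<lambda>t. indicator ?S t *\<^sub>R h k t) = h k" using IS[OF k] by (auto simp: h_def indicator_def fun_eq_iff)
    ultimately show ?thesis by (subst has_bochner_integral_restrict_space) simp_all
  qed
  define G where "G t = (\<Sum>k<n. h k t)" for t
  have Gb: "has_bochner_integral (lebesgue_on ?S) G (\<Sum>k<n. LI (F k) (z k))"
    unfolding G_def[abs_def] by (rule has_bochner_integral_sum) (use hb in auto)
  have uniq: "i = k" if "t \<in> I i" "t \<in> S.cell k" for t i k
    by (rule S.cell_unique[OF _ that(2)]) (use that(1) in \<open>auto simp: I_def S.cell_def\<close>)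
  have "(\<lambda>k. real k * \<tau>) ` {..n} \<in> null_sets lebesgue"
    using negligible_finite[of "(\<lambda>k. real k * \<tau>) ` {..n}"] by (simp add: negligible_iff_null_sets)
  then have "AE t in lebesgue. t \<notin> (\<lambda>k. real k * \<tau>) ` {..n}" by (rule AE_not_in)
  then have "AE t in lebesgue. t \<in> ?S \<longrightarrow> G t = g t"
  proof eventually_elim
    case (elim t)
    show ?case
    proof
      assume t: "t \<in> ?S"
      then obtain k where k: "t \<in> S.cell k" using S.ex_cell[of t] by auto
      then have kn: "k < n" using t by (auto intro: S.cell_lt)
      then have "t \<noteq> real k * \<tau>" using elim by auto
      then have tI: "t \<in> I k" using k by (simp add: I_def S.cell_def)
      have "h i t = (if i = k then LI (f t) (z k) else 0)" for i
      proof (cases "i = k")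
        case False
        then have "t \<notin> I i" using uniq[of t i k] k by blast
        then show ?thesis using False by (simp add: h_def)
      qed (use tI in \<open>simp add: h_def\<close>)
      then have "G t = (\<Sum>i<n. if i = k then LI (f t) (z k) else 0)" unfolding G_def by (simp only:)
      then show "G t = g t" using kn g[OF kn] tI by (simp add: I_def)
    qed
  qed
  then have ae: "AE t in lebesgue_on ?S. G t = g t" by (simp add: AE_restrict_space_iff)
  have Gm: "G \<in> borel_measurable (lebesgue_on ?S)" using Gb by (auto simp: has_bochner_integral_iff)
  have "AE t in lebesgue_on ?S. (\<lambda>n::nat. G t) \<longlonglongrightarrow> g t" using ae by eventually_elim simp
  then have gm: "g \<in> borel_measurable (lebesgue_on ?S)" by (rule borel_measurable_AE_LIMSEQ[rotated 2]) (auto simp: Gm)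
  have "integral\<^sup>L (lebesgue_on ?S) g = integral\<^sup>L (lebesgue_on ?S) G" using ae by (intro integral_cong_AE gm Gm) auto
  then show ?thesis using Gb by (simp add: has_bochner_integral_iff)
qed

lemma energy_identity:
  assumes z: "\<And>k. z k \<in> Sh" and zU: "\<And>k w. w \<in> Sh \<Longrightarrow> gi (z k) w = LI (U (k + 1) - U k) w"
  shows "(\<Sum>k<n. \<Sum>j\<le>k. kern c (k - j) * gi (z j) (z k)) + \<tau> powr \<alpha> / 2 * ((NL (U n))^2 - (NL (U 0))^2)
    = \<tau> powr (\<alpha> - 1) * (\<Sum>k<n. LI (F k) (z k)) + \<tau> * (\<Sum>k<n. (c (k + 1) - c k) * LI u1 (z k))"
proof -
  have step: "(\<Sum>j\<le>k. kern c (k - j) * gi (z j) (z k)) + \<tau> powr \<alpha> / 2 * ((NL (U (Suc k)))^2 - (NL (U k))^2)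
    = \<tau> powr (\<alpha> - 1) * LI (F k) (z k) + \<tau> * ((c (k + 1) - c k) * LI u1 (z k))" for k
  proof -
    let ?d = "\<lambda>j. U (j + 1) - U j" and ?s = "U k + U (k + 1)"
    have d: "?d j \<in> Sh" for j by (intro SL.diff_mem U_Sh)
    have s: "?s \<in> Sh" by (intro add_Sh U_Sh)
    have dl: "discrete_laplacian \<Omega> \<K> ?s \<in> Sh" by (rule discrete_laplacian(1)[OF s])
    have sumS: "(\<Sum>j\<le>k. kern c (k - j) *\<^sub>R ?d j) \<in> Sh" by (intro SL.sum_mem SL.scale_mem d)
    have PF: "L2_projection \<Omega> \<K> (F k) \<in> Sh" "L2_projection \<Omega> \<K> u1 \<in> Sh" by (rule L2_projection(1)[OF F_L2], rule L2_projection(1)[OF u1])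
    have "(\<Sum>j\<le>k. kern c (k - j) *\<^sub>R ?d j) - (\<tau> powr \<alpha> / 2) *\<^sub>R discrete_laplacian \<Omega> \<K> ?s
      = \<tau> powr (\<alpha> - 1) *\<^sub>R L2_projection \<Omega> \<K> (F k) + (\<tau> * (c (k + 1) - c k)) *\<^sub>R L2_projection \<Omega> \<K> u1"
      using U unfolding is_scheme_solution_def scheme_lhs_kern by blast
    then have e1: "LI ((\<Sum>j\<le>k. kern c (k - j) *\<^sub>R ?d j) - (\<tau> powr \<alpha> / 2) *\<^sub>R discrete_laplacian \<Omega> \<K> ?s) (z k)
      = LI (\<tau> powr (\<alpha> - 1) *\<^sub>R L2_projection \<Omega> \<K> (F k) + (\<tau> * (c (k + 1) - c k)) *\<^sub>R L2_projection \<Omega> \<K> u1) (z k)" by (rule arg_cong)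
    have e2: "LI ((\<Sum>j\<le>k. kern c (k - j) *\<^sub>R ?d j) - (\<tau> powr \<alpha> / 2) *\<^sub>R discrete_laplacian \<Omega> \<K> ?s) (z k)
      = LI (\<Sum>j\<le>k. kern c (k - j) *\<^sub>R ?d j) (z k) - \<tau> powr \<alpha> / 2 * LI (discrete_laplacian \<Omega> \<K> ?s) (z k)"
      by (simp only: SL.ip_diff[OF sumS SL.scale_mem[OF dl] z] SL.ip_scale[OF dl z])
    have e3: "LI (\<Sum>j\<le>k. kern c (k - j) *\<^sub>R ?d j) (z k) = (\<Sum>j\<le>k. kern c (k - j) * LI (?d j) (z k))"
      by (subst SL.ip_sum[OF SL.scale_mem[OF d] z]) (simp only: SL.ip_scale[OF d z])
    have e4: "(\<Sum>j\<le>k. kern c (k - j) * LI (?d j) (z k)) = (\<Sum>j\<le>k. kern c (k - j) * gi (z j) (z k))" by (simp only: zU[OF z])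
    \<comment> \<open>By symmetry and the defining property of \<open>z k\<close>, testing the
      Laplacian of the sum of two consecutive iterates gives minus the L2 product of their
      difference and their sum, which telescopes.\<close>
    have e5: "LI (discrete_laplacian \<Omega> \<K> ?s) (z k) = - LI (?d k) ?s" using discrete_laplacian(2)[OF s z] SG.ip_sym[OF s z] zU[OF s] by simp
    have e6: "LI (?d k) ?s = (NL (U (Suc k)))^2 - (NL (U k))^2"
    proof -
      have "LI (?d k) ?s = LI (U (k + 1)) ?s - LI (U k) ?s" by (rule SL.ip_diff[OF U_Sh U_Sh s])
      also have "\<dots> = LI (U (k + 1)) (U (k + 1)) - LI (U k) (U k)"
        unfolding SL.ip_add_right[OF U_Sh U_Sh U_Sh] using SL.ip_sym[OF U_Sh U_Sh, of "k + 1" k] by simp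
      finally show ?thesis by (simp add: SL.N_sq[OF U_Sh])
    qed
    have e7: "LI (\<tau> powr (\<alpha> - 1) *\<^sub>R L2_projection \<Omega> \<K> (F k) + (\<tau> * (c (k + 1) - c k)) *\<^sub>R L2_projection \<Omega> \<K> u1) (z k)
      = \<tau> powr (\<alpha> - 1) * LI (F k) (z k) + (\<tau> * (c (k + 1) - c k)) * LI u1 (z k)"
      by (simp only: SL.ip_add[OF SL.scale_mem[OF PF(1)] SL.scale_mem[OF PF(2)] z] SL.ip_scale[OF PF(1) z] SL.ip_scale[OF PF(2) z]
          L2_projection(2)[OF F_L2 z] L2_projection(2)[OF u1 z])
    show ?thesis using e1 unfolding e2 e3 e4 e5 e6 e7 by (simp add: algebra_simps diff_divide_distrib)
  qed
  have "(\<Sum>k<n. (\<Sum>j\<le>k. kern c (k - j) * gi (z j) (z k)) + \<tau> powr \<alpha> / 2 * ((NL (U (Suc k)))^2 - (NL (U k))^2))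
    = (\<Sum>k<n. \<tau> powr (\<alpha> - 1) * LI (F k) (z k) + \<tau> * ((c (k + 1) - c k) * LI u1 (z k)))" by (intro sum.cong refl step)
  moreover have "(\<Sum>k<n. \<tau> powr \<alpha> / 2 * ((NL (U (Suc k)))^2 - (NL (U k))^2)) = \<tau> powr \<alpha> / 2 * ((NL (U n))^2 - (NL (U 0))^2)"
    by (simp only: sum_distrib_left[symmetric] sum_lessThan_telescope[of "\<lambda>k. (NL (U k))^2" n])
  ultimately show ?thesis by (simp only: sum.distrib sum_distrib_left)
qed

text \<open>Each data term of \<open>energy_identity\<close> is bounded by s sqrt(Q) times a data
  norm, where s = \<open>\<tau> powr (\<alpha> / 2)\<close>: the one with f by duality and
  \<open>W_Hfrac\<close>, the one with u_1 by a weighted Cauchy-Schwarz inequality. Then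
  \<open>energy_young\<close> applies.\<close>

lemma stability:
  assumes n: "0 < n"
  defines "T \<equiv> real n * \<tau>"
  shows "NL (U n) \<le> NL u0 + sqrt (1 / (2 * \<epsilon>)) *
    (sqrt (2 * ((1 + 1 / \<alpha>) * step_fun.cc \<alpha>)) * Fneg T
     + B * sqrt (2 / Gamma (3 - \<alpha>)) * (T powr (1 - \<alpha> / 2) * A))"
proof -
  have "\<forall>k. \<exists>y. y \<in> Sh \<and> (\<forall>w\<in>Sh. gi y w = LI (U (k + 1) - U k) w)"
  proof
    fix k
    have d: "U (k + 1) - U k \<in> Sh" by (intro SL.diff_mem U_Sh)
    show "\<exists>y. y \<in> Sh \<and> (\<forall>w\<in>Sh. gi y w = LI (U (k + 1) - U k) w)"
      by (rule ex1_implies_ex[OF Sh_representation[OF SG.semi_inner_space_axioms SG_definite SL.ip_add_right[OF _ _ d] SL.ip_scale_right[OF _ d]]])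
  qed
  then obtain z where z: "\<And>k. z k \<in> Sh" and zU: "\<And>k w. w \<in> Sh \<Longrightarrow> gi (z k) w = LI (U (k + 1) - U k) w" by metis
  obtain E where E: "finite E" "E \<subseteq> Sh" "\<And>w. w \<in> Sh \<Longrightarrow> w = (\<Sum>e\<in>E. gi w e *\<^sub>R e)"
    using Sh_expansion[OF SG.semi_inner_space_axioms SG_definite] by blast
  interpret R: riesz_step \<alpha> H10 gi "NH" \<tau> n z E by unfold_locales (use \<tau> n z E Sh_H10 in auto)
  have eS: "e \<in> Sh" if "e \<in> E" for e using that E(2) by auto
  have gie: "gi (z j) (z k) = (\<Sum>e\<in>E. gi (z j) e * gi (z k) e)" for j k
  proof -
    have "gi (z j) (z k) = gi (z j) (\<Sum>e\<in>E. gi (z k) e *\<^sub>R e)" using E(3)[OF z[of k]] by simp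
    also have "\<dots> = (\<Sum>e\<in>E. gi (z j) (gi (z k) e *\<^sub>R e))" by (rule SG.ip_sum_right) (auto intro: scale_Sh eS z)
    also have "\<dots> = (\<Sum>e\<in>E. gi (z j) e * gi (z k) e)" by (intro sum.cong refl) (simp add: SG.ip_scale_right[OF eS z] mult.commute)
    finally show ?thesis .
  qed
  define Q where "Q = (\<Sum>e\<in>E. kform (coeff_b \<alpha>) n (\<lambda>k. gi (z k) e))"
  define P where "P = Fneg T"
  define s where "s = \<tau> powr (\<alpha> / 2)"
  have s: "0 < s" "s^2 = \<tau> powr \<alpha>" using \<tau> by (simp_all add: s_def power2_eq_square flip: powr_add)
  have Q0: "0 \<le> Q" unfolding Q_def by (intro sum_nonneg kform_b_nonneg)
  have cc0: "0 \<le> (1 + 1 / \<alpha>) * R.S.cc" using pp \<alpha> Gpos by (simp add: R.S.cc_def)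
  have form: "(\<Sum>k<n. \<Sum>j\<le>k. kern c (k - j) * gi (z j) (z k)) = (\<Sum>e\<in>E. kform c n (\<lambda>k. gi (z k) e))"
  proof -
    have "(\<Sum>k<n. \<Sum>j\<le>k. kern c (k - j) * gi (z j) (z k)) = (\<Sum>k<n. \<Sum>j\<le>k. \<Sum>e\<in>E. gi (z k) e * (kern c (k - j) * gi (z j) e))"
      unfolding gie sum_distrib_left by (intro sum.cong refl) (simp add: mult_ac)
    also have "\<dots> = (\<Sum>k<n. \<Sum>e\<in>E. \<Sum>j\<le>k. gi (z k) e * (kern c (k - j) * gi (z j) e))" by (intro sum.cong refl sum.swap)
    also have "\<dots> = (\<Sum>e\<in>E. \<Sum>k<n. \<Sum>j\<le>k. gi (z k) e * (kern c (k - j) * gi (z j) e))" by (rule sum.swap)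
    finally show ?thesis by (simp only: kform_def sum_distrib_left)
  qed
  have lower: "\<epsilon> * Q \<le> (\<Sum>k<n. \<Sum>j\<le>k. kern c (k - j) * gi (z j) (z k))" unfolding form Q_def sum_distrib_left by (intro sum_mono \<epsilon>(2))
  have fneg': "(\<lambda>t. to_Hm1 \<Omega> (f t)) \<in> Hneg_time R.gam R.V R.N 0 \<infinity>" using fneg unfolding Hm1_space_def Hm1_norm_def .
  have P': "P = Hneg_time_norm R.gam R.V R.N 0 (ereal T) (\<lambda>t. to_Hm1 \<Omega> (f t))" unfolding P_def Hm1_space_def Hm1_norm_def ..
  have Wb: "R.N (R.W t) \<le> (\<Sum>k<n. NH (z k))" for t by (rule R.W_bound)
  note Pb = R.Hneg_time_norm_bound[OF R.T fneg' R.W_Hfrac(1) Wb, folded T_def, folded P']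
  have zH: "z k \<in> H10" for k by (rule Sh_H10[OF z])
  have zL: "z k \<in> L2" for k by (rule Sh_L2[OF z])
  have fL: "f t \<in> L2" if "0 < t" for t using f that by (auto simp: bochner_L1_def strongly_measurable_def)
  have "integral\<^sup>L (lebesgue_on {0<..<T}) (\<lambda>t. polar_inner R.N (to_Hm1 \<Omega> (f t)) (R.W t)) = (\<Sum>k<n. LI (F k) (z k))" unfolding T_def
  proof (rule pairing_sum[OF zL])
    fix k t assume k: "k < n" and t: "real k * \<tau> < t" "t < real (k + 1) * \<tau>"
    have "0 \<le> real k * \<tau>" using \<tau> by simp
    then have t0: "0 < t" using t(1) by linarith
    have "t \<in> R.cell k" using t by (simp add: R.S.cell_def)
    then have W: "R.W t = H10.riesz (z k)" by (rule R.W_cell[OF _ k])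
    show "polar_inner R.N (to_Hm1 \<Omega> (f t)) (R.W t) = LI (f t) (z k)"
      unfolding W H10.polar_inner_riesz[OF to_Hm1_mem[OF fL[OF t0]] zH] using zH by (simp add: to_Hm1_def)
  qed
  then have "\<bar>\<Sum>k<n. LI (F k) (z k)\<bar> \<le> P * Hfrac_right_norm R.gam R.V R.N 0 (ereal T) R.W" using Pb(1) by simp
  also have "\<dots> \<le> P * sqrt (2 * ((1 + 1 / \<alpha>) * R.S.cc * \<tau> powr p) * Q)"
    unfolding T_def Q_def by (intro mult_left_mono R.W_Hfrac(2)) (rule Pb(2))
  also have "sqrt (2 * ((1 + 1 / \<alpha>) * R.S.cc * \<tau> powr p) * Q) = sqrt (2 * ((1 + 1 / \<alpha>) * R.S.cc)) * (sqrt (\<tau> powr p) * sqrt Q)"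
    by (simp only: real_sqrt_mult[symmetric] mult_ac)
  finally have "\<bar>\<Sum>k<n. LI (F k) (z k)\<bar> \<le> P * (sqrt (2 * ((1 + 1 / \<alpha>) * R.S.cc)) * (sqrt (\<tau> powr p) * sqrt Q))" .
  then have "\<tau> powr (\<alpha> - 1) * (\<Sum>k<n. LI (F k) (z k))
      \<le> \<tau> powr (\<alpha> - 1) * (P * (sqrt (2 * ((1 + 1 / \<alpha>) * R.S.cc)) * (sqrt (\<tau> powr p) * sqrt Q)))" by (intro mult_left_mono) auto
  also have "\<dots> = (\<tau> powr (\<alpha> - 1) * sqrt (\<tau> powr p)) * sqrt Q * (sqrt (2 * ((1 + 1 / \<alpha>) * R.S.cc)) * P)" by (simp only: mult_ac)
  \<comment> \<open>Half of p is 1 - \<alpha> / 2, so the exponents add up to \<alpha> / 2.\<close>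
  also have "\<tau> powr (\<alpha> - 1) * sqrt (\<tau> powr p) = s"
  proof -
    have "sqrt (\<tau> powr p) = \<tau> powr (p / 2)" using \<tau> by (simp add: powr_half_sqrt[symmetric] powr_powr)
    moreover have "\<tau> powr (\<alpha> - 1 + p / 2) = \<tau> powr (\<alpha> / 2)" by (intro arg_cong2[where f = "(powr)"] refl) (simp add: field_simps)
    ultimately show ?thesis unfolding s_def by (simp only: powr_add)
  qed
  finally have fterm: "\<tau> powr (\<alpha> - 1) * (\<Sum>k<n. LI (F k) (z k)) \<le> s * sqrt Q * (sqrt (2 * ((1 + 1 / \<alpha>) * R.S.cc)) * P)" .
  define w where "w k = coeff_b \<alpha> (k + 1) - coeff_b \<alpha> k" for k
  have w: "0 \<le> w k" for k using coeff_b_mono[of k] by (simp add: w_def)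
  have Bw: "\<bar>c (k + 1) - c k\<bar> \<le> B * w k" for k using B(2)[of k] by (simp only: w_def)
  define Z where "Z = (\<Sum>k<n. w k * NH (z k))"
  have "\<bar>\<Sum>k<n. (c (k + 1) - c k) * LI u1 (z k)\<bar> \<le> (\<Sum>k<n. \<bar>(c (k + 1) - c k) * LI u1 (z k)\<bar>)" by (rule sum_abs)
  also have "\<dots> \<le> (\<Sum>k<n. (B * w k) * (A * NH (z k)))" unfolding abs_mult using B(1) w by (intro sum_mono mult_mono Bw Hm1_bound u1 zH) auto
  also have "\<dots> = B * A * Z" unfolding Z_def sum_distrib_left by (intro sum.cong refl) (simp only: mult_ac)
  finally have u1b: "(\<Sum>k<n. (c (k + 1) - c k) * LI u1 (z k)) \<le> B * A * Z" by (rule order_trans[OF abs_ge_self])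
  \<comment> \<open>Cauchy-Schwarz with weights \<open>w\<close>: their sum telescopes to
    \<open>coeff_b \<alpha> n\<close>, as b vanishes at 0, and supplies the power of n; the other
    factor is bounded by twice the form.\<close>
  have "Z^2 = (\<Sum>k<n. sqrt (w k) * (sqrt (w k) * NH (z k)))^2" unfolding Z_def using w by (simp add: mult.assoc[symmetric])
  also have "\<dots> \<le> (\<Sum>k<n. (sqrt (w k))^2) * (\<Sum>k<n. (sqrt (w k) * NH (z k))^2)" by (rule Cauchy_Schwarz_ineq_sum)
  also have "\<dots> = (\<Sum>k<n. w k) * (\<Sum>k<n. w k * (NH (z k))^2)" using w by (simp add: power_mult_distrib)
  also have "(\<Sum>k<n. w k) = coeff_b \<alpha> n" unfolding w_def using sum_lessThan_telescope[of "coeff_b \<alpha>" n] by (simp add: coeff_b_def)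
  also have "(\<Sum>k<n. w k * (NH (z k))^2) = (\<Sum>e\<in>E. \<Sum>k<n. w k * (gi (z k) e)^2)"
  proof -
    have "(\<Sum>k<n. w k * (NH (z k))^2) = (\<Sum>k<n. \<Sum>e\<in>E. w k * (gi (z k) e)^2)"
      by (intro sum.cong refl) (subst H10.N_sq[OF zH], simp only: gie sum_distrib_left power2_eq_square)
    then show ?thesis by (simp only: sum.swap[of _ E])
  qed
  also have "coeff_b \<alpha> n * \<dots> \<le> coeff_b \<alpha> n * (2 * Q)"
  proof (rule mult_left_mono)
    show "(\<Sum>e\<in>E. \<Sum>k<n. w k * (gi (z k) e)^2) \<le> 2 * Q" unfolding Q_def sum_distrib_left w_def by (intro sum_mono sum_squares_le_kform)
    show "0 \<le> coeff_b \<alpha> n" using Gpos by (simp add: coeff_b_def)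
  qed
  also have "\<dots> = (sqrt (2 / Gamma (3 - \<alpha>)) * real n powr (1 - \<alpha> / 2) * sqrt Q)^2"
  proof -
    have "(real n powr (1 - \<alpha> / 2))^2 = real n powr p" by (simp add: power2_eq_square flip: powr_add)
    then show ?thesis using Gpos Q0 by (simp add: power_mult_distrib coeff_b_def)
  qed
  finally have "Z \<le> sqrt (2 / Gamma (3 - \<alpha>)) * real n powr (1 - \<alpha> / 2) * sqrt Q" by (rule power2_le_imp_le) (use Gpos Q0 in simp)
  then have "\<tau> * (B * A * Z) \<le> \<tau> * (B * A * (sqrt (2 / Gamma (3 - \<alpha>)) * real n powr (1 - \<alpha> / 2) * sqrt Q))"
    using \<tau> B(1) A_nonneg by (intro mult_left_mono) auto
  also have "\<dots> = (\<tau> * real n powr (1 - \<alpha> / 2)) * sqrt Q * (B * sqrt (2 / Gamma (3 - \<alpha>)) * A)" by (simp only: mult_ac)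
  \<comment> \<open>Since \<tau> = s \<open>\<tau> powr (1 - \<alpha> / 2)\<close>, the remaining
    power of \<tau> joins that of n into the power of the final time.\<close>
  also have "\<tau> * real n powr (1 - \<alpha> / 2) = s * T powr (1 - \<alpha> / 2)"
  proof -
    have "s * \<tau> powr (1 - \<alpha> / 2) = \<tau>" unfolding s_def using \<tau> by (simp flip: powr_add)
    then show ?thesis unfolding T_def using \<tau> by (simp add: powr_mult mult_ac)
  qed
  finally have Zb: "\<tau> * (B * A * Z) \<le> s * T powr (1 - \<alpha> / 2) * sqrt Q * (B * sqrt (2 / Gamma (3 - \<alpha>)) * A)" .
  have "\<tau> * (\<Sum>k<n. (c (k + 1) - c k) * LI u1 (z k)) \<le> \<tau> * (B * A * Z)" by (rule mult_left_mono[OF u1b]) (use \<tau> in simp)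
  also note Zb
  also have "s * T powr (1 - \<alpha> / 2) * sqrt Q * (B * sqrt (2 / Gamma (3 - \<alpha>)) * A)
      = s * sqrt Q * (B * sqrt (2 / Gamma (3 - \<alpha>)) * (T powr (1 - \<alpha> / 2) * A))" by (simp only: mult_ac)
  finally have u1term: "\<tau> * (\<Sum>k<n. (c (k + 1) - c k) * LI u1 (z k))
      \<le> s * sqrt Q * (B * sqrt (2 / Gamma (3 - \<alpha>)) * (T powr (1 - \<alpha> / 2) * A))" .
  define D where "D = sqrt (2 * ((1 + 1 / \<alpha>) * R.S.cc)) * P + B * sqrt (2 / Gamma (3 - \<alpha>)) * (T powr (1 - \<alpha> / 2) * A)"
  have D0: "0 \<le> D" unfolding D_def using cc0 Pb(2) B(1) Gpos A_nonneg by (intro add_nonneg_nonneg mult_nonneg_nonneg) auto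
  have "\<epsilon> * Q + s^2 / 2 * ((NL (U n))^2 - (NL (U 0))^2) \<le> s * sqrt Q * D"
    using energy_identity[OF z zU, of n] lower fterm u1term unfolding s(2) D_def distrib_left by linarith
  then have "NL (U n) \<le> NL (U 0) + sqrt (1 / (2 * \<epsilon>)) * D" by (rule energy_young[OF \<epsilon>(1) s(1) Q0 D0 L2_norm_nonneg L2_norm_nonneg])
  moreover have "NL (U 0) \<le> NL u0" using U L2_projection_norm[OF u0] by (simp add: is_scheme_solution_def)
  ultimately show ?thesis unfolding D_def P_def by simp
qed

end

section \<open>The constant and the final bound\<close>

definition stability_const :: "real \<Rightarrow> real \<Rightarrow> real \<Rightarrow> real" where
  "stability_const \<alpha> \<epsilon> B =
     sqrt (1 / (2 * \<epsilon>)) * (sqrt (2 * ((1 + 1 / \<alpha>) * step_fun.cc \<alpha>)) + B * sqrt (2 / Gamma (3 - \<alpha>)))"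

lemma stability_const_nonneg:
  assumes "1 < \<alpha>" "\<alpha> < 2" "0 < \<epsilon>" "0 \<le> B" shows "0 \<le> stability_const \<alpha> \<epsilon> B"
proof -
  interpret step_fun \<alpha> 1 0 "\<lambda>_. 0" by unfold_locales (use assms in auto)
  have "0 \<le> cc" using pp Gpos assms by (simp add: cc_def)
  then show ?thesis using assms Gpos by (simp add: stability_const_def)
qed

lemma (in scheme_energy) stability_const_bound:
  assumes n: "1 \<le> n" and C: "1 + stability_const \<alpha> \<epsilon> B \<le> C"
  shows "NL (U n) \<le> C * (NL u0 + (real n * \<tau>) powr (1 - \<alpha> / 2) * A
    + Fneg (real n * \<tau>))"
proof -
  define P where "P = Fneg (real n * \<tau>)"
  define a b q where "a = sqrt (2 * ((1 + 1 / \<alpha>) * step_fun.cc \<alpha>))" and "b = B * sqrt (2 / Gamma (3 - \<alpha>))"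
    and "q = sqrt (1 / (2 * \<epsilon>))"
  define t where "t = (real n * \<tau>) powr (1 - \<alpha> / 2) * A"
  interpret S: step_fun \<alpha> \<tau> n "\<lambda>_. 0" by unfold_locales (rule \<tau>)
  interpret D: dual_time H10 "H10_norm \<Omega>" by (rule dual_time.intro) (rule H10.seminormed_space_axioms)
  have nn: "0 \<le> a" "0 \<le> b" "0 \<le> q" using pp Gpos \<alpha> B(1) \<epsilon>(1) by (simp_all add: a_def b_def q_def S.cc_def)
  have t: "0 \<le> t" unfolding t_def using A_nonneg by simp
  have P: "0 \<le> P"
  proof -
    have T: "0 < real n * \<tau>" using n \<tau> by simp
    \<comment> \<open>The zero function is a bounded element of the space, which is all that the
      sign of the dual norm requires from \<open>Hneg_time_norm_bound\<close>.\<close>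
    have "0 \<in> Hfrac_right ((\<alpha> - 1) / 2) D.V D.N 0 (ereal (real n * \<tau>))" using D.Hfrac_seminormed[OF T] by (rule seminormed_space.zero_mem)
    then show ?thesis using D.Hneg_time_norm_bound(2)[OF T fneg[unfolded Hm1_space_def Hm1_norm_def], of 0 0]
      unfolding P_def Hm1_space_def Hm1_norm_def by (simp add: D.D.N_zero)
  qed
  have "NL (U n) \<le> NL u0 + q * (a * P + b * t)" using stability[of n] n unfolding a_def b_def q_def P_def t_def by simp
  also have "\<dots> \<le> NL u0 + q * ((a + b) * (NL u0 + t + P))"
  proof (intro add_left_mono mult_left_mono nn)
    have "a * P \<le> a * (NL u0 + t + P)" "b * t \<le> b * (NL u0 + t + P)" using t P L2_norm_nonneg[of \<Omega> u0] nn by (auto intro!: mult_left_mono)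
    then show "a * P + b * t \<le> (a + b) * (NL u0 + t + P)" by (simp add: distrib_right)
  qed
  also have "\<dots> \<le> (1 + q * (a + b)) * (NL u0 + t + P)" using t P L2_norm_nonneg[of \<Omega> u0] by (simp add: distrib_right mult.assoc)
  also have "\<dots> \<le> C * (NL u0 + t + P)"
    using C t P L2_norm_nonneg[of \<Omega> u0] by (intro mult_right_mono) (auto simp: stability_const_def a_def b_def q_def)
  finally show ?thesis unfolding t_def P_def .
qed

text \<open>Polymorphic in the Euclidean space, while the condition on \<open>C\<close> mentions
  only \<alpha>, \<epsilon> and \<open>B\<close>; a constant fixed beforehand therefore serves all
  three dimensions. Boundedness of \<Omega> comes from its closure being a polytope.\<close>

lemma scheme_stability:
  fixes \<Omega> :: "'a::euclidean_space set"
  assumes \<alpha>: "1 < \<alpha>" "\<alpha> < 2" and \<epsilon>: "0 < \<epsilon>" "\<And>n x. \<epsilon> * kform (coeff_b \<alpha>) n x \<le> kform c n x"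
    and B: "0 \<le> B" "\<And>k. \<bar>c (k + 1) - c k\<bar> \<le> B * (coeff_b \<alpha> (k + 1) - coeff_b \<alpha> k)"
    and C: "1 + stability_const \<alpha> \<epsilon> B \<le> C"
    and \<Omega>: "convex_polytope_domain \<Omega>" "simplicial_mesh \<Omega> \<K>" and u: "u0 \<in> L2_space \<Omega>" "u1 \<in> L2_space \<Omega>"
    and f: "f \<in> bochner_L1 (L2_space \<Omega>) (L2_norm \<Omega>) {0<..}"
      "(\<lambda>t. to_Hm1 \<Omega> (f t)) \<in> Hneg_time ((\<alpha> - 1) / 2) (Hm1_space \<Omega>) (Hm1_norm \<Omega>) 0 \<infinity>"
    and \<tau>: "0 < \<tau>" and U: "is_scheme_solution c \<alpha> \<Omega> \<K> \<tau> u0 u1 f U" and k: "1 \<le> k"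
  shows "L2_norm \<Omega> (U k) \<le>
    C * (L2_norm \<Omega> u0 + (real k * \<tau>) powr (1 - \<alpha> / 2) * Hm1_norm \<Omega> (to_Hm1 \<Omega> u1)
      + Hneg_time_norm ((\<alpha> - 1) / 2) (Hm1_space \<Omega>) (Hm1_norm \<Omega>) 0 (ereal (real k * \<tau>)) (\<lambda>t. to_Hm1 \<Omega> (f t)))"
proof -
  have "bounded (closure \<Omega>)" using \<Omega>(1) by (auto simp: convex_polytope_domain_def intro: polytope_imp_bounded)
  then have bd: "bounded \<Omega>" by (rule bounded_subset[OF _ closure_subset])
  interpret scheme_energy \<Omega> \<K> \<alpha> \<tau> c \<epsilon> B u0 u1 f U by unfold_locales (use \<alpha> \<epsilon> B \<Omega> u f \<tau> U bd in \<open>auto simp: convex_polytope_domain_def\<close>)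
  show ?thesis by (rule stability_const_bound[OF k C])
qed

(* C is chosen before the dimension; an HOL formula cannot quantify over types, hence one
   conjunct for each dimension 1, 2, 3. *)
theorem theorem4p1:
  fixes \<alpha> :: real
  assumes "1 < \<alpha>" and "\<alpha> < 2"
  shows "\<exists>C>0.
          (\<forall>(\<Omega> :: (real^1) set) \<K> \<kappa> \<rho> u0 u1 f \<tau> U V.
            convex_polytope_domain \<Omega> \<and>
            simplicial_mesh \<Omega> \<K> \<and> shape_regular \<kappa> \<K> \<and> quasi_uniform \<rho> \<K> \<and>
            u0 \<in> L2_space \<Omega> \<and> u1 \<in> L2_space \<Omega> \<and>
            f \<in> bochner_L1 (L2_space \<Omega>) (L2_norm \<Omega>) {0<..} \<and>
            (\<lambda>t. to_Hm1 \<Omega> (f t)) \<in> Hneg_time ((\<alpha> - 1) / 2) (Hm1_space \<Omega>) (Hm1_norm \<Omega>) 0 \<infinity> \<and>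
            0 < \<tau> \<and>
            is_scheme_solution (coeff_b \<alpha>) \<alpha> \<Omega> \<K> \<tau> u0 u1 f U \<and>
            is_scheme_solution (coeff_beta \<alpha>) \<alpha> \<Omega> \<K> \<tau> u0 u1 f V \<longrightarrow>
            (\<forall>k\<ge>1.
               L2_norm \<Omega> (U k) \<le>
                 C * (L2_norm \<Omega> u0 + (real k * \<tau>) powr (1 - \<alpha> / 2) * Hm1_norm \<Omega> (to_Hm1 \<Omega> u1)
                      + Hneg_time_norm ((\<alpha> - 1) / 2) (Hm1_space \<Omega>) (Hm1_norm \<Omega>)
                          0 (ereal (real k * \<tau>)) (\<lambda>t. to_Hm1 \<Omega> (f t))) \<and>
               L2_norm \<Omega> (V k) \<le>
                 C * (L2_norm \<Omega> u0 + (real k * \<tau>) powr (1 - \<alpha> / 2) * Hm1_norm \<Omega> (to_Hm1 \<Omega> u1)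
                      + Hneg_time_norm ((\<alpha> - 1) / 2) (Hm1_space \<Omega>) (Hm1_norm \<Omega>)
                          0 (ereal (real k * \<tau>)) (\<lambda>t. to_Hm1 \<Omega> (f t))))) \<and>
          (\<forall>(\<Omega> :: (real^2) set) \<K> \<kappa> \<rho> u0 u1 f \<tau> U V.
            convex_polytope_domain \<Omega> \<and>
            simplicial_mesh \<Omega> \<K> \<and> shape_regular \<kappa> \<K> \<and> quasi_uniform \<rho> \<K> \<and>
            u0 \<in> L2_space \<Omega> \<and> u1 \<in> L2_space \<Omega> \<and>
            f \<in> bochner_L1 (L2_space \<Omega>) (L2_norm \<Omega>) {0<..} \<and>
            (\<lambda>t. to_Hm1 \<Omega> (f t)) \<in> Hneg_time ((\<alpha> - 1) / 2) (Hm1_space \<Omega>) (Hm1_norm \<Omega>) 0 \<infinity> \<and>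
            0 < \<tau> \<and>
            is_scheme_solution (coeff_b \<alpha>) \<alpha> \<Omega> \<K> \<tau> u0 u1 f U \<and>
            is_scheme_solution (coeff_beta \<alpha>) \<alpha> \<Omega> \<K> \<tau> u0 u1 f V \<longrightarrow>
            (\<forall>k\<ge>1.
               L2_norm \<Omega> (U k) \<le>
                 C * (L2_norm \<Omega> u0 + (real k * \<tau>) powr (1 - \<alpha> / 2) * Hm1_norm \<Omega> (to_Hm1 \<Omega> u1)
                      + Hneg_time_norm ((\<alpha> - 1) / 2) (Hm1_space \<Omega>) (Hm1_norm \<Omega>)
                          0 (ereal (real k * \<tau>)) (\<lambda>t. to_Hm1 \<Omega> (f t))) \<and>
               L2_norm \<Omega> (V k) \<le>
                 C * (L2_norm \<Omega> u0 + (real k * \<tau>) powr (1 - \<alpha> / 2) * Hm1_norm \<Omega> (to_Hm1 \<Omega> u1)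
                      + Hneg_time_norm ((\<alpha> - 1) / 2) (Hm1_space \<Omega>) (Hm1_norm \<Omega>)
                          0 (ereal (real k * \<tau>)) (\<lambda>t. to_Hm1 \<Omega> (f t))))) \<and>
          (\<forall>(\<Omega> :: (real^3) set) \<K> \<kappa> \<rho> u0 u1 f \<tau> U V.
            convex_polytope_domain \<Omega> \<and>
            simplicial_mesh \<Omega> \<K> \<and> shape_regular \<kappa> \<K> \<and> quasi_uniform \<rho> \<K> \<and>
            u0 \<in> L2_space \<Omega> \<and> u1 \<in> L2_space \<Omega> \<and>
            f \<in> bochner_L1 (L2_space \<Omega>) (L2_norm \<Omega>) {0<..} \<and>
            (\<lambda>t. to_Hm1 \<Omega> (f t)) \<in> Hneg_time ((\<alpha> - 1) / 2) (Hm1_space \<Omega>) (Hm1_norm \<Omega>) 0 \<infinity> \<and>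
            0 < \<tau> \<and>
            is_scheme_solution (coeff_b \<alpha>) \<alpha> \<Omega> \<K> \<tau> u0 u1 f U \<and>
            is_scheme_solution (coeff_beta \<alpha>) \<alpha> \<Omega> \<K> \<tau> u0 u1 f V \<longrightarrow>
            (\<forall>k\<ge>1.
               L2_norm \<Omega> (U k) \<le>
                 C * (L2_norm \<Omega> u0 + (real k * \<tau>) powr (1 - \<alpha> / 2) * Hm1_norm \<Omega> (to_Hm1 \<Omega> u1)
                      + Hneg_time_norm ((\<alpha> - 1) / 2) (Hm1_space \<Omega>) (Hm1_norm \<Omega>)
                          0 (ereal (real k * \<tau>)) (\<lambda>t. to_Hm1 \<Omega> (f t))) \<and>
               L2_norm \<Omega> (V k) \<le>
                 C * (L2_norm \<Omega> u0 + (real k * \<tau>) powr (1 - \<alpha> / 2) * Hm1_norm \<Omega> (to_Hm1 \<Omega> u1)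
                      + Hneg_time_norm ((\<alpha> - 1) / 2) (Hm1_space \<Omega>) (Hm1_norm \<Omega>)
                          0 (ereal (real k * \<tau>)) (\<lambda>t. to_Hm1 \<Omega> (f t)))))"
proof -
  interpret order_param \<alpha> by unfold_locales (use assms in auto)
  obtain B where B: "0 \<le> B" "\<And>k. \<bar>coeff_beta \<alpha> (k + 1) - coeff_beta \<alpha> k\<bar> \<le> B * (coeff_b \<alpha> (k + 1) - coeff_b \<alpha> k)"
    using coeff_beta_diff_le by blast
  define \<epsilon> where "\<epsilon> = 1 - IM / IA"
  have \<epsilon>: "0 < \<epsilon>" "\<And>n x. \<epsilon> * kform (coeff_b \<alpha>) n x \<le> kform (coeff_beta \<alpha>) n x" unfolding \<epsilon>_def by (rule beta_ratio_pos, rule kform_beta_ge)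
  \<comment> \<open>For b itself both comparisons hold with constant 1.\<close>
  have b: "\<And>n x. 1 * kform (coeff_b \<alpha>) n x \<le> kform (coeff_b \<alpha>) n x"
    "\<And>k. \<bar>coeff_b \<alpha> (k + 1) - coeff_b \<alpha> k\<bar> \<le> 1 * (coeff_b \<alpha> (k + 1) - coeff_b \<alpha> k)" using coeff_b_mono by (auto simp: less_imp_le)
  \<comment> \<open>Since both stability constants are nonnegative, their sum plus 1 meets the
    requirement of either scheme; \<open>IM\<close>, \<open>IA\<close> and \<open>B\<close> were
    fixed from \<alpha> alone.\<close>
  define C where "C = 1 + stability_const \<alpha> 1 1 + stability_const \<alpha> \<epsilon> B"
  have nn: "0 \<le> stability_const \<alpha> 1 1" "0 \<le> stability_const \<alpha> \<epsilon> B" by (rule stability_const_nonneg[OF assms], use \<epsilon>(1) B(1) in simp_all)+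
  have C: "1 + stability_const \<alpha> 1 1 \<le> C" "1 + stability_const \<alpha> \<epsilon> B \<le> C" "0 < C" using nn by (auto simp: C_def)
  note s = scheme_stability[OF assms zero_less_one b(1) zero_le_one b(2) C(1)]
    scheme_stability[OF assms \<epsilon> B C(2)]
  show ?thesis by (intro exI[of _ C] conjI allI impI C(3); elim conjE; (rule s; assumption))
qed

end
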